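(* Let $1<p<\infty$, let $Z=(Z,d,\mu)$ be a $p$-PI space, let $\Omega\subset Z$ be a measurable set satisfying the measure-density condition, and let $\mathbb V$ be a Banach space. Then the following are equivalent: (1) There exists a linear extension operator $E_{\mathbb V}:W^{1,p}(\Omega;\mathbb V)\to W^{1,p}(Z;\mathbb V)$. (2) For every $u\in W^{1,p}(\Omega;\mathbb V)$ there exists $h\in W^{1,p}(Z;\mathbb V)$ with $h|_\Omega=u$.
   Context: Metric measure space: a triple $(Z,d,\mu)$ with $(Z,d)$ a separable metric space and $\mu$ a Borel regular outer measure with $0<\mu(B)<\infty$ for all open balls $B$. $\mu$ is doubling if there is $c_\mu>0$ with $\mu(2B)\le c_\mu\mu(B)$ for every open ball $B$. $L^p(Z;\mathbb V)$: a map $u:Z\to\mathbb V$ is measurable if preimages of open sets are $\mu$-measurable and $u(Z\setminus N)$ is separable for some $\mu$-null set $N$; $L^p(Z;\mathbb V)$ is the space of a.e.-equivalence classes of measurable $u$ with $|u|\in L^p(Z)$. Newton–Sobolev functions: a path is a continuous $\gamma:[a,b]\to Z$. For Borel $\rho:Z\to[0,\infty]$, $\int_\gamma\rho\,ds$ is the usual integral with respect to the length measure of $\gamma$ if $\gamma$ is rectifiable, and $\infty$ otherwise. A family of paths $\Gamma$ is $p$-negligible if there is an $L^p$-integrable Borel $\rho:Z\to[0,\infty]$ with $\int_\gamma\rho\,ds=\infty$ for all $\gamma\in\Gamma$; "$p$-almost every path" means outside a $p$-negligible family. A Borel function $\rho:Z\to[0,\infty]$ is a $p$-weak upper gradient of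 $u:Z\to\mathbb V$ if $|u(\gamma(a))-u(\gamma(b))|\le\int_\gamma\rho\,ds$ for $p$-almost every path $\gamma:[a,b]\to Z$. $W^{1,p}(Z;\mathbb V)$ is the set of $u\in L^p(Z;\mathbb V)$ having a representative $\widetilde u$ that admits an $L^p$-integrable $p$-weak upper gradient, with norm $\|u\|_{L^p(Z;\mathbb V)}+\inf_\rho\|\rho\|_{L^p(Z)}$, the infimum being over $L^p$-integrable $p$-weak upper gradients of $\widetilde u$. For measurable $\Omega\subset Z$, $W^{1,p}(\Omega;\mathbb V)$ is defined the same way for $\Omega$ with the restricted distance and measure. $p$-PI space: a complete metric measure space with $\mu$ doubling and supporting a weak $(1,p)$-Poincaré inequality: there are $C>0$, $\lambda\ge1$ such that $\frac1{\mu(B)}\int_B|u-u_B|\,d\mu\le C\operatorname{diam}(B)\big(\frac1{\mu(\lambda B)}\int_{\lambda B}\rho^p\,d\mu\big)^{1/p}$ for every ball $B$, every integrable $u:\lambda B\to\mathbb R$ and every $L^p$-integrable $p$-weak upper gradient $\rho:\lambda B\to[0,\infty]$ of $u$, where $u_B$ is the average of $u$ over $B$. Measure-density condition: there is $c_\Omega>0$ with $\mu(B(x,r)\cap\Omega)\ge c_\Omega\,\mu(B(x,r))$ for every $x\in\Omega$, $r\in(0,1]$. Extension operator: a map $E:W^{1,p}(\Omega;\mathbb V)\to W^{1,p}(Z;\mathbb V)$ (in general not required linear) with $E(u)|_\Omega=u$ (a.e.) and $\|E(u)\|_{W^{1,p}(Z;\mathbb V)}\le C\|u\|_{W^{1,p}(\Omega;\mathbb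 V)}$ for all $u$, with $C>0$ independent of $u$. *)

theory Defs
  imports "HOL-Analysis.Analysis"
begin

section \<open>Metric measure spaces\<close>

text \<open>
  The ambient space \<open>Z\<close> is the universe of a type \<open>'a\<close>. As in the literature on analysis in metric
  spaces, \<open>\<mu>\<close> is an outer measure defined on all subsets of \<open>Z\<close>; \<open>\<mu>\<close>-measurability is meant in the
  sense of Caratheodory, and all integrals are taken against the induced (complete) measure.
\<close>

definition borel_regular_outer_measure :: "('a::topological_space set \<Rightarrow> ennreal) \<Rightarrow> bool" where
  "borel_regular_outer_measure \<mu> \<longleftrightarrow>
     outer_measure_space (Pow UNIV) \<mu> \<and>
     sets borel \<subseteq> lambda_system UNIV (Pow UNIV) \<mu> \<and>
     (\<forall>A. \<exists>B \<in> sets borel. A \<subseteq> B \<and> \<mu> B = \<mu> A)"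

definition caratheodory_measure :: "('a set \<Rightarrow> ennreal) \<Rightarrow> 'a measure" where
  "caratheodory_measure \<mu> = measure_of UNIV (lambda_system UNIV (Pow UNIV) \<mu>) \<mu>"

lemma
  assumes "outer_measure_space (Pow UNIV) \<mu>"
  shows space_caratheodory_measure: "space (caratheodory_measure \<mu>) = UNIV"
    and sets_caratheodory_measure:
      "sets (caratheodory_measure \<mu>) = lambda_system UNIV (Pow UNIV) \<mu>"
    and emeasure_caratheodory_measure:
      "A \<in> lambda_system UNIV (Pow UNIV) \<mu> \<Longrightarrow> emeasure (caratheodory_measure \<mu>) A = \<mu> A"
proof -
  have ms: "measure_space UNIV (lambda_system UNIV (Pow UNIV) \<mu>) \<mu>"
    by (rule sigma_algebra.caratheodory_lemma[OF sigma_algebra_Pow assms])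
  then have sa: "sigma_algebra UNIV (lambda_system UNIV (Pow UNIV) \<mu>)"
    by (simp add: measure_space_def)
  show "space (caratheodory_measure \<mu>) = UNIV"
    by (simp add: caratheodory_measure_def space_measure_of_conv)
  show sets: "sets (caratheodory_measure \<mu>) = lambda_system UNIV (Pow UNIV) \<mu>"
    unfolding caratheodory_measure_def by (rule sigma_algebra.sets_measure_of_eq[OF sa])
  show "emeasure (caratheodory_measure \<mu>) A = \<mu> A" if "A \<in> lambda_system UNIV (Pow UNIV) \<mu>"
    using ms that unfolding caratheodory_measure_def measure_space_def
    by (blast intro: emeasure_measure_of_sigma)
qed

text \<open>Separability of the metric space is carried by the sort.\<close>

definition metric_measure_space ::
    "('a::{metric_space, second_countable_topology} set \<Rightarrow> ennreal) \<Rightarrow> bool" where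
  "metric_measure_space \<mu> \<longleftrightarrow>
     borel_regular_outer_measure \<mu> \<and> (\<forall>x. \<forall>r>0. 0 < \<mu> (ball x r) \<and> \<mu> (ball x r) < \<infinity>)"

definition doubling :: "('a::metric_space set \<Rightarrow> ennreal) \<Rightarrow> bool" where
  "doubling \<mu> \<longleftrightarrow> (\<exists>c>0. \<forall>x. \<forall>r>0. \<mu> (ball x (2 * r)) \<le> ennreal c * \<mu> (ball x r))"

definition measure_density :: "('a::metric_space set \<Rightarrow> ennreal) \<Rightarrow> 'a set \<Rightarrow> bool" where
  "measure_density \<mu> \<Omega> \<longleftrightarrow>
     (\<exists>c>0. \<forall>x\<in>\<Omega>. \<forall>r. 0 < r \<and> r \<le> 1 \<longrightarrow> \<mu> (ball x r \<inter> \<Omega>) \<ge> ennreal c * \<mu> (ball x r))"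


section \<open>Lebesgue spaces\<close>

text \<open>
  Functions on a measurable subset \<open>S\<close> of the ambient space are total functions of which only the
  values on \<open>S\<close> matter. \<open>S\<close> carries the restricted distance and measure; \<open>S = UNIV\<close> gives the
  whole space.
\<close>

abbreviation measure_on :: "('a set \<Rightarrow> ennreal) \<Rightarrow> 'a set \<Rightarrow> 'a measure" where
  "measure_on \<mu> S \<equiv> restrict_space (caratheodory_measure \<mu>) S"

text \<open>The power \<open>a\<^sup>q\<close> for \<open>a \<in> [0,\<infinity>]\<close> and \<open>0 < q < \<infinity>\<close>.\<close>

definition ennreal_powr :: "ennreal \<Rightarrow> real \<Rightarrow> ennreal" where
  "ennreal_powr a q = (if a = \<infinity> then \<infinity> else ennreal (enn2real a powr q))"

definition Lp_norm :: "real \<Rightarrow> ('a set \<Rightarrow> ennreal) \<Rightarrow> 'a set \<Rightarrow> ('a \<Rightarrow> ennreal) \<Rightarrow> ennreal" where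
  "Lp_norm p \<mu> S g = ennreal_powr (\<integral>\<^sup>+x. ennreal_powr (g x) p \<partial>measure_on \<mu> S) (1 / p)"

definition measurable_map ::
    "('a set \<Rightarrow> ennreal) \<Rightarrow> 'a set \<Rightarrow> ('a \<Rightarrow> 'b::metric_space) \<Rightarrow> bool" where
  "measurable_map \<mu> S u \<longleftrightarrow>
     u \<in> borel_measurable (measure_on \<mu> S) \<and>
     (\<exists>N \<in> null_sets (measure_on \<mu> S). separable_space (top_of_set (u ` (S - N))))"

text \<open>
  Elements of \<open>L\<^sup>p(S;V)\<close> are represented by functions; equality of elements is equality almost
  everywhere with respect to \<open>measure_on \<mu> S\<close>.
\<close>

definition Lp_space ::
    "real \<Rightarrow> ('a set \<Rightarrow> ennreal) \<Rightarrow> 'a set \<Rightarrow> ('a \<Rightarrow> 'b::real_normed_vector) set" where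
  "Lp_space p \<mu> S =
     {u. measurable_map \<mu> S u \<and> Lp_norm p \<mu> S (\<lambda>x. ennreal (norm (u x))) < \<infinity>}"


section \<open>Paths and path integrals\<close>

text \<open>A triple \<open>(a, b, \<gamma>)\<close> stands for the path \<open>\<gamma> : [a,b] \<rightarrow> S\<close>.\<close>

definition paths_in :: "'a::metric_space set \<Rightarrow> (real \<times> real \<times> (real \<Rightarrow> 'a)) set" where
  "paths_in S = {(a, b, \<gamma>). a \<le> b \<and> continuous_on {a..b} \<gamma> \<and> \<gamma> ` {a..b} \<subseteq> S}"

text \<open>Length of \<open>\<gamma>\<close> over \<open>[a,b]\<close>: supremum over finite chains \<open>a \<le> t 0 \<le> \<dots> \<le> t n \<le> b\<close>.\<close>

definition path_length :: "real \<Rightarrow> real \<Rightarrow> (real \<Rightarrow> 'a::metric_space) \<Rightarrow> ennreal" where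
  "path_length a b \<gamma> =
     (SUP (n, t) \<in> {(n::nat, t::nat \<Rightarrow> real). mono t \<and> range t \<subseteq> {a..b}}.
        \<Sum>i<n. ennreal (dist (\<gamma> (t i)) (\<gamma> (t (Suc i)))))"

definition rectifiable :: "real \<Rightarrow> real \<Rightarrow> (real \<Rightarrow> 'a::metric_space) \<Rightarrow> bool" where
  "rectifiable a b \<gamma> \<longleftrightarrow> path_length a b \<gamma> < \<infinity>"

text \<open>
  The length measure of a rectifiable path is the Stieltjes measure assigning to each
  \<open>[s,t] \<subseteq> [a,b]\<close> the length of \<open>\<gamma>\<close> over \<open>[s,t]\<close>; its distribution function is extended to be constant
  to the left of \<open>a\<close> and to the right of \<open>b\<close>.
\<close>

definition length_measure :: "real \<Rightarrow> real \<Rightarrow> (real \<Rightarrow> 'a::metric_space) \<Rightarrow> real measure" where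
  "length_measure a b \<gamma> =
     interval_measure (\<lambda>t. enn2real (path_length a (max a (min b t)) \<gamma>))"

definition path_integral ::
    "('a::metric_space \<Rightarrow> ennreal) \<Rightarrow> real \<times> real \<times> (real \<Rightarrow> 'a) \<Rightarrow> ennreal" where
  "path_integral \<rho> = (\<lambda>(a, b, \<gamma>).
     if rectifiable a b \<gamma> then \<integral>\<^sup>+t\<in>{a..b}. \<rho> (\<gamma> t) \<partial>length_measure a b \<gamma> else \<infinity>)"


section \<open>Newton-Sobolev spaces\<close>

definition Lp_borel ::
    "real \<Rightarrow> ('a::metric_space set \<Rightarrow> ennreal) \<Rightarrow> 'a set \<Rightarrow> ('a \<Rightarrow> ennreal) set" where
  "Lp_borel p \<mu> S = {\<rho> \<in> borel_measurable (restrict_space borel S). Lp_norm p \<mu> S \<rho> < \<infinity>}"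

definition negligible_paths ::
    "real \<Rightarrow> ('a::metric_space set \<Rightarrow> ennreal) \<Rightarrow> 'a set
      \<Rightarrow> (real \<times> real \<times> (real \<Rightarrow> 'a)) set \<Rightarrow> bool" where
  "negligible_paths p \<mu> S \<Gamma> \<longleftrightarrow>
     \<Gamma> \<subseteq> paths_in S \<and> (\<exists>\<rho> \<in> Lp_borel p \<mu> S. \<forall>\<gamma>\<in>\<Gamma>. path_integral \<rho> \<gamma> = \<infinity>)"

definition weak_upper_gradient ::
    "real \<Rightarrow> ('a::metric_space set \<Rightarrow> ennreal) \<Rightarrow> 'a set
      \<Rightarrow> ('a \<Rightarrow> 'b::real_normed_vector) \<Rightarrow> ('a \<Rightarrow> ennreal) \<Rightarrow> bool" where
  "weak_upper_gradient p \<mu> S u \<rho> \<longleftrightarrow>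
     \<rho> \<in> borel_measurable (restrict_space borel S) \<and>
     (\<exists>\<Gamma>. negligible_paths p \<mu> S \<Gamma> \<and>
        (\<forall>(a, b, \<gamma>) \<in> paths_in S - \<Gamma>.
           ennreal (norm (u (\<gamma> a) - u (\<gamma> b))) \<le> path_integral \<rho> (a, b, \<gamma>)))"

text \<open>
  Pairs of a representative \<open>u'\<close> of \<open>u\<close> and an \<open>L\<^sup>p\<close>-integrable \<open>p\<close>-weak upper gradient of \<open>u'\<close>.
\<close>

definition sobolev_pairs ::
    "real \<Rightarrow> ('a::metric_space set \<Rightarrow> ennreal) \<Rightarrow> 'a set
      \<Rightarrow> ('a \<Rightarrow> 'b::real_normed_vector) \<Rightarrow> (('a \<Rightarrow> 'b) \<times> ('a \<Rightarrow> ennreal)) set" where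
  "sobolev_pairs p \<mu> S u =
     {(u', \<rho>). u' \<in> Lp_space p \<mu> S \<and> (AE x in measure_on \<mu> S. u' x = u x) \<and>
        \<rho> \<in> Lp_borel p \<mu> S \<and> weak_upper_gradient p \<mu> S u' \<rho>}"

definition sobolev_space ::
    "real \<Rightarrow> ('a::metric_space set \<Rightarrow> ennreal) \<Rightarrow> 'a set
      \<Rightarrow> ('a \<Rightarrow> 'b::real_normed_vector) set" where
  "sobolev_space p \<mu> S = {u \<in> Lp_space p \<mu> S. sobolev_pairs p \<mu> S u \<noteq> {}}"

text \<open>
  The norm takes the infimum over all admissible representatives as well; since two a.e. equal
  representatives with \<open>L\<^sup>p\<close>-integrable \<open>p\<close>-weak upper gradients have the same \<open>p\<close>-weak upper gradients,
  every admissible representative yields the same value.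
\<close>

definition sobolev_norm ::
    "real \<Rightarrow> ('a::metric_space set \<Rightarrow> ennreal) \<Rightarrow> 'a set
      \<Rightarrow> ('a \<Rightarrow> 'b::real_normed_vector) \<Rightarrow> ennreal" where
  "sobolev_norm p \<mu> S u =
     Lp_norm p \<mu> S (\<lambda>x. ennreal (norm (u x))) +
     (INF (u', \<rho>) \<in> sobolev_pairs p \<mu> S u. Lp_norm p \<mu> S \<rho>)"


section \<open>PI spaces\<close>

definition mean_value :: "('a set \<Rightarrow> ennreal) \<Rightarrow> 'a set \<Rightarrow> ('a \<Rightarrow> real) \<Rightarrow> real" where
  "mean_value \<mu> B u = (LINT x|measure_on \<mu> B. u x) / enn2real (\<mu> B)"

definition weak_poincare :: "real \<Rightarrow> ('a::metric_space set \<Rightarrow> ennreal) \<Rightarrow> bool" where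
  "weak_poincare p \<mu> \<longleftrightarrow>
     (\<exists>C>0. \<exists>\<Lambda>\<ge>1. \<forall>x. \<forall>r>0. \<forall>u :: 'a \<Rightarrow> real. \<forall>\<rho>.
        integrable (measure_on \<mu> (ball x (\<Lambda> * r))) u \<and>
        \<rho> \<in> Lp_borel p \<mu> (ball x (\<Lambda> * r)) \<and>
        weak_upper_gradient p \<mu> (ball x (\<Lambda> * r)) u \<rho> \<longrightarrow>
        (\<integral>\<^sup>+y. ennreal \<bar>u y - mean_value \<mu> (ball x r) u\<bar> \<partial>measure_on \<mu> (ball x r)) / \<mu> (ball x r)
          \<le> ennreal (C * diameter (ball x r)) *
             ennreal_powr ((\<integral>\<^sup>+y. ennreal_powr (\<rho> y) p \<partial>measure_on \<mu> (ball x (\<Lambda> * r)))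
                            / \<mu> (ball x (\<Lambda> * r))) (1 / p))"

text \<open>Completeness, like separability, is carried by the sort.\<close>

definition PI_space :: "real \<Rightarrow> ('a::polish_space set \<Rightarrow> ennreal) \<Rightarrow> bool" where
  "PI_space p \<mu> \<longleftrightarrow> metric_measure_space \<mu> \<and> doubling \<mu> \<and> weak_poincare p \<mu>"


section \<open>Extension operators\<close>

text \<open>
  Operators between Sobolev spaces act on representatives; the second clause says that the operator
  descends to a.e. equivalence classes.
\<close>

definition extension_operator ::
    "real \<Rightarrow> ('a::metric_space set \<Rightarrow> ennreal) \<Rightarrow> 'a set
      \<Rightarrow> (('a \<Rightarrow> 'b::real_normed_vector) \<Rightarrow> ('a \<Rightarrow> 'b)) \<Rightarrow> bool" where
  "extension_operator p \<mu> \<Omega> E \<longleftrightarrow>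
     (\<forall>u \<in> sobolev_space p \<mu> \<Omega>. E u \<in> sobolev_space p \<mu> UNIV) \<and>
     (\<forall>u \<in> sobolev_space p \<mu> \<Omega>. \<forall>v \<in> sobolev_space p \<mu> \<Omega>.
        (AE x in measure_on \<mu> \<Omega>. u x = v x) \<longrightarrow> (AE x in measure_on \<mu> UNIV. E u x = E v x)) \<and>
     (\<forall>u \<in> sobolev_space p \<mu> \<Omega>. AE x in measure_on \<mu> \<Omega>. E u x = u x) \<and>
     (\<exists>C>0. \<forall>u \<in> sobolev_space p \<mu> \<Omega>.
        sobolev_norm p \<mu> UNIV (E u) \<le> ennreal C * sobolev_norm p \<mu> \<Omega> u)"

definition linear_extension_operator ::
    "real \<Rightarrow> ('a::metric_space set \<Rightarrow> ennreal) \<Rightarrow> 'a set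
      \<Rightarrow> (('a \<Rightarrow> 'b::real_normed_vector) \<Rightarrow> ('a \<Rightarrow> 'b)) \<Rightarrow> bool" where
  "linear_extension_operator p \<mu> \<Omega> E \<longleftrightarrow>
     extension_operator p \<mu> \<Omega> E \<and>
     (\<forall>u \<in> sobolev_space p \<mu> \<Omega>. \<forall>v \<in> sobolev_space p \<mu> \<Omega>.
        AE x in measure_on \<mu> UNIV. E (\<lambda>y. u y + v y) x = E u x + E v x) \<and>
     (\<forall>c::real. \<forall>u \<in> sobolev_space p \<mu> \<Omega>.
        AE x in measure_on \<mu> UNIV. E (\<lambda>y. c *\<^sub>R u y) x = c *\<^sub>R E u x)"

end

theory Submission
  imports Defs "HOL-Library.Nat_Bijection"
begin

text \<open>
  Suppose that every Sobolev function on \<open>\<Omega>\<close> extends to the whole space. Sobolev spaces are complete, so a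
  Baire category argument gives extensions \<open>h\<close> of \<open>u\<close> with norm bounded by that of \<open>u\<close>, although
  without linear dependence on \<open>u\<close>. The Poincare inequality improves itself: \<open>h\<close> satisfies a pointwise
  estimate \<open>|h x - h y| \<le> d(x,y) (g x + g y)\<close> outside a null set, with \<open>g\<close> bounded in \<open>L\<^sup>p\<close> at the exponent
  \<open>p\<close> itself. Restricted to \<open>\<Omega>\<close> this estimate involves \<open>u\<close> alone, and by measure density the averages of
  \<open>u\<close> over \<open>\<Omega> \<inter> B(x, 4s)\<close>, with \<open>s\<close> comparable to the distance of \<open>x\<close> from \<open>\<Omega>\<close>, make sense near \<open>\<Omega>\<close>.
  They depend linearly on \<open>u\<close> and, cut off away from \<open>\<Omega>\<close>, have an upper gradient dominated by the maximal
  functions of \<open>g\<close> and of \<open>u\<close>, which are in \<open>L\<^sup>p\<close> because \<open>p > 1\<close>.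
\<close>

section \<open>Powers and Lebesgue norms\<close>

text \<open>At the exponent p itself, the Poincare inequality controls u through the maximal
  function of \<rho>^p, which is only of weak type: it bounds 2^(jp) times the measure of the bad
  set at each level 2^j, but not the sum over j. The Keith-Zhong argument overcomes this. The least
  measure of an open set off which the functions are 2^j-Lipschitz satisfies a recursion in j;
  absorbing half of its sum makes the series converge, and no inequality with a smaller exponent is
  passed through.

  A Banach-valued h is tested by real functions, its truncated distances to a countable dense set.
  The recursion treats them all together, with common exceptional sets.

  The operator is a formula in u. The extension h and its pointwise gradient occur only in the
  estimates, so the choices made for them cannot spoil linearity. Baire category enters because
  condition (2) carries no bound.

  Weak upper gradients belong to good representatives, so limits must be shown to exist along almost
  every path and not just almost everywhere (\<open>wug_limit\<close>).\<close>

notation ennreal_powr (infixr "powe" 80)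

lemma powe_ennreal: "0 \<le> a \<Longrightarrow> ennreal a powe q = ennreal (a powr q)"
  by (simp add: ennreal_powr_def)

lemma powe_top [simp]: "top powe q = top"
  by (simp add: ennreal_powr_def)

lemma powe_zero [simp]: "0 powe q = 0"
  by (simp add: ennreal_powr_def)

lemma powe_mono: "a \<le> b \<Longrightarrow> 0 \<le> q \<Longrightarrow> a powe q \<le> b powe q"
  by (cases a; cases b)
     (auto simp: powe_ennreal top_unique intro!: ennreal_leI powr_mono2)

lemma powe_eq_0_iff: "a powe q = 0 \<longleftrightarrow> a = 0"
  by (cases a) (auto simp: powe_ennreal)

lemma powe_mult: "(a * b) powe q = a powe q * b powe q"
proof (cases a)
  case (real r)
  show ?thesis
  proof (cases b)
    case (real s)
    then show ?thesis
      using \<open>a = ennreal r\<close> \<open>0 \<le> r\<close> by (simp add: powe_ennreal powr_mult ennreal_mult[symmetric])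
  next
    case top
    then show ?thesis
      using powe_eq_0_iff[of a q] by (cases "a = 0") (auto simp: ennreal_mult_top)
  qed
next
  case top
  then show ?thesis
    using powe_eq_0_iff[of b q] by (cases "b = 0") (auto simp: ennreal_top_mult)
qed

lemma powe_powe_inverse: "0 < q \<Longrightarrow> (a powe q) powe (1 / q) = a"
  by (cases a) (auto simp: powe_ennreal powr_powr)

lemma powe_inverse_powe: "0 < q \<Longrightarrow> (a powe (1 / q)) powe q = a"
  by (cases a) (auto simp: powe_ennreal powr_powr)

lemma powe_le_iff: "0 < q \<Longrightarrow> a powe q \<le> b powe q \<longleftrightarrow> a \<le> b"
  using powe_mono[of a b q] powe_mono[of "a powe q" "b powe q" "1 / q"]
  by (auto simp: powe_powe_inverse)

lemma powe_less_top_iff [simp]: "a powe q < top \<longleftrightarrow> a < top"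
  by (cases a) (auto simp: powe_ennreal)

lemma powe_eq_top_iff [simp]: "a powe q = top \<longleftrightarrow> a = top"
  by (cases a) (auto simp: powe_ennreal)

lemma borel_measurable_powe [measurable (raw)]:
  assumes [measurable]: "f \<in> borel_measurable M"
  shows "(\<lambda>x. f x powe q) \<in> borel_measurable M"
  unfolding ennreal_powr_def by measurable

lemma powe_add_le: 
  assumes "0 < q"
  shows "(a + b) powe q \<le> ennreal (2 powr q) * (a powe q + b powe q)"
proof -
  have "a + b \<le> 2 * max a b"
    unfolding mult_2 by (intro add_mono) auto
  then have "(a + b) powe q \<le> (ennreal 2 * max a b) powe q"
    using assms by (intro powe_mono) auto
  also have "\<dots> = ennreal (2 powr q) * max a b powe q"
    by (simp only: powe_mult powe_ennreal[of 2 q, OF zero_le_numeral])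
  also have "max a b powe q \<le> a powe q + b powe q"
    by (auto simp: max_def)
  finally show ?thesis by (simp add: mult_left_mono)
qed

lemma suminf_ennreal_half: "(\<Sum>n. ennreal ((1/2) ^ Suc n)) = 1"
  by (rule trans[OF suminf_ennreal_eq[OF _ power_half_series] ennreal_1]) (rule zero_le_power, simp)

text \<open>With \<open>B\<close> the right-hand side, each \<open>a n\<close> is at most
  (1/2)^(n+1) * B^(1/q), and these factors sum to 1. The weights 2^(n+1) replace Minkowski's
  inequality for series and work for every q > 0.\<close>

lemma powe_suminf_le:
  assumes "0 < q"
  shows "(\<Sum>n. a n) powe q \<le> (\<Sum>n. ennreal (2 ^ Suc n) powe q * a n powe q)"
proof -
  define B where "B = (\<Sum>n. ennreal (2 ^ Suc n) powe q * a n powe q)"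
  have "a n \<le> ennreal ((1/2) ^ Suc n) * B powe (1 / q)" for n
  proof -
    have "(ennreal (2 ^ Suc n) * a n) powe q \<le> B"
      unfolding B_def powe_mult
      by (rule order_trans[OF _ sum_le_suminf[where I="{n}"]]) auto
    then have "ennreal (2 ^ Suc n) * a n \<le> B powe (1 / q)"
      using powe_le_iff[OF assms, of _ "B powe (1 / q)"] assms by (simp add: powe_inverse_powe)
    then have "ennreal ((1/2) ^ Suc n) * (ennreal (2 ^ Suc n) * a n) \<le> ennreal ((1/2) ^ Suc n) * B powe (1 / q)"
      by (intro mult_left_mono) auto
    also have "ennreal ((1/2) ^ Suc n) * (ennreal (2 ^ Suc n) * a n) = a n"
      unfolding mult.assoc[symmetric]
      by (subst ennreal_mult[symmetric]) (auto simp: power_divide)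
    finally show ?thesis .
  qed
  then have "(\<Sum>n. a n) \<le> (\<Sum>n. ennreal ((1/2) ^ Suc n) * B powe (1 / q))"
    by (intro suminf_le) auto
  also have "\<dots> = B powe (1 / q)"
    using suminf_ennreal_half by (simp add: ennreal_suminf_multc)
  finally have "(\<Sum>n. a n) powe q \<le> (B powe (1 / q)) powe q"
    using assms by (intro powe_mono) auto
  then show ?thesis using assms by (simp add: powe_inverse_powe B_def)
qed

definition Lp_int :: "real \<Rightarrow> ('a set \<Rightarrow> ennreal) \<Rightarrow> 'a set \<Rightarrow> ('a \<Rightarrow> ennreal) \<Rightarrow> ennreal" where
  "Lp_int p \<mu> S g = (\<integral>\<^sup>+x. g x powe p \<partial>measure_on \<mu> S)"

lemma Lp_norm_eq: "Lp_norm p \<mu> S g = Lp_int p \<mu> S g powe (1 / p)"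
  by (simp add: Lp_norm_def Lp_int_def)

lemma Lp_norm_less_top_iff: "Lp_norm p \<mu> S g < top \<longleftrightarrow> Lp_int p \<mu> S g < top"
  by (simp add: Lp_norm_eq)

lemma Lp_norm_le_iff: "0 < p \<Longrightarrow> Lp_norm p \<mu> S g \<le> c \<longleftrightarrow> Lp_int p \<mu> S g \<le> c powe p"
  using powe_le_iff[of p "Lp_norm p \<mu> S g" c] by (simp add: Lp_norm_eq powe_inverse_powe)

section \<open>The complete measure induced by the outer measure\<close>

locale metric_measure =
  fixes \<mu> :: "'a::polish_space set \<Rightarrow> ennreal"
  assumes mms: "metric_measure_space \<mu>"
begin

abbreviation M where "M \<equiv> caratheodory_measure \<mu>"

lemma oms: "outer_measure_space (Pow UNIV) \<mu>"
  using mms by (simp add: metric_measure_space_def borel_regular_outer_measure_def)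

lemma space_M [simp]: "space M = UNIV"
  by (rule space_caratheodory_measure[OF oms])

lemma sets_M: "sets M = lambda_system UNIV (Pow UNIV) \<mu>"
  by (rule sets_caratheodory_measure[OF oms])

lemma emeasure_M: "A \<in> sets M \<Longrightarrow> emeasure M A = \<mu> A"
  unfolding sets_M by (rule emeasure_caratheodory_measure[OF oms])

lemma borel_sets_M: "A \<in> sets borel \<Longrightarrow> A \<in> sets M"
  using mms unfolding sets_M metric_measure_space_def borel_regular_outer_measure_def by auto

lemma open_M [measurable]: "open A \<Longrightarrow> A \<in> sets M"
  by (simp add: borel_sets_M)

lemma borel_measurable_M: "f \<in> borel_measurable borel \<Longrightarrow> f \<in> borel_measurable M"
  by (auto simp: measurable_def intro!: borel_sets_M)

lemma mu_mono: "A \<subseteq> B \<Longrightarrow> \<mu> A \<le> \<mu> B"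
  using oms by (auto simp: outer_measure_space_def increasing_def)

text \<open>Completeness of the Caratheodory measure: monotonicity and subadditivity make a set of
  outer measure zero split every set. Exceptional sets therefore never need a measurability proof of
  their own.\<close>

lemma mu_null_set: "\<mu> A = 0 \<Longrightarrow> A \<in> null_sets M"
proof -
  assume A: "\<mu> A = 0"
  have "\<mu> (A \<inter> X) + \<mu> (- A \<inter> X) = \<mu> X" for X
  proof (rule antisym)
    have "\<mu> (A \<inter> X) = 0" using mu_mono[of "A \<inter> X" A] A by simp
    then show "\<mu> (A \<inter> X) + \<mu> (- A \<inter> X) \<le> \<mu> X" using mu_mono[of "- A \<inter> X" X] by simp
    have "subadditive (Pow UNIV) \<mu>"
      using oms sigma_algebra_Pow[of UNIV]
      by (auto simp: outer_measure_space_def sigma_algebra_iff algebra_def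
          intro!: ring_of_sets.countably_subadditive_subadditive)
    then have "\<mu> ((A \<inter> X) \<union> (- A \<inter> X)) \<le> \<mu> (A \<inter> X) + \<mu> (- A \<inter> X)"
      by (auto simp: subadditive_def)
    then show "\<mu> X \<le> \<mu> (A \<inter> X) + \<mu> (- A \<inter> X)" by (simp add: Int_Un_distrib2[symmetric])
  qed
  then have "A \<in> sets M" by (auto simp: sets_M lambda_system_def Compl_eq_Diff_UNIV)
  then show ?thesis using A by (auto simp: null_sets_def emeasure_M)
qed

lemma null_sets_iff: "A \<in> null_sets M \<longleftrightarrow> \<mu> A = 0"
  using mu_null_set emeasure_M by (auto simp: null_sets_def)

lemma null_subset: "A \<in> null_sets M \<Longrightarrow> B \<subseteq> A \<Longrightarrow> B \<in> null_sets M"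
  using mu_mono[of B A] by (simp add: null_sets_iff)

text \<open>Exceptional sets are merely null, while the functions integrated along paths must be
  Borel. Borel regularity of \<mu> closes this gap in \<open>wug_limit\<close>.\<close>

lemma null_borel_cover:
  assumes "A \<in> null_sets M"
  obtains B where "B \<in> sets borel" "A \<subseteq> B" "emeasure M B = 0"
  using mms assms borel_sets_M emeasure_M unfolding metric_measure_space_def borel_regular_outer_measure_def
  by (metis null_sets_iff)

lemma AE_M_iff: "(AE x in M. P x) \<longleftrightarrow> {x. \<not> P x} \<in> null_sets M"
  using null_subset by (auto simp: eventually_ae_filter)

lemma AE_on_iff: "S \<in> sets M \<Longrightarrow> (AE x in measure_on \<mu> S. P x) \<longleftrightarrow> (AE x in M. x \<in> S \<longrightarrow> P x)"
  by (subst AE_restrict_space_iff) auto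

lemma sets_on: "S \<in> sets M \<Longrightarrow> A \<in> sets (measure_on \<mu> S) \<longleftrightarrow> A \<in> sets M \<and> A \<subseteq> S"
  by (subst sets_restrict_space_iff) auto

lemma null_sets_on: "S \<in> sets M \<Longrightarrow> N \<in> null_sets (measure_on \<mu> S) \<longleftrightarrow> N \<in> null_sets M \<and> N \<subseteq> S"
  by (auto simp: null_sets_def sets_on emeasure_restrict_space)

lemma space_on [simp]: "space (measure_on \<mu> S) = S"
  by (simp add: space_restrict_space)

lemma nn_integral_on: "S \<in> sets M \<Longrightarrow> (\<integral>\<^sup>+x. f x \<partial>measure_on \<mu> S) = (\<integral>\<^sup>+x. f x * indicator S x \<partial>M)"
  by (subst nn_integral_restrict_space) auto

lemma Lp_int_on: "S \<in> sets M \<Longrightarrow> Lp_int p \<mu> S g = (\<integral>\<^sup>+x. g x powe p * indicator S x \<partial>M)"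
  by (simp add: Lp_int_def nn_integral_on)

lemma Lp_int_UNIV: "Lp_int p \<mu> UNIV g = (\<integral>\<^sup>+x. g x powe p \<partial>M)"
  by (simp add: Lp_int_on)

lemma borel_on_measurable:
  assumes "f \<in> borel_measurable (restrict_space borel S)"
  shows "f \<in> borel_measurable (measure_on \<mu> S)"
  using assms borel_sets_M by (auto simp: measurable_def space_restrict_space sets_restrict_space)

lemma AE_on_cong_measurable:
  fixes f :: "'a \<Rightarrow> 'b::topological_space"
  assumes S: "S \<in> sets M" and f: "f \<in> borel_measurable (measure_on \<mu> S)"
    and eq: "AE x in measure_on \<mu> S. g x = f x"
  shows "g \<in> borel_measurable (measure_on \<mu> S)"
proof (rule measurableI)
  fix A :: "'b set" assume A: "A \<in> sets borel"
  obtain N where N: "N \<in> null_sets M" "\<And>x. x \<in> S \<Longrightarrow> x \<notin> N \<Longrightarrow> g x = f x"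
    using eq by (auto simp: AE_on_iff[OF S] AE_M_iff)
  have "g -` A \<inter> S = ((f -` A \<inter> S) - N) \<union> (g -` A \<inter> S \<inter> N)"
    using N by auto
  moreover have "f -` A \<inter> S \<in> sets M" 
    using measurable_sets[OF f A] by (simp add: sets_on[OF S])
  moreover have "g -` A \<inter> S \<inter> N \<in> sets M"
    using null_subset[OF N(1), of "g -` A \<inter> S \<inter> N"] by auto
  ultimately have "g -` A \<inter> S \<in> sets M"
    using N(1) by (metis sets.Un sets.Diff null_setsD2)
  then show "g -` A \<inter> space (measure_on \<mu> S) \<in> sets (measure_on \<mu> S)"
    by (simp add: sets_on[OF S])
qed auto

lemma ball_emeasure: "0 < r \<Longrightarrow> 0 < emeasure M (ball x r)" "emeasure M (ball x r) < top"
proof -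
  show "0 < r \<Longrightarrow> 0 < emeasure M (ball x r)"
    using mms by (simp add: emeasure_M metric_measure_space_def)
  show "emeasure M (ball x r) < top"
  proof (cases "0 < r")
    case True
    then show ?thesis
      using mms by (simp add: emeasure_M metric_measure_space_def)
  qed (simp add: ball_empty)
qed

end

section \<open>Length of paths\<close>

lemma path_length_upper:
  "mono t \<Longrightarrow> range t \<subseteq> {a..b} \<Longrightarrow> (\<Sum>i<n. ennreal (dist (\<gamma> (t i)) (\<gamma> (t (Suc i))))) \<le> path_length a b \<gamma>"
  unfolding path_length_def by (rule SUP_upper2[of "(n, t)"]) auto

lemma path_length_least:
  "(\<And>n t. mono t \<Longrightarrow> range t \<subseteq> {a..b} \<Longrightarrow> (\<Sum>i<n. ennreal (dist (\<gamma> (t i)) (\<gamma> (t (Suc i))))) \<le> c)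
   \<Longrightarrow> path_length a b \<gamma> \<le> c"
  unfolding path_length_def by (rule SUP_least) auto

lemma dist_le_path_length:
  assumes "s \<le> t"
  shows "ennreal (dist (\<gamma> s) (\<gamma> t)) \<le> path_length s t \<gamma>"
proof -
  have "mono (\<lambda>i. if i = (0::nat) then s else t)" "range (\<lambda>i. if i = (0::nat) then s else t) \<subseteq> {s..t}"
    using assms by (auto simp: mono_def)
  from path_length_upper[OF this, where n=1 and \<gamma>=\<gamma>] show ?thesis by simp
qed

text \<open>If m lies between x and y this is the triangle inequality; otherwise one of the two
  terms vanishes and the other is the left-hand side.\<close>

lemma dist_clamp_le:
  fixes \<gamma> :: "real \<Rightarrow> 'a::metric_space"
  assumes "x \<le> y"
  shows "ennreal (dist (\<gamma> x) (\<gamma> y)) \<le>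
    ennreal (dist (\<gamma> (min x m)) (\<gamma> (min y m))) + ennreal (dist (\<gamma> (max x m)) (\<gamma> (max y m)))"
  using assms dist_triangle[of "\<gamma> x" "\<gamma> y" "\<gamma> m"]
  by (auto simp: min_def max_def ennreal_plus[symmetric] simp del: ennreal_plus intro!: ennreal_leI)

text \<open>Splitting a chain at \<open>m\<close>: replace every point \<open>t i\<close> by \<open>min (t i) m\<close> and by \<open>max (t i) m\<close>.\<close>

lemma sum_clamp_le:
  fixes \<gamma> :: "real \<Rightarrow> 'a::metric_space"
  assumes "mono t"
  shows "(\<Sum>i<n. ennreal (dist (\<gamma> (t i)) (\<gamma> (t (Suc i))))) \<le>
    (\<Sum>i<n. ennreal (dist (\<gamma> (min (t i) m)) (\<gamma> (min (t (Suc i)) m)))) +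
    (\<Sum>i<n. ennreal (dist (\<gamma> (max (t i) m)) (\<gamma> (max (t (Suc i)) m))))"
  using assms unfolding sum.distrib[symmetric]
  by (intro sum_mono dist_clamp_le) (auto simp: mono_def)

lemma path_length_split:
  fixes \<gamma> :: "real \<Rightarrow> 'a::metric_space"
  assumes "a \<le> m" "m \<le> b"
  shows "path_length a b \<gamma> = path_length a m \<gamma> + path_length m b \<gamma>"
proof (rule antisym)
  show "path_length a b \<gamma> \<le> path_length a m \<gamma> + path_length m b \<gamma>"
  proof (rule path_length_least)
    fix n and t :: "nat \<Rightarrow> real" assume t: "mono t" "range t \<subseteq> {a..b}"
    show "(\<Sum>i<n. ennreal (dist (\<gamma> (t i)) (\<gamma> (t (Suc i))))) \<le> path_length a m \<gamma> + path_length m b \<gamma>"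
      using t assms
      by (intro order_trans[OF sum_clamp_le[of t \<gamma> n m]] add_mono path_length_upper[of "\<lambda>i. min (t i) m" a m]
            path_length_upper[of "\<lambda>i. max (t i) m" m b])
         (auto simp: mono_def image_subset_iff intro: min.coboundedI1 max.coboundedI1 min.mono max.mono)
  qed
  let ?C = "\<lambda>a b. {(n::nat, t::nat \<Rightarrow> real). mono t \<and> range t \<subseteq> {a..b}}"
  let ?s = "\<lambda>(n, t). \<Sum>i<n. ennreal (dist (\<gamma> (t i)) (\<gamma> (t (Suc i))))"
  have pl: "path_length a b \<gamma> = (SUP x\<in>?C a b. ?s x)" for a b
    by (simp only: path_length_def)
  have ne: "?C a b \<noteq> {}" if "a \<le> b" for a b
    using that by (auto simp: mono_def intro!: exI[of _ "\<lambda>_. a"])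
  have "?s x + ?s y \<le> path_length a b \<gamma>" if "x \<in> ?C a m" "y \<in> ?C m b" for x y
  proof -
    obtain n t k u where xy: "x = (n, t)" "y = (k, u)" by (cases x; cases y)
    with that have t: "mono t" "\<And>i. a \<le> t i \<and> t i \<le> m" and u: "mono u" "\<And>i. m \<le> u i \<and> u i \<le> b"
      by (auto simp: image_subset_iff)
    \<comment> \<open>Concatenation of the two chains: the n + 1 points of \<open>t\<close> come
      first, and the step from \<open>t n\<close> to \<open>u 0\<close> is dropped from the
      sum.\<close>
    define r where "r i = (if i \<le> n then t i else u (i - Suc n))" for i
    have "r i \<le> r j" if "i \<le> j" for i j
      using that t(2)[of i] u(2)[of "j - Suc n"] monoD[OF t(1), of i j] monoD[OF u(1), of "i - Suc n" "j - Suc n"]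
      by (auto simp: r_def diff_le_mono)
    moreover have "a \<le> r i \<and> r i \<le> b" for i
      using t(2)[of i] u(2)[of "i - Suc n"] assms by (auto simp: r_def)
    ultimately have r: "mono r" "range r \<subseteq> {a..b}"
      by (auto simp: mono_def)
    have "?s x = (\<Sum>i<n. ennreal (dist (\<gamma> (r i)) (\<gamma> (r (Suc i)))))"
      unfolding xy by (auto simp: r_def intro!: sum.cong)
    moreover have "?s y = (\<Sum>i\<in>{Suc n..<Suc n + k}. ennreal (dist (\<gamma> (r i)) (\<gamma> (r (Suc i)))))"
      unfolding xy by (simp only: prod.case, intro sum.reindex_bij_witness[of _ "\<lambda>i. i - Suc n" "\<lambda>i. i + Suc n"])
         (auto simp: r_def Suc_diff_le)
    ultimately have "?s x + ?s y = (\<Sum>i\<in>{..<n} \<union> {Suc n..<Suc n + k}. ennreal (dist (\<gamma> (r i)) (\<gamma> (r (Suc i)))))"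
      by (subst sum.union_disjoint) auto
    also have "\<dots> \<le> (\<Sum>i<Suc n + k. ennreal (dist (\<gamma> (r i)) (\<gamma> (r (Suc i)))))"
      by (intro sum_mono2) auto
    also have "\<dots> \<le> path_length a b \<gamma>"
      by (rule path_length_upper[OF r])
    finally show ?thesis .
  qed
  then have "(SUP x\<in>?C a m. ?s x + ?s y) \<le> path_length a b \<gamma>" if "y \<in> ?C m b" for y
    using that by (intro SUP_least)
  then have *: "path_length a m \<gamma> + ?s y \<le> path_length a b \<gamma>" if "y \<in> ?C m b" for y
    using that unfolding pl[of a m] ennreal_SUP_add_left[OF ne[OF assms(1)], of ?s "?s y", symmetric] by blast
  then have "(SUP y\<in>?C m b. path_length a m \<gamma> + ?s y) \<le> path_length a b \<gamma>"
    by (intro SUP_least)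
  then show "path_length a m \<gamma> + path_length m b \<gamma> \<le> path_length a b \<gamma>"
    unfolding pl[of m b] ennreal_SUP_add_right[OF ne[OF assms(2)], of "path_length a m \<gamma>" ?s, symmetric] by blast
qed

locale rect_path =
  fixes a b :: real and \<gamma> :: "real \<Rightarrow> 'a::metric_space"
  assumes ab: "a \<le> b" and cont: "continuous_on {a..b} \<gamma>" and rect: "rectifiable a b \<gamma>"
begin

abbreviation L where "L s t \<equiv> path_length s t \<gamma>"

lemma L_split: "s \<le> m \<Longrightarrow> m \<le> t \<Longrightarrow> L s t = L s m + L m t"
  by (rule path_length_split)

lemma L_finite: "a \<le> s \<Longrightarrow> s \<le> t \<Longrightarrow> t \<le> b \<Longrightarrow> L s t < top"
  using rect L_split[of a s b] L_split[of s t b] by (simp add: rectifiable_def)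

lemma sub: "a \<le> s \<Longrightarrow> s \<le> t \<Longrightarrow> t \<le> b \<Longrightarrow> rect_path s t \<gamma>"
  using L_finite[of s t] by (auto simp: rect_path_def rectifiable_def intro: continuous_on_subset[OF cont])

text \<open>Continuity of arc length. Clamp a chain that is optimal up to e/2 at s and at t: its
  outer parts are at most \<open>L a s\<close> and \<open>L t b\<close>, and its n middle steps are
  shorter than \<eta> each by uniform continuity, so they add up to at most e/2. Additivity of
  length leaves at most e for \<open>L s t\<close>.\<close>

lemma L_uniformly_small:
  assumes "0 < e"
  shows "\<exists>d>0. \<forall>s t. a \<le> s \<and> s \<le> t \<and> t \<le> b \<and> t - s < d \<longrightarrow> L s t \<le> ennreal e"
proof -
  have fin: "L a b < top" using L_finite[of a b] ab by simp
  have ex: "\<exists>n u. mono u \<and> range u \<subseteq> {a..b} \<and>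
      L a b \<le> (\<Sum>i<n. ennreal (dist (\<gamma> (u i)) (\<gamma> (u (Suc i))))) + ennreal (e/2)"
  \<comment> \<open>Truncated subtraction of e/2 falls strictly below \<open>L a b\<close> only if
    that length is positive; in the small case the empty sum is good enough.\<close>
  proof (cases "L a b \<le> ennreal (e/2)")
    case True
    then show ?thesis
      using ab by (intro exI[of _ "0::nat"] exI[of _ "\<lambda>_. a"]) (auto simp: mono_def)
  next
    case False
    then have "L a b - ennreal (e/2) < L a b"
      using fin assms by (cases "L a b") (auto simp: ennreal_minus ennreal_less_iff)
    then obtain n u where u: "mono u" "range u \<subseteq> {a..b}"
      "L a b - ennreal (e/2) < (\<Sum>i<n. ennreal (dist (\<gamma> (u i)) (\<gamma> (u (Suc i)))))"
      by (subst (asm) (2) path_length_def) (auto simp: less_SUP_iff)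
    then show ?thesis
      by (intro exI[of _ n] exI[of _ u]) (auto simp: ennreal_minus_le_iff add.commute dest!: less_imp_le)
  qed
  then obtain n u where u: "mono u" "range u \<subseteq> {a..b}"
    and nu: "L a b \<le> (\<Sum>i<n. ennreal (dist (\<gamma> (u i)) (\<gamma> (u (Suc i))))) + ennreal (e/2)"
    by blast
  define \<eta> where "\<eta> = e / (2 * (real n + 1))"
  have \<eta>: "0 < \<eta>" using assms by (simp add: \<eta>_def)
  have "uniformly_continuous_on {a..b} \<gamma>"
    by (rule compact_uniformly_continuous[OF cont]) simp
  then obtain d where d: "0 < d" "\<And>x y. x \<in> {a..b} \<Longrightarrow> y \<in> {a..b} \<Longrightarrow> dist y x < d \<Longrightarrow> dist (\<gamma> y) (\<gamma> x) < \<eta>"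
    using \<eta> unfolding uniformly_continuous_on_def by metis
  have "L s t \<le> ennreal e" if st: "a \<le> s" "s \<le> t" "t \<le> b" "t - s < d" for s t
  proof -
    let ?v = "\<lambda>i. max (u i) s"
    have v: "mono ?v" by (rule monoI, rule max.mono[OF monoD[OF u(1)] order_refl])
    have ul: "a \<le> u i" "u i \<le> b" for i using u by (auto simp: image_subset_iff)
    have "(\<Sum>i<n. ennreal (dist (\<gamma> (u i)) (\<gamma> (u (Suc i))))) \<le>
      L a s + (\<Sum>i<n. ennreal (dist (\<gamma> (?v i)) (\<gamma> (?v (Suc i)))))"
    proof (intro order_trans[OF sum_clamp_le[of u \<gamma> n s]] add_mono path_length_upper[of "\<lambda>i. min (u i) s" a s])
      show "mono (\<lambda>i. min (u i) s)" using monoD[OF u(1)] by (intro monoI min.mono) auto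
      show "range (\<lambda>i. min (u i) s) \<subseteq> {a..s}" using ul st by auto
    qed (use u in auto)
    also have "(\<Sum>i<n. ennreal (dist (\<gamma> (?v i)) (\<gamma> (?v (Suc i))))) \<le>
       (\<Sum>i<n. ennreal \<eta>) + L t b"
    proof (intro order_trans[OF sum_clamp_le[of ?v \<gamma> n t, OF v]] add_mono sum_mono path_length_upper[of "\<lambda>i. max (?v i) t" t b])
      show "ennreal (dist (\<gamma> (min (?v i) t)) (\<gamma> (min (?v (Suc i)) t))) \<le> ennreal \<eta>" for i
        using st by (intro ennreal_leI less_imp_le d(2)) (auto simp: dist_real_def)
      show "mono (\<lambda>i. max (?v i) t)" by (rule monoI, rule max.mono[OF monoD[OF v] order_refl])
      show "range (\<lambda>i. max (?v i) t) \<subseteq> {t..b}" using ul st by auto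
    qed
    also have "(\<Sum>i<n. ennreal \<eta>) \<le> ennreal (e / 2)"
    proof -
      have "real n * \<eta> \<le> e / 2" using assms by (simp add: \<eta>_def field_simps)
      then show ?thesis using \<eta> by (auto simp: ennreal_of_nat_eq_real_of_nat ennreal_mult[symmetric] intro: ennreal_leI)
    qed
    finally have "L a b \<le> L a s + (ennreal (e/2) + L t b) + ennreal (e/2)"
      using nu by (auto elim!: order_trans intro: add_mono)
    moreover have "L a b = L a s + (L s t + L t b)"
      using L_split[of a s b] L_split[of s t b] st by simp
    moreover have "L a s < top" "L s t < top" "L t b < top"
      using L_finite st by auto
    ultimately show ?thesis using assms
      by (cases "L a s"; cases "L s t"; cases "L t b") (auto simp: ennreal_plus[symmetric] simp del: ennreal_plus)
  qed
  then show ?thesis using d(1) by blast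
qed

definition F where "F t = enn2real (L a (max a (min b t)))"

lemma F_diff: "a \<le> s \<Longrightarrow> s \<le> t \<Longrightarrow> t \<le> b \<Longrightarrow> ennreal (F t - F s) = L s t \<and> F s \<le> F t"
  using L_split[of a s t] L_finite[of a s] L_finite[of s t]
  by (cases "L a s"; cases "L s t") (auto simp: F_def ennreal_plus[symmetric] simp del: ennreal_plus)

lemma F_clamp: "F t = F (max a (min b t))"
  using ab by (simp add: F_def)

lemma F_mono: "s \<le> t \<Longrightarrow> F s \<le> F t"
  using F_diff[of "max a (min b s)" "max a (min b t)"] ab
  by (subst (1 2) F_clamp) (auto simp: min_def max_def)

text \<open>Continuity of \<open>F\<close> makes the length measure atomless, which is what allows
  integrals over adjacent closed intervals to be added in \<open>integral_split\<close>.\<close>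

lemma F_cont: "continuous_on UNIV F"
  unfolding continuous_on_iff
proof (intro ballI allI impI)
  fix x e :: real assume "0 < e"
  then obtain d where d: "0 < d" "\<And>s t. a \<le> s \<Longrightarrow> s \<le> t \<Longrightarrow> t \<le> b \<Longrightarrow> t - s < d \<Longrightarrow> L s t \<le> ennreal (e/2)"
    using L_uniformly_small[of "e/2"] by auto
  have *: "F t - F s \<le> e/2" if "s \<le> t" "t - s < d" for s t
  proof -
    have "ennreal (F (max a (min b t)) - F (max a (min b s))) \<le> ennreal (e/2)"
      using that ab F_diff[of "max a (min b s)" "max a (min b t)"] 
        d(2)[of "max a (min b s)" "max a (min b t)"] by (auto simp: min_def max_def split: if_splits)
    then show ?thesis using \<open>0 < e\<close> F_clamp by (simp add: ennreal_le_iff)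
  qed
  show "\<exists>d>0. \<forall>x'\<in>UNIV. dist x' x < d \<longrightarrow> dist (F x') (F x) < e"
  proof (intro exI[of _ d] conjI ballI impI d(1))
    fix y assume "dist y x < d"
    then show "dist (F y) (F x) < e"
      using *[of x y] *[of y x] F_mono[of x y] F_mono[of y x] \<open>0 < e\<close> 
      by (cases "x \<le> y") (auto simp: dist_real_def)
  qed
qed

abbreviation lm where "lm \<equiv> length_measure a b \<gamma>"

lemma lm_eq: "lm = interval_measure F"
  by (simp add: length_measure_def F_def[abs_def])

lemma sets_lm [simp, measurable_cong]: "sets lm = sets borel" and space_lm [simp]: "space lm = UNIV"
  by (simp_all add: lm_eq)

lemma emeasure_lm_Icc: "a \<le> s \<Longrightarrow> s \<le> t \<Longrightarrow> t \<le> b \<Longrightarrow> emeasure lm {s..t} = L s t"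
  using F_diff by (simp add: lm_eq emeasure_interval_measure_Icc F_mono F_cont)

lemma emeasure_lm_Ioc: "a \<le> s \<Longrightarrow> s \<le> t \<Longrightarrow> t \<le> b \<Longrightarrow> emeasure lm {s<..t} = L s t"
  using F_diff F_cont by (simp add: lm_eq emeasure_interval_measure_Ioc F_mono continuous_on_eq_continuous_within
      continuous_at_imp_continuous_at_within)

lemma lm_singleton: "emeasure lm {x} = 0"
  using emeasure_interval_measure_Icc[of x x F] F_mono F_cont by (simp add: lm_eq)

lemma AE_lm_neq: "AE t in lm. t \<noteq> x"
  using lm_singleton by (intro AE_I[of _ _ "{x}"]) auto

lemma path_integral_eq: "path_integral \<rho> (a, b, \<gamma>) = (\<integral>\<^sup>+t\<in>{a..b}. \<rho> (\<gamma> t) \<partial>lm)"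
  using rect by (simp add: path_integral_def)

text \<open>The subpath has a length measure of its own, built from its own endpoints. Restricted to
  {s..t} the two measures give the same finite mass to every half-line {x<..}, hence
  coincide.\<close>

lemma path_integral_sub:
  assumes st: "a \<le> s" "s \<le> t" "t \<le> b"
    and m: "(\<lambda>x. \<rho> (\<gamma> x) * indicator {a..b} x) \<in> borel_measurable borel"
  shows "path_integral \<rho> (s, t, \<gamma>) = (\<integral>\<^sup>+x\<in>{s..t}. \<rho> (\<gamma> x) \<partial>lm)"
proof -
  interpret S: rect_path s t \<gamma> by (rule sub[OF st])
  have e: "emeasure (density lm (indicator {s..t})) {x<..} = emeasure (density S.lm (indicator {s..t})) {x<..}"
       "emeasure (density lm (indicator {s..t})) {x<..} < \<infinity>" for x
  proof -
    have i: "{s..t} \<inter> {x<..} = (if x < s then {s..t} else if x \<le> t then {x<..t} else {})"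
      by auto
    have "emeasure lm ({s..t} \<inter> {x<..}) = emeasure S.lm ({s..t} \<inter> {x<..})"
         "emeasure lm ({s..t} \<inter> {x<..}) < top"
      unfolding i using st emeasure_lm_Icc[of s t] S.emeasure_lm_Icc[of s t] emeasure_lm_Ioc[of x t] S.emeasure_lm_Ioc[of x t]
        L_finite[of s t] L_finite[of x t]
      by auto
    then show "emeasure (density lm (indicator {s..t})) {x<..} = emeasure (density S.lm (indicator {s..t})) {x<..}"
       "emeasure (density lm (indicator {s..t})) {x<..} < \<infinity>"
      by (simp_all add: emeasure_density indicator_inter_arith[symmetric])
  qed
  have eq: "density lm (indicator {s..t}) = density S.lm (indicator {s..t})"
    by (rule measure_eqI_lessThan) (use e in simp_all)
  have mf: "(\<lambda>x. \<rho> (\<gamma> x) * indicator {s..t} x) \<in> borel_measurable borel"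
  proof -
    have "(\<lambda>x. \<rho> (\<gamma> x) * indicator {s..t} x) = (\<lambda>x. \<rho> (\<gamma> x) * indicator {a..b} x * indicator {s..t} x)"
      using st by (auto simp: fun_eq_iff split: split_indicator)
    then show ?thesis using m by simp
  qed
  have "(\<integral>\<^sup>+x\<in>{s..t}. \<rho> (\<gamma> x) \<partial>S.lm) = (\<integral>\<^sup>+x. (\<rho> (\<gamma> x) * indicator {s..t} x) \<partial>density S.lm (indicator {s..t}))"
    using mf by (subst nn_integral_density) (auto intro!: nn_integral_cong split: split_indicator)
  also have "\<dots> = (\<integral>\<^sup>+x\<in>{s..t}. \<rho> (\<gamma> x) \<partial>lm)"
    unfolding eq[symmetric] using mf by (subst nn_integral_density) (auto intro!: nn_integral_cong split: split_indicator)
  finally show ?thesis by (simp add: S.path_integral_eq)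
qed

lemma integral_split:
  assumes st: "a \<le> s" "s \<le> m" "m \<le> t" "t \<le> b"
    and [measurable]: "(\<lambda>x. f x * indicator {a..b} x) \<in> borel_measurable borel"
  shows "(\<integral>\<^sup>+x\<in>{s..t}. f x \<partial>lm) = (\<integral>\<^sup>+x\<in>{s..m}. f x \<partial>lm) + (\<integral>\<^sup>+x\<in>{m..t}. f x \<partial>lm)"
proof -
  have f: "f x * indicator {u..v} x = f x * indicator {a..b} x * indicator {u..v} x" if "a \<le> u" "v \<le> b" for u v x
    using that by (auto split: split_indicator)
  have [measurable]: "(\<lambda>x. f x * indicator {u..v} x) \<in> borel_measurable borel" if "a \<le> u" "v \<le> b" for u v
    unfolding f[OF that] by measurable
  have "(\<integral>\<^sup>+x\<in>{s..m}. f x \<partial>lm) + (\<integral>\<^sup>+x\<in>{m..t}. f x \<partial>lm) = 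
    (\<integral>\<^sup>+x. (f x * indicator {s..m} x + f x * indicator {m..t} x) \<partial>lm)"
    using st by (subst nn_integral_add) auto
  also have "\<dots> = (\<integral>\<^sup>+x\<in>{s..t}. f x \<partial>lm)"
    using AE_lm_neq[of m] st by (intro nn_integral_cong_AE) (auto elim!: eventually_mono split: split_indicator)
  finally show ?thesis by simp
qed

end

text \<open>Compactness in the form of bisection: the estimate passes from two adjacent intervals to
  their union by the triangle inequality and superadditivity of \<open>I\<close>. The local
  hypothesis concerns only intervals containing x, so near x everything may be compared with the
  value at x itself.\<close>

lemma local_to_global:
  fixes \<phi> :: "real \<Rightarrow> 'b::metric_space" and I :: "real \<Rightarrow> real \<Rightarrow> ennreal"
  assumes "a \<le> b"
    and add: "\<And>s m t. a \<le> s \<Longrightarrow> s \<le> m \<Longrightarrow> m \<le> t \<Longrightarrow> t \<le> b \<Longrightarrow> I s m + I m t \<le> I s t"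
    and loc: "\<And>x. a \<le> x \<Longrightarrow> x \<le> b \<Longrightarrow> \<exists>d>0. \<forall>s t. a \<le> s \<and> s \<le> x \<and> x \<le> t \<and> t \<le> b \<and> t - s < d \<longrightarrow>
      ennreal (dist (\<phi> s) (\<phi> t)) \<le> I s t"
  shows "ennreal (dist (\<phi> a) (\<phi> b)) \<le> I a b"
proof -
  have "a \<le> a \<and> b \<le> b \<longrightarrow> ennreal (dist (\<phi> a) (\<phi> b)) \<le> I a b"
    using \<open>a \<le> b\<close>
  proof (rule Bolzano[where P="\<lambda>s t. a \<le> s \<and> t \<le> b \<longrightarrow> ennreal (dist (\<phi> s) (\<phi> t)) \<le> I s t"])
    fix s m t assume *: "a \<le> s \<and> m \<le> b \<longrightarrow> ennreal (dist (\<phi> s) (\<phi> m)) \<le> I s m"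
      "a \<le> m \<and> t \<le> b \<longrightarrow> ennreal (dist (\<phi> m) (\<phi> t)) \<le> I m t" "s \<le> m" "m \<le> t"
    show "a \<le> s \<and> t \<le> b \<longrightarrow> ennreal (dist (\<phi> s) (\<phi> t)) \<le> I s t"
    proof
      assume st: "a \<le> s \<and> t \<le> b"
      have "ennreal (dist (\<phi> s) (\<phi> t)) \<le> ennreal (dist (\<phi> s) (\<phi> m)) + ennreal (dist (\<phi> m) (\<phi> t))"
        by (simp add: ennreal_plus[symmetric] ennreal_leI dist_triangle del: ennreal_plus)
      also have "\<dots> \<le> I s m + I m t" using * st by (intro add_mono) auto
      also have "\<dots> \<le> I s t" using add[of s m t] * st by auto
      finally show "ennreal (dist (\<phi> s) (\<phi> t)) \<le> I s t" .
    qed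
  next
    fix x assume "a \<le> x" "x \<le> b"
    from loc[OF this] show "\<exists>d>0. \<forall>s t. s \<le> x \<and> x \<le> t \<and> t - s < d \<longrightarrow> a \<le> s \<and> t \<le> b \<longrightarrow> ennreal (dist (\<phi> s) (\<phi> t)) \<le> I s t"
      by blast
  qed
  then show ?thesis by simp
qed

lemma atomless_small_interval:
  fixes N :: "real measure"
  assumes "finite_measure N" "sets N = sets borel" "emeasure N {x} = 0" "0 < e"
  shows "\<exists>d>0. measure N {x-d..x+d} < e"
proof -
  interpret finite_measure N by fact
  have "(\<lambda>n. measure N {x - 1 / real (Suc n)..x + 1 / real (Suc n)}) \<longlonglongrightarrow> measure N (\<Inter>n. {x - 1 / real (Suc n)..x + 1 / real (Suc n)})"
  proof (rule finite_Lim_measure_decseq)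
    show "decseq (\<lambda>n. {x - 1 / real (Suc n)..x + 1 / real (Suc n)})"
    proof (rule decseq_SucI)
      fix n
      have "1 / real (Suc (Suc n)) \<le> 1 / real (Suc n)" by (simp add: frac_le)
      then show "{x - 1 / real (Suc (Suc n))..x + 1 / real (Suc (Suc n))} \<le> {x - 1 / real (Suc n)..x + 1 / real (Suc n)}"
        by auto
    qed
  next
    show "range (\<lambda>n. {x - 1 / real (Suc n)..x + 1 / real (Suc n)}) \<subseteq> sets N"
      by (simp add: assms(2) image_subset_iff del: of_nat_Suc)
  qed
  also have "(\<Inter>n. {x - 1 / real (Suc n)..x + 1 / real (Suc n)}) = {x}"
  proof (intro set_eqI iffI)
    fix y assume "y \<in> (\<Inter>n. {x - 1 / real (Suc n)..x + 1 / real (Suc n)})"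
    then have "\<bar>y - x\<bar> \<le> 1 / real (Suc n)" for n
      by (auto simp: abs_le_iff algebra_simps simp del: of_nat_Suc)
    then have "\<bar>y - x\<bar> \<le> 0"
      by (intro LIMSEQ_le_const[OF LIMSEQ_inverse_real_of_nat, of "\<bar>y - x\<bar>"])
         (auto simp: inverse_eq_divide simp del: of_nat_Suc)
    then show "y \<in> {x}" by auto
  qed auto
  finally have "(\<lambda>n. measure N {x - 1 / real (Suc n)..x + 1 / real (Suc n)}) \<longlonglongrightarrow> 0"
    using assms(3) by (simp add: measure_def)
  from order_tendstoD(2)[OF this \<open>0 < e\<close>] obtain n where "measure N {x - 1 / real (Suc n)..x + 1 / real (Suc n)} < e"
    by (auto simp: eventually_sequentially)
  then show ?thesis by (intro exI[of _ "1 / real (Suc n)"]) (auto simp del: of_nat_Suc)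
qed

section \<open>Weak upper gradients\<close>

lemma paths_in_rect_path:
  "(a, b, \<gamma>) \<in> paths_in S \<Longrightarrow> rectifiable a b \<gamma> \<Longrightarrow> rect_path a b \<gamma>"
  by (auto simp: paths_in_def rect_path_def)

lemma path_integral_finite_rectifiable: "path_integral \<rho> (a, b, \<gamma>) < top \<Longrightarrow> rectifiable a b \<gamma>"
  by (auto simp: path_integral_def split: if_splits)

lemma paths_in_sub:
  "(a, b, \<gamma>) \<in> paths_in S \<Longrightarrow> a \<le> s \<Longrightarrow> s \<le> t \<Longrightarrow> t \<le> b \<Longrightarrow> (s, t, \<gamma>) \<in> paths_in S"
  by (force simp: paths_in_def intro: continuous_on_subset)

lemma measurable_along_path:
  assumes \<rho>: "\<rho> \<in> borel_measurable (restrict_space borel S)" and \<gamma>: "(a, b, \<gamma>) \<in> paths_in S"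
  shows "(\<lambda>x. \<rho> (\<gamma> x) * indicator {a..b} x :: ennreal) \<in> borel_measurable borel"
proof -
  have "\<gamma> \<in> restrict_space borel {a..b} \<rightarrow>\<^sub>M restrict_space borel S"
    using \<gamma> by (intro measurable_restrict_space2 borel_measurable_continuous_on_restrict)
      (auto simp: paths_in_def space_restrict_space)
  from measurable_compose[OF this \<rho>] show ?thesis
    by (subst (asm) borel_measurable_restrict_space_iff_ennreal) auto
qed

lemma path_integral_sub_le:
  assumes \<rho>: "\<rho> \<in> borel_measurable (restrict_space borel S)" and \<gamma>: "(a, b, \<gamma>) \<in> paths_in S"
    and st: "a \<le> s" "s \<le> t" "t \<le> b"
  shows "path_integral \<rho> (s, t, \<gamma>) \<le> path_integral \<rho> (a, b, \<gamma>)"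
proof (cases "rectifiable a b \<gamma>")
  case True
  interpret rect_path a b \<gamma> by (rule paths_in_rect_path[OF \<gamma> True])
  show ?thesis
    unfolding path_integral_sub[OF st measurable_along_path[OF \<rho> \<gamma>]] path_integral_eq
    using st by (intro nn_integral_mono) (auto split: split_indicator)
qed (simp add: path_integral_def)

lemma path_integral_mono:
  assumes "(a, b, \<gamma>) \<in> paths_in S" "\<And>x. x \<in> S \<Longrightarrow> \<rho> x \<le> \<rho>' x"
  shows "path_integral \<rho> (a, b, \<gamma>) \<le> path_integral \<rho>' (a, b, \<gamma>)"
  using assms by (force simp: path_integral_def paths_in_def intro!: nn_integral_mono split: split_indicator)

lemma path_integral_add:
  assumes "(a, b, \<gamma>) \<in> paths_in S" "\<rho> \<in> borel_measurable (restrict_space borel S)"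
    "\<rho>' \<in> borel_measurable (restrict_space borel S)"
  shows "path_integral (\<lambda>x. \<rho> x + \<rho>' x) (a, b, \<gamma>) = path_integral \<rho> (a, b, \<gamma>) + path_integral \<rho>' (a, b, \<gamma>)"
  using measurable_along_path[OF assms(2,1)] measurable_along_path[OF assms(3,1)]
  by (auto simp: path_integral_def distrib_right nn_integral_add length_measure_def)

text \<open>Positivity of \<open>c\<close> matters on paths that are not rectifiable, where both
  sides have to be \<infinity>.\<close>

lemma path_integral_cmult:
  assumes "(a, b, \<gamma>) \<in> paths_in S" "\<rho> \<in> borel_measurable (restrict_space borel S)" "0 < c"
  shows "path_integral (\<lambda>x. c * \<rho> x) (a, b, \<gamma>) = c * path_integral \<rho> (a, b, \<gamma>)"
  using measurable_along_path[OF assms(2,1)] assms(3)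
  by (auto simp: path_integral_def mult.assoc nn_integral_cmult length_measure_def ennreal_mult_top)

lemma path_integral_dominated:
  assumes "(a, b, \<gamma>) \<in> paths_in S" "\<rho> \<in> borel_measurable (restrict_space borel S)" "0 < c"
    "\<And>x. x \<in> S \<Longrightarrow> c * \<rho> x \<le> \<rho>' x" "path_integral \<rho>' (a, b, \<gamma>) < top"
  shows "path_integral \<rho> (a, b, \<gamma>) < top"
proof -
  have "c * path_integral \<rho> (a, b, \<gamma>) < top"
    using path_integral_mono[OF assms(1), of "\<lambda>x. c * \<rho> x" \<rho>'] assms
    by (simp add: path_integral_cmult[OF assms(1-3)] order.strict_trans1)
  then show ?thesis using \<open>0 < c\<close> by (auto simp: ennreal_mult_less_top)
qed

text \<open>Trades the exceptional family for one function: the largest family that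
  \<open>\<rho>0\<close> shows to be negligible consists of the paths with infinite
  \<open>\<rho>0\<close>-integral. "Almost every path" becomes "every path with finite
  \<open>\<rho>0\<close>-integral", and such a path is automatically rectifiable.\<close>

lemma wug_iff:
  "weak_upper_gradient p \<mu> S u \<rho> \<longleftrightarrow> \<rho> \<in> borel_measurable (restrict_space borel S) \<and>
    (\<exists>\<rho>0\<in>Lp_borel p \<mu> S. \<forall>a b \<gamma>. (a, b, \<gamma>) \<in> paths_in S \<longrightarrow> path_integral \<rho>0 (a, b, \<gamma>) < top \<longrightarrow>
      ennreal (norm (u (\<gamma> a) - u (\<gamma> b))) \<le> path_integral \<rho> (a, b, \<gamma>))" (is "?l \<longleftrightarrow> ?r")
proof
  assume ?l
  then obtain \<Gamma> \<rho>0 where *: "\<rho> \<in> borel_measurable (restrict_space borel S)" "\<rho>0 \<in> Lp_borel p \<mu> S"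
    "\<forall>\<gamma>\<in>\<Gamma>. path_integral \<rho>0 \<gamma> = \<infinity>" "\<forall>(a, b, \<gamma>) \<in> paths_in S - \<Gamma>.
           ennreal (norm (u (\<gamma> a) - u (\<gamma> b))) \<le> path_integral \<rho> (a, b, \<gamma>)"
    by (auto simp: weak_upper_gradient_def negligible_paths_def)
  then show ?r by (intro conjI bexI[of _ \<rho>0]) force+
next
  assume ?r
  then obtain \<rho>0 where *: "\<rho> \<in> borel_measurable (restrict_space borel S)" "\<rho>0 \<in> Lp_borel p \<mu> S"
    "\<forall>a b \<gamma>. (a, b, \<gamma>) \<in> paths_in S \<longrightarrow> path_integral \<rho>0 (a, b, \<gamma>) < top \<longrightarrow>
      ennreal (norm (u (\<gamma> a) - u (\<gamma> b))) \<le> path_integral \<rho> (a, b, \<gamma>)" by blast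
  then show ?l unfolding weak_upper_gradient_def negligible_paths_def
    by (intro conjI exI[of _ "{x\<in>paths_in S. path_integral \<rho>0 x = \<infinity>}"] bexI[of _ \<rho>0])
       (auto simp: less_top[symmetric])
qed

lemma wugI:
  assumes "\<rho> \<in> borel_measurable (restrict_space borel S)" "\<rho>0 \<in> Lp_borel p \<mu> S"
    "\<And>a b \<gamma>. (a, b, \<gamma>) \<in> paths_in S \<Longrightarrow> path_integral \<rho>0 (a, b, \<gamma>) < top \<Longrightarrow>
      ennreal (norm (u (\<gamma> a) - u (\<gamma> b))) \<le> path_integral \<rho> (a, b, \<gamma>)"
  shows "weak_upper_gradient p \<mu> S u \<rho>"
  using assms unfolding wug_iff by blast

lemma wugE:
  assumes "weak_upper_gradient p \<mu> S u \<rho>"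
  obtains \<rho>0 where "\<rho> \<in> borel_measurable (restrict_space borel S)" "\<rho>0 \<in> Lp_borel p \<mu> S"
    "\<rho>0 \<in> borel_measurable (restrict_space borel S)"
    "\<And>a b \<gamma>. (a, b, \<gamma>) \<in> paths_in S \<Longrightarrow> path_integral \<rho>0 (a, b, \<gamma>) < top \<Longrightarrow>
      ennreal (norm (u (\<gamma> a) - u (\<gamma> b))) \<le> path_integral \<rho> (a, b, \<gamma>)"
  using assms unfolding wug_iff Lp_borel_def by blast

lemma wug_lipschitz_comp:
  assumes "weak_upper_gradient p \<mu> S u \<rho>" "\<And>x y. norm (f x - f y) \<le> norm (x - y)"
  shows "weak_upper_gradient p \<mu> S (\<lambda>x. f (u x)) \<rho>"
proof -
  obtain \<rho>0 where \<rho>0: "\<rho> \<in> borel_measurable (restrict_space borel S)" "\<rho>0 \<in> Lp_borel p \<mu> S"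
    "\<And>a b \<gamma>. (a, b, \<gamma>) \<in> paths_in S \<Longrightarrow> path_integral \<rho>0 (a, b, \<gamma>) < top \<Longrightarrow>
      ennreal (norm (u (\<gamma> a) - u (\<gamma> b))) \<le> path_integral \<rho> (a, b, \<gamma>)"
    using wugE[OF assms(1)] by metis
  show ?thesis
    by (rule wugI[OF \<rho>0(1,2)]) (rule order_trans[OF ennreal_leI[OF assms(2)] \<rho>0(3)])
qed

lemma wug_mono:
  assumes "weak_upper_gradient p \<mu> S u \<rho>" "\<rho>' \<in> borel_measurable (restrict_space borel S)"
    "\<And>x. x \<in> S \<Longrightarrow> \<rho> x \<le> \<rho>' x"
  shows "weak_upper_gradient p \<mu> S u \<rho>'"
proof -
  obtain \<rho>0 where \<rho>0: "\<rho> \<in> borel_measurable (restrict_space borel S)" "\<rho>0 \<in> Lp_borel p \<mu> S"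
    "\<And>a b \<gamma>. (a, b, \<gamma>) \<in> paths_in S \<Longrightarrow> path_integral \<rho>0 (a, b, \<gamma>) < top \<Longrightarrow>
      ennreal (norm (u (\<gamma> a) - u (\<gamma> b))) \<le> path_integral \<rho> (a, b, \<gamma>)"
    using wugE[OF assms(1)] by metis
  show ?thesis
    by (rule wugI[OF assms(2) \<rho>0(2)]) (rule order_trans[OF \<rho>0(3) path_integral_mono[OF _ assms(3)]])
qed

lemma wug_cmult:
  assumes "weak_upper_gradient p \<mu> S u \<rho>" 
  shows "weak_upper_gradient p \<mu> S (\<lambda>x. c *\<^sub>R u x) (\<lambda>x. ennreal \<bar>c\<bar> * \<rho> x)"
proof -
  obtain \<rho>0 where \<rho>0: "\<rho> \<in> borel_measurable (restrict_space borel S)" "\<rho>0 \<in> Lp_borel p \<mu> S"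
    "\<And>a b \<gamma>. (a, b, \<gamma>) \<in> paths_in S \<Longrightarrow> path_integral \<rho>0 (a, b, \<gamma>) < top \<Longrightarrow>
      ennreal (norm (u (\<gamma> a) - u (\<gamma> b))) \<le> path_integral \<rho> (a, b, \<gamma>)"
    using wugE[OF assms(1)] by metis
  show ?thesis
  proof (rule wugI[OF _ \<rho>0(2)])
    show "(\<lambda>x. ennreal \<bar>c\<bar> * \<rho> x) \<in> borel_measurable (restrict_space borel S)"
      using \<rho>0(1) by measurable
    fix a b \<gamma> assume *: "(a, b, \<gamma>) \<in> paths_in S" "path_integral \<rho>0 (a, b, \<gamma>) < top"
    have "norm (c *\<^sub>R u (\<gamma> a) - c *\<^sub>R u (\<gamma> b)) = \<bar>c\<bar> * norm (u (\<gamma> a) - u (\<gamma> b))"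
      by (simp add: scaleR_diff_right[symmetric])
    then show "ennreal (norm (c *\<^sub>R u (\<gamma> a) - c *\<^sub>R u (\<gamma> b))) \<le> path_integral (\<lambda>x. ennreal \<bar>c\<bar> * \<rho> x) (a, b, \<gamma>)"
      using path_integral_cmult[OF *(1) \<rho>0(1), of "ennreal \<bar>c\<bar>"] \<rho>0(3)[OF *]
      by (cases "c = 0") (auto simp: ennreal_mult intro!: mult_left_mono)
  qed
qed

context metric_measure
begin

lemma Lp_borel_iff:
  "\<rho> \<in> Lp_borel p \<mu> S \<longleftrightarrow> \<rho> \<in> borel_measurable (restrict_space borel S) \<and> Lp_int p \<mu> S \<rho> < top"
  by (auto simp: Lp_borel_def Lp_norm_less_top_iff[symmetric] top.not_eq_extremum)

lemma Lp_int_mono: 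
  assumes "0 \<le> p" "AE x in measure_on \<mu> S. f x \<le> g x"
  shows "Lp_int p \<mu> S f \<le> Lp_int p \<mu> S g"
  unfolding Lp_int_def using assms by (intro nn_integral_mono_AE) (auto elim!: eventually_mono intro: powe_mono)

lemma Lp_int_subset: 
  assumes "S \<in> sets M" "T \<in> sets M" "S \<subseteq> T"
  shows "Lp_int p \<mu> S f \<le> Lp_int p \<mu> T f"
  using assms by (auto simp: Lp_int_on intro!: nn_integral_mono mult_left_mono split: split_indicator)

lemma Lp_int_cmult:
  assumes "f \<in> borel_measurable (measure_on \<mu> S)"
  shows "Lp_int p \<mu> S (\<lambda>x. c * f x) = c powe p * Lp_int p \<mu> S f"
  unfolding Lp_int_def powe_mult using assms by (intro nn_integral_cmult) measurable

lemma Lp_int_suminf: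
  assumes "0 < p" "\<And>n. f n \<in> borel_measurable (measure_on \<mu> S)"
  shows "Lp_int p \<mu> S (\<lambda>x. \<Sum>n. f n x) \<le> (\<Sum>n. ennreal (2 ^ Suc n) powe p * Lp_int p \<mu> S (f n))"
proof -
  have "Lp_int p \<mu> S (\<lambda>x. \<Sum>n. f n x) \<le> (\<integral>\<^sup>+x. (\<Sum>n. ennreal (2 ^ Suc n) powe p * f n x powe p) \<partial>measure_on \<mu> S)"
    unfolding Lp_int_def by (intro nn_integral_mono powe_suminf_le assms)
  also have "\<dots> = (\<Sum>n. ennreal (2 ^ Suc n) powe p * Lp_int p \<mu> S (f n))"
    unfolding Lp_int_def using assms(2) by (subst nn_integral_suminf) (auto simp: nn_integral_cmult)
  finally show ?thesis .
qed

lemma Lp_int_add: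
  assumes "0 < p" "f \<in> borel_measurable (measure_on \<mu> S)" "g \<in> borel_measurable (measure_on \<mu> S)"
  shows "Lp_int p \<mu> S (\<lambda>x. f x + g x) \<le> ennreal (2 powr p) * (Lp_int p \<mu> S f + Lp_int p \<mu> S g)"
proof -
  have "Lp_int p \<mu> S (\<lambda>x. f x + g x) \<le> (\<integral>\<^sup>+x. ennreal (2 powr p) * (f x powe p + g x powe p) \<partial>measure_on \<mu> S)"
    unfolding Lp_int_def by (intro nn_integral_mono powe_add_le assms)
  also have "\<dots> = ennreal (2 powr p) * (Lp_int p \<mu> S f + Lp_int p \<mu> S g)"
    unfolding Lp_int_def using assms by (simp add: nn_integral_cmult nn_integral_add)
  finally show ?thesis .
qed

lemma Lp_borel_add:
  assumes "0 < p" "f \<in> Lp_borel p \<mu> S" "g \<in> Lp_borel p \<mu> S"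
  shows "(\<lambda>x. f x + g x) \<in> Lp_borel p \<mu> S"
  using assms Lp_int_add[OF assms(1) borel_on_measurable borel_on_measurable, of f S g]
  by (auto simp: Lp_borel_iff ennreal_mult_less_top elim!: order.strict_trans1)

text \<open>Scale each function until the weighted series of \<open>Lp_int_suminf\<close> converges,
  then add. A path with finite integral of the sum has finite integral of every
  \<open>\<rho> n\<close>, so countably many exceptional families merge into one.\<close>

lemma Lp_borel_countable:
  assumes p: "0 < p" and \<rho>: "\<And>n::nat. \<rho> n \<in> Lp_borel p \<mu> S"
  obtains \<rho>' where "\<rho>' \<in> Lp_borel p \<mu> S" "\<And>n. \<exists>c>0. \<forall>x. c * \<rho> n x \<le> \<rho>' x"
proof -
  have m: "\<rho> n \<in> borel_measurable (restrict_space borel S)" for n using \<rho> by (auto simp: Lp_borel_iff)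
  have "\<exists>c>0. ennreal (2 ^ Suc n) powe p * Lp_int p \<mu> S (\<lambda>x. ennreal c * \<rho> n x) \<le> ennreal ((1/2) ^ Suc n)" for n
  proof -
    obtain K where K: "Lp_int p \<mu> S (\<rho> n) = ennreal K" "0 \<le> K"
      using \<rho>[of n] by (cases "Lp_int p \<mu> S (\<rho> n)") (auto simp: Lp_borel_iff)
    define A where "A = (2::real) ^ Suc n"
    have A: "0 < A" by (simp add: A_def)
    \<comment> \<open>Chosen so that c^p * K * A^p is at most 1/A; K + 1 in place of K keeps the
      quotient defined when the integral vanishes.\<close>
    define c where "c = (1 / (A powr p * A * (K + 1))) powr (1/p)"
    have c: "0 < c" "c powr p = 1 / (A powr p * A * (K + 1))"
      using A K p by (auto simp: c_def powr_powr)
    have "A powr p * (c powr p * K) \<le> 1 / A"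
    proof -
      have "A powr p * (c powr p * K) = (1 / A) * (K / (K + 1))"
        using A K by (simp add: c(2))
      also have "\<dots> \<le> (1 / A) * 1"
        using A K by (intro mult_left_mono) auto
      finally show ?thesis by simp
    qed
    then have "ennreal A powe p * Lp_int p \<mu> S (\<lambda>x. ennreal c * \<rho> n x) \<le> ennreal (1 / A)"
      using A c K by (subst Lp_int_cmult[OF borel_on_measurable[OF m]])
        (auto simp: powe_ennreal ennreal_mult[symmetric] intro!: ennreal_leI)
    then show ?thesis using c(1) by (auto simp: A_def power_divide)
  qed
  then obtain c where c: "\<And>n. c n > 0" "\<And>n. ennreal (2 ^ Suc n) powe p * Lp_int p \<mu> S (\<lambda>x. ennreal (c n) * \<rho> n x) \<le> ennreal ((1/2) ^ Suc n)"
    by metis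
  define \<rho>' where "\<rho>' x = (\<Sum>n. ennreal (c n) * \<rho> n x)" for x
  have m': "\<rho>' \<in> borel_measurable (restrict_space borel S)"
    unfolding \<rho>'_def[abs_def] using m by measurable
  have "Lp_int p \<mu> S \<rho>' \<le> (\<Sum>n. ennreal (2 ^ Suc n) powe p * Lp_int p \<mu> S (\<lambda>x. ennreal (c n) * \<rho> n x))"
    unfolding \<rho>'_def[abs_def] using borel_on_measurable[OF m] by (intro Lp_int_suminf p) measurable
  also have "\<dots> \<le> (\<Sum>n. ennreal ((1/2) ^ Suc n))"
    by (intro suminf_le c) auto
  also have "\<dots> < top" unfolding suminf_ennreal_half by simp
  finally have "\<rho>' \<in> Lp_borel p \<mu> S" using m' by (simp add: Lp_borel_iff)
  moreover have "ennreal (c n) * \<rho> n x \<le> \<rho>' x" for n x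
    unfolding \<rho>'_def by (rule order_trans[OF _ sum_le_suminf[where I="{n}"]]) auto
  ultimately show ?thesis using c(1) by (intro that[of \<rho>']) (auto intro!: exI[of _ "ennreal (c _)"])
qed

text \<open>One function makes a path good for all n at once and on all of its subpaths, since the
  integral over a subpath is no larger. \<open>\<sigma>\<close> is put in front of the sequence so
  that its own integral is finite on good paths too.\<close>

lemma wug_countable:
  assumes p: "0 < p" and u: "\<And>n::nat. weak_upper_gradient p \<mu> S (u n) (\<rho> n)" and \<sigma>: "\<sigma> \<in> Lp_borel p \<mu> S"
  obtains \<rho>0 where "\<rho>0 \<in> Lp_borel p \<mu> S" "\<And>a b \<gamma>. (a, b, \<gamma>) \<in> paths_in S \<Longrightarrow> path_integral \<rho>0 (a, b, \<gamma>) < top \<Longrightarrow>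
      path_integral \<sigma> (a, b, \<gamma>) < top \<and> (\<forall>n. \<forall>s t. a \<le> s \<longrightarrow> s \<le> t \<longrightarrow> t \<le> b \<longrightarrow>
        ennreal (norm (u n (\<gamma> s) - u n (\<gamma> t))) \<le> (\<integral>\<^sup>+x\<in>{s..t}. \<rho> n (\<gamma> x) \<partial>length_measure a b \<gamma>))"
proof -
  have "\<exists>\<rho>0. \<rho>0 \<in> Lp_borel p \<mu> S \<and> (\<forall>a b \<gamma>. (a, b, \<gamma>) \<in> paths_in S \<longrightarrow> path_integral \<rho>0 (a, b, \<gamma>) < top \<longrightarrow>
      ennreal (norm (u n (\<gamma> a) - u n (\<gamma> b))) \<le> path_integral (\<rho> n) (a, b, \<gamma>))" for n
    using u[of n] by (auto simp: wug_iff)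
  then obtain r where r: "\<And>n. r n \<in> Lp_borel p \<mu> S" 
    "\<And>n a b \<gamma>. (a, b, \<gamma>) \<in> paths_in S \<Longrightarrow> path_integral (r n) (a, b, \<gamma>) < top \<Longrightarrow>
      ennreal (norm (u n (\<gamma> a) - u n (\<gamma> b))) \<le> path_integral (\<rho> n) (a, b, \<gamma>)" by metis
  obtain \<rho>' where \<rho>': "\<rho>' \<in> Lp_borel p \<mu> S" "\<And>n. \<exists>c>0. \<forall>x. c * case_nat \<sigma> r n x \<le> \<rho>' x"
  proof (rule Lp_borel_countable[OF p, of "case_nat \<sigma> r" S])
    show "case_nat \<sigma> r n \<in> Lp_borel p \<mu> S" for n
      using r(1) \<sigma> by (cases n) auto
  qed blast
  have bm: "\<And>n. r n \<in> borel_measurable (restrict_space borel S)" "\<sigma> \<in> borel_measurable (restrict_space borel S)"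
    "\<And>n. \<rho> n \<in> borel_measurable (restrict_space borel S)"
    using r \<sigma> u by (auto simp: Lp_borel_iff wug_iff)
  show ?thesis
  proof (rule that[OF \<rho>'(1)], intro conjI allI impI)
    fix a b \<gamma> assume g: "(a, b, \<gamma>) \<in> paths_in S" "path_integral \<rho>' (a, b, \<gamma>) < top"
    show "path_integral \<sigma> (a, b, \<gamma>) < top"
      using \<rho>'(2)[of 0] g path_integral_dominated[OF g(1) bm(2)] by auto
    fix n s t assume st: "a \<le> s" "s \<le> t" "t \<le> b"
    interpret rect_path a b \<gamma>
      using g by (intro paths_in_rect_path path_integral_finite_rectifiable)
    have "path_integral (r n) (a, b, \<gamma>) < top"
      using \<rho>'(2)[of "Suc n"] g path_integral_dominated[OF g(1) bm(1)] by auto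
    then have "path_integral (r n) (s, t, \<gamma>) < top"
      using path_integral_sub_le[OF bm(1) g(1) st] order.strict_trans1 by blast
    from r(2)[OF paths_in_sub[OF g(1) st] this]
    show "ennreal (norm (u n (\<gamma> s) - u n (\<gamma> t))) \<le> (\<integral>\<^sup>+x\<in>{s..t}. \<rho> n (\<gamma> x) \<partial>lm)"
      by (simp add: path_integral_sub[OF st measurable_along_path[OF bm(3) g(1)]])
  qed
qed

lemma wug_add:
  assumes p: "0 < p" and u: "weak_upper_gradient p \<mu> S u \<rho>" "weak_upper_gradient p \<mu> S v \<sigma>"
  shows "weak_upper_gradient p \<mu> S (\<lambda>x. u x + v x) (\<lambda>x. \<rho> x + \<sigma> x)"
proof -
  have bm: "\<rho> \<in> borel_measurable (restrict_space borel S)" "\<sigma> \<in> borel_measurable (restrict_space borel S)"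
    using u by (auto simp: wug_iff)
  obtain r where r: "r \<in> Lp_borel p \<mu> S" "\<And>a b \<gamma>. (a, b, \<gamma>) \<in> paths_in S \<Longrightarrow> path_integral r (a, b, \<gamma>) < top \<Longrightarrow>
      ennreal (norm (u (\<gamma> a) - u (\<gamma> b))) \<le> path_integral \<rho> (a, b, \<gamma>)"
    using u(1) by (auto simp: wug_iff)
  obtain s where s: "s \<in> Lp_borel p \<mu> S" "\<And>a b \<gamma>. (a, b, \<gamma>) \<in> paths_in S \<Longrightarrow> path_integral s (a, b, \<gamma>) < top \<Longrightarrow>
      ennreal (norm (v (\<gamma> a) - v (\<gamma> b))) \<le> path_integral \<sigma> (a, b, \<gamma>)"
    using u(2) by (auto simp: wug_iff)
  show ?thesis
  proof (rule wugI[OF _ Lp_borel_add[OF p r(1) s(1)]])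
    show "(\<lambda>x. \<rho> x + \<sigma> x) \<in> borel_measurable (restrict_space borel S)" using bm by measurable
    fix a b \<gamma> assume g: "(a, b, \<gamma>) \<in> paths_in S" "path_integral (\<lambda>x. r x + s x) (a, b, \<gamma>) < top"
    have "path_integral r (a, b, \<gamma>) < top" "path_integral s (a, b, \<gamma>) < top"
      using g r(1) s(1) by (auto simp: path_integral_add[OF g(1)] Lp_borel_iff)
    note * = r(2)[OF g(1) this(1)] s(2)[OF g(1) this(2)]
    have "ennreal (norm (u (\<gamma> a) + v (\<gamma> a) - (u (\<gamma> b) + v (\<gamma> b)))) \<le>
      ennreal (norm (u (\<gamma> a) - u (\<gamma> b))) + ennreal (norm (v (\<gamma> a) - v (\<gamma> b)))"
      by (simp add: ennreal_plus[symmetric] ennreal_leI add_diff_add norm_triangle_ineq del: ennreal_plus)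
    also have "\<dots> \<le> path_integral (\<lambda>x. \<rho> x + \<sigma> x) (a, b, \<gamma>)"
      unfolding path_integral_add[OF g(1) bm] using * by (intro add_mono)
    finally show "ennreal (norm (u (\<gamma> a) + v (\<gamma> a) - (u (\<gamma> b) + v (\<gamma> b)))) \<le> path_integral (\<lambda>x. \<rho> x + \<sigma> x) (a, b, \<gamma>)" .
  qed
qed

lemma wug_zero: "0 < p \<Longrightarrow> weak_upper_gradient p \<mu> S (\<lambda>x. 0) (\<lambda>x. 0)"
  by (rule wugI[of _ _ "\<lambda>x. 0"]) (auto simp: Lp_borel_iff Lp_int_def)

lemma wug_sum:
  assumes p: "0 < p" and "\<And>i. i \<in> I \<Longrightarrow> weak_upper_gradient p \<mu> S (u i) (\<rho> i)"
  shows "weak_upper_gradient p \<mu> S (\<lambda>x. \<Sum>i\<in>I. u i x) (\<lambda>x. \<Sum>i\<in>I. \<rho> i x)"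
proof (cases "finite I")
  case True
  then show ?thesis using assms(2)
    by (induction I) (auto intro!: wug_add wug_zero p)
qed (auto intro: wug_zero p)

lemma wug_subset:
  assumes p: "0 < p" and u: "weak_upper_gradient p \<mu> S u \<rho>" and T: "T \<subseteq> S" "T \<in> sets M" "S \<in> sets M"
  shows "weak_upper_gradient p \<mu> T u \<rho>"
proof -
  obtain r where r: "\<rho> \<in> borel_measurable (restrict_space borel S)" "r \<in> Lp_borel p \<mu> S" 
    "\<And>a b \<gamma>. (a, b, \<gamma>) \<in> paths_in S \<Longrightarrow> path_integral r (a, b, \<gamma>) < top \<Longrightarrow>
      ennreal (norm (u (\<gamma> a) - u (\<gamma> b))) \<le> path_integral \<rho> (a, b, \<gamma>)"
    using u by (auto simp: wug_iff)
  have m: "\<rho> \<in> borel_measurable (restrict_space borel T)"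
    by (rule measurable_restrict_mono[OF r(1) T(1)])
  have "r \<in> borel_measurable (restrict_space borel T)"
    using r(2) by (intro measurable_restrict_mono[OF _ T(1)]) (simp add: Lp_borel_iff)
  moreover have "Lp_int p \<mu> T r < top"
    using r(2) by (intro order.strict_trans1[OF Lp_int_subset[OF T(2,3,1)]]) (simp add: Lp_borel_iff)
  ultimately have "r \<in> Lp_borel p \<mu> T"
    by (simp only: Lp_borel_iff)
  from m this show ?thesis
  proof (rule wugI)
    fix a b \<gamma> assume g: "(a, b, \<gamma>) \<in> paths_in T" "path_integral r (a, b, \<gamma>) < top"
    have "(a, b, \<gamma>) \<in> paths_in S" using g T by (auto simp: paths_in_def)
    from r(3)[OF this g(2)]
    show "ennreal (norm (u (\<gamma> a) - u (\<gamma> b))) \<le> path_integral \<rho> (a, b, \<gamma>)" .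
  qed
qed

end

text \<open>The point \<open>s\<close> is found in the smallest interval around \<open>t0\<close> that has positive length.\<close>

lemma (in rect_path) near_point:
  assumes f: "(\<lambda>x. f x * indicator {a..b} x) \<in> borel_measurable borel" "(\<integral>\<^sup>+x\<in>{a..b}. f x \<partial>lm) < top"
    and L: "0 < L a b" and P: "AE t in lm. t \<in> {a..b} \<longrightarrow> P t" and t0: "t0 \<in> {a..b}" and e: "0 < e"
  obtains s where "s \<in> {a..b}" "P s" "(\<integral>\<^sup>+x\<in>{min s t0..max s t0}. f x \<partial>lm) < ennreal e"
proof -
  define N where "N = density lm (\<lambda>x. f x * indicator {a..b} x)"
  have [measurable]: "(\<lambda>x. f x * indicator {a..b} x) \<in> borel_measurable lm"
    using f(1) by simp
  have em: "emeasure N A = (\<integral>\<^sup>+x. f x * indicator {a..b} x * indicator A x \<partial>lm)" if "A \<in> sets borel" for A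
    unfolding N_def using that by (subst emeasure_density) auto
  have sN[simp]: "sets N = sets borel" "space N = UNIV" by (auto simp: N_def)
  interpret N: finite_measure N
    using f(2) by (intro finite_measureI) (auto simp: em less_top[symmetric])
  have null: "emeasure N A = 0" if "A \<in> sets borel" "emeasure lm (A \<inter> {a..b}) = 0" for A
  proof -
    have "AE x in lm. x \<notin> A \<inter> {a..b}"
      using that by (intro AE_not_in) (auto simp: null_sets_def)
    then have "AE x in lm. f x * indicator {a..b} x * indicator A x = 0"
      by eventually_elim (auto split: split_indicator)
    then show ?thesis unfolding em[OF that(1)] by (subst nn_integral_0_iff_AE) (use that in auto)
  qed
  have atom: "emeasure N {x} = 0" for x
  proof (rule null)
    have "emeasure lm ({x} \<inter> {a..b}) \<le> emeasure lm {x}" by (intro emeasure_mono) auto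
    then show "emeasure lm ({x} \<inter> {a..b}) = 0" by (simp add: lm_singleton)
  qed auto
  have pos: "\<exists>s\<in>A \<inter> {a..b}. P s" if "A \<in> sets borel" "emeasure lm (A \<inter> {a..b}) \<noteq> 0" for A
  proof (rule ccontr)
    assume "\<not> ?thesis"
    then have "AE t in lm. t \<notin> A \<inter> {a..b}" using P by (auto elim!: eventually_mono)
    moreover have "{t \<in> space lm. \<not> t \<notin> A \<inter> {a..b}} = A \<inter> {a..b}" by auto
    ultimately have "emeasure lm (A \<inter> {a..b}) = 0"
      using that(1) by (subst (asm) AE_iff_measurable) auto
    then show False using that by simp
  qed
  let ?J = "\<lambda>r. {t0 - r..t0 + r}"
  define R where "R = {r. 0 \<le> r \<and> emeasure lm (?J r \<inter> {a..b}) \<noteq> 0}"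
  have "?J (b - a) \<inter> {a..b} = {a..b}" using t0 by auto
  then have "b - a \<in> R" using ab L emeasure_lm_Icc[of a b] by (auto simp: R_def)
  define r where "r = Inf R"
  have bdd: "bdd_below R" by (auto simp: R_def intro: bdd_belowI[of _ 0])
  have "R \<noteq> {}" using \<open>b - a \<in> R\<close> by blast
  then have r0: "0 \<le> r" unfolding r_def by (intro cInf_greatest) (simp_all add: R_def)
  obtain d1 where d1: "0 < d1" "measure N {t0 - r - d1..t0 - r + d1} < e / 2"
    using atomless_small_interval[of N "t0 - r" "e / 2"] atom N.finite_measure_axioms e by auto
  obtain d2 where d2: "0 < d2" "measure N {t0 + r - d2..t0 + r + d2} < e / 2"
    using atomless_small_interval[of N "t0 + r" "e / 2"] atom N.finite_measure_axioms e by auto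
  define d where "d = min d1 d2"
  have d: "0 < d" using d1 d2 by (simp add: d_def)
  obtain r' where r': "r' \<in> R" "r' < r + d"
    using cInf_lessD[of R "r + d"] \<open>b - a \<in> R\<close> d by (auto simp: r_def)
  then obtain s where s: "s \<in> ?J r'" "s \<in> {a..b}" "P s"
    using pos[of "?J r'"] by (auto simp: R_def)
  have "emeasure N (?J (r - d)) = 0"
  proof (cases "0 \<le> r - d")
    case True
    have "r - d \<notin> R" using cInf_lower[OF _ bdd, of "r - d"] d by (auto simp: r_def)
    then show ?thesis using True by (intro null) (auto simp: R_def)
  qed simp
  then have "measure N (?J (r - d)) = 0" by (simp add: measure_def)
  \<comment> \<open>\<open>?J (r - d)\<close> is null, or empty when r < d. What
    \<open>?J r'\<close> adds to it lies in two short intervals about the endpoints t0 - r and t0 +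
    r, each of mass below e/2 because \<open>N\<close> has no atoms.\<close>
  moreover have "measure N (?J r') \<le> measure N (?J (r - d) \<union> ({t0 - r - d1..t0 - r + d1} \<union> {t0 + r - d2..t0 + r + d2}))"
    using r' by (intro N.finite_measure_mono) (auto simp: d_def)
  moreover have "\<dots> \<le> measure N (?J (r - d)) + (measure N {t0 - r - d1..t0 - r + d1} + measure N {t0 + r - d2..t0 + r + d2})"
    by (intro order_trans[OF measure_Un_le] add_left_mono measure_Un_le) auto
  ultimately have "measure N (?J r') < e" using d1(2) d2(2) by linarith
  moreover have "(\<integral>\<^sup>+x\<in>{min s t0..max s t0}. f x \<partial>lm) \<le> emeasure N (?J r')"
    using s t0 by (subst em) (auto intro!: nn_integral_mono split: split_indicator)
  moreover have "emeasure N (?J r') = ennreal (measure N (?J r'))"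
    by (rule N.emeasure_eq_measure)
  ultimately have "(\<integral>\<^sup>+x\<in>{min s t0..max s t0}. f x \<partial>lm) < ennreal e"
    using e by (simp add: ennreal_lessI order.strict_trans1)
  then show ?thesis using that s by blast
qed

section \<open>Limits of functions with a common weak upper gradient\<close>

context metric_measure
begin

text \<open>A Fuglede-type closure property. On almost every path the sequence converges at almost
  every parameter with respect to length. The common gradient \<open>G\<close> makes the sequence
  equicontinuous along the path, so it converges at every parameter, in particular at both
  endpoints, and the inequality passes to the limit. The pointwise limit is thus itself a good
  representative.\<close>

lemma wug_limit:
  fixes v :: "nat \<Rightarrow> 'a \<Rightarrow> 'b::banach"
  assumes p: "0 < p" and S: "S \<in> sets M" and v: "\<And>n. weak_upper_gradient p \<mu> S (v n) G"
    and G: "G \<in> Lp_borel p \<mu> S" and conv: "AE x in measure_on \<mu> S. convergent (\<lambda>n. v n x)"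
  shows "weak_upper_gradient p \<mu> S (\<lambda>x. if convergent (\<lambda>n. v n x) then lim (\<lambda>n. v n x) else 0) G"
proof -
  define w where "w = (\<lambda>x. if convergent (\<lambda>n. v n x) then lim (\<lambda>n. v n x) else 0)"
  have "{x\<in>S. \<not> convergent (\<lambda>n. v n x)} \<in> null_sets M"
    using conv by (simp add: AE_on_iff[OF S] AE_M_iff)
  then obtain B where B: "B \<in> sets borel" "{x\<in>S. \<not> convergent (\<lambda>n. v n x)} \<subseteq> B" "emeasure M B = 0"
    by (rule null_borel_cover)
  \<comment> \<open>Zero in L^p since \<open>B\<close> is null, yet of infinite integral along every
    path that spends positive length in \<open>B\<close>: finiteness of its path integral forces
    convergence at almost every parameter.\<close>
  define \<beta> :: "'a \<Rightarrow> ennreal" where "\<beta> x = top * indicator B x" for x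
  have bm: "G \<in> borel_measurable (restrict_space borel S)" "\<beta> \<in> borel_measurable (restrict_space borel S)"
    using G B(1) by (auto simp: Lp_borel_iff \<beta>_def[abs_def] intro!: measurable_restrict_space1)
  have "Lp_int p \<mu> S \<beta> = 0"
  proof -
    have "B \<in> null_sets M" using B borel_sets_M by (auto simp: null_sets_def)
    then have "AE x in M. x \<notin> B" by (rule AE_not_in)
    then have "AE x in M. \<beta> x powe p * indicator S x = 0" 
      by eventually_elim (auto simp: \<beta>_def)
    then have "Lp_int p \<mu> S \<beta> = (\<integral>\<^sup>+x. 0 \<partial>M)"
      unfolding Lp_int_on[OF S] by (intro nn_integral_cong_AE)
    then show ?thesis by simp
  qed
  then have \<beta>: "\<beta> \<in> Lp_borel p \<mu> S" using bm by (simp add: Lp_borel_iff)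
  obtain \<rho>0 where \<rho>0: "\<rho>0 \<in> Lp_borel p \<mu> S" "\<And>a b \<gamma>. (a, b, \<gamma>) \<in> paths_in S \<Longrightarrow> path_integral \<rho>0 (a, b, \<gamma>) < top \<Longrightarrow>
      path_integral (\<lambda>x. G x + \<beta> x) (a, b, \<gamma>) < top \<and> (\<forall>n. \<forall>s t. a \<le> s \<longrightarrow> s \<le> t \<longrightarrow> t \<le> b \<longrightarrow>
        ennreal (norm (v n (\<gamma> s) - v n (\<gamma> t))) \<le> (\<integral>\<^sup>+x\<in>{s..t}. G (\<gamma> x) \<partial>length_measure a b \<gamma>))"
  proof (rule wug_countable[where u = v and \<rho> = "\<lambda>_. G", OF p _ Lp_borel_add[OF p G \<beta>]])
    show "weak_upper_gradient p \<mu> S (v n) G" for n by (rule v)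
  qed (rule that)
  have "weak_upper_gradient p \<mu> S w G"
  proof (rule wugI[OF bm(1) \<rho>0(1)])
    fix a b \<gamma> assume g: "(a, b, \<gamma>) \<in> paths_in S" "path_integral \<rho>0 (a, b, \<gamma>) < top"
    interpret rect_path a b \<gamma>
      using g by (intro paths_in_rect_path path_integral_finite_rectifiable)
    note r = \<rho>0(2)[OF g]
    have mG: "(\<lambda>x. G (\<gamma> x) * indicator {a..b} x) \<in> borel_measurable borel"
      and m\<beta>: "(\<lambda>x. \<beta> (\<gamma> x) * indicator {a..b} x) \<in> borel_measurable borel"
      by (rule measurable_along_path[OF _ g(1)], fact bm)+
    have fin: "path_integral G (a, b, \<gamma>) < top" "path_integral \<beta> (a, b, \<gamma>) < top"
      using r by (auto simp: path_integral_add[OF g(1) bm])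
    have step: "ennreal (norm (v n (\<gamma> s) - v n (\<gamma> t))) \<le> (\<integral>\<^sup>+x\<in>{min s t..max s t}. G (\<gamma> x) \<partial>lm)"
      if "s \<in> {a..b}" "t \<in> {a..b}" for n s t
    proof (cases "s \<le> t")
      case True then show ?thesis using r that by (auto simp: min_def max_def)
    next
      case False
      then have "ennreal (norm (v n (\<gamma> t) - v n (\<gamma> s))) \<le> (\<integral>\<^sup>+x\<in>{t..s}. G (\<gamma> x) \<partial>lm)"
        using r that by auto
      then show ?thesis using False by (simp add: norm_minus_commute)
    qed
    show "ennreal (norm (w (\<gamma> a) - w (\<gamma> b))) \<le> path_integral G (a, b, \<gamma>)"
    proof (cases "L a b = 0")
      case True
      then have "\<gamma> a = \<gamma> b" using dist_le_path_length[OF ab, of \<gamma>] by simp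
      then show ?thesis by simp
    next
      case False
      have "AE x in lm. \<beta> (\<gamma> x) * indicator {a..b} x \<noteq> \<infinity>"
        using fin(2) m\<beta> by (intro nn_integral_PInf_AE) (auto simp: path_integral_eq less_top)
      then have ae: "AE t in lm. t \<in> {a..b} \<longrightarrow> convergent (\<lambda>n. v n (\<gamma> t))"
      proof eventually_elim
        case (elim t)
        show ?case
        proof
          assume "t \<in> {a..b}"
          then have "\<gamma> t \<notin> B" "\<gamma> t \<in> S" using elim g(1) by (auto simp: \<beta>_def paths_in_def)
          then show "convergent (\<lambda>n. v n (\<gamma> t))" using B(2) by auto
        qed
      qed
      \<comment> \<open>From almost every to every parameter: some point s of convergence has so
        little of \<open>G\<close> between it and t0 that all \<open>v n\<close> vary by less than
        e/3 from s to t0.\<close>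
      have cv: "convergent (\<lambda>n. v n (\<gamma> t0))" if t0: "t0 \<in> {a..b}" for t0
        unfolding Cauchy_convergent_iff[symmetric]
      proof (rule metric_CauchyI)
        fix e :: real assume e: "0 < e"
        obtain s where s: "s \<in> {a..b}" "convergent (\<lambda>n. v n (\<gamma> s))" 
          "(\<integral>\<^sup>+x\<in>{min s t0..max s t0}. G (\<gamma> x) \<partial>lm) < ennreal (e/3)"
          using near_point[OF mG _ _ ae t0, of "e/3"] fin(1) False e
          by (auto simp: path_integral_eq zero_less_iff_neq_zero)
        have *: "dist (v n (\<gamma> s)) (v n (\<gamma> t0)) < e/3" for n
          using order.strict_trans1[OF step[OF s(1) t0] s(3)] e by (simp add: ennreal_less_iff dist_norm)
        obtain K where K: "\<And>m n. K \<le> m \<Longrightarrow> K \<le> n \<Longrightarrow> dist (v m (\<gamma> s)) (v n (\<gamma> s)) < e/3"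
          using s(2) e unfolding Cauchy_convergent_iff[symmetric] by (metis metric_CauchyD zero_less_divide_iff zero_less_numeral)
        show "\<exists>K. \<forall>m\<ge>K. \<forall>n\<ge>K. dist (v m (\<gamma> t0)) (v n (\<gamma> t0)) < e"
        proof (intro exI allI impI)
          fix m n assume "K \<le> m" "K \<le> n"
          have "dist (v m (\<gamma> t0)) (v n (\<gamma> t0)) \<le> dist (v m (\<gamma> s)) (v m (\<gamma> t0)) + dist (v m (\<gamma> s)) (v n (\<gamma> s)) + dist (v n (\<gamma> s)) (v n (\<gamma> t0))"
            using dist_triangle2[of "v m (\<gamma> t0)" "v n (\<gamma> t0)" "v m (\<gamma> s)"] dist_triangle[of "v m (\<gamma> s)" "v n (\<gamma> t0)" "v n (\<gamma> s)"]
            by (simp add: dist_commute)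
          then show "dist (v m (\<gamma> t0)) (v n (\<gamma> t0)) < e"
            using *[of m] *[of n] K[OF \<open>K \<le> m\<close> \<open>K \<le> n\<close>] by linarith
        qed
      qed
      have lims: "(\<lambda>n. v n (\<gamma> a)) \<longlonglongrightarrow> w (\<gamma> a)" "(\<lambda>n. v n (\<gamma> b)) \<longlonglongrightarrow> w (\<gamma> b)"
        using cv[of a] cv[of b] ab by (auto simp: w_def convergent_LIMSEQ_iff)
      obtain c where c: "path_integral G (a, b, \<gamma>) = ennreal c" "0 \<le> c"
        using fin(1) by (cases "path_integral G (a, b, \<gamma>)") auto
      have "norm (v n (\<gamma> a) - v n (\<gamma> b)) \<le> c" for n
        using step[of a b n] ab c by (simp add: path_integral_eq min_absorb1 max_absorb2)
      then have "norm (w (\<gamma> a) - w (\<gamma> b)) \<le> c"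
        by (intro LIMSEQ_le_const2[OF tendsto_norm[OF tendsto_diff[OF lims]]]) auto
      then show ?thesis using c by (simp add: ennreal_leI)
    qed
  qed
  then show ?thesis by (simp add: w_def)
qed

end

section \<open>Measurable maps\<close>

text \<open>Letting the countable set lie outside \<open>A\<close> makes the condition inherited by
  subsets and stable under countable unions. To move it into \<open>A\<close>, pick for each d and n
  a point of \<open>A\<close> within 1/(n+1) of d whenever there is one.\<close>

lemma separable_top_of_set_iff:
  fixes A :: "'b::metric_space set"
  shows "separable_space (top_of_set A) \<longleftrightarrow> (\<exists>D. countable D \<and> A \<subseteq> closure D)"
proof
  assume "separable_space (top_of_set A)"
  then obtain C where C: "countable C" "C \<subseteq> A" "top_of_set A closure_of C = A"
    by (auto simp: separable_space_def)
  then have "A \<subseteq> closure C"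
    by (auto simp: closure_of_subtopology Int_absorb1)
  with C show "\<exists>D. countable D \<and> A \<subseteq> closure D" by blast
next
  assume "\<exists>D. countable D \<and> A \<subseteq> closure D"
  then obtain D where D: "countable D" "A \<subseteq> closure D" by blast
  define pt where "pt d n = (SOME a. a \<in> A \<and> dist a d < inverse (real (Suc n)))" for d n
  define C where "C = {pt d n | d n. d \<in> D \<and> (\<exists>a. a \<in> A \<and> dist a d < inverse (real (Suc n)))}"
  have "C \<subseteq> (\<lambda>(d, n). pt d n) ` (D \<times> UNIV)" by (auto simp: C_def)
  then have "countable C" using D(1) by (meson countable_SIGMA countable_image countable_subset uncountable_def countableI_type)
  moreover have pt: "pt d n \<in> A \<and> dist (pt d n) d < inverse (real (Suc n))" if "a \<in> A" "dist a d < inverse (real (Suc n))" for a d n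
    unfolding pt_def by (rule someI[of _ a]) (use that in auto)
  then have CA: "C \<subseteq> A" by (auto simp: C_def)
  moreover have "A \<subseteq> closure C"
  proof
    fix a assume a: "a \<in> A"
    show "a \<in> closure C"
      unfolding closure_approachable
    proof (intro allI impI)
      fix e :: real assume "0 < e"
      then obtain n where n: "inverse (real (Suc n)) < e / 2" using reals_Archimedean[of "e/2"] by auto
      obtain d where d: "d \<in> D" "dist d a < inverse (real (Suc n))"
        using a D(2) unfolding closure_approachable subset_iff by (metis inverse_positive_iff_positive of_nat_0_less_iff zero_less_Suc)
      then have "pt d n \<in> C" "dist (pt d n) d < inverse (real (Suc n))"
        using a pt[of a d n] by (auto simp: C_def dist_commute)
      moreover have "dist (pt d n) a < e"
        using dist_triangle[of "pt d n" a d] calculation(2) d(2) n by linarith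
      ultimately show "\<exists>y\<in>C. dist y a < e" by blast
    qed
  qed
  ultimately show "separable_space (top_of_set A)"
    unfolding separable_space_def by (intro exI[of _ C]) (auto simp: closure_of_subtopology Int_absorb1)
qed

context metric_measure
begin

lemma measurable_map_iff:
  fixes u :: "'a \<Rightarrow> 'b::metric_space"
  assumes S: "S \<in> sets M"
  shows "measurable_map \<mu> S u \<longleftrightarrow> u \<in> borel_measurable (measure_on \<mu> S) \<and>
    (\<exists>D. countable D \<and> (AE x in measure_on \<mu> S. u x \<in> closure D))"
proof -
  have eq: "(\<exists>N\<in>null_sets (measure_on \<mu> S). u ` (S - N) \<subseteq> closure D) \<longleftrightarrow> (AE x in measure_on \<mu> S. u x \<in> closure D)" for D
  proof
    assume "AE x in measure_on \<mu> S. u x \<in> closure D"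
    then have "{x\<in>S. u x \<notin> closure D} \<in> null_sets M" by (simp add: AE_on_iff[OF S] AE_M_iff)
    then show "\<exists>N\<in>null_sets (measure_on \<mu> S). u ` (S - N) \<subseteq> closure D"
      by (intro bexI[of _ "{x\<in>S. u x \<notin> closure D}"]) (auto simp: null_sets_on[OF S])
  next
    assume "\<exists>N\<in>null_sets (measure_on \<mu> S). u ` (S - N) \<subseteq> closure D"
    then obtain N where "N \<in> null_sets (measure_on \<mu> S)" "u ` (S - N) \<subseteq> closure D" by blast
    then show "AE x in measure_on \<mu> S. u x \<in> closure D"
      by (intro AE_I'[of N]) fastforce+
  qed
  show ?thesis
    unfolding measurable_map_def separable_top_of_set_iff by (simp only: eq[symmetric]) blast
qed

lemma measurable_map_cong_AE:
  fixes u :: "'a \<Rightarrow> 'b::metric_space"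
  assumes S: "S \<in> sets M" and u: "measurable_map \<mu> S u" and eq: "AE x in measure_on \<mu> S. v x = u x"
  shows "measurable_map \<mu> S v"
proof -
  obtain D where D: "countable D" "AE x in measure_on \<mu> S. u x \<in> closure D"
    using u by (auto simp: measurable_map_iff[OF S])
  have "AE x in measure_on \<mu> S. v x \<in> closure D"
    using D(2) eq by eventually_elim simp
  then show ?thesis
    using AE_on_cong_measurable[OF S _ eq] u D(1) by (auto simp: measurable_map_iff[OF S])
qed

lemma measurable_map_limit:
  fixes u :: "nat \<Rightarrow> 'a \<Rightarrow> 'b::metric_space"
  assumes S: "S \<in> sets M" and u: "\<And>n. measurable_map \<mu> S (u n)" and lim: "AE x in measure_on \<mu> S. (\<lambda>n. u n x) \<longlonglongrightarrow> v x"
  shows "measurable_map \<mu> S v"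
proof -
  obtain N where N: "N \<in> null_sets M" "N = {x\<in>S. \<not> (\<lambda>n. u n x) \<longlonglongrightarrow> v x}"
    using lim by (auto simp: AE_on_iff[OF S] AE_M_iff)
  \<comment> \<open>Freezing all functions on the null set \<open>N\<close> turns almost everywhere
    convergence into convergence everywhere, as the limit theorem for measurable functions
    requires.\<close>
  define v' where "v' x = (if x \<in> N then undefined else v x)" for x
  define u' where "u' n x = (if x \<in> N then undefined else u n x)" for n x
  have "AE x in M. x \<notin> N" by (rule AE_not_in[OF N(1)])
  then have aeN: "AE x in measure_on \<mu> S. x \<notin> N" unfolding AE_on_iff[OF S] by eventually_elim simp
  have eq: "AE x in measure_on \<mu> S. v x = v' x" "\<And>n. AE x in measure_on \<mu> S. u' n x = u n x"
    using aeN by (auto simp: v'_def u'_def elim!: eventually_mono)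
  have u': "measurable_map \<mu> S (u' n)" for n
    by (rule measurable_map_cong_AE[OF S u[of n] eq(2)])
  have bm: "v' \<in> borel_measurable (measure_on \<mu> S)"
  proof (rule borel_measurable_LIMSEQ_metric)
    show "u' i \<in> borel_measurable (measure_on \<mu> S)" for i using u'[of i] by (simp add: measurable_map_iff[OF S])
    show "(\<lambda>i. u' i x) \<longlonglongrightarrow> v' x" if "x \<in> space (measure_on \<mu> S)" for x
      using that N by (auto simp: v'_def u'_def)
  qed
  have "\<exists>D. \<forall>n. countable (D n) \<and> (AE x in measure_on \<mu> S. u' n x \<in> closure (D n))"
    using u' unfolding measurable_map_iff[OF S] by metis
  then obtain D where D: "\<And>n. countable (D n)" "\<And>n. AE x in measure_on \<mu> S. u' n x \<in> closure (D n)"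
    by blast
  have "AE x in measure_on \<mu> S. \<forall>n. u' n x \<in> closure (D n)"
    using D(2) by (simp add: AE_all_countable)
  then have cl: "AE x in measure_on \<mu> S. v' x \<in> closure (\<Union>n. D n)"
  proof (rule AE_mp, intro AE_I2 impI)
    fix x assume x: "x \<in> space (measure_on \<mu> S)" and *: "\<forall>n. u' n x \<in> closure (D n)"
    have "u' n x \<in> closure (\<Union>n. D n)" for n
      using * closure_mono[of "D n" "\<Union>n. D n"] by blast
    moreover have "(\<lambda>i. u' i x) \<longlonglongrightarrow> v' x" using x N by (auto simp: v'_def u'_def)
    ultimately show "v' x \<in> closure (\<Union>n. D n)"
      using closed_sequentially[OF closed_closure, of "\<lambda>n. u' n x"] by blast
  qed
  have "countable (\<Union>n. D n)" using D(1) by auto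
  with bm cl have "measurable_map \<mu> S v'"
    unfolding measurable_map_iff[OF S] by (intro conjI exI[of _ "\<Union>n. D n"])
  then show ?thesis by (rule measurable_map_cong_AE[OF S]) (rule eq(1))
qed

lemma measurable_map_simple:
  fixes s :: "'a \<Rightarrow> 'b::metric_space"
  assumes S: "S \<in> sets M" and s: "simple_function (measure_on \<mu> S) s"
  shows "measurable_map \<mu> S s"
  unfolding measurable_map_iff[OF S]
proof (intro conjI exI[of _ "s ` S"] AE_I2)
  show "s \<in> borel_measurable (measure_on \<mu> S)" by (rule borel_measurable_simple_function[OF s])
  show "countable (s ` S)" using simple_functionD(1)[OF s] by (simp add: countable_finite)
  show "s x \<in> closure (s ` S)" if "x \<in> space (measure_on \<mu> S)" for x
    using that by (auto intro: closure_subset[THEN subsetD])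
qed

text \<open>The \<open>n\<close>th approximation is the closest to \<open>u x\<close> of the first \<open>n\<close> points of a dense sequence
  that starts with \<open>0\<close>.\<close>

lemma measurable_map_imp_simple:
  fixes u :: "'a \<Rightarrow> 'b::real_normed_vector"
  assumes S: "S \<in> sets M" and u: "measurable_map \<mu> S u"
  obtains s where "\<And>n::nat. simple_function (measure_on \<mu> S) (s n)" "AE x in measure_on \<mu> S. (\<lambda>n. s n x) \<longlonglongrightarrow> u x"
    "\<And>n x. norm (s n x - u x) \<le> norm (u x)"
proof -
  obtain D where D: "countable D" "AE x in measure_on \<mu> S. u x \<in> closure D" and um: "u \<in> borel_measurable (measure_on \<mu> S)"
    using u by (auto simp: measurable_map_iff[OF S])
  define e where "e n = (case n of 0 \<Rightarrow> 0 | Suc n \<Rightarrow> from_nat_into (insert 0 D) n)" for n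
  have eD: "insert 0 D = range e"
  proof -
    have r: "range (from_nat_into (insert 0 D)) = insert 0 D" using D(1) by (intro range_from_nat_into) auto
    have "d \<in> range e" if dD: "d \<in> insert 0 D" for d
    proof -
      obtain n where "d = from_nat_into (insert 0 D) n" using subsetD[OF equalityD2[OF r] dD] by blast
      then have "d = e (Suc n)" by (simp add: e_def)
      then show ?thesis by (rule range_eqI)
    qed
    moreover have "e n \<in> insert 0 D" for n
      using from_nat_into[of "insert 0 D"] by (cases n) (simp_all add: e_def)
    ultimately show ?thesis by blast
  qed
  define P where "P n x i \<longleftrightarrow> i \<le> n \<and> (\<forall>j\<in>{..n}. dist (e i) (u x) \<le> dist (e j) (u x))" for n x i
  define k where "k n x = (LEAST i. P n x i)" for n x
  define s where "s n x = e (k n x)" for n x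
  have "\<exists>i. P n x i" for n x
  proof -
    obtain i where i: "i \<in> {..n}" "\<And>j. j \<in> {..n} \<Longrightarrow> dist (e i) (u x) \<le> dist (e j) (u x)"
      using arg_min_if_finite[of "{..n}" "\<lambda>i. dist (e i) (u x)"] by (fastforce simp: not_less)
    then show ?thesis by (auto simp: P_def)
  qed
  then have k: "P n x (k n x)" for n x unfolding k_def by (metis LeastI)
  have kle: "i \<le> n \<Longrightarrow> dist (s n x) (u x) \<le> dist (e i) (u x)" for i n x
    using k[of n x] by (simp add: P_def s_def)
  have dm[measurable]: "(\<lambda>x. dist (e i) (u x)) \<in> borel_measurable (measure_on \<mu> S)" for i
    by (rule measurable_compose[OF um]) (intro borel_measurable_continuous_onI continuous_intros)
  have km: "k n \<in> measurable (measure_on \<mu> S) (count_space UNIV)" for n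
    unfolding k_def[abs_def] P_def by measurable
  show ?thesis
  proof (rule that[of s])
    fix n
    have "simple_function (measure_on \<mu> S) (k n)"
      unfolding simple_function_def
    proof (intro conjI ballI)
      show "finite (k n ` space (measure_on \<mu> S))"
        by (rule finite_subset[of _ "{..n}"]) (use k in \<open>auto simp: P_def\<close>)
      show "k n -` {y} \<inter> space (measure_on \<mu> S) \<in> sets (measure_on \<mu> S)" for y
        using measurable_sets[OF km] by simp
    qed
    then show "simple_function (measure_on \<mu> S) (s n)"
      unfolding s_def using simple_function_compose[of _ "k n" e] by (simp add: comp_def)
  next
    show "AE x in measure_on \<mu> S. (\<lambda>n. s n x) \<longlonglongrightarrow> u x"
      using D(2)
    proof eventually_elim
      case (elim x)
      show ?case
      proof (rule metric_LIMSEQ_I)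
        fix r :: real assume "0 < r"
        then obtain d where "d \<in> D" "dist d (u x) < r" using elim by (auto simp: closure_approachable)
        then obtain i where i: "dist (e i) (u x) < r" using eD by (metis insertCI imageE)
        then show "\<exists>N. \<forall>n\<ge>N. dist (s n x) (u x) < r"
          using kle order.strict_trans1 by blast
      qed
    qed
  next
    show "norm (s n x - u x) \<le> norm (u x)" for n x
      using kle[of 0 n x] by (simp add: dist_norm e_def)
  qed
qed

text \<open>In a non-separable space addition need not be measurable for the product of the Borel
  algebras. The essentially separable range supplies simple approximations, whose sums are
  simple.\<close>

lemma measurable_map_add:
  fixes u v :: "'a \<Rightarrow> 'b::real_normed_vector"
  assumes S: "S \<in> sets M" and u: "measurable_map \<mu> S u" and v: "measurable_map \<mu> S v"
  shows "measurable_map \<mu> S (\<lambda>x. u x + v x)"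
proof -
  obtain s where s: "\<And>n::nat. simple_function (measure_on \<mu> S) (s n)" "AE x in measure_on \<mu> S. (\<lambda>n. s n x) \<longlonglongrightarrow> u x"
    "\<And>n x. norm (s n x - u x) \<le> norm (u x)"
    by (rule measurable_map_imp_simple[OF S u]) (rule that)
  obtain t where t: "\<And>n::nat. simple_function (measure_on \<mu> S) (t n)" "AE x in measure_on \<mu> S. (\<lambda>n. t n x) \<longlonglongrightarrow> v x"
    "\<And>n x. norm (t n x - v x) \<le> norm (v x)"
    by (rule measurable_map_imp_simple[OF S v]) (rule that)
  show ?thesis
  proof (rule measurable_map_limit[OF S])
    show "measurable_map \<mu> S (\<lambda>x. s n x + t n x)" for n
      using simple_function_compose2[OF s(1) t(1), where h="(+)"] by (intro measurable_map_simple[OF S])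
    show "AE x in measure_on \<mu> S. (\<lambda>n. s n x + t n x) \<longlonglongrightarrow> u x + v x"
      using s(2) t(2) by eventually_elim (rule tendsto_add)
  qed
qed

lemma measurable_map_cmult:
  fixes u :: "'a \<Rightarrow> 'b::real_normed_vector"
  assumes S: "S \<in> sets M" and u: "measurable_map \<mu> S u"
  shows "measurable_map \<mu> S (\<lambda>x. c *\<^sub>R u x)"
proof -
  obtain s where s: "\<And>n::nat. simple_function (measure_on \<mu> S) (s n)" "AE x in measure_on \<mu> S. (\<lambda>n. s n x) \<longlonglongrightarrow> u x"
    "\<And>n x. norm (s n x - u x) \<le> norm (u x)"
    by (rule measurable_map_imp_simple[OF S u]) (rule that)
  show ?thesis
  proof (rule measurable_map_limit[OF S])
    show "measurable_map \<mu> S (\<lambda>x. c *\<^sub>R s n x)" for n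
      using simple_function_compose1[OF s(1), of "(*\<^sub>R) c"] by (intro measurable_map_simple[OF S])
    show "AE x in measure_on \<mu> S. (\<lambda>n. c *\<^sub>R s n x) \<longlonglongrightarrow> c *\<^sub>R u x"
      using s(2) by eventually_elim (intro tendsto_intros)
  qed
qed

lemma measurable_map_continuous:
  fixes u :: "'a \<Rightarrow> 'b::metric_space"
  assumes "continuous_on UNIV u"
  shows "measurable_map \<mu> UNIV u"
proof -
  obtain D :: "'a set" where D: "countable D" "\<And>X. open X \<Longrightarrow> X \<noteq> {} \<Longrightarrow> \<exists>d\<in>D. d \<in> X"
    by (erule countable_dense_setE)
  have "x \<in> closure D" for x
    unfolding closure_approachable
  proof (intro allI impI)
    fix e :: real assume "0 < e"
    then show "\<exists>y\<in>D. dist y x < e"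
      using D(2)[of "ball x e"] by (auto simp: dist_commute)
  qed
  then have "closure D = UNIV" by auto
  then have "u x \<in> closure (u ` D)" for x
    using image_closure_subset[of D u "closure (u ` D)"] assms closure_subset by (metis closed_closure image_subset_iff UNIV_I continuous_on_subset subset_UNIV)
  moreover have "u \<in> borel_measurable (measure_on \<mu> UNIV)"
    using borel_measurable_M[OF borel_measurable_continuous_onI[OF assms]] by (rule measurable_restrict_space1)
  ultimately show ?thesis
    using D(1) by (subst measurable_map_iff) (auto intro!: exI[of _ "u ` D"])
qed

lemma measurable_map_norm:
  fixes u :: "'a \<Rightarrow> 'b::real_normed_vector"
  assumes "measurable_map \<mu> S u"
  shows "(\<lambda>x. norm (u x - c)) \<in> borel_measurable (measure_on \<mu> S)"
proof -
  have "u \<in> borel_measurable (measure_on \<mu> S)" using assms by (simp add: measurable_map_def)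
  moreover have "(\<lambda>y. norm (y - c)) \<in> borel_measurable borel"
    by (intro borel_measurable_continuous_onI continuous_intros)
  ultimately show ?thesis by (rule measurable_compose)
qed

end

section \<open>Bounds for the Sobolev norm\<close>

text \<open>Absorbs the factor of \<open>powe_add_le\<close> into the gauge: one 2 comes from there,
  the other from replacing a sum by twice a maximum, where 2 <= 2^p.\<close>

lemma sum_powr_le: "0 \<le> a \<Longrightarrow> 0 \<le> b \<Longrightarrow> 1 \<le> p \<Longrightarrow> 2 powr p * (a powr p + b powr p) \<le> (4 * max a b) powr p" for a b p :: real
proof -
  assume ab: "0 \<le> a" "0 \<le> b" and p: "1 \<le> p"
  have "a powr p \<le> max a b powr p" "b powr p \<le> max a b powr p"
    using ab p by (auto intro!: powr_mono2)
  then have "2 powr p * (a powr p + b powr p) \<le> 2 powr p * (2 powr 1 * max a b powr p)"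
    by (intro mult_left_mono) auto
  also have "\<dots> \<le> 2 powr p * (2 powr p * max a b powr p)"
    using p by (intro mult_left_mono mult_right_mono powr_mono) auto
  also have "\<dots> = (2 * (2 * max a b)) powr p"
    using ab by (simp only: powr_mult[symmetric])
  finally show ?thesis by simp
qed

context metric_measure
begin

text \<open>\<open>sob_gauge p S u K\<close> says that \<open>K\<close> bounds both parts of the Sobolev norm of \<open>u\<close>. It is
  equivalent to the norm up to a factor 2 and spares Minkowski's inequality.\<close>

definition sob_gauge :: "real \<Rightarrow> 'a set \<Rightarrow> ('a \<Rightarrow> 'b::real_normed_vector) \<Rightarrow> real \<Rightarrow> bool" where
  "sob_gauge p S u K \<longleftrightarrow> measurable_map \<mu> S u \<and> Lp_int p \<mu> S (\<lambda>x. ennreal (norm (u x))) \<le> ennreal (K powr p) \<and>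
    (\<exists>u' \<rho>. (AE x in measure_on \<mu> S. u' x = u x) \<and> weak_upper_gradient p \<mu> S u' \<rho> \<and>
      Lp_int p \<mu> S \<rho> \<le> ennreal (K powr p))"

lemma sob_gaugeI:
  assumes "measurable_map \<mu> S u" "Lp_int p \<mu> S (\<lambda>x. ennreal (norm (u x))) \<le> ennreal (K powr p)"
    "AE x in measure_on \<mu> S. u' x = u x" "weak_upper_gradient p \<mu> S u' \<rho>" "Lp_int p \<mu> S \<rho> \<le> ennreal (K powr p)"
  shows "sob_gauge p S u K"
  unfolding sob_gauge_def using assms by (intro conjI exI[of _ u'] exI[of _ \<rho>])

lemma sob_gaugeE:
  assumes "sob_gauge p S u K"
  obtains u' \<rho> where "measurable_map \<mu> S u" "Lp_int p \<mu> S (\<lambda>x. ennreal (norm (u x))) \<le> ennreal (K powr p)"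
    "AE x in measure_on \<mu> S. u' x = u x" "weak_upper_gradient p \<mu> S u' \<rho>" "Lp_int p \<mu> S \<rho> \<le> ennreal (K powr p)"
    "\<rho> \<in> borel_measurable (restrict_space borel S)" "\<rho> \<in> Lp_borel p \<mu> S"
proof -
  obtain u' \<rho> where *: "measurable_map \<mu> S u" "Lp_int p \<mu> S (\<lambda>x. ennreal (norm (u x))) \<le> ennreal (K powr p)"
    "AE x in measure_on \<mu> S. u' x = u x" "weak_upper_gradient p \<mu> S u' \<rho>" "Lp_int p \<mu> S \<rho> \<le> ennreal (K powr p)"
    using assms unfolding sob_gauge_def by blast
  moreover have "\<rho> \<in> borel_measurable (restrict_space borel S)" using *(4) by (simp add: wug_iff)
  moreover have "Lp_int p \<mu> S \<rho> < top" using *(5) by (rule order.strict_trans1) simp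
  ultimately show ?thesis by (intro that) (auto simp: Lp_borel_iff)
qed

lemma sob_gauge_mono: "sob_gauge p S u K \<Longrightarrow> 0 \<le> K \<Longrightarrow> K \<le> K' \<Longrightarrow> 0 \<le> p \<Longrightarrow> sob_gauge p S u K'"
proof -
  assume *: "sob_gauge p S u K" "0 \<le> K" "K \<le> K'" "0 \<le> p"
  have "ennreal (K powr p) \<le> ennreal (K' powr p)"
    using * by (intro ennreal_leI powr_mono2) auto
  then show ?thesis using *(1) unfolding sob_gauge_def by (meson order_trans)
qed

lemma Lp_int_cong_AE:
  assumes "AE x in measure_on \<mu> S. f x = g x"
  shows "Lp_int p \<mu> S f = Lp_int p \<mu> S g"
  unfolding Lp_int_def using assms by (intro nn_integral_cong_AE) (auto elim!: eventually_mono)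

lemma sob_gauge_cong:
  assumes S: "S \<in> sets M" and u: "sob_gauge p S u K" and eq: "AE x in measure_on \<mu> S. v x = u x"
  shows "sob_gauge p S v K"
proof -
  obtain u' \<rho> where *: "measurable_map \<mu> S u" "Lp_int p \<mu> S (\<lambda>x. ennreal (norm (u x))) \<le> ennreal (K powr p)"
    "AE x in measure_on \<mu> S. u' x = u x" "weak_upper_gradient p \<mu> S u' \<rho>" "Lp_int p \<mu> S \<rho> \<le> ennreal (K powr p)"
    using u unfolding sob_gauge_def by blast
  have "AE x in measure_on \<mu> S. ennreal (norm (v x)) = ennreal (norm (u x))"
    using eq by eventually_elim simp
  from Lp_int_cong_AE[OF this] have 1: "Lp_int p \<mu> S (\<lambda>x. ennreal (norm (v x))) \<le> ennreal (K powr p)"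
    using *(2) by simp
  have 2: "AE x in measure_on \<mu> S. u' x = v x"
    using *(3) eq by eventually_elim simp
  show ?thesis
    unfolding sob_gauge_def using measurable_map_cong_AE[OF S *(1) eq] 1 2 *(4,5) by blast
qed

lemma sob_gauge_cmult:
  assumes S: "S \<in> sets M" and u: "sob_gauge p S u K" and K: "0 \<le> K"
  shows "sob_gauge p S (\<lambda>x. c *\<^sub>R u x) (\<bar>c\<bar> * K)"
proof -
  obtain u' \<rho> where *: "measurable_map \<mu> S u" "Lp_int p \<mu> S (\<lambda>x. ennreal (norm (u x))) \<le> ennreal (K powr p)"
    "AE x in measure_on \<mu> S. u' x = u x" "weak_upper_gradient p \<mu> S u' \<rho>" "Lp_int p \<mu> S \<rho> \<le> ennreal (K powr p)"
    "\<rho> \<in> borel_measurable (restrict_space borel S)" "\<rho> \<in> Lp_borel p \<mu> S"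
    using u by (rule sob_gaugeE) (rule that)
  have c: "ennreal \<bar>c\<bar> powe p * ennreal (K powr p) = ennreal ((\<bar>c\<bar> * K) powr p)"
    using K by (simp add: powe_ennreal ennreal_mult[symmetric] powr_mult)
  have m: "(\<lambda>x. ennreal (norm (u x))) \<in> borel_measurable (measure_on \<mu> S)"
    using measurable_map_norm[OF *(1), of 0] by simp
  have 1: "Lp_int p \<mu> S (\<lambda>x. ennreal (norm (c *\<^sub>R u x))) \<le> ennreal ((\<bar>c\<bar> * K) powr p)"
    using mult_left_mono[OF *(2), of "ennreal \<bar>c\<bar> powe p"] Lp_int_cmult[OF m, of p "ennreal \<bar>c\<bar>"]
    unfolding c by (simp add: ennreal_mult)
  have 2: "Lp_int p \<mu> S (\<lambda>x. ennreal \<bar>c\<bar> * \<rho> x) \<le> ennreal ((\<bar>c\<bar> * K) powr p)"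
    using mult_left_mono[OF *(5), of "ennreal \<bar>c\<bar> powe p"] Lp_int_cmult[OF borel_on_measurable[OF *(6)], of p "ennreal \<bar>c\<bar>"]
    unfolding c by simp
  have 3: "AE x in measure_on \<mu> S. c *\<^sub>R u' x = c *\<^sub>R u x"
    using *(3) by eventually_elim simp
  show ?thesis
    by (rule sob_gaugeI[OF measurable_map_cmult[OF S *(1)] 1 3 wug_cmult[OF *(4)] 2])
qed

lemma sob_gauge_add:
  assumes S: "S \<in> sets M" and p: "1 \<le> p" and u: "sob_gauge p S u K" and v: "sob_gauge p S v L" and KL: "0 \<le> K" "0 \<le> L"
  shows "sob_gauge p S (\<lambda>x. u x + v x) (4 * max K L)"
proof -
  obtain u' \<rho> where *: "measurable_map \<mu> S u" "Lp_int p \<mu> S (\<lambda>x. ennreal (norm (u x))) \<le> ennreal (K powr p)"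
    "AE x in measure_on \<mu> S. u' x = u x" "weak_upper_gradient p \<mu> S u' \<rho>" "Lp_int p \<mu> S \<rho> \<le> ennreal (K powr p)"
    "\<rho> \<in> borel_measurable (restrict_space borel S)" "\<rho> \<in> Lp_borel p \<mu> S"
    using u by (rule sob_gaugeE) (rule that)
  obtain v' \<sigma> where **: "measurable_map \<mu> S v" "Lp_int p \<mu> S (\<lambda>x. ennreal (norm (v x))) \<le> ennreal (L powr p)"
    "AE x in measure_on \<mu> S. v' x = v x" "weak_upper_gradient p \<mu> S v' \<sigma>" "Lp_int p \<mu> S \<sigma> \<le> ennreal (L powr p)"
    "\<sigma> \<in> borel_measurable (restrict_space borel S)" "\<sigma> \<in> Lp_borel p \<mu> S"
    using v by (rule sob_gaugeE) (rule that)
  have p0: "0 < p" using p by simp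
  have m: "(\<lambda>x. ennreal (norm (u x))) \<in> borel_measurable (measure_on \<mu> S)" "(\<lambda>x. ennreal (norm (v x))) \<in> borel_measurable (measure_on \<mu> S)"
    using measurable_map_norm[OF *(1), of 0] measurable_map_norm[OF **(1), of 0] by simp_all
  have c: "ennreal (2 powr p) * (x + y) \<le> ennreal ((4 * max K L) powr p)"
    if "x \<le> ennreal (K powr p)" "y \<le> ennreal (L powr p)" for x y
  proof -
    have "ennreal (2 powr p) * (x + y) \<le> ennreal (2 powr p) * (ennreal (K powr p) + ennreal (L powr p))"
      using that by (intro mult_left_mono add_mono) auto
    also have "\<dots> = ennreal (2 powr p * (K powr p + L powr p))"
      by (simp add: ennreal_mult)
    also have "\<dots> \<le> ennreal ((4 * max K L) powr p)"
      by (intro ennreal_leI sum_powr_le KL p)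
    finally show ?thesis .
  qed
  have "Lp_int p \<mu> S (\<lambda>x. ennreal (norm (u x + v x))) \<le> Lp_int p \<mu> S (\<lambda>x. ennreal (norm (u x)) + ennreal (norm (v x)))"
    using p0 by (intro Lp_int_mono AE_I2) (auto simp: ennreal_plus[symmetric] norm_triangle_ineq intro!: ennreal_leI simp del: ennreal_plus)
  also have "\<dots> \<le> ennreal ((4 * max K L) powr p)"
    by (rule order_trans[OF Lp_int_add[OF p0 m] c[OF *(2) **(2)]])
  finally have 1: "Lp_int p \<mu> S (\<lambda>x. ennreal (norm (u x + v x))) \<le> ennreal ((4 * max K L) powr p)" .
  have 2: "Lp_int p \<mu> S (\<lambda>x. \<rho> x + \<sigma> x) \<le> ennreal ((4 * max K L) powr p)"
    by (rule order_trans[OF Lp_int_add[OF p0 borel_on_measurable[OF *(6)] borel_on_measurable[OF **(6)]] c[OF *(5) **(5)]])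
  have 3: "AE x in measure_on \<mu> S. u' x + v' x = u x + v x"
    using *(3) **(3) by eventually_elim simp
  show ?thesis
    by (rule sob_gaugeI[OF measurable_map_add[OF S *(1) **(1)] 1 3 wug_add[OF p0 *(4) **(4)] 2])
qed

lemma sob_gauge_diff:
  assumes S: "S \<in> sets M" and p: "1 \<le> p" and u: "sob_gauge p S u K" and v: "sob_gauge p S v L" and KL: "0 \<le> K" "0 \<le> L"
  shows "sob_gauge p S (\<lambda>x. u x - v x) (4 * max K L)"
  using sob_gauge_add[OF S p u sob_gauge_cmult[OF S v, of "-1"]] KL by simp

lemma sob_gauge_zero:
  assumes S: "S \<in> sets M" and p: "1 \<le> p"
  shows "sob_gauge p S (\<lambda>x. 0) K"
proof -
  have "measurable_map \<mu> S (\<lambda>x. 0 :: 'b)"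
    by (rule measurable_map_simple[OF S]) simp
  then show ?thesis
    unfolding sob_gauge_def using wug_zero[of p S] p
    by (intro conjI exI[of _ "\<lambda>x. 0"]) (auto simp: Lp_int_def)
qed

text \<open>Completeness, stated for series. The rate 1/4 beats the weights 2^(n+1) of
  \<open>powe_suminf_le\<close> and leaves a geometric series; the sum of the upper gradients serves
  all partial sums, and \<open>wug_limit\<close> carries it to the limit.\<close>

lemma sob_gauge_series:
  fixes u :: "nat \<Rightarrow> 'a \<Rightarrow> 'b::banach"
  assumes S: "S \<in> sets M" and p: "1 \<le> p" and K: "0 \<le> K" and u: "\<And>n. sob_gauge p S (u n) (K * (1/4) ^ n)"
  obtains w where "AE x in measure_on \<mu> S. (\<lambda>n. \<Sum>i<n. u i x) \<longlonglongrightarrow> w x" "sob_gauge p S w (4 * K)"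
proof -
  have p0: "0 < p" using p by simp
  have "\<exists>u' \<rho>. (AE x in measure_on \<mu> S. u' x = u n x) \<and> weak_upper_gradient p \<mu> S u' \<rho> \<and>
      Lp_int p \<mu> S \<rho> \<le> ennreal ((K * (1/4) ^ n) powr p)" for n
    using u[of n] unfolding sob_gauge_def by blast
  then obtain u' \<rho> where u': "\<And>n. AE x in measure_on \<mu> S. u' n x = u n x" and \<rho>: "\<And>n. weak_upper_gradient p \<mu> S (u' n) (\<rho> n)"
    and I\<rho>: "\<And>n. Lp_int p \<mu> S (\<rho> n) \<le> ennreal ((K * (1/4) ^ n) powr p)" by metis
  have um: "measurable_map \<mu> S (u n)" and Iu: "Lp_int p \<mu> S (\<lambda>x. ennreal (norm (u n x))) \<le> ennreal ((K * (1/4) ^ n) powr p)" for n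
    using u[of n] unfolding sob_gauge_def by blast+
  have \<rho>b: "\<rho> n \<in> borel_measurable (restrict_space borel S)" for n using \<rho>[of n] by (simp add: wug_iff)
  have sum_le: "Lp_int p \<mu> S (\<lambda>x. \<Sum>n. f n x) \<le> ennreal ((4 * K) powr p)"
    if f: "\<And>n. f n \<in> borel_measurable (measure_on \<mu> S)" "\<And>n. Lp_int p \<mu> S (f n) \<le> ennreal ((K * (1/4) ^ n) powr p)" for f
  proof -
    have "Lp_int p \<mu> S (\<lambda>x. \<Sum>n. f n x) \<le> (\<Sum>n. ennreal (2 ^ Suc n) powe p * Lp_int p \<mu> S (f n))"
      by (rule Lp_int_suminf[OF p0 f(1)])
    also have "\<dots> \<le> (\<Sum>n. ennreal (2 * (2 * K) powr p) * ennreal ((1/2) ^ Suc n))"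
    proof (intro suminf_le)
      fix n
      have "(2::real) ^ n * (1/4) ^ n = (1/2) ^ n"
        by (simp flip: power_mult_distrib)
      then have e: "2 ^ Suc n * (K * (1/4) ^ n) = (2 * K) * (1/2::real) ^ n"
        by simp
      have "(2 ^ Suc n) powr p * (K * (1/4) ^ n) powr p = (2 * K) powr p * ((1/2) ^ n) powr p"
        by (simp only: powr_mult[symmetric] e)
      also have "((1/2) ^ n) powr p \<le> ((1/2::real) ^ n) powr 1"
        using p by (intro powr_mono') (auto simp: power_le_one)
      also have "(2 * K) powr p * ((1/2::real) ^ n) powr 1 = 2 * (2 * K) powr p * (1/2) ^ Suc n"
        by simp
      finally have *: "(2 ^ Suc n) powr p * (K * (1/4) ^ n) powr p \<le> 2 * (2 * K) powr p * (1/2) ^ Suc n"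
        by (simp add: mult_left_mono)
      have "ennreal (2 ^ Suc n) powe p * Lp_int p \<mu> S (f n) \<le> ennreal (2 ^ Suc n) powe p * ennreal ((K * (1/4) ^ n) powr p)"
        by (intro mult_left_mono f) auto
      also have "\<dots> = ennreal ((2 ^ Suc n) powr p * (K * (1/4) ^ n) powr p)"
        by (subst powe_ennreal) (simp_all only: zero_le_power zero_le_numeral ennreal_mult powr_ge_zero)
      also have "\<dots> \<le> ennreal (2 * (2 * K) powr p * (1/2) ^ Suc n)"
        by (intro ennreal_leI *)
      also have "\<dots> = ennreal (2 * (2 * K) powr p) * ennreal ((1/2) ^ Suc n)"
        by (rule ennreal_mult) simp_all
      finally show "ennreal (2 ^ Suc n) powe p * Lp_int p \<mu> S (f n) \<le> ennreal (2 * (2 * K) powr p) * ennreal ((1/2) ^ Suc n)" .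
    qed auto
    also have "\<dots> = ennreal (2 * (2 * K) powr p) * 1"
      by (simp only: ennreal_suminf_cmult suminf_ennreal_half)
    also have "\<dots> \<le> ennreal (2 powr p * (2 * K) powr p)"
      using p powr_mono[of 1 p 2] by (auto intro!: ennreal_leI mult_right_mono)
    also have "2 powr p * (2 * K) powr p = (4 * K) powr p"
      using K by (simp flip: powr_mult)
    finally show ?thesis .
  qed
  define A where "A x = (\<Sum>n. ennreal (norm (u n x)))" for x
  have nm: "(\<lambda>x. ennreal (norm (u n x))) \<in> borel_measurable (measure_on \<mu> S)" for n
    using measurable_map_norm[OF um[of n], of 0] by simp
  have IA: "Lp_int p \<mu> S A \<le> ennreal ((4 * K) powr p)"
    unfolding A_def[abs_def] by (rule sum_le[OF nm Iu])
  define G where "G x = (\<Sum>n. \<rho> n x)" for x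
  have Gb: "G \<in> borel_measurable (restrict_space borel S)"
    unfolding G_def[abs_def] by (intro borel_measurable_suminf_order \<rho>b)
  have G: "Lp_int p \<mu> S G \<le> ennreal ((4 * K) powr p)"
    unfolding G_def[abs_def] by (rule sum_le[OF borel_on_measurable[OF \<rho>b] I\<rho>])
  have "Lp_int p \<mu> S G < top" using G by (rule order.strict_trans1) simp
  then have GL: "G \<in> Lp_borel p \<mu> S" using Gb by (simp add: Lp_borel_iff)
  have "A \<in> borel_measurable (measure_on \<mu> S)"
    unfolding A_def[abs_def] by (intro borel_measurable_suminf_order nm)
  then have "(\<lambda>x. A x powe p) \<in> borel_measurable (measure_on \<mu> S)" by measurable
  moreover have "(\<integral>\<^sup>+x. A x powe p \<partial>measure_on \<mu> S) \<noteq> \<infinity>"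
    using order.strict_trans1[OF IA ennreal_less_top] by (simp add: Lp_int_def)
  ultimately have "AE x in measure_on \<mu> S. A x powe p \<noteq> \<infinity>" by (rule nn_integral_PInf_AE)
  then have sm: "AE x in measure_on \<mu> S. summable (\<lambda>n. norm (u n x))"
  proof eventually_elim
    case (elim x)
    then have "A x \<noteq> top" by simp
    then show ?case unfolding A_def by (intro summable_suminf_not_top) auto
  qed
  \<comment> \<open>The limit is formed from the representatives \<open>u'\<close>: the gradient
    inequality along paths is known for them, whereas \<open>u\<close> may be arbitrary on a null
    set.\<close>
  define w where "w = (\<lambda>x. if convergent (\<lambda>n. \<Sum>i<n. u' i x) then lim (\<lambda>n. \<Sum>i<n. u' i x) else 0)"
  have all: "AE x in measure_on \<mu> S. \<forall>n. u' n x = u n x" using u' by (simp add: AE_all_countable)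
  have cv: "AE x in measure_on \<mu> S. (\<lambda>n. \<Sum>i<n. u i x) \<longlonglongrightarrow> w x \<and> (\<lambda>n. \<Sum>i<n. u' i x) \<longlonglongrightarrow> w x \<and>
      ennreal (norm (w x)) \<le> A x"
    using all sm
  proof eventually_elim
    case (elim x)
    then have e: "(\<lambda>n. \<Sum>i<n. u' i x) = (\<lambda>n. \<Sum>i<n. u i x)" by simp
    have s: "summable (\<lambda>n. u n x)" by (rule summable_norm_cancel[OF elim(2)])
    then have "convergent (\<lambda>n. \<Sum>i<n. u i x)" by (simp add: summable_iff_convergent)
    then have w: "(\<lambda>n. \<Sum>i<n. u i x) \<longlonglongrightarrow> w x" unfolding w_def e by (simp add: convergent_LIMSEQ_iff)
    have "w x = suminf (\<lambda>n. u n x)" using w summable_LIMSEQ[OF s] by (rule LIMSEQ_unique)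
    then have "norm (w x) \<le> (\<Sum>n. norm (u n x))" using summable_norm[OF elim(2)] by simp
    also have "ennreal (\<Sum>n. norm (u n x)) = A x"
      unfolding A_def using elim(2) by (intro suminf_ennreal2[symmetric]) auto
    finally show ?case using w e by (simp add: ennreal_leI)
  qed
  have "weak_upper_gradient p \<mu> S w G"
    unfolding w_def
  proof (rule wug_limit[OF p0 S _ GL])
    show "weak_upper_gradient p \<mu> S (\<lambda>x. \<Sum>i<n. u' i x) G" for n
    proof (rule wug_mono[OF wug_sum[OF p0 \<rho>] Gb])
      show "(\<Sum>i<n. \<rho> i x) \<le> G x" for x unfolding G_def by (rule sum_le_suminf) auto
    qed
    show "AE x in measure_on \<mu> S. convergent (\<lambda>n. \<Sum>i<n. u' i x)"
      using cv by eventually_elim (auto intro: convergentI)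
  qed
  moreover have "measurable_map \<mu> S w"
  proof (rule measurable_map_limit[OF S])
    show "measurable_map \<mu> S (\<lambda>x. \<Sum>i<n. u i x)" for n
    proof (induction n)
      case 0
      show ?case by (simp, rule measurable_map_simple[OF S]) simp
    next
      case (Suc n)
      then show ?case using measurable_map_add[OF S Suc um[of n]] by simp
    qed
    show "AE x in measure_on \<mu> S. (\<lambda>n. \<Sum>i<n. u i x) \<longlonglongrightarrow> w x" using cv by eventually_elim simp
  qed
  moreover have "Lp_int p \<mu> S (\<lambda>x. ennreal (norm (w x))) \<le> ennreal ((4 * K) powr p)"
    by (rule order_trans[OF Lp_int_mono IA]) (use cv p in \<open>auto elim!: eventually_mono\<close>)
  ultimately have "sob_gauge p S w (4 * K)"
    unfolding sob_gauge_def using G by blast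
  moreover have "AE x in measure_on \<mu> S. (\<lambda>n. \<Sum>i<n. u i x) \<longlonglongrightarrow> w x" using cv by eventually_elim simp
  ultimately show ?thesis using that by blast
qed

end

context metric_measure
begin

lemma Lp_space_iff:
  "u \<in> Lp_space p \<mu> S \<longleftrightarrow> measurable_map \<mu> S u \<and> Lp_int p \<mu> S (\<lambda>x. ennreal (norm (u x))) < top"
  by (simp add: Lp_space_def Lp_norm_less_top_iff)

lemma sob_gauge_space:
  assumes S: "S \<in> sets M" and u: "sob_gauge p S u K"
  shows "u \<in> sobolev_space p \<mu> S"
    and "\<exists>u' \<rho>. (u', \<rho>) \<in> sobolev_pairs p \<mu> S u \<and> Lp_int p \<mu> S \<rho> \<le> ennreal (K powr p)"
proof -
  obtain u' \<rho> where *: "measurable_map \<mu> S u" "Lp_int p \<mu> S (\<lambda>x. ennreal (norm (u x))) \<le> ennreal (K powr p)"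
    "AE x in measure_on \<mu> S. u' x = u x" "weak_upper_gradient p \<mu> S u' \<rho>" "Lp_int p \<mu> S \<rho> \<le> ennreal (K powr p)"
    "\<rho> \<in> borel_measurable (restrict_space borel S)" "\<rho> \<in> Lp_borel p \<mu> S"
    using u by (rule sob_gaugeE) (rule that)
  have "AE x in measure_on \<mu> S. ennreal (norm (u' x)) = ennreal (norm (u x))"
    using *(3) by eventually_elim simp
  from Lp_int_cong_AE[OF this] have "Lp_int p \<mu> S (\<lambda>x. ennreal (norm (u' x))) = Lp_int p \<mu> S (\<lambda>x. ennreal (norm (u x)))" .
  moreover have fin: "Lp_int p \<mu> S (\<lambda>x. ennreal (norm (u x))) < top"
    using *(2) by (rule order.strict_trans1) simp
  ultimately have "u' \<in> Lp_space p \<mu> S"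
    using measurable_map_cong_AE[OF S *(1,3)] by (simp add: Lp_space_iff)
  then have pr: "(u', \<rho>) \<in> sobolev_pairs p \<mu> S u"
    using * by (simp add: sobolev_pairs_def)
  then show "\<exists>u' \<rho>. (u', \<rho>) \<in> sobolev_pairs p \<mu> S u \<and> Lp_int p \<mu> S \<rho> \<le> ennreal (K powr p)"
    using *(5) by blast
  show "u \<in> sobolev_space p \<mu> S"
    using pr fin *(1) unfolding sobolev_space_def Lp_space_iff by blast
qed

lemma sob_gauge_norm_le:
  assumes S: "S \<in> sets M" and u: "sob_gauge p S u K" and K: "0 \<le> K" and p: "0 < p"
  shows "sobolev_norm p \<mu> S u \<le> ennreal (2 * K)"
proof -
  obtain u' \<rho> where pr: "(u', \<rho>) \<in> sobolev_pairs p \<mu> S u" "Lp_int p \<mu> S \<rho> \<le> ennreal (K powr p)"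
    using sob_gauge_space(2)[OF S u] by blast
  have "Lp_norm p \<mu> S \<rho> \<le> ennreal K"
    using pr(2) K by (simp add: Lp_norm_le_iff[OF p] powe_ennreal)
  then have "(INF (u', \<rho>) \<in> sobolev_pairs p \<mu> S u. Lp_norm p \<mu> S \<rho>) \<le> ennreal K"
    using pr(1) by (intro INF_lower2[of "(u', \<rho>)"]) auto
  moreover have "Lp_norm p \<mu> S (\<lambda>x. ennreal (norm (u x))) \<le> ennreal K"
    using u K by (simp add: Lp_norm_le_iff[OF p] powe_ennreal sob_gauge_def)
  ultimately have "sobolev_norm p \<mu> S u \<le> ennreal K + ennreal K"
    unfolding sobolev_norm_def by (intro add_mono)
  also have "\<dots> = ennreal (2 * K)"
    using K by (simp flip: ennreal_plus)
  finally show ?thesis .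
qed

text \<open>The inequality is strict because a gauge needs an actual gradient, while the norm only
  provides an infimum over them.\<close>

lemma sob_gauge_of_norm_less:
  assumes u: "u \<in> sobolev_space p \<mu> S" and K: "sobolev_norm p \<mu> S u < ennreal K" and p: "0 < p"
  shows "sob_gauge p S u K"
proof -
  have K0: "0 \<le> K" using K by (cases "0 \<le> K") (auto simp: ennreal_neg)
  have "Lp_norm p \<mu> S (\<lambda>x. ennreal (norm (u x))) \<le> ennreal K"
    using K unfolding sobolev_norm_def by (meson add_increasing2 less_imp_le order_trans zero_le order_refl)
  then have 1: "Lp_int p \<mu> S (\<lambda>x. ennreal (norm (u x))) \<le> ennreal (K powr p)"
    using K0 by (simp add: Lp_norm_le_iff[OF p] powe_ennreal)
  have "(INF (u', \<rho>) \<in> sobolev_pairs p \<mu> S u. Lp_norm p \<mu> S \<rho>) \<le> sobolev_norm p \<mu> S u"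
    unfolding sobolev_norm_def by simp
  then have "(INF (u', \<rho>) \<in> sobolev_pairs p \<mu> S u. Lp_norm p \<mu> S \<rho>) < ennreal K"
    using K by (rule order.strict_trans1)
  then obtain u' \<rho> where pr: "(u', \<rho>) \<in> sobolev_pairs p \<mu> S u" "Lp_norm p \<mu> S \<rho> < ennreal K"
    by (auto simp: INF_less_iff)
  then have 2: "Lp_int p \<mu> S \<rho> \<le> ennreal (K powr p)"
    using K0 less_imp_le[OF pr(2)] by (simp add: Lp_norm_le_iff[OF p] powe_ennreal)
  show ?thesis
    by (rule sob_gaugeI[OF _ 1 _ _ 2]) (use pr(1) u in \<open>auto simp: sobolev_pairs_def sobolev_space_def Lp_space_iff\<close>)
qed

lemma sobolev_norm_finite:
  assumes "u \<in> sobolev_space p \<mu> S" shows "sobolev_norm p \<mu> S u < top"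
proof -
  obtain u' \<rho> where pr: "(u', \<rho>) \<in> sobolev_pairs p \<mu> S u"
    using assms by (auto simp: sobolev_space_def)
  then have "Lp_norm p \<mu> S \<rho> < top" by (auto simp: sobolev_pairs_def Lp_borel_def)
  then have "(INF (u', \<rho>) \<in> sobolev_pairs p \<mu> S u. Lp_norm p \<mu> S \<rho>) < top"
    using pr by (intro order.strict_trans1[OF INF_lower2[of "(u', \<rho>)"]]) auto
  then show ?thesis
    using assms by (simp add: sobolev_norm_def sobolev_space_def Lp_space_def)
qed

lemma sobolev_space_gauge:
  assumes "u \<in> sobolev_space p \<mu> S" "0 < p"
  obtains K where "0 < K" "sob_gauge p S u K"
proof -
  obtain k where k: "sobolev_norm p \<mu> S u = ennreal k" "0 \<le> k"
    using sobolev_norm_finite[OF assms(1)] by (cases "sobolev_norm p \<mu> S u") auto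
  then have "sob_gauge p S u (k + 1)"
    using assms by (intro sob_gauge_of_norm_less) (auto simp: ennreal_less_iff)
  then show ?thesis using that[of "k + 1"] k by simp
qed

end

section \<open>Baire category: extensions with a uniform bound\<close>

locale extension_property = metric_measure \<mu>
  for \<mu> :: "'a::polish_space set \<Rightarrow> ennreal" +
  fixes p :: real and \<Omega> :: "'a set" and dummy :: "'b::banach itself"
  assumes p: "1 \<le> p" and \<Omega>: "\<Omega> \<in> sets M"
    and ext: "\<And>u :: 'a \<Rightarrow> 'b. u \<in> sobolev_space p \<mu> \<Omega> \<Longrightarrow>
      \<exists>h \<in> sobolev_space p \<mu> UNIV. AE x in measure_on \<mu> \<Omega>. h x = u x"
begin

abbreviation W :: "('a \<Rightarrow> 'b) \<Rightarrow> real \<Rightarrow> bool" where "W \<equiv> sob_gauge p \<Omega>"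

text \<open>Up to the equivalence of gauge and norm, K bounds the quotient norm of \<open>u\<close>,
  that is, the norm in the Sobolev space of Z modulo functions vanishing on \<Omega>.\<close>

definition Q :: "('a \<Rightarrow> 'b) \<Rightarrow> real \<Rightarrow> bool" where
  "Q u K \<longleftrightarrow> (\<exists>h. sob_gauge p UNIV h K \<and> (AE x in measure_on \<mu> \<Omega>. h x = u x))"

lemma UNIV_M: "UNIV \<in> sets M" using sets.top[of M] by simp

lemma Q_mono: "Q u K \<Longrightarrow> 0 \<le> K \<Longrightarrow> K \<le> L \<Longrightarrow> Q u L"
  unfolding Q_def using p sob_gauge_mono[of p UNIV _ K L] by auto

lemma Q_diff:
  assumes "Q u K" "Q v L" "0 \<le> K" "0 \<le> L"
  shows "Q (\<lambda>x. u x - v x) (4 * max K L)"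
proof -
  obtain g h where "sob_gauge p UNIV g K" "AE x in measure_on \<mu> \<Omega>. g x = u x"
    "sob_gauge p UNIV h L" "AE x in measure_on \<mu> \<Omega>. h x = v x"
    using assms unfolding Q_def by blast
  then show ?thesis unfolding Q_def using assms(3,4)
    by (intro exI[of _ "\<lambda>x. g x - h x"] conjI sob_gauge_diff UNIV_M p) (auto elim!: eventually_elim2)
qed

lemma Q_cmult:
  assumes "Q u K" "0 \<le> K"
  shows "Q (\<lambda>x. c *\<^sub>R u x) (\<bar>c\<bar> * K)"
proof -
  obtain g where "sob_gauge p UNIV g K" "AE x in measure_on \<mu> \<Omega>. g x = u x"
    using assms unfolding Q_def by blast
  then show ?thesis unfolding Q_def using assms(2)
    by (intro exI[of _ "\<lambda>x. c *\<^sub>R g x"] conjI sob_gauge_cmult UNIV_M) (auto elim!: eventually_mono)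
qed

lemma W_imp_Q: "W u K \<Longrightarrow> \<exists>L>0. Q u L"
proof -
  assume "W u K"
  then have "u \<in> sobolev_space p \<mu> \<Omega>" by (rule sob_gauge_space(1)[OF \<Omega>])
  then obtain h where h: "h \<in> sobolev_space p \<mu> UNIV" "AE x in measure_on \<mu> \<Omega>. h x = u x"
    using ext by blast
  obtain L where "0 < L" "sob_gauge p UNIV h L"
    by (rule sobolev_space_gauge[OF h(1)]) (use p in auto)
  then show ?thesis using h(2) unfolding Q_def by blast
qed

text \<open>Baire category: some set \<open>{u. Q u n}\<close> is dense in a ball of \<open>W\<close>.\<close>

lemma dense_in_ball:
  "\<exists>(n::nat) x0 r. 0 < r \<and> (\<forall>v e. W v r \<longrightarrow> 0 < e \<longrightarrow> (\<exists>a. Q a (real n) \<and> W (\<lambda>x. x0 x + v x - a x) e))"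
proof (rule ccontr)
  assume "\<not> ?thesis"
  then have "\<forall>(n::nat) x0 r. 0 < r \<longrightarrow> (\<exists>v e. W v r \<and> 0 < e \<and> (\<forall>a. Q a (real n) \<longrightarrow> \<not> W (\<lambda>x. x0 x + v x - a x) e))"
    by meson
  then obtain V E where VE: "\<And>(n::nat) x0 r. 0 < r \<Longrightarrow> W (V n x0 r) r \<and> 0 < E n x0 r \<and>
      (\<forall>a. Q a (real n) \<longrightarrow> \<not> W (\<lambda>x. x0 x + V n x0 r x - a x) (E n x0 r))"
    by metis
  \<comment> \<open>Nested balls with centre \<open>X n\<close> and radius \<open>R n\<close>. The
    move \<open>v n\<close> reaches a point that is not within \<open>e n\<close> of any function
    satisfying \<open>Q\<close> with bound n. As the next radius is at most \<open>e n / 4\<close>,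
    the tail of the series has gauge at most \<open>e n\<close>, so the limit \<open>w\<close> is
    within \<open>e n\<close> of that point and violates \<open>Q\<close> with bound n, for every
    n.\<close>
  define st where "st = rec_nat ((\<lambda>x. 0 :: 'b), 1 :: real)
    (\<lambda>n (x0, r). ((\<lambda>x. x0 x + V n x0 r x), min (r / 4) (E n x0 r / 4)))"
  define X R where "X n = fst (st n)" and "R n = snd (st n)" for n
  have st0: "X 0 = (\<lambda>x. 0)" "R 0 = 1" by (simp_all add: X_def R_def st_def)
  define v e where "v n = V n (X n) (R n)" and "e n = E n (X n) (R n)" for n
  have stS: "X (Suc n) = (\<lambda>x. X n x + v n x)" "R (Suc n) = min (R n / 4) (e n / 4)" for n
    by (simp_all add: X_def R_def st_def v_def e_def split: prod.split)
  have R: "0 < R n" for n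
  proof (induction n)
    case (Suc n) then show ?case using VE[of "R n" n "X n"] by (simp add: stS e_def)
  qed (simp add: st0)
  have v: "W (v n) (R n)" "0 < e n" "\<And>a. Q a (real n) \<Longrightarrow> \<not> W (\<lambda>x. X n x + v n x - a x) (e n)" for n
    using VE[OF R[of n], of n "X n"] by (auto simp: v_def e_def)
  have Rk: "R (n + k) \<le> R n * (1/4) ^ k" for n k
  proof (induction k)
    case (Suc k)
    have "R (n + Suc k) \<le> R (n + k) / 4" by (simp add: stS)
    then show ?case using Suc by simp
  qed simp
  have X: "X n x = (\<Sum>i<n. v i x)" for n x
    by (induction n) (simp_all add: st0 stS)
  have shift: "\<exists>w. (AE x in measure_on \<mu> \<Omega>. (\<lambda>k. \<Sum>i<k. v (n + i) x) \<longlonglongrightarrow> w x) \<and> W w (4 * R n)" for n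
  proof -
    have "W (v (n + i)) (R n * (1/4) ^ i)" for i
      using sob_gauge_mono[OF v(1)[of "n + i"] less_imp_le[OF R] Rk] p by simp
    then show ?thesis by (rule sob_gauge_series[OF \<Omega> p less_imp_le[OF R[of n]]]) blast
  qed
  obtain w where w: "AE x in measure_on \<mu> \<Omega>. (\<lambda>k. \<Sum>i<k. v i x) \<longlonglongrightarrow> w x" "W w 4"
    using shift[of 0] by (auto simp: st0)
  obtain L where L: "0 < L" "Q w L" using W_imp_Q[OF w(2)] by blast
  obtain n :: nat where n: "L \<le> real n" using real_arch_simple by blast
  have Qw: "Q w (real n)" using Q_mono[OF L(2) _ n] L(1) by simp
  obtain w' where w': "AE x in measure_on \<mu> \<Omega>. (\<lambda>k. \<Sum>i<k. v (Suc n + i) x) \<longlonglongrightarrow> w' x" "W w' (4 * R (Suc n))"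
    using shift[of "Suc n"] by blast
  have ae: "AE x in measure_on \<mu> \<Omega>. X n x + v n x - w x = (-1) *\<^sub>R w' x"
    using w(1) w'(1)
  proof eventually_elim
    case (elim x)
    have "(\<lambda>k. \<Sum>i<k + Suc n. v i x) \<longlonglongrightarrow> w x" by (rule LIMSEQ_ignore_initial_segment[OF elim(1)])
    moreover have "(\<Sum>i<k + N. v i x) = (\<Sum>i<N. v i x) + (\<Sum>i<k. v (N + i) x)" for k N
      by (induction k) (simp_all add: add.commute add.left_commute)
    then have "(\<Sum>i<k + Suc n. v i x) = (\<Sum>i<Suc n. v i x) + (\<Sum>i<k. v (Suc n + i) x)" for k
      by blast
    ultimately have "(\<lambda>k. (\<Sum>i<Suc n. v i x) + (\<Sum>i<k. v (Suc n + i) x)) \<longlonglongrightarrow> w x" by simp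
    moreover have "(\<lambda>k. (\<Sum>i<Suc n. v i x) + (\<Sum>i<k. v (Suc n + i) x)) \<longlonglongrightarrow> (\<Sum>i<Suc n. v i x) + w' x"
      by (intro tendsto_intros elim)
    ultimately have "w x = (\<Sum>i<Suc n. v i x) + w' x" by (rule LIMSEQ_unique)
    then show ?case by (simp add: X)
  qed
  have "W (\<lambda>x. (-1) *\<^sub>R w' x) (\<bar>-1\<bar> * (4 * R (Suc n)))"
    by (rule sob_gauge_cmult[OF \<Omega> w'(2)]) (use R[of "Suc n"] in simp)
  from sob_gauge_cong[OF \<Omega> this ae]
  have "W (\<lambda>x. X n x + v n x - w x) (\<bar>-1\<bar> * (4 * R (Suc n)))" .
  then have "W (\<lambda>x. X n x + v n x - w x) (e n)"
    by (rule sob_gauge_mono) (use R[of "Suc n"] p in \<open>auto simp: stS min_def\<close>)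
  then show False using v(3)[OF Qw] by blast
qed

text \<open>The successive-approximation half of the open mapping theorem. Differences turn density
  in a ball about \<open>x0\<close> into density in a ball about 0 (\<open>d1\<close>); rescaling
  approximates v of gauge t up to t/4 by something that extends with gauge C * t
  (\<open>d2\<close>). Iterating on the error, the extensions form a series of ratio 1/4, which
  converges in the Sobolev space of Z.\<close>

lemma uniform_extension: "\<exists>C>0. \<forall>u. W u 1 \<longrightarrow> Q u C"
proof -
  obtain n :: nat and x0 r where r: "0 < r" and
    d: "\<And>v e. W v r \<Longrightarrow> 0 < e \<Longrightarrow> \<exists>a. Q a (real n) \<and> W (\<lambda>x. x0 x + v x - a x) e"
    using dense_in_ball by blast
  \<comment> \<open>4 * n / r is the cost of \<open>d1\<close> after rescaling from gauge r; adding
    1 keeps it positive.\<close>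
  define C where "C = 4 * real n / r + 1"
  have C: "0 < C" using r by (simp add: C_def add_nonneg_pos)
  have d1: "\<exists>a. Q a (4 * real n) \<and> W (\<lambda>x. v x - a x) e" if v: "W v r" and e: "0 < e" for v e
  proof -
    obtain a1 where a1: "Q a1 (real n)" "W (\<lambda>x. x0 x + v x - a1 x) (e/4)" using d[OF v, of "e/4"] e by auto
    obtain a2 where a2: "Q a2 (real n)" "W (\<lambda>x. x0 x + 0 - a2 x) (e/4)" using d[OF sob_gauge_zero[OF \<Omega> p], of "e/4"] e by auto
    have "W (\<lambda>x. (x0 x + v x - a1 x) - (x0 x + 0 - a2 x)) (4 * max (e/4) (e/4))"
      by (rule sob_gauge_diff[OF \<Omega> p a1(2) a2(2)]) (use e in auto)
    then have "W (\<lambda>x. v x - (a1 x - a2 x)) e" by (simp add: algebra_simps)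
    moreover have "Q (\<lambda>x. a1 x - a2 x) (4 * real n)" using Q_diff[OF a1(1) a2(1)] by simp
    ultimately show ?thesis by blast
  qed
  have d2: "\<exists>a. Q a (C * t) \<and> W (\<lambda>x. v x - a x) (t / 4)" if v: "W v t" and t: "0 < t" for v t
  proof -
    have "W (\<lambda>x. (r/t) *\<^sub>R v x) r" using sob_gauge_cmult[OF \<Omega> v, of "r/t"] r t by simp
    then obtain a where a: "Q a (4 * real n)" "W (\<lambda>x. (r/t) *\<^sub>R v x - a x) (r / 4)" using d1[of _ "r/4"] r by force
    have "Q (\<lambda>x. (t/r) *\<^sub>R a x) (t/r * (4 * real n))" using Q_cmult[OF a(1), of "t/r"] r t by simp
    then have 1: "Q (\<lambda>x. (t/r) *\<^sub>R a x) (C * t)"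
      by (rule Q_mono) (use r t in \<open>auto simp: C_def field_simps\<close>)
    have "W (\<lambda>x. (t/r) *\<^sub>R ((r/t) *\<^sub>R v x - a x)) (\<bar>t/r\<bar> * (r/4))"
      by (rule sob_gauge_cmult[OF \<Omega> a(2)]) (use r in simp)
    then have "W (\<lambda>x. v x - (t/r) *\<^sub>R a x) (t / 4)" using r t by (simp add: scaleR_diff_right)
    with 1 show ?thesis by blast
  qed
  then obtain f where f: "\<And>v t. W v t \<Longrightarrow> 0 < t \<Longrightarrow> Q (f v t) (C * t) \<and> W (\<lambda>x. v x - f v t x) (t / 4)"
    by metis
  have "Q u (4 * C)" if u: "W u 1" for u
  proof -
    define v where "v = rec_nat u (\<lambda>k v. (\<lambda>x. v x - f v ((1/4) ^ k) x))"
    have v0: "v 0 = u" and vS: "v (Suc k) = (\<lambda>x. v k x - f (v k) ((1/4) ^ k) x)" for k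
      by (simp_all add: v_def)
    have Wv: "W (v k) ((1/4) ^ k)" for k
    proof (induction k)
      case (Suc k)
      then show ?case using f[OF Suc] by (simp add: vS)
    qed (simp add: v0 u)
    define a where "a k = f (v k) ((1/4) ^ k)" for k
    have "Q (a k) (C * (1/4) ^ k)" for k using f[OF Wv[of k]] by (simp add: a_def)
    then obtain h where h: "\<And>k. sob_gauge p UNIV (h k) (C * (1/4) ^ k)" "\<And>k. AE x in measure_on \<mu> \<Omega>. h k x = a k x"
      unfolding Q_def by metis
    obtain H where H: "AE x in measure_on \<mu> UNIV. (\<lambda>n. \<Sum>i<n. h i x) \<longlonglongrightarrow> H x" "sob_gauge p UNIV H (4 * C)"
      by (rule sob_gauge_series[OF UNIV_M p less_imp_le[OF C] h(1)]) (rule that)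
    have H1: "AE x in measure_on \<mu> \<Omega>. (\<lambda>n. \<Sum>i<n. h i x) \<longlonglongrightarrow> H x"
      using H(1) unfolding AE_on_iff[OF \<Omega>] AE_on_iff[OF UNIV_M] by eventually_elim simp
    have "W (v k) (1 * (1/4) ^ k)" for k using Wv[of k] by simp
    then obtain z where z: "AE x in measure_on \<mu> \<Omega>. (\<lambda>n. \<Sum>i<n. v i x) \<longlonglongrightarrow> z x"
      by (rule sob_gauge_series[OF \<Omega> p zero_le_one]) (rule that)
    have "AE x in measure_on \<mu> \<Omega>. \<forall>k. h k x = a k x" using h(2) by (simp add: AE_all_countable)
    with H1 z have "AE x in measure_on \<mu> \<Omega>. H x = u x"
    proof eventually_elim
      case (elim x)
      have "(\<Sum>i<n. a i x) = u x - v n x" for n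
        by (induction n) (simp_all add: v0 vS a_def)
      then have "(\<lambda>n. u x - v n x) \<longlonglongrightarrow> H x" using elim by simp
      moreover have "summable (\<lambda>n. v n x)" using elim(2) by (auto simp: sums_def summable_def)
      then have "(\<lambda>n. u x - v n x) \<longlonglongrightarrow> u x - 0" by (intro tendsto_intros summable_LIMSEQ_zero)
      ultimately show ?case using LIMSEQ_unique by force
    qed
    then show ?thesis unfolding Q_def using H(2) by blast
  qed
  then show ?thesis using C by (intro exI[of _ "4 * C"]) auto
qed

end

section \<open>Maximal functions\<close>

lemma ennreal_divide_mult_self: "b \<noteq> 0 \<Longrightarrow> b \<noteq> top \<Longrightarrow> a / b * b = (a :: ennreal)"
  by (simp add: mult.commute[of _ b] ennreal_times_divide) (simp add: mult.commute[of b] ennreal_mult_divide_eq)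

text \<open>Sum over all integers. The enumeration \<open>int_decode\<close> is immaterial for
  nonnegative terms: \<open>isum_ge_sum\<close> and \<open>isum_le\<close> characterise the value
  through finite subsets.\<close>

definition isum :: "(int \<Rightarrow> ennreal) \<Rightarrow> ennreal" where
  "isum g = (\<Sum>n. g (int_decode n))"

lemma isum_ge_sum: "finite F \<Longrightarrow> sum g F \<le> isum g"
proof -
  assume F: "finite F"
  have "sum g F = (\<Sum>n\<in>int_encode ` F. g (int_decode n))"
    by (subst sum.reindex) (auto intro: inj_on_subset[OF inj_int_encode])
  also have "\<dots> \<le> isum g" unfolding isum_def using F by (intro sum_le_suminf) auto
  finally show ?thesis .
qed

lemma isum_ge: "g j \<le> isum g"
  using isum_ge_sum[of "{j}" g] by simp

lemma isum_le:
  assumes "\<And>F. finite F \<Longrightarrow> sum g F \<le> C"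
  shows "isum g \<le> C"
  unfolding isum_def
proof (rule suminf_le_const)
  fix n
  have "(\<Sum>i<n. g (int_decode i)) = sum g (int_decode ` {..<n})"
    by (subst sum.reindex) (auto intro: inj_on_subset[OF inj_int_decode])
  then show "(\<Sum>i<n. g (int_decode i)) \<le> C" using assms by simp
qed simp

lemma isum_mono: "(\<And>j. f j \<le> g j) \<Longrightarrow> isum f \<le> isum g"
  unfolding isum_def by (intro suminf_le) auto

lemma isum_cmult: "isum (\<lambda>j. a * g j) = a * isum g"
  unfolding isum_def by (rule ennreal_suminf_cmult)

lemma isum_add: "isum (\<lambda>j. f j + g j) = isum f + isum g"
  unfolding isum_def by (rule suminf_add[symmetric]) auto

lemma nn_integral_isum:
  assumes "\<And>j. f j \<in> borel_measurable M"
  shows "(\<integral>\<^sup>+x. isum (\<lambda>j. f j x) \<partial>M) = isum (\<lambda>j. \<integral>\<^sup>+x. f j x \<partial>M)"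
  unfolding isum_def using assms by (intro nn_integral_suminf)

lemma sum_int_geometric:
  assumes F: "finite F" "\<And>j. j \<in> F \<Longrightarrow> j \<le> J" and q: "0 < q"
  shows "(\<Sum>j\<in>F. 2 powr (real_of_int j * q)) \<le> 2 powr (real_of_int J * q) * (1 / (1 - 2 powr - q))"
proof -
  define r where "r = (2::real) powr - q"
  have r: "0 < r" "r < 1" using q powr_less_mono[of "-q" 0 2] by (auto simp: r_def)
  have "(\<Sum>j\<in>F. 2 powr (real_of_int j * q)) = (\<Sum>j\<in>F. 2 powr (real_of_int J * q) * r ^ nat (J - j))"
  proof (intro sum.cong refl)
    fix j assume "j \<in> F"
    then have "real (nat (J - j)) = real_of_int J - real_of_int j" using F(2) by fastforce
    then have "2 powr (real_of_int J * q) * r ^ nat (J - j) = 2 powr (real_of_int J * q + - q * (real_of_int J - real_of_int j))"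
      by (simp add: r_def powr_add[symmetric] powr_powr flip: powr_realpow)
    also have "real_of_int J * q + - q * (real_of_int J - real_of_int j) = real_of_int j * q"
      by (simp add: algebra_simps)
    finally show "2 powr (real_of_int j * q) = 2 powr (real_of_int J * q) * r ^ nat (J - j)" by simp
  qed
  also have "\<dots> = 2 powr (real_of_int J * q) * (\<Sum>n\<in>(\<lambda>j. nat (J - j)) ` F. r ^ n)"
  proof -
    have "inj_on (\<lambda>j. nat (J - j)) F"
    proof (rule inj_onI)
      fix x y assume "x \<in> F" "y \<in> F" "nat (J - x) = nat (J - y)"
      then show "x = y" using F(2)[of x] F(2)[of y] by linarith
    qed
    then show ?thesis unfolding sum_distrib_left[symmetric] by (subst sum.reindex) auto
  qed
  also have "(\<Sum>n\<in>(\<lambda>j. nat (J - j)) ` F. r ^ n) \<le> (\<Sum>n. r ^ n)"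
    using r F(1) by (intro sum_le_suminf summable_geometric) auto
  also have "(\<Sum>n. r ^ n) = 1 / (1 - r)" using r by (intro suminf_geometric) auto
  finally show ?thesis by (simp add: r_def mult_left_mono)
qed

definition geom_const :: "real \<Rightarrow> real" where "geom_const q = 1 / (1 - 2 powr - q)"

lemma geom_const_pos: "0 < q \<Longrightarrow> 0 < geom_const q"
  using powr_less_mono[of "-q" 0 2] by (auto simp: geom_const_def)

definition lev :: "int \<Rightarrow> ennreal" where "lev j = ennreal (2 powr real_of_int j)"

lemma lev_less_ennreal: "0 \<le> w \<Longrightarrow> lev j < ennreal w \<longleftrightarrow> 2 powr real_of_int j < w"
  by (simp add: lev_def ennreal_less_iff)

lemma lev_pos [simp]: "0 < lev j" and lev_finite [simp]: "lev j < top"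
  by (simp_all add: lev_def)

lemma lev_powe: "lev j powe q = ennreal (2 powr (real_of_int j * q))"
  by (simp add: lev_def powe_ennreal powr_powr)

text \<open>One half of the dyadic layer-cake decomposition: the powers 2^(jq) with 2^j < v form a
  geometric series dominated by its largest term. \<open>le_isum_geom\<close> is the other
  half.\<close>

lemma isum_geom_le:
  assumes q: "0 < q"
  shows "isum (\<lambda>j. lev j powe q * of_bool (lev j < v)) \<le> ennreal (geom_const q) * v powe q"
proof (cases v)
  case (real w)
  show ?thesis
  proof (cases "w = 0")
    case True
    then show ?thesis using real by (simp add: isum_def)
  next
    case False
    then have w: "0 < w" using real by simp
    \<comment> \<open>The largest j with 2^j < w; rounding up and subtracting 1 respects the strict
      inequality when w is a power of 2.\<close>
    define J where "J = \<lceil>log 2 w\<rceil> - 1"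
    have J: "j \<le> J \<and> 2 powr real_of_int j \<le> w" if "lev j < v" for j
    proof -
      have "2 powr real_of_int j < w" using that real by (simp add: lev_less_ennreal)
      then have "real_of_int j < log 2 w" using w by (simp add: less_log_iff)
      then show ?thesis using \<open>2 powr real_of_int j < w\<close> unfolding J_def by linarith
    qed
    have "real_of_int J \<le> log 2 w" unfolding J_def by linarith
    then have "2 powr real_of_int J \<le> w" using w by (simp add: le_log_iff)
    then have Jw: "2 powr (real_of_int J * q) \<le> w powr q"
      using q powr_mono2[of q "2 powr real_of_int J" w] by (simp add: powr_powr)
    show ?thesis
    proof (rule isum_le)
      fix F :: "int set" assume F: "finite F"
      have "(\<Sum>j\<in>F. lev j powe q * of_bool (lev j < v)) = (\<Sum>j\<in>{j\<in>F. lev j < v}. lev j powe q)"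
        using F by (intro sum.mono_neutral_cong_right) auto
      also have "\<dots> = ennreal (\<Sum>j\<in>{j\<in>F. lev j < v}. 2 powr (real_of_int j * q))"
        by (simp add: lev_powe sum_ennreal)
      also have "\<dots> \<le> ennreal (2 powr (real_of_int J * q) * (1 / (1 - 2 powr - q)))"
        using F J q by (intro ennreal_leI sum_int_geometric) auto
      also have "\<dots> \<le> ennreal (w powr q * geom_const q)"
        using Jw geom_const_pos[OF q] by (intro ennreal_leI) (auto simp: geom_const_def[symmetric] intro!: mult_right_mono)
      also have "\<dots> = ennreal (geom_const q) * v powe q"
        using geom_const_pos[OF q] w by (simp add: real powe_ennreal ennreal_mult[symmetric] mult.commute)
      finally show "(\<Sum>j\<in>F. lev j powe q * of_bool (lev j < v)) \<le> ennreal (geom_const q) * v powe q" .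
    qed
  qed
next
  case top
  then show ?thesis using geom_const_pos[OF q] by (simp add: ennreal_mult_top)
qed

text \<open>For finite positive v the top level alone suffices: 2^j < v <= 2^(j+1). For infinite v
  the terms are unbounded.\<close>

lemma le_isum_geom:
  assumes q: "0 < q"
  shows "v powe q \<le> isum (\<lambda>j. lev (j + 1) powe q * of_bool (lev j < v))"
proof (cases v)
  case (real w)
  show ?thesis
  proof (cases "w = 0")
    case False
    then have w: "0 < w" using real by simp
    define j where "j = \<lceil>log 2 w\<rceil> - 1"
    have "real_of_int j < log 2 w" "log 2 w \<le> real_of_int (j + 1)" unfolding j_def by linarith+
    then have j: "2 powr real_of_int j < w" "w \<le> 2 powr real_of_int (j + 1)"
      using w by (simp_all add: less_log_iff log_le_iff)
    have "v powe q \<le> lev (j + 1) powe q"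
      using j(2) real q by (intro powe_mono) (auto simp: lev_def intro: ennreal_leI)
    also have "\<dots> = lev (j + 1) powe q * of_bool (lev j < v)"
      using j(1) real by (simp add: lev_less_ennreal)
    also have "\<dots> \<le> isum (\<lambda>j. lev (j + 1) powe q * of_bool (lev j < v))"
      by (rule isum_ge)
    finally show ?thesis .
  qed (use real in simp)
next
  case top
  let ?S = "isum (\<lambda>j. lev (j + 1) powe q * of_bool (lev j < v))"
  have "?S = top"
  proof (rule ccontr)
    assume "?S \<noteq> top"
    then obtain s where s: "?S = ennreal s" "0 \<le> s" by (cases ?S) auto
    obtain j :: int where j: "log 2 (s + 1) / q < real_of_int j" using ex_less_of_int by blast
    then have "log 2 (s + 1) < (real_of_int j + 1) * q" using q by (simp add: field_simps)
    then have "s + 1 < 2 powr (real_of_int (j + 1) * q)" using s by (simp add: log_less_iff)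
    moreover have "lev (j + 1) powe q * of_bool (lev j < v) \<le> ?S" by (rule isum_ge)
    ultimately show False using s by (simp add: top lev_powe)
  qed
  then show ?thesis by simp
qed

section \<open>Covering by balls and the maximal theorem\<close>

locale doubling_mms = metric_measure \<mu> for \<mu> :: "'a::polish_space set \<Rightarrow> ennreal" +
  fixes c :: real
  assumes c: "1 \<le> c" and dbl0: "\<And>x r. 0 < r \<Longrightarrow> \<mu> (ball x (2 * r)) \<le> ennreal c * \<mu> (ball x r)"
begin

lemma dbl: "emeasure M (ball x (2 * r)) \<le> ennreal c * emeasure M (ball x r)"
  using dbl0[of r x] by (cases "0 < r") (auto simp: emeasure_M ball_empty)

lemma dbl_pow: "emeasure M (ball x (2 ^ n * r)) \<le> ennreal (c ^ n) * emeasure M (ball x r)"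
proof (induction n)
  case (Suc n)
  have "emeasure M (ball x (2 ^ Suc n * r)) \<le> ennreal c * emeasure M (ball x (2 ^ n * r))"
    using dbl[of x "2 ^ n * r"] by (simp add: mult.assoc)
  also have "\<dots> \<le> ennreal c * (ennreal (c ^ n) * emeasure M (ball x r))"
    using Suc by (rule mult_left_mono) simp
  also have "\<dots> = ennreal (c ^ Suc n) * emeasure M (ball x r)"
    using c by (simp add: ennreal_mult mult.assoc)
  finally show ?case .
qed simp

lemma ball_compare:
  assumes "dist x y + r \<le> 2 ^ n * s"
  shows "emeasure M (ball x r) \<le> ennreal (c ^ n) * emeasure M (ball y s)"
proof -
  have "ball x r \<subseteq> ball y (2 ^ n * s)"
  proof
    fix z assume "z \<in> ball x r"
    then show "z \<in> ball y (2 ^ n * s)"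
      using assms dist_triangle[of y z x] by (simp add: dist_commute)
  qed
  then have "emeasure M (ball x r) \<le> emeasure M (ball y (2 ^ n * s))"
    by (intro emeasure_mono) auto
  also note dbl_pow
  finally show ?thesis .
qed

definition avg :: "('a \<Rightarrow> ennreal) \<Rightarrow> 'a \<Rightarrow> real \<Rightarrow> ennreal" where
  "avg f z r = (\<integral>\<^sup>+y\<in>ball z r. f y \<partial>M) / emeasure M (ball z r)"

text \<open>The uncentred Hardy-Littlewood maximal function. Uncentred, because its level sets are
  then unions of open balls, and because an average over one ball bounds \<open>mf\<close> from
  below at every point of that ball (used in \<open>V_local\<close>).\<close>

definition mf :: "('a \<Rightarrow> ennreal) \<Rightarrow> 'a \<Rightarrow> ennreal" where
  "mf f x = (SUP (z, r)\<in>{(z, r). dist z x < r}. avg f z r)"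

lemma avg_le_mf: "dist z x < r \<Longrightarrow> avg f z r \<le> mf f x"
  unfolding mf_def by (intro SUP_upper2[of "(z, r)"]) auto

lemma less_mf_iff: "t < mf f x \<longleftrightarrow> (\<exists>z r. dist z x < r \<and> t < avg f z r)"
  by (auto simp: mf_def less_SUP_iff)

lemma mf_level_eq: "{x. t < mf f x} = (\<Union>(z, r)\<in>{(z, r). 0 < r \<and> t < avg f z r}. ball z r)"
proof -
  have "dist z x < r \<Longrightarrow> 0 < r" for z x :: 'a and r using zero_le_dist[of z x] by linarith
  then show ?thesis by (fastforce simp: less_mf_iff)
qed

lemma open_mf_level: "open {x. t < mf f x}"
  unfolding mf_level_eq by auto

lemma mf_measurable [measurable]: "mf f \<in> borel_measurable borel"
  by (rule borel_measurableI_greater) (use open_mf_level in auto)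

lemma integral_le_avg:
  assumes "0 < r" "avg f z r \<le> t"
  shows "(\<integral>\<^sup>+y\<in>ball z r. f y \<partial>M) \<le> t * emeasure M (ball z r)"
proof -
  let ?b = "emeasure M (ball z r)"
  have b: "?b \<noteq> 0" "?b \<noteq> top" using ball_emeasure(1)[of r z] ball_emeasure(2)[of z r] assms(1) by auto
  have "(\<integral>\<^sup>+y\<in>ball z r. f y \<partial>M) = avg f z r * ?b"
    unfolding avg_def using b by (simp add: ennreal_divide_mult_self)
  also have "\<dots> \<le> t * ?b" using assms(2) by (rule mult_right_mono) simp
  finally show ?thesis .
qed

text \<open>Greedy choice: keep a ball of largest radius, drop all balls meeting it, since they lie
  in its triple, and continue with the remaining ones.\<close>

lemma finite_vitali:
  assumes "finite I" "\<And>z r. (z, r) \<in> I \<Longrightarrow> 0 < r"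
  shows "\<exists>J\<subseteq>I. disjoint_family_on (\<lambda>(z, r). ball z r :: 'a set) J \<and>
    (\<Union>(z, r)\<in>I. ball z r) \<subseteq> (\<Union>(z, r)\<in>J. ball z (3 * r))"
  using assms
proof (induction I rule: finite_psubset_induct)
  case (psubset I)
  show ?case
  proof (cases "I = {}")
    case False
    obtain z0 r0 where j: "(z0, r0) \<in> I" "\<And>z r. (z, r) \<in> I \<Longrightarrow> r \<le> r0"
    proof -
      have "Max (snd ` I) \<in> snd ` I" using psubset(1) False by (intro Max_in) auto
      then obtain i where "i \<in> I" "Max (snd ` I) = snd i" by blast
      moreover have "r \<le> Max (snd ` I)" if "(z, r) \<in> I" for z r
        using psubset(1) that by (intro Max_ge) force+
      ultimately show ?thesis using that[of "fst i" "snd i"] by auto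
    qed
    define I' where "I' = {(z, r)\<in>I. ball z r \<inter> ball z0 r0 = {}}"
    have "(z0, r0) \<notin> I'" using psubset(3)[OF j(1)] by (auto simp: I'_def)
    moreover have "I' \<subseteq> I" by (auto simp: I'_def)
    ultimately have "I' \<subset> I" using j(1) by blast
    have pos: "0 < r" if "(z, r) \<in> I'" for z r using that psubset(3) by (auto simp: I'_def)
    have "\<exists>J\<subseteq>I'. disjoint_family_on (\<lambda>(z, r). ball z r) J \<and> (\<Union>(z, r)\<in>I'. ball z r) \<subseteq> (\<Union>(z, r)\<in>J. ball z (3 * r))"
      by (rule psubset(2)[OF \<open>I' \<subset> I\<close>]) (rule pos)
    then obtain J where J: "J \<subseteq> I'" "disjoint_family_on (\<lambda>(z, r). ball z r) J"
      "(\<Union>(z, r)\<in>I'. ball z r) \<subseteq> (\<Union>(z, r)\<in>J. ball z (3 * r))"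
      by (elim exE conjE) (rule that)
    have "disjoint_family_on (\<lambda>(z, r). ball z r) (insert (z0, r0) J)"
      using J(1,2) unfolding disjoint_family_on_def I'_def by fast
    moreover have "ball z r \<subseteq> (\<Union>(z, r)\<in>insert (z0, r0) J. ball z (3 * r))" if zI: "(z, r) \<in> I" for z r
    proof (cases "(z, r) \<in> I'")
      case True
      then show ?thesis using J(3) by blast
    next
      case False
      then obtain w where w: "dist z w < r" "dist z0 w < r0" using zI by (auto simp: I'_def)
      have "ball z r \<subseteq> ball z0 (3 * r0)"
      proof
        fix y assume "y \<in> ball z r"
        then have "dist z y < r" by simp
        then show "y \<in> ball z0 (3 * r0)"
          using w j(2)[OF zI] dist_triangle[of z0 y w] dist_triangle[of w y z] by (simp add: dist_commute)
      qed
      then show ?thesis by auto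
    qed
    ultimately show ?thesis
      using J(1) j(1) by (intro exI[of _ "insert (z0, r0) J"]) (auto simp: I'_def)
  qed (auto simp: disjoint_family_on_def)
qed

text \<open>On finitely many balls with large average, pass to disjoint ones by
  \<open>finite_vitali\<close>; tripling costs c^2 because 3 <= 2^2. By the Lindelof property the
  level set is an increasing union of such finite unions.\<close>

lemma weak_type:
  assumes f[measurable]: "f \<in> borel_measurable M" and t: "0 < t" "t < top"
  shows "t * emeasure M {x. t < mf f x} \<le> ennreal (c ^ 2) * (\<integral>\<^sup>+x. f x \<partial>M)"
proof -
  define B where "B = {(z, r). 0 < r \<and> t < avg f z r}"
  have bound: "t * emeasure M (\<Union>(z, r)\<in>I. ball z r) \<le> ennreal (c ^ 2) * (\<integral>\<^sup>+x. f x \<partial>M)"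
    if I: "finite I" "I \<subseteq> B" for I
  proof -
    obtain J where J: "J \<subseteq> I" "disjoint_family_on (\<lambda>(z, r). ball z r) J"
      "(\<Union>(z, r)\<in>I. ball z r) \<subseteq> (\<Union>(z, r)\<in>J. ball z (3 * r))"
      using finite_vitali[OF I(1)] I(2) by (auto simp: B_def)
    have fJ: "finite J" using J(1) I(1) by (rule finite_subset)
    have "t * emeasure M (\<Union>(z, r)\<in>I. ball z r) \<le> t * emeasure M (\<Union>j\<in>J. ball (fst j) (3 * snd j))"
      using J(3) fJ by (intro mult_left_mono emeasure_mono sets.finite_UN) (auto simp: split_beta)
    also have "\<dots> \<le> t * (\<Sum>j\<in>J. emeasure M (ball (fst j) (3 * snd j)))"
      by (intro mult_left_mono emeasure_subadditive_finite fJ) auto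
    also have "\<dots> = (\<Sum>j\<in>J. t * emeasure M (ball (fst j) (3 * snd j)))"
      by (rule sum_distrib_left)
    also have "\<dots> \<le> (\<Sum>j\<in>J. ennreal (c ^ 2) * (\<integral>\<^sup>+y\<in>ball (fst j) (snd j). f y \<partial>M))"
    proof (rule sum_mono)
      fix j assume "j \<in> J"
      then have j: "0 < snd j" "t < avg f (fst j) (snd j)" using J(1) I(2) by (auto simp: B_def)
      have "emeasure M (ball (fst j) (3 * snd j)) \<le> ennreal (c ^ 2) * emeasure M (ball (fst j) (snd j))"
        using j(1) by (intro ball_compare) auto
      moreover have "t * emeasure M (ball (fst j) (snd j)) \<le> (\<integral>\<^sup>+y\<in>ball (fst j) (snd j). f y \<partial>M)"
      proof -
        let ?b = "emeasure M (ball (fst j) (snd j))"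
        have b: "?b \<noteq> 0" "?b \<noteq> top" using ball_emeasure(1)[of "snd j" "fst j"] ball_emeasure(2)[of "fst j" "snd j"] j(1) by auto
        have "t * ?b \<le> avg f (fst j) (snd j) * ?b" using j(2) by (intro mult_right_mono) auto
        also have "\<dots> = (\<integral>\<^sup>+y\<in>ball (fst j) (snd j). f y \<partial>M)"
          unfolding avg_def using b by (simp add: ennreal_divide_mult_self)
        finally show ?thesis .
      qed
      ultimately have "t * emeasure M (ball (fst j) (3 * snd j)) \<le> t * (ennreal (c ^ 2) * emeasure M (ball (fst j) (snd j)))"
        by (intro mult_left_mono) auto
      also have "\<dots> = ennreal (c ^ 2) * (t * emeasure M (ball (fst j) (snd j)))"
        by (simp add: mult.left_commute)
      also have "\<dots> \<le> ennreal (c ^ 2) * (\<integral>\<^sup>+y\<in>ball (fst j) (snd j). f y \<partial>M)"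
        by (rule mult_left_mono) (fact, simp)
      finally show "t * emeasure M (ball (fst j) (3 * snd j)) \<le> ennreal (c ^ 2) * (\<integral>\<^sup>+y\<in>ball (fst j) (snd j). f y \<partial>M)" .
    qed
    also have "\<dots> = ennreal (c ^ 2) * (\<integral>\<^sup>+x. (\<Sum>j\<in>J. f x * indicator (ball (fst j) (snd j)) x) \<partial>M)"
      by (subst nn_integral_sum) (auto simp: sum_distrib_left)
    also have "\<dots> \<le> ennreal (c ^ 2) * (\<integral>\<^sup>+x. f x \<partial>M)"
    proof (intro mult_left_mono nn_integral_mono)
      fix x
      have "(\<Sum>j\<in>J. indicator (ball (fst j) (snd j)) x :: ennreal) = indicator (\<Union>j\<in>J. ball (fst j) (snd j)) x"
        using J(2) by (intro indicator_UN_disjoint[symmetric] fJ) (simp add: case_prod_unfold)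
      then show "(\<Sum>j\<in>J. f x * indicator (ball (fst j) (snd j)) x) \<le> f x"
        by (simp add: sum_distrib_left[symmetric] indicator_def)
    qed simp
    finally show ?thesis .
  qed
  define \<F> where "\<F> = (\<lambda>(z, r). ball z r) ` B"
  obtain \<F>' where F': "\<F>' \<subseteq> \<F>" "countable \<F>'" "\<Union>\<F>' = \<Union>\<F>"
    using Lindelof[of \<F>] unfolding \<F>_def by (auto simp: split_beta)
  have U: "{x. t < mf f x} = \<Union>\<F>'"
    unfolding F'(3) mf_level_eq \<F>_def B_def by simp
  show ?thesis
  proof (cases "\<F>' = {}")
    case False
    then have rng: "range (from_nat_into \<F>') = \<F>'" using F'(2) by (intro range_from_nat_into)
    define V where "V n = (\<Union>i<n. from_nat_into \<F>' i)" for n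
    have "(\<Union>n. V n) = \<Union>(range (from_nat_into \<F>'))"
      unfolding V_def by (auto simp: Bex_def intro: lessI)
    then have "(\<Union>n. V n) = \<Union>\<F>'" unfolding rng .
    moreover have "incseq V" unfolding V_def by (intro incseq_SucI UN_mono) auto
    moreover have Vo: "open (V n)" for n
    proof -
      have "open X" if "X \<in> \<F>" for X using that by (auto simp: \<F>_def)
      then show ?thesis unfolding V_def using from_nat_into[OF False] F'(1) by (intro open_UN) blast
    qed
    ultimately have "emeasure M {x. t < mf f x} = (SUP n. emeasure M (V n))"
      unfolding U using SUP_emeasure_incseq[of V M] open_M by (simp add: image_subset_iff)
    moreover have "t * emeasure M (V n) \<le> ennreal (c ^ 2) * (\<integral>\<^sup>+x. f x \<partial>M)" for n
    proof -
      have "from_nat_into \<F>' i \<in> (\<lambda>(z, r). ball z r) ` B" for i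
        using subsetD[OF F'(1) from_nat_into[OF False]] by (simp only: \<F>_def)
      then have "\<exists>b. b \<in> B \<and> from_nat_into \<F>' i = (\<lambda>(z, r). ball z r) b" for i
        by (simp add: image_iff Bex_def)
      then obtain b where b: "\<And>i. b i \<in> B" "\<And>i. from_nat_into \<F>' i = (\<lambda>(z, r). ball z r) (b i)" by metis
      have "V n = (\<Union>(z, r)\<in>b ` {..<n}. ball z r)" unfolding V_def b(2) by auto
      then show ?thesis using bound[of "b ` {..<n}"] b(1) by auto
    qed
    ultimately show ?thesis by (simp add: SUP_mult_left_ennreal SUP_least)
  qed (simp add: U)
qed

text \<open>Allows the bounded part of a function to be moved into the threshold, so that the
  weak-type bound is applied to its large part only.\<close>

lemma mf_mono_add:
  assumes [measurable]: "f \<in> borel_measurable M" "g \<in> borel_measurable M" and le: "\<And>y. f y \<le> g y + a"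
  shows "mf f x \<le> mf g x + a"
  unfolding mf_def[of f]
proof (rule SUP_least, clarify)
  fix z r assume zx: "dist z x < r"
  let ?b = "emeasure M (ball z r)"
  have "0 < r" using zx zero_le_dist[of z x] by linarith
  then have b: "?b \<noteq> 0" "?b \<noteq> top" using ball_emeasure(1)[of r z] ball_emeasure(2)[of z r] by auto
  have "(\<integral>\<^sup>+y\<in>ball z r. f y \<partial>M) \<le> (\<integral>\<^sup>+y. g y * indicator (ball z r) y + a * indicator (ball z r) y \<partial>M)"
    using le by (intro nn_integral_mono) (auto split: split_indicator)
  also have "\<dots> = (\<integral>\<^sup>+y\<in>ball z r. g y \<partial>M) + a * ?b"
    by (subst nn_integral_add) (auto simp: nn_integral_cmult)
  finally have "avg f z r \<le> ((\<integral>\<^sup>+y\<in>ball z r. g y \<partial>M) + a * ?b) / ?b"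
    unfolding avg_def by (rule divide_right_mono_ennreal)
  also have "\<dots> = avg g z r + a"
    unfolding avg_def using b by (simp add: add_divide_distrib_ennreal ennreal_mult_divide_eq)
  also have "\<dots> \<le> mf g x + a" by (intro add_right_mono avg_le_mf zx)
  finally show "avg f z r \<le> mf g x + a" .
qed

lemma lev_Suc: "lev (j + 1) = 2 * lev j"
proof -
  have "2 powr real_of_int (j + 1) = 2 * 2 powr real_of_int j" by (simp add: powr_add)
  then show ?thesis by (simp only: lev_def ennreal_mult'[of 2, OF zero_le_numeral]) simp
qed

text \<open>Marcinkiewicz interpolation between L^1 and L^\<infinity>: at level 2^(j+1) only the
  part \<open>h j\<close> of f above 2^j matters. Of the constant, c^2 is the weak-type bound, 4^p
  the passage from level j + 1 to level j - 1, and \<open>geom_const (p - 1)\<close> the sum of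
  2^(j(p-1)) over 2^j < f x, which converges because p > 1.\<close>

lemma strong_type:
  assumes p: "1 < p" and f[measurable]: "f \<in> borel_measurable M"
  shows "(\<integral>\<^sup>+x. mf f x powe p \<partial>M) \<le> ennreal (c ^ 2 * 4 powr p * geom_const (p - 1)) * (\<integral>\<^sup>+x. f x powe p \<partial>M)"
proof -
  note [measurable] = borel_measurable_M[OF mf_measurable]
  define h where "h j x = f x * of_bool (lev j < f x)" for j x
  have [measurable]: "h j \<in> borel_measurable M" for j
    unfolding h_def[abs_def] by measurable
  have *: "lev j * emeasure M {x. lev (j + 1) < mf f x} \<le> ennreal (c ^ 2) * (\<integral>\<^sup>+x. h j x \<partial>M)" for j
  proof -
    have "{x. lev (j + 1) < mf f x} \<subseteq> {x. lev j < mf (h j) x}"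
    proof safe
      fix x assume x: "lev (j + 1) < mf f x"
      have "mf f x \<le> mf (h j) x + lev j"
        by (rule mf_mono_add) (auto simp: h_def)
      show "lev j < mf (h j) x"
      proof (rule ccontr)
        assume "\<not> ?thesis"
        then have "mf (h j) x + lev j \<le> lev j + lev j" by (intro add_right_mono) simp
        with \<open>mf f x \<le> mf (h j) x + lev j\<close> have "mf f x \<le> lev (j + 1)"
          unfolding lev_Suc mult_2 by (rule order_trans)
        with x show False by simp
      qed
    qed
    then have "lev j * emeasure M {x. lev (j + 1) < mf f x} \<le> lev j * emeasure M {x. lev j < mf (h j) x}"
      by (intro mult_left_mono emeasure_mono) (auto intro: open_M open_mf_level)
    also have "\<dots> \<le> ennreal (c ^ 2) * (\<integral>\<^sup>+x. h j x \<partial>M)"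
      by (rule weak_type) auto
    finally show ?thesis .
  qed
  have **: "lev (j + 1) powe p * emeasure M {x. lev j < mf f x} \<le>
      ennreal (c ^ 2 * 4 powr p) * (lev (j - 1) powe (p - 1) * (\<integral>\<^sup>+x. h (j - 1) x \<partial>M))" for j
  proof -
    have "4 powr p * 2 powr (real_of_int (j - 1) * (p - 1)) * 2 powr real_of_int (j - 1) = 2 powr (real_of_int (j + 1) * p)"
    proof -
      have "4 powr p = 2 powr (2 * p)" by (simp add: powr_powr[symmetric])
      then show ?thesis by (simp add: powr_add[symmetric] algebra_simps)
    qed
    then have "lev (j + 1) powe p = ennreal (4 powr p) * lev (j - 1) powe (p - 1) * lev (j - 1)"
      by (simp only: lev_powe, simp add: lev_def ennreal_mult[symmetric])
    then have "lev (j + 1) powe p * emeasure M {x. lev j < mf f x} =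
      ennreal (4 powr p) * lev (j - 1) powe (p - 1) * (lev (j - 1) * emeasure M {x. lev ((j - 1) + 1) < mf f x})"
      by (simp add: mult.assoc)
    also have "\<dots> \<le> ennreal (4 powr p) * lev (j - 1) powe (p - 1) * (ennreal (c ^ 2) * (\<integral>\<^sup>+x. h (j - 1) x \<partial>M))"
      by (intro mult_left_mono *) auto
    also have "\<dots> = ennreal (c ^ 2 * 4 powr p) * (lev (j - 1) powe (p - 1) * (\<integral>\<^sup>+x. h (j - 1) x \<partial>M))"
      by (simp add: ennreal_mult mult_ac)
    finally show ?thesis .
  qed
  have "(\<integral>\<^sup>+x. mf f x powe p \<partial>M) \<le> (\<integral>\<^sup>+x. isum (\<lambda>j. lev (j + 1) powe p * of_bool (lev j < mf f x)) \<partial>M)"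
    using p by (intro nn_integral_mono le_isum_geom) simp
  also have "\<dots> = isum (\<lambda>j. \<integral>\<^sup>+x. lev (j + 1) powe p * of_bool (lev j < mf f x) \<partial>M)"
    by (rule nn_integral_isum) measurable
  also have "\<dots> = isum (\<lambda>j. lev (j + 1) powe p * emeasure M {x. lev j < mf f x})"
  proof (rule arg_cong[where f = isum], rule ext)
    fix j
    have "(\<integral>\<^sup>+x. lev (j + 1) powe p * of_bool (lev j < mf f x) \<partial>M) = (\<integral>\<^sup>+x. lev (j + 1) powe p * indicator {x. lev j < mf f x} x \<partial>M)"
      by (intro nn_integral_cong) (auto split: split_indicator)
    also have "\<dots> = lev (j + 1) powe p * emeasure M {x. lev j < mf f x}"
      by (rule nn_integral_cmult_indicator) (rule open_M[OF open_mf_level])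
    finally show "(\<integral>\<^sup>+x. lev (j + 1) powe p * of_bool (lev j < mf f x) \<partial>M) = lev (j + 1) powe p * emeasure M {x. lev j < mf f x}" .
  qed
  also have "\<dots> \<le> isum (\<lambda>j. ennreal (c ^ 2 * 4 powr p) * (lev (j - 1) powe (p - 1) * (\<integral>\<^sup>+x. h (j - 1) x \<partial>M)))"
    by (rule isum_mono) (rule **)
  also have "\<dots> = ennreal (c ^ 2 * 4 powr p) * isum (\<lambda>j. lev (j - 1) powe (p - 1) * (\<integral>\<^sup>+x. h (j - 1) x \<partial>M))"
    by (rule isum_cmult)
  also have "isum (\<lambda>j. lev (j - 1) powe (p - 1) * (\<integral>\<^sup>+x. h (j - 1) x \<partial>M)) \<le> isum (\<lambda>j. lev j powe (p - 1) * (\<integral>\<^sup>+x. h j x \<partial>M))"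
  proof (rule isum_le)
    fix F :: "int set" assume "finite F"
    have "(\<Sum>j\<in>F. lev (j - 1) powe (p - 1) * (\<integral>\<^sup>+x. h (j - 1) x \<partial>M)) = (\<Sum>j\<in>(\<lambda>j. j - 1) ` F. lev j powe (p - 1) * (\<integral>\<^sup>+x. h j x \<partial>M))"
      by (subst sum.reindex) (auto simp: inj_on_def)
    also have "\<dots> \<le> isum (\<lambda>j. lev j powe (p - 1) * (\<integral>\<^sup>+x. h j x \<partial>M))"
      using \<open>finite F\<close> by (intro isum_ge_sum) simp
    finally show "(\<Sum>j\<in>F. lev (j - 1) powe (p - 1) * (\<integral>\<^sup>+x. h (j - 1) x \<partial>M)) \<le> isum (\<lambda>j. lev j powe (p - 1) * (\<integral>\<^sup>+x. h j x \<partial>M))" .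
  qed
  also have "isum (\<lambda>j. lev j powe (p - 1) * (\<integral>\<^sup>+x. h j x \<partial>M)) = (\<integral>\<^sup>+x. isum (\<lambda>j. lev j powe (p - 1) * h j x) \<partial>M)"
    by (subst nn_integral_isum) (auto simp: nn_integral_cmult)
  also have "\<dots> \<le> (\<integral>\<^sup>+x. ennreal (geom_const (p - 1)) * f x powe p \<partial>M)"
  proof (rule nn_integral_mono)
    fix x
    have "isum (\<lambda>j. lev j powe (p - 1) * h j x) = f x * isum (\<lambda>j. lev j powe (p - 1) * of_bool (lev j < f x))"
      unfolding isum_cmult[symmetric] by (simp add: h_def mult_ac)
    also have "\<dots> \<le> f x * (ennreal (geom_const (p - 1)) * f x powe (p - 1))"
      using p by (intro mult_left_mono isum_geom_le) auto
    also have "\<dots> = ennreal (geom_const (p - 1)) * (f x * f x powe (p - 1))"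
      by (simp add: mult_ac)
    also have "f x * f x powe (p - 1) = f x powe p"
    proof (cases "f x")
      case (real w)
      then have "w * w powr (p - 1) = w powr p" by (cases "w = 0") (simp_all add: powr_mult_base)
      then show ?thesis using real by (simp add: powe_ennreal ennreal_mult[symmetric])
    qed simp
    finally show "isum (\<lambda>j. lev j powe (p - 1) * h j x) \<le> ennreal (geom_const (p - 1)) * f x powe p" .
  qed
  also have "\<dots> = ennreal (geom_const (p - 1)) * (\<integral>\<^sup>+x. f x powe p \<partial>M)"
    by (rule nn_integral_cmult) measurable
  finally show ?thesis
    using geom_const_pos[of "p - 1"] p by (simp add: ennreal_mult mult.assoc mult_left_mono)
qed

end

section \<open>Lebesgue points\<close>

context doubling_mms
begin

abbreviation mean :: "('a \<Rightarrow> real) \<Rightarrow> 'a \<Rightarrow> real \<Rightarrow> real" where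
  "mean u x r \<equiv> mean_value \<mu> (ball x r) u"

definition loc_int :: "('a \<Rightarrow> real) \<Rightarrow> bool" where
  "loc_int u \<longleftrightarrow> (\<forall>x r. integrable (measure_on \<mu> (ball x r)) u)"

lemma finite_measure_ball: "finite_measure (measure_on \<mu> (ball x r))"
  using ball_emeasure(2)[of x r] by (intro finite_measureI) (auto simp: emeasure_restrict_space)

lemma loc_int_bounded_on_balls:
  assumes m: "u \<in> borel_measurable M" and b: "\<And>x r. \<exists>K. \<forall>y\<in>ball x r. \<bar>u y\<bar> \<le> K"
  shows "loc_int u"
  unfolding loc_int_def
proof (intro allI)
  fix x r
  interpret finite_measure "measure_on \<mu> (ball x r)" by (rule finite_measure_ball)
  obtain K where "\<forall>y\<in>ball x r. \<bar>u y\<bar> \<le> K" using b by blast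
  then show "integrable (measure_on \<mu> (ball x r)) u"
    using m by (intro integrable_const_bound[of _ K]) (auto intro: measurable_restrict_space1)
qed

lemma mean_diff:
  assumes u: "loc_int u" and r: "0 < r"
  shows "ennreal \<bar>mean u x r - a\<bar> * emeasure M (ball x r) \<le> (\<integral>\<^sup>+y\<in>ball x r. ennreal \<bar>u y - a\<bar> \<partial>M)"
proof -
  let ?N = "measure_on \<mu> (ball x r)"
  interpret finite_measure ?N by (rule finite_measure_ball)
  have i: "integrable ?N u" using u by (simp add: loc_int_def)
  have sp: "measure ?N (ball x r) = enn2real (\<mu> (ball x r))"
    by (simp add: measure_def emeasure_restrict_space emeasure_M)
  define m where "m = enn2real (\<mu> (ball x r))"
  have em: "emeasure M (ball x r) = ennreal m"
    using ball_emeasure(2)[of x r] by (simp add: m_def emeasure_M)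
  then have m: "0 < m" using ball_emeasure(1)[OF r, of x] by simp
  have "(LINT y|?N. u y - a) = (LINT y|?N. u y) - a * m"
    using i sp by (simp add: m_def)
  also have "\<dots> = (mean u x r - a) * m"
    using m by (simp add: mean_value_def m_def[symmetric] field_simps)
  finally have "\<bar>mean u x r - a\<bar> * m = \<bar>LINT y|?N. u y - a\<bar>"
    using m by (simp add: abs_mult)
  also have "\<dots> \<le> (LINT y|?N. \<bar>u y - a\<bar>)"
    by (rule integral_abs_bound)
  finally have "ennreal (\<bar>mean u x r - a\<bar> * m) \<le> ennreal (LINT y|?N. \<bar>u y - a\<bar>)"
    by (rule ennreal_leI)
  also have "\<dots> = (\<integral>\<^sup>+y. ennreal \<bar>u y - a\<bar> \<partial>?N)"
    using i by (intro nn_integral_eq_integral[symmetric]) auto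
  also have "\<dots> = (\<integral>\<^sup>+y\<in>ball x r. ennreal \<bar>u y - a\<bar> \<partial>M)"
    by (simp add: nn_integral_on)
  finally show ?thesis using m by (simp add: em ennreal_mult)
qed

text \<open>Weaker than the usual notion: only the means have to converge, which is what the
  telescoping in \<open>lipschitz_at_good_points\<close> uses.\<close>

definition leb_point :: "('a \<Rightarrow> real) \<Rightarrow> 'a \<Rightarrow> bool" where
  "leb_point u x \<longleftrightarrow> (\<forall>e>0. \<exists>d>0. \<forall>r. 0 < r \<longrightarrow> r < d \<longrightarrow> \<bar>mean u x r - u x\<bar> \<le> e)"

lemma leb_point_continuous:
  assumes u: "loc_int u" and c: "continuous_on UNIV u"
  shows "leb_point u x"
  unfolding leb_point_def
proof (intro allI impI)
  fix e :: real assume e: "0 < e"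
  then obtain d where d: "0 < d" "\<And>y. dist y x < d \<Longrightarrow> dist (u y) (u x) < e"
    using c unfolding continuous_on_iff by (metis UNIV_I)
  show "\<exists>d>0. \<forall>r. 0 < r \<longrightarrow> r < d \<longrightarrow> \<bar>mean u x r - u x\<bar> \<le> e"
  proof (intro exI[of _ d] conjI allI impI d(1))
    fix r assume r: "0 < r" "r < d"
    have b: "emeasure M (ball x r) \<noteq> 0" "emeasure M (ball x r) \<noteq> top"
      using ball_emeasure(1)[OF r(1), of x] ball_emeasure(2)[of x r] by auto
    have "ennreal \<bar>mean u x r - u x\<bar> * emeasure M (ball x r) \<le> (\<integral>\<^sup>+y\<in>ball x r. ennreal \<bar>u y - u x\<bar> \<partial>M)"
      by (rule mean_diff[OF u r(1)])
    also have "\<dots> \<le> (\<integral>\<^sup>+y. ennreal e * indicator (ball x r) y \<partial>M)"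
    proof (rule nn_integral_mono)
      fix y
      show "ennreal \<bar>u y - u x\<bar> * indicator (ball x r) y \<le> ennreal e * indicator (ball x r) y"
        using d(2)[of y] r by (auto split: split_indicator intro!: ennreal_leI simp: dist_commute[of x] dist_real_def)
    qed
    also have "\<dots> = ennreal e * emeasure M (ball x r)" by (rule nn_integral_cmult_indicator) simp
    finally have "ennreal \<bar>mean u x r - u x\<bar> \<le> ennreal e"
      using b by (metis ennreal_mult_divide_eq divide_right_mono_ennreal)
    then show "\<bar>mean u x r - u x\<bar> \<le> e" using e by simp
  qed
qed

text \<open>Two stages. A Borel hull of the complement within the ball cuts \<open>A\<close> down to
  a Borel subset of full measure; a finite Borel measure on a Polish space is then inner regular
  with respect to compact sets.\<close>

lemma inner_approx:
  assumes A: "A \<in> sets M" "A \<subseteq> ball z n" and e: "0 < e"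
  obtains L where "closed L" "L \<subseteq> A" "emeasure M (A - L) < ennreal e"
proof -
  obtain B where B: "B \<in> sets borel" "ball z n - A \<subseteq> B" "\<mu> B = \<mu> (ball z n - A)"
    using mms unfolding metric_measure_space_def borel_regular_outer_measure_def by blast
  define A' where "A' = ball z n - B"
  have A': "A' \<in> sets borel" "A' \<subseteq> A" using B by (auto simp: A'_def)
  have bM: "B \<in> sets M" using B borel_sets_M by simp
  have cm: "ball z n - A \<in> sets M" using A by auto
  have fin: "emeasure M (ball z n - A) < top"
    using emeasure_mono[of "ball z n - A" "ball z n" M] ball_emeasure(2)[of z n] by (simp add: order.strict_trans1)
  have nul: "emeasure M (A - A') = 0"
  proof -
    have "A - A' \<subseteq> B - (ball z n - A)" using A by (auto simp: A'_def)
    then have "emeasure M (A - A') \<le> emeasure M (B - (ball z n - A))"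
      using bM cm by (intro emeasure_mono) auto
    also have "\<dots> = emeasure M B - emeasure M (ball z n - A)"
      using bM cm B fin by (intro emeasure_Diff) auto
    also have "\<dots> = 0" using B(3) bM cm fin by (simp add: emeasure_M)
    finally show ?thesis by simp
  qed
  \<comment> \<open>Transferred to the Borel sets and cut down to the ball, the measure is finite
    and \<open>inner_regular\<close> applies.\<close>
  define N where "N = density (distr M borel (\<lambda>x. x)) (indicator (ball z n))"
  have idm: "(\<lambda>x. x) \<in> borel_measurable M" by (rule borel_measurable_M) simp
  have sN: "sets N = sets borel" "space N = UNIV" by (auto simp: N_def)
  have eN: "emeasure N X = emeasure M (ball z n \<inter> X)" if "X \<in> sets borel" for X
    unfolding N_def using that
    by (subst emeasure_density) (auto simp: emeasure_distr[OF idm] indicator_inter_arith[symmetric] intro!: borel_measurable_indicator)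
  have "emeasure N (space N) \<noteq> \<infinity>" using ball_emeasure(2)[of z n] by (simp add: sN eN less_top)
  from inner_regular[OF sN(1) this A'(1)]
  have ir: "emeasure N A' = (SUP K\<in>{K. K \<subseteq> A' \<and> compact K}. emeasure N K)" .
  have fA: "emeasure N A' < top"
    using emeasure_mono[of "ball z n \<inter> A'" "ball z n" M] ball_emeasure(2)[of z n] A'(1) borel_sets_M
    by (auto simp: eN elim: order.strict_trans1)
  have "\<exists>K\<subseteq>A'. compact K \<and> emeasure N A' < emeasure N K + ennreal e"
  proof (cases "emeasure N A' < ennreal e")
    case True
    then show ?thesis by (intro exI[of _ "{}"]) auto
  next
    case False
    then have "emeasure N A' - ennreal e < emeasure N A'"
      using fA e by (cases "emeasure N A'") (auto simp: ennreal_minus ennreal_less_iff)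
    then obtain K where "K \<subseteq> A'" "compact K" "emeasure N A' - ennreal e < emeasure N K"
      by (subst (asm) (2) ir) (auto simp: less_SUP_iff)
    then show ?thesis using False fA e
      by (intro exI[of _ K]) (cases "emeasure N A'"; cases "emeasure N K"; auto simp: ennreal_minus ennreal_less_iff simp flip: ennreal_plus)
  qed
  then obtain K where K: "K \<subseteq> A'" "compact K" "emeasure N A' < emeasure N K + ennreal e" by blast
  have Kb: "K \<in> sets borel" "K \<subseteq> ball z n" using K A' A(2) by (auto intro: borel_compact)
  have A'b: "A' \<subseteq> ball z n" by (auto simp: A'_def)
  have MK: "K \<in> sets M" "A' \<in> sets M" using Kb A' borel_sets_M by auto
  have "emeasure M (A - K) \<le> emeasure M ((A - A') \<union> (A' - K))"
    using A MK by (intro emeasure_mono) auto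
  also have "\<dots> \<le> emeasure M (A - A') + emeasure M (A' - K)"
    using A MK by (intro emeasure_subadditive) auto
  also have "\<dots> = emeasure M A' - emeasure M K"
    using MK K(1) order.strict_trans1[OF emeasure_mono[OF Kb(2)] ball_emeasure(2)] by (simp add: nul emeasure_Diff less_top)
  also have "\<dots> < ennreal e"
    using K(3) A'b Kb A'(1) fA e by (cases "emeasure M A'"; cases "emeasure M K")
      (auto simp: eN Int_absorb1 ennreal_minus ennreal_less_iff intro!: ennreal_lessI simp flip: ennreal_plus)
  finally show ?thesis using that[of K] K A'(2) compact_imp_closed by blast
qed

text \<open>Exhaust \<open>ball z n - A\<close> by a closed set \<open>L\<close> up to a remainder
  \<open>D\<close> of measure below e. Small balls about a point of \<open>?X\<close> avoid
  \<open>L\<close>, so there the maximal function of the indicator of \<open>D\<close> exceeds t.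
  The weak-type bound gives t * m <= c^2 * e, contradicting the choice of e. The outer measure is
  used because \<open>?X\<close> is not known to be measurable.\<close>

lemma density_null:
  assumes A: "A \<in> sets M" and t: "0 < t"
  shows "\<mu> {x\<in>A \<inter> ball z n. \<forall>d>0. \<exists>r. 0 < r \<and> r < d \<and> ennreal t * emeasure M (ball x r) < emeasure M (ball x r - A)} = 0"
    (is "\<mu> ?X = 0")
proof (rule ccontr)
  assume "\<mu> ?X \<noteq> 0"
  have "\<mu> ?X \<le> \<mu> (ball z n)" by (rule mu_mono) auto
  then have "\<mu> ?X < top" using ball_emeasure(2)[of z n] by (simp add: emeasure_M order.strict_trans1)
  then obtain m where m: "\<mu> ?X = ennreal m" "0 < m"
    using \<open>\<mu> ?X \<noteq> 0\<close> by (cases "\<mu> ?X") auto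
  define e where "e = t * m / (2 * c ^ 2)"
  have e: "0 < e" using t m c by (simp add: e_def)
  obtain L where L: "closed L" "L \<subseteq> ball z n - A" "emeasure M (ball z n - A - L) < ennreal e"
    by (rule inner_approx[of "ball z n - A" z n, OF _ _ e]) (use A in auto)
  define D where "D = ball z n - A - L"
  have D: "D \<in> sets M" using A borel_sets_M[OF borel_closed[OF L(1)]] by (simp add: D_def sets.Diff)
  have "?X \<subseteq> {x. ennreal t < mf (indicator D) x}"
  proof safe
    fix x assume x: "x \<in> A" "x \<in> ball z n"
      and *: "\<forall>d>0. \<exists>r. 0 < r \<and> r < d \<and> ennreal t * emeasure M (ball x r) < emeasure M (ball x r - A)"
    have "open (ball z n - L)" "x \<in> ball z n - L" using L x by auto
    then obtain d where d: "0 < d" "ball x d \<subseteq> ball z n - L" by (meson open_contains_ball)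
    then obtain r where r: "0 < r" "r < d" "ennreal t * emeasure M (ball x r) < emeasure M (ball x r - A)" using * by blast
    have b: "emeasure M (ball x r) \<noteq> 0" "emeasure M (ball x r) \<noteq> top"
      using ball_emeasure(1)[OF r(1), of x] ball_emeasure(2)[of x r] by auto
    have "ball x r \<subseteq> ball x d" using r by auto
    then have "ball x r - A \<subseteq> D \<inter> ball x r" using d(2) by (auto simp: D_def)
    then have "emeasure M (ball x r - A) \<le> emeasure M (D \<inter> ball x r)" using D by (intro emeasure_mono) auto
    also have "\<dots> = (\<integral>\<^sup>+y\<in>ball x r. indicator D y \<partial>M)" using D by (simp flip: indicator_inter_arith)
    finally have "ennreal t * emeasure M (ball x r) < (\<integral>\<^sup>+y\<in>ball x r. indicator D y \<partial>M)" using r(3) by simp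
    then have "ennreal t < avg (indicator D) x r"
      using integral_le_avg[OF r(1), of "indicator D" x "ennreal t"] by (auto simp: not_le[symmetric])
    also have "\<dots> \<le> mf (indicator D) x" by (rule avg_le_mf) (simp add: r)
    finally show "ennreal t < mf (indicator D) x" .
  qed
  then have "ennreal m \<le> emeasure M {x. ennreal t < mf (indicator D) x}"
    unfolding m(1)[symmetric] by (subst emeasure_M) (auto intro!: mu_mono open_M open_mf_level)
  then have "ennreal t * ennreal m \<le> ennreal t * emeasure M {x. ennreal t < mf (indicator D) x}"
    by (rule mult_left_mono) simp
  also have "\<dots> \<le> ennreal (c ^ 2) * (\<integral>\<^sup>+x. indicator D x \<partial>M)"
    using t D by (intro weak_type) auto
  also have "\<dots> \<le> ennreal (c ^ 2) * ennreal e"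
    using L(3) D by (intro mult_left_mono) (auto simp: D_def)
  finally have "t * m \<le> c ^ 2 * e" using t m e c by (simp add: ennreal_mult[symmetric])
  then show False using t m c by (simp add: e_def)
qed

lemma AE_density:
  assumes A: "A \<in> sets M"
  shows "AE x in M. x \<in> A \<longrightarrow> (\<forall>t>0. \<exists>d>0. \<forall>r. 0 < r \<longrightarrow> r < d \<longrightarrow> emeasure M (ball x r - A) \<le> ennreal t * emeasure M (ball x r))"
proof -
  fix z0 :: 'a
  \<comment> \<open>Balls about one point exhaust the space and the thresholds 1/(k+1) tend to 0, so
    countably many null sets contain every failure.\<close>
  define X where "X n k = {x\<in>A \<inter> ball z0 (real n). \<forall>d>0. \<exists>r. 0 < r \<and> r < d \<and>
     ennreal (inverse (real (Suc k))) * emeasure M (ball x r) < emeasure M (ball x r - A)}" for n k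
  have "X n k \<in> null_sets M" for n k
    unfolding X_def by (rule mu_null_set) (rule density_null[OF A], simp)
  then have "AE x in M. \<forall>n k. x \<notin> X n k"
    by (simp add: AE_all_countable AE_not_in)
  then show ?thesis
  proof (eventually_elim, intro impI allI)
    fix x and t :: real assume x: "\<forall>n k. x \<notin> X n k" "x \<in> A" and t: "0 < t"
    obtain n :: nat where "dist z0 x < real n" using reals_Archimedean2 by blast
    obtain k where k: "inverse (real (Suc k)) < t" using reals_Archimedean[OF t] by blast
    have "x \<notin> X n k" using x by blast
    then have "\<not> (\<forall>d>0. \<exists>r. 0 < r \<and> r < d \<and>
        ennreal (inverse (real (Suc k))) * emeasure M (ball x r) < emeasure M (ball x r - A))"
      using x(2) \<open>dist z0 x < real n\<close> unfolding X_def by simp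
    then obtain d where d: "0 < d" "\<forall>r. 0 < r \<and> r < d \<longrightarrow> emeasure M (ball x r - A) \<le> ennreal (inverse (real (Suc k))) * emeasure M (ball x r)"
      unfolding not_less[symmetric] by blast
    have "ennreal (inverse (real (Suc k))) * emeasure M (ball x r) \<le> ennreal t * emeasure M (ball x r)" for r
      using k by (intro mult_right_mono ennreal_leI) auto
    then show "\<exists>d>0. \<forall>r. 0 < r \<longrightarrow> r < d \<longrightarrow> emeasure M (ball x r - A) \<le> ennreal t * emeasure M (ball x r)"
      using d by (meson order_trans)
  qed
qed

text \<open>Almost every x is a density point of each rational band \<open>A q\<close> that contains
  it. Take a band about \<open>u x\<close> of half-width at most e/2: in small balls it misses only
  the proportion t, where u deviates by at most 2 * K, and t is chosen so that 2 * K * t <=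
  e/2.\<close>

lemma AE_leb_point:
  assumes m: "u \<in> borel_measurable M" and b: "\<And>x. \<bar>u x\<bar> \<le> K"
  shows "AE x in M. leb_point u x"
proof -
  have K: "0 \<le> K" using b[of undefined] by linarith
  have li: "loc_int u" by (rule loc_int_bounded_on_balls[OF m]) (use b in blast)
  define A where "A q = {x. of_rat (fst q) < u x \<and> u x < of_rat (snd q)}" for q :: "rat \<times> rat"
  have AM: "A q \<in> sets M" for q
  proof -
    have "A q = u -` {of_rat (fst q)<..<of_rat (snd q)} \<inter> space M" by (auto simp: A_def)
    then show ?thesis using measurable_sets[OF m] by simp
  qed
  have "AE x in M. \<forall>q. x \<in> A q \<longrightarrow> (\<forall>t>0. \<exists>d>0. \<forall>r. 0 < r \<longrightarrow> r < d \<longrightarrow> emeasure M (ball x r - A q) \<le> ennreal t * emeasure M (ball x r))"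
    unfolding AE_all_countable using AE_density[OF AM] by blast
  then show ?thesis
  proof eventually_elim
    case (elim x)
    show ?case unfolding leb_point_def
    proof (intro allI impI)
      fix e :: real assume e: "0 < e"
      obtain q1 q2 where q: "u x - e/2 < of_rat q1" "of_rat q1 < u x" "u x < of_rat q2" "of_rat q2 < u x + e/2"
        using of_rat_dense[of "u x - e/2" "u x"] of_rat_dense[of "u x" "u x + e/2"] e by auto
      define t where "t = e / (4 * (K + 1))"
      have t: "0 < t" using e K by (simp add: t_def)
      define D where "D = A (q1, q2)"
      have "x \<in> D" using q by (simp add: D_def A_def)
      then obtain d where d: "0 < d" "\<And>r. 0 < r \<Longrightarrow> r < d \<Longrightarrow> emeasure M (ball x r - D) \<le> ennreal t * emeasure M (ball x r)"
        using elim t unfolding D_def by blast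
      have De: "\<bar>u y - u x\<bar> \<le> e / 2" if "y \<in> D" for y
      proof -
        have "of_rat q1 < u y" "u y < of_rat q2" using that by (simp_all add: D_def A_def)
        with q have "u y - u x \<le> e / 2" "- (u y - u x) \<le> e / 2" by linarith+
        then show ?thesis by (rule abs_leI)
      qed
      have D: "D \<in> sets M" by (simp add: D_def AM)
      show "\<exists>d>0. \<forall>r. 0 < r \<longrightarrow> r < d \<longrightarrow> \<bar>mean u x r - u x\<bar> \<le> e"
      proof (intro exI[of _ d] conjI allI impI d(1))
        fix r assume r: "0 < r" "r < d"
        have bb: "emeasure M (ball x r) \<noteq> 0" "emeasure M (ball x r) \<noteq> top"
          using ball_emeasure(1)[OF r(1), of x] ball_emeasure(2)[of x r] by auto
        have "ennreal \<bar>mean u x r - u x\<bar> * emeasure M (ball x r) \<le> (\<integral>\<^sup>+y\<in>ball x r. ennreal \<bar>u y - u x\<bar> \<partial>M)"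
          by (rule mean_diff[OF li r(1)])
        also have "\<dots> \<le> (\<integral>\<^sup>+y. ennreal (e/2) * indicator (ball x r) y + ennreal (2 * K) * indicator (ball x r - D) y \<partial>M)"
        proof (rule nn_integral_mono)
          fix y
          have "\<bar>u y - u x\<bar> \<le> 2 * K" using b[of x] b[of y] by linarith
          then have "ennreal \<bar>u y - u x\<bar> \<le> ennreal (2 * K)" by (rule ennreal_leI)
          then show "ennreal \<bar>u y - u x\<bar> * indicator (ball x r) y \<le> ennreal (e/2) * indicator (ball x r) y + ennreal (2 * K) * indicator (ball x r - D) y"
            using De[of y] e by (cases "y \<in> D") (auto split: split_indicator intro: ennreal_leI add_increasing)
        qed
        also have "\<dots> = ennreal (e/2) * emeasure M (ball x r) + ennreal (2 * K) * emeasure M (ball x r - D)"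
          using D by (subst nn_integral_add) (auto simp: nn_integral_cmult_indicator)
        also have "\<dots> \<le> ennreal (e/2) * emeasure M (ball x r) + ennreal (2 * K) * (ennreal t * emeasure M (ball x r))"
          by (intro add_left_mono mult_left_mono d r) simp
        also have "\<dots> = ennreal (e/2 + 2 * K * t) * emeasure M (ball x r)"
          using e K t by (simp add: ennreal_mult[symmetric] mult.assoc[symmetric] distrib_right ennreal_plus)
        also have "\<dots> \<le> ennreal e * emeasure M (ball x r)"
        proof -
          have "2 * K * t \<le> e / 2" using e K by (simp add: t_def field_simps)
          then show ?thesis by (intro mult_right_mono ennreal_leI) auto
        qed
        finally have "ennreal \<bar>mean u x r - u x\<bar> \<le> ennreal e"
          using bb by (metis ennreal_mult_divide_eq divide_right_mono_ennreal)
        then show "\<bar>mean u x r - u x\<bar> \<le> e" using e by simp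
      qed
    qed
  qed
qed

end

section \<open>McShane extensions\<close>

lemma mcshane:
  fixes f :: "'a::metric_space \<Rightarrow> real"
  assumes L: "0 \<le> L" and f: "\<And>x y. x \<in> A \<Longrightarrow> y \<in> A \<Longrightarrow> \<bar>f x - f y\<bar> \<le> L * dist x y"
  obtains g where "\<And>x. x \<in> A \<Longrightarrow> g x = f x" "\<And>x y. \<bar>g x - g y\<bar> \<le> L * dist x y"
proof (cases "A = {}")
  case True
  then show ?thesis using that[of "\<lambda>_. 0"] L by simp
next
  case False
  then obtain a where a: "a \<in> A" by blast
  define g where "g x = (INF y\<in>A. f y + L * dist x y)" for x
  have tri: "L * dist x z \<le> L * dist x y + L * dist y z" for x y z
    using mult_left_mono[OF dist_triangle[of x z y] L] by (simp add: distrib_left)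
  have bdd: "bdd_below ((\<lambda>y. f y + L * dist x y) ` A)" for x
  proof (rule bdd_belowI2)
    fix y assume "y \<in> A"
    then show "f a - L * dist x a \<le> f y + L * dist x y"
      using f[OF \<open>y \<in> A\<close> a] tri[of y a x] by (simp add: dist_commute abs_le_iff)
  qed
  have one: "g x \<le> g z + L * dist x z" for x z
  proof -
    have "g x - L * dist x z \<le> f y + L * dist z y" if "y \<in> A" for y
    proof -
      have "g x \<le> f y + L * dist x y" unfolding g_def by (rule cINF_lower[OF bdd that])
      then show ?thesis using tri[of x y z] by linarith
    qed
    then have "g x - L * dist x z \<le> g z"
      unfolding g_def[of z] using False by (intro cINF_greatest) auto
    then show ?thesis by linarith
  qed
  have "g x = f x" if "x \<in> A" for x
  proof (rule antisym)
    show "g x \<le> f x" using cINF_lower[OF bdd that, of x] by (simp add: g_def)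
    show "f x \<le> g x" unfolding g_def
    proof (rule cINF_greatest[OF False])
      fix y assume "y \<in> A"
      then show "f x \<le> f y + L * dist x y" using f[OF that \<open>y \<in> A\<close>] by (simp add: abs_le_iff)
    qed
  qed
  moreover have "\<bar>g x - g y\<bar> \<le> L * dist x y" for x y
    using one[of x y] one[of y x] by (simp add: abs_le_iff dist_commute)
  ultimately show ?thesis using that by blast
qed

text \<open>The path may enter and leave \<open>E\<close> infinitely often, so it cannot be cut into
  finitely many pieces inside and outside. Instead the closed set \<open>K\<close> of parameters
  outside \<open>E\<close> is enlarged to an open \<open>U\<close> carrying at most e more of the
  measure with density r. The inequality with \<open>h\<close> then holds locally, by the Lipschitz
  bound inside \<open>E\<close> and through f near \<open>K\<close>, and
  \<open>local_to_global\<close> finishes it.\<close>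

lemma (in rect_path) glue_along_path:
  fixes f g :: "'a \<Rightarrow> real"
  assumes E: "open E" and C0: "0 \<le> C0" and g: "\<And>x y. \<bar>g x - g y\<bar> \<le> C0 * dist x y" and fg: "\<And>x. x \<notin> E \<Longrightarrow> g x = f x"
    and r: "(\<lambda>x. r x * indicator {a..b} x) \<in> borel_measurable borel" and fin: "(\<integral>\<^sup>+x\<in>{a..b}. r x \<partial>lm) < top"
    and f: "\<And>s t. a \<le> s \<Longrightarrow> s \<le> t \<Longrightarrow> t \<le> b \<Longrightarrow> ennreal \<bar>f (\<gamma> s) - f (\<gamma> t)\<bar> \<le> (\<integral>\<^sup>+x\<in>{s..t}. r x \<partial>lm)"
  shows "ennreal \<bar>g (\<gamma> a) - g (\<gamma> b)\<bar> \<le> (\<integral>\<^sup>+x\<in>{a..b}. r x * indicator (- E) (\<gamma> x) + ennreal C0 * indicator E (\<gamma> x) \<partial>lm)"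
proof (rule ennreal_le_epsilon)
  fix e :: real assume e: "0 < e"
  have paths: "(a, b, \<gamma>) \<in> paths_in UNIV" using ab cont by (simp add: paths_in_def)
  have mE: "(\<lambda>x. indicator X (\<gamma> x) * indicator {a..b} x :: ennreal) \<in> borel_measurable borel" if "X \<in> sets borel" for X
    using that by (intro measurable_along_path[OF _ paths]) auto
  define K where "K = {x\<in>{a..b}. \<gamma> x \<notin> E}"
  have "closedin (top_of_set {a..b}) ({a..b} \<inter> \<gamma> -` (- E))"
    using cont E by (intro continuous_closedin_preimage) auto
  moreover have "{a..b} \<inter> \<gamma> -` (- E) = K" by (auto simp: K_def)
  ultimately have K: "closed K" by (auto intro: closedin_closed_trans)
  define N where "N = density lm (\<lambda>x. r x * indicator {a..b} x)"
  have [measurable]: "(\<lambda>x. r x * indicator {a..b} x) \<in> borel_measurable lm" using r by simp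
  have eN: "emeasure N X = (\<integral>\<^sup>+x. r x * indicator {a..b} x * indicator X x \<partial>lm)" if "X \<in> sets borel" for X
    unfolding N_def using that by (subst emeasure_density) auto
  have sN: "sets N = sets borel" "space N = UNIV" by (auto simp: N_def)
  have "emeasure N (space N) \<noteq> \<infinity>" using fin by (simp add: sN eN less_top)
  from outer_regular[OF sN(1) this borel_closed[OF K]]
  have NKi: "emeasure N K = (INF U\<in>{U. K \<subseteq> U \<and> open U}. emeasure N U)" .
  have NK: "emeasure N K < top"
    using fin by (subst eN[OF borel_closed[OF K]]) (auto intro!: order.strict_trans1[OF nn_integral_mono fin] split: split_indicator)
  then have "emeasure N K < emeasure N K + ennreal e"
    using e by (cases "emeasure N K") (auto simp: ennreal_less_iff simp flip: ennreal_plus)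
  then have "(INF U\<in>{U. K \<subseteq> U \<and> open U}. emeasure N U) < emeasure N K + ennreal e"
    by (subst NKi[symmetric])
  then obtain U where U: "K \<subseteq> U" "open U" "emeasure N U < emeasure N K + ennreal e"
    by (auto simp: INF_less_iff)
  define h where "h x = ennreal C0 * indicator E (\<gamma> x) + r x * indicator U x" for x
  have "(\<lambda>x. h x * indicator {a..b} x) = (\<lambda>x. ennreal C0 * (indicator E (\<gamma> x) * indicator {a..b} x) + r x * indicator {a..b} x * indicator U x)"
    by (auto simp: h_def fun_eq_iff split: split_indicator)
  then have hm: "(\<lambda>x. h x * indicator {a..b} x) \<in> borel_measurable borel"
    using mE[of E] r E U(2) by simp
  have Llen: "ennreal \<bar>g (\<gamma> s) - g (\<gamma> t)\<bar> \<le> (\<integral>\<^sup>+x\<in>{s..t}. h x \<partial>lm)"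
    if st: "a \<le> s" "s \<le> t" "t \<le> b" and inE: "\<And>x. s < x \<Longrightarrow> x < t \<Longrightarrow> \<gamma> x \<in> E" for s t
  proof -
    have "ennreal \<bar>g (\<gamma> s) - g (\<gamma> t)\<bar> \<le> ennreal (C0 * dist (\<gamma> s) (\<gamma> t))" using g by (rule ennreal_leI)
    also have "\<dots> = ennreal C0 * ennreal (dist (\<gamma> s) (\<gamma> t))" using C0 by (simp add: ennreal_mult)
    also have "\<dots> \<le> ennreal C0 * emeasure lm {s..t}"
      unfolding emeasure_lm_Icc[OF st] by (intro mult_left_mono dist_le_path_length st) simp
    also have "\<dots> = (\<integral>\<^sup>+x. ennreal C0 * indicator {s..t} x \<partial>lm)"
      by (subst nn_integral_cmult_indicator) auto
    also have "\<dots> \<le> (\<integral>\<^sup>+x\<in>{s..t}. h x \<partial>lm)"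
    proof (rule nn_integral_mono_AE)
      show "AE x in lm. ennreal C0 * indicator {s..t} x \<le> h x * indicator {s..t} x"
        using AE_lm_neq[of s] AE_lm_neq[of t]
      proof eventually_elim
        case (elim x)
        then show ?case using inE[of x] by (auto simp: h_def split: split_indicator)
      qed
    qed
    finally show ?thesis .
  qed
  have "ennreal (dist (g (\<gamma> a)) (g (\<gamma> b))) \<le> (\<integral>\<^sup>+x\<in>{a..b}. h x \<partial>lm)"
  proof (rule local_to_global[OF ab, where \<phi> = "\<lambda>x. g (\<gamma> x)" and I = "\<lambda>s t. \<integral>\<^sup>+x\<in>{s..t}. h x \<partial>lm"])
    show "(\<integral>\<^sup>+x\<in>{s..m}. h x \<partial>lm) + (\<integral>\<^sup>+x\<in>{m..t}. h x \<partial>lm) \<le> (\<integral>\<^sup>+x\<in>{s..t}. h x \<partial>lm)"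
      if "a \<le> s" "s \<le> m" "m \<le> t" "t \<le> b" for s m t
      using integral_split[OF that hm] by simp
    fix x assume x: "a \<le> x" "x \<le> b"
    show "\<exists>d>0. \<forall>s t. a \<le> s \<and> s \<le> x \<and> x \<le> t \<and> t \<le> b \<and> t - s < d \<longrightarrow>
        ennreal (dist (g (\<gamma> s)) (g (\<gamma> t))) \<le> (\<integral>\<^sup>+x\<in>{s..t}. h x \<partial>lm)"
    proof (cases "x \<in> K")
      case False
      then have xE: "\<gamma> x \<in> E" using x by (simp add: K_def)
      obtain d where d: "0 < d" "\<And>y. dist y (\<gamma> x) < d \<Longrightarrow> y \<in> E" using E xE unfolding open_dist by blast
      obtain d' where d': "0 < d'" "\<And>y. y \<in> {a..b} \<Longrightarrow> dist y x < d' \<Longrightarrow> dist (\<gamma> y) (\<gamma> x) < d"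
        using cont x d(1) unfolding continuous_on_iff by (metis atLeastAtMost_iff)
      show ?thesis
      proof (intro exI[of _ d'] conjI allI impI d'(1))
        fix s t assume st: "a \<le> s \<and> s \<le> x \<and> x \<le> t \<and> t \<le> b \<and> t - s < d'"
        show "ennreal (dist (g (\<gamma> s)) (g (\<gamma> t))) \<le> (\<integral>\<^sup>+x\<in>{s..t}. h x \<partial>lm)"
          unfolding dist_real_def
        proof (rule Llen)
          fix y assume "s < y" "y < t"
          then show "\<gamma> y \<in> E" using st by (intro d(2) d'(2)) (auto simp: dist_real_def abs_less_iff)
        qed (use st in auto)
      qed
    next
      case True
      then have "x \<in> U" using U(1) by blast
      then obtain d where d: "0 < d" "\<And>y. dist y x < d \<Longrightarrow> y \<in> U" using U(2) unfolding open_dist by blast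
      show ?thesis
      proof (intro exI[of _ d] conjI allI impI d(1))
        fix s t assume st: "a \<le> s \<and> s \<le> x \<and> x \<le> t \<and> t \<le> b \<and> t - s < d"
        \<comment> \<open>Cut at the first and the last parameter outside \<open>E\<close>. The
          outer pieces run inside \<open>E\<close>, and at the two cuts g equals f, so the middle
          piece inherits the gradient inequality of f.\<close>
        define C where "C = K \<inter> {s..t}"
        have C: "compact C" "C \<noteq> {}" using K True st by (auto simp: C_def intro: closed_Int_compact)
        obtain k0 where k0: "k0 \<in> C" "\<And>y. y \<in> C \<Longrightarrow> k0 \<le> y" using compact_attains_inf[OF C] by blast
        obtain k1 where k1: "k1 \<in> C" "\<And>y. y \<in> C \<Longrightarrow> y \<le> k1" using compact_attains_sup[OF C] by blast
        have o: "s \<le> k0" "k0 \<le> k1" "k1 \<le> t" using k0 k1 by (auto simp: C_def)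
        have nE: "\<gamma> k0 \<notin> E" "\<gamma> k1 \<notin> E" using k0(1) k1(1) by (auto simp: C_def K_def)
        have 1: "ennreal \<bar>g (\<gamma> s) - g (\<gamma> k0)\<bar> \<le> (\<integral>\<^sup>+x\<in>{s..k0}. h x \<partial>lm)"
        proof (rule Llen)
          fix y assume "s < y" "y < k0"
          then show "\<gamma> y \<in> E" using k0(2)[of y] st o by (force simp: C_def K_def)
        qed (use st o in auto)
        have 3: "ennreal \<bar>g (\<gamma> k1) - g (\<gamma> t)\<bar> \<le> (\<integral>\<^sup>+x\<in>{k1..t}. h x \<partial>lm)"
        proof (rule Llen)
          fix y assume "k1 < y" "y < t"
          then show "\<gamma> y \<in> E" using k1(2)[of y] st o by (force simp: C_def K_def)
        qed (use st o in auto)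
        have "ennreal \<bar>f (\<gamma> k0) - f (\<gamma> k1)\<bar> \<le> (\<integral>\<^sup>+x\<in>{k0..k1}. r x \<partial>lm)"
          using st o by (intro f) auto
        also have "\<dots> \<le> (\<integral>\<^sup>+x\<in>{k0..k1}. h x \<partial>lm)"
        proof (rule nn_integral_mono)
          fix y
          have "y \<in> U" if "y \<in> {k0..k1}" using that st o by (intro d(2)) (auto simp: dist_real_def abs_less_iff)
          then show "r y * indicator {k0..k1} y \<le> h y * indicator {k0..k1} y"
            by (auto simp: h_def split: split_indicator)
        qed
        finally have 2: "ennreal \<bar>g (\<gamma> k0) - g (\<gamma> k1)\<bar> \<le> (\<integral>\<^sup>+x\<in>{k0..k1}. h x \<partial>lm)"
          using fg[OF nE(1)] fg[OF nE(2)] by simp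
        have "\<bar>g (\<gamma> s) - g (\<gamma> t)\<bar> \<le> \<bar>g (\<gamma> s) - g (\<gamma> k0)\<bar> + (\<bar>g (\<gamma> k0) - g (\<gamma> k1)\<bar> + \<bar>g (\<gamma> k1) - g (\<gamma> t)\<bar>)" by linarith
        then have "ennreal (dist (g (\<gamma> s)) (g (\<gamma> t))) \<le> ennreal \<bar>g (\<gamma> s) - g (\<gamma> k0)\<bar> + (ennreal \<bar>g (\<gamma> k0) - g (\<gamma> k1)\<bar> + ennreal \<bar>g (\<gamma> k1) - g (\<gamma> t)\<bar>)"
          unfolding dist_real_def by (simp add: ennreal_leI flip: ennreal_plus)
        also have "\<dots> \<le> (\<integral>\<^sup>+x\<in>{s..k0}. h x \<partial>lm) + ((\<integral>\<^sup>+x\<in>{k0..k1}. h x \<partial>lm) + (\<integral>\<^sup>+x\<in>{k1..t}. h x \<partial>lm))"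
          by (intro add_mono 1 2 3)
        also have "\<dots> = (\<integral>\<^sup>+x\<in>{s..t}. h x \<partial>lm)"
          using integral_split[of s k0 t h, OF _ _ _ _ hm] integral_split[of k0 k1 t h, OF _ _ _ _ hm] st o by simp
        finally show "ennreal (dist (g (\<gamma> s)) (g (\<gamma> t))) \<le> (\<integral>\<^sup>+x\<in>{s..t}. h x \<partial>lm)" .
      qed
    qed
  qed
  also have "(\<integral>\<^sup>+x\<in>{a..b}. h x \<partial>lm) \<le> (\<integral>\<^sup>+x\<in>{a..b}. r x * indicator (- E) (\<gamma> x) + ennreal C0 * indicator E (\<gamma> x) \<partial>lm) + ennreal e"
  proof -
    let ?q = "\<lambda>x. (r x * indicator (- E) (\<gamma> x) + ennreal C0 * indicator E (\<gamma> x)) * indicator {a..b} x"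
    have "?q = (\<lambda>x. r x * indicator {a..b} x * (indicator (- E) (\<gamma> x) * indicator {a..b} x) + ennreal C0 * (indicator E (\<gamma> x) * indicator {a..b} x))"
      by (auto simp: fun_eq_iff split: split_indicator)
    then have qm: "?q \<in> borel_measurable lm" using mE[of E] mE[of "- E"] r E by simp
    have [measurable]: "U - K \<in> sets lm" using K U(2) by (simp add: borel_closed borel_open sets.Diff)
    have rm: "(\<lambda>x. r x * indicator {a..b} x * indicator (U - K) x) \<in> borel_measurable lm" by measurable
    have "(\<integral>\<^sup>+x\<in>{a..b}. h x \<partial>lm) \<le> (\<integral>\<^sup>+x. ?q x + r x * indicator {a..b} x * indicator (U - K) x \<partial>lm)"
      by (intro nn_integral_mono) (auto simp: h_def K_def split: split_indicator)
    also have "\<dots> = (\<integral>\<^sup>+x. ?q x \<partial>lm) + emeasure N (U - K)"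
      using qm rm K U(2) by (subst nn_integral_add) (auto simp: eN borel_closed borel_open)
    also have "emeasure N (U - K) = emeasure N U - emeasure N K"
      using K U NK by (intro emeasure_Diff) (auto simp: sN borel_closed borel_open)
    also have "\<dots> \<le> ennreal e"
      using U(3) NK by (auto simp: ennreal_minus_le_iff less_imp_le)
    finally show ?thesis by (simp add: add_left_mono)
  qed
  finally show "ennreal \<bar>g (\<gamma> a) - g (\<gamma> b)\<bar> \<le> (\<integral>\<^sup>+x\<in>{a..b}. r x * indicator (- E) (\<gamma> x) + ennreal C0 * indicator E (\<gamma> x) \<partial>lm) + ennreal e"
    by (simp add: dist_real_def)
qed

lemma (in metric_measure) wug_glue:
  fixes f g :: "'a \<Rightarrow> real"
  assumes p: "0 < p" and E: "open E" and L: "0 \<le> L" and g: "\<And>x y. \<bar>g x - g y\<bar> \<le> L * dist x y" and fg: "\<And>x. x \<notin> E \<Longrightarrow> g x = f x"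
    and f: "weak_upper_gradient p \<mu> UNIV f \<rho>" and \<rho>: "\<rho> \<in> Lp_borel p \<mu> UNIV"
  shows "weak_upper_gradient p \<mu> UNIV g (\<lambda>x. \<rho> x * indicator (- E) x + ennreal L * indicator E x)"
proof -
  obtain \<rho>0 where \<rho>0: "\<rho>0 \<in> Lp_borel p \<mu> UNIV" "\<And>a b \<gamma>. (a, b, \<gamma>) \<in> paths_in UNIV \<Longrightarrow> path_integral \<rho>0 (a, b, \<gamma>) < top \<Longrightarrow>
      path_integral \<rho> (a, b, \<gamma>) < top \<and> (\<forall>n::nat. \<forall>s t. a \<le> s \<longrightarrow> s \<le> t \<longrightarrow> t \<le> b \<longrightarrow>
        ennreal (norm (f (\<gamma> s) - f (\<gamma> t))) \<le> (\<integral>\<^sup>+x\<in>{s..t}. \<rho> (\<gamma> x) \<partial>length_measure a b \<gamma>))"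
  proof (rule wug_countable[where u = "\<lambda>_. f" and \<rho> = "\<lambda>_. \<rho>", OF p _ \<rho>])
    show "weak_upper_gradient p \<mu> UNIV f \<rho>" by (rule f)
  qed (rule that)
  have \<rho>b: "\<rho> \<in> borel_measurable (restrict_space borel UNIV)" using \<rho> by (simp add: Lp_borel_iff)
  have "(indicator X :: 'a \<Rightarrow> ennreal) \<in> borel_measurable (restrict_space borel UNIV)" if "X \<in> sets borel" for X
    using that by (intro measurable_restrict_space1 borel_measurable_indicator)
  from this[of E] this[of "- E"] E
  have [measurable]: "(indicator E :: 'a \<Rightarrow> ennreal) \<in> borel_measurable (restrict_space borel UNIV)"
    "(indicator (- E) :: 'a \<Rightarrow> ennreal) \<in> borel_measurable (restrict_space borel UNIV)" by auto
  show ?thesis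
  proof (rule wugI[OF _ \<rho>0(1)])
    show "(\<lambda>x. \<rho> x * indicator (- E) x + ennreal L * indicator E x) \<in> borel_measurable (restrict_space borel UNIV)"
      using \<rho>b by measurable
    fix a b \<gamma> assume q: "(a, b, \<gamma>) \<in> paths_in UNIV" "path_integral \<rho>0 (a, b, \<gamma>) < top"
    interpret rect_path a b \<gamma>
      using q by (intro paths_in_rect_path path_integral_finite_rectifiable)
    note r = \<rho>0(2)[OF q]
    show "ennreal (norm (g (\<gamma> a) - g (\<gamma> b))) \<le> path_integral (\<lambda>x. \<rho> x * indicator (- E) x + ennreal L * indicator E x) (a, b, \<gamma>)"
      unfolding path_integral_eq real_norm_def
    proof (rule glue_along_path[OF E L g fg measurable_along_path[OF \<rho>b q(1)]])
      show "(\<integral>\<^sup>+x\<in>{a..b}. \<rho> (\<gamma> x) \<partial>lm) < top" using r by (simp add: path_integral_eq)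
      show "ennreal \<bar>f (\<gamma> s) - f (\<gamma> t)\<bar> \<le> (\<integral>\<^sup>+x\<in>{s..t}. \<rho> (\<gamma> x) \<partial>lm)" if "a \<le> s" "s \<le> t" "t \<le> b" for s t
        using r that by simp
    qed
  qed
qed

section \<open>The pointwise estimate for Sobolev functions\<close>

lemma diameter_ball_le: "0 < r \<Longrightarrow> diameter (ball x r) \<le> 2 * r" for x :: "'a::metric_space"
  unfolding diameter_def
proof (simp, rule cSUP_least)
  fix q assume "0 < r" "q \<in> ball x r \<times> ball x r"
  then show "(case q of (y, z) \<Rightarrow> dist y z) \<le> 2 * r"
    using dist_triangle3[of "fst q" "snd q" x] by (auto simp: split_beta)
qed auto

locale poincare_mms = doubling_mms \<mu> c for \<mu> :: "'a::polish_space set \<Rightarrow> ennreal" and c :: real +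
  fixes p CP \<Lambda> :: real
  assumes p: "1 < p" and CP: "0 < CP" and \<Lambda>: "1 \<le> \<Lambda>"
    and poincare: "\<And>x r (u :: 'a \<Rightarrow> real) \<rho>. 0 < r \<Longrightarrow> integrable (measure_on \<mu> (ball x (\<Lambda> * r))) u \<Longrightarrow>
        \<rho> \<in> Lp_borel p \<mu> (ball x (\<Lambda> * r)) \<Longrightarrow> weak_upper_gradient p \<mu> (ball x (\<Lambda> * r)) u \<rho> \<Longrightarrow>
        (\<integral>\<^sup>+y. ennreal \<bar>u y - mean_value \<mu> (ball x r) u\<bar> \<partial>measure_on \<mu> (ball x r)) / \<mu> (ball x r)
          \<le> ennreal (CP * diameter (ball x r)) *
             ennreal_powr ((\<integral>\<^sup>+y. ennreal_powr (\<rho> y) p \<partial>measure_on \<mu> (ball x (\<Lambda> * r)))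
                            / \<mu> (ball x (\<Lambda> * r))) (1 / p)"
begin

lemma p0: "0 < p" using p by simp

lemma osc_le:
  assumes u: "loc_int u" and G: "G \<in> borel_measurable borel" and ug: "weak_upper_gradient p \<mu> UNIV u G"
    and r: "0 < r" and \<tau>: "0 < \<tau>" and a: "avg (\<lambda>x. G x powe p) z (\<Lambda> * r) \<le> ennreal (\<tau> powr p)"
  shows "(\<integral>\<^sup>+y\<in>ball z r. ennreal \<bar>u y - mean u z r\<bar> \<partial>M) \<le> ennreal (2 * CP * \<tau> * r) * emeasure M (ball z r)"
proof -
  let ?B = "ball z (\<Lambda> * r)"
  have Lr: "0 < \<Lambda> * r" using \<Lambda> r by simp
  have int: "(\<integral>\<^sup>+y. G y powe p \<partial>measure_on \<mu> ?B) = (\<integral>\<^sup>+y\<in>?B. G y powe p \<partial>M)"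
    by (simp add: nn_integral_on)
  have "(\<integral>\<^sup>+y\<in>?B. G y powe p \<partial>M) \<le> ennreal (\<tau> powr p) * emeasure M ?B"
    by (rule integral_le_avg[OF Lr a])
  also have "\<dots> < top" using ball_emeasure(2)[of z "\<Lambda> * r"] by (simp add: ennreal_mult_less_top)
  finally have "G \<in> Lp_borel p \<mu> ?B"
    using G int by (auto simp: Lp_borel_iff Lp_int_def intro: measurable_restrict_space1)
  moreover have "weak_upper_gradient p \<mu> ?B u G"
    by (rule wug_subset[OF p0 ug]) (auto simp: open_M)
  moreover have "integrable (measure_on \<mu> ?B) u" using u by (simp add: loc_int_def)
  ultimately have "(\<integral>\<^sup>+y. ennreal \<bar>u y - mean u z r\<bar> \<partial>measure_on \<mu> (ball z r)) / \<mu> (ball z r)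
          \<le> ennreal (CP * diameter (ball z r)) * ((\<integral>\<^sup>+y. G y powe p \<partial>measure_on \<mu> ?B) / \<mu> ?B) powe (1 / p)"
    using poincare[OF r] by blast
  also have "(\<integral>\<^sup>+y. G y powe p \<partial>measure_on \<mu> ?B) / \<mu> ?B = avg (\<lambda>x. G x powe p) z (\<Lambda> * r)"
    by (simp add: int avg_def emeasure_M)
  also have "ennreal (CP * diameter (ball z r)) * avg (\<lambda>x. G x powe p) z (\<Lambda> * r) powe (1 / p) \<le> ennreal (CP * (2 * r)) * ennreal (\<tau> powr p) powe (1 / p)"
    using CP r p0 a by (intro mult_mono ennreal_leI mult_left_mono diameter_ball_le powe_mono) auto
  also have "\<dots> = ennreal (2 * CP * \<tau> * r)"
    using \<tau> p0 CP r by (simp add: powe_ennreal powr_powr ennreal_mult[symmetric] mult_ac)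
  finally have "(\<integral>\<^sup>+y\<in>ball z r. ennreal \<bar>u y - mean u z r\<bar> \<partial>M) / emeasure M (ball z r) \<le> ennreal (2 * CP * \<tau> * r)"
    by (simp add: nn_integral_on emeasure_M)
  then have "(\<integral>\<^sup>+y\<in>ball z r. ennreal \<bar>u y - mean u z r\<bar> \<partial>M) / emeasure M (ball z r) * emeasure M (ball z r) \<le> ennreal (2 * CP * \<tau> * r) * emeasure M (ball z r)"
    by (rule mult_right_mono) simp
  then show ?thesis
    using ball_emeasure(1)[OF r, of z] ball_emeasure(2)[of z r] by (simp add: ennreal_divide_mult_self)
qed

text \<open>8 * c^2 from chaining means over balls in \<open>lipschitz_at_good_points\<close>, times
  2 * CP from \<open>osc_le\<close>.\<close>

definition K0 where "K0 = 16 * c ^ 2 * CP"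

lemma K0: "0 < K0" using c CP by (simp add: K0_def)

text \<open>Telescoping: the means over the balls of radius r / 2^n about a good point change by at
  most c * K * r / 2^n per step and converge to the value there. The chains of x and y are joined by
  comparing the ball of radius d about y with the ball of radius 2 * d about x that contains
  it.\<close>

lemma lipschitz_at_good_points:
  assumes u: "loc_int u" and G: "G \<in> borel_measurable borel" and ug: "weak_upper_gradient p \<mu> UNIV u G"
    and leb: "leb_point u x" "leb_point u y" and \<tau>: "0 < \<tau>"
    and good: "mf (\<lambda>x. G x powe p) x \<le> ennreal (\<tau> powr p)" "mf (\<lambda>x. G x powe p) y \<le> ennreal (\<tau> powr p)"
  shows "\<bar>u x - u y\<bar> \<le> K0 * \<tau> * dist x y"
proof (cases "x = y")
  case False
  define d where "d = dist x y"
  have d: "0 < d" using False by (simp add: d_def)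
  define K where "K = 2 * CP * \<tau>"
  have K: "0 < K" using CP \<tau> by (simp add: K_def)
  have osc: "(\<integral>\<^sup>+y\<in>ball w r. ennreal \<bar>u y - mean u w r\<bar> \<partial>M) \<le> ennreal (K * r) * emeasure M (ball w r)"
    if w: "w = x \<or> w = y" and r: "0 < r" for w r
    unfolding K_def
  proof (rule osc_le[OF u G ug r \<tau>])
    have "avg (\<lambda>x. G x powe p) w (\<Lambda> * r) \<le> mf (\<lambda>x. G x powe p) w"
      using \<Lambda> r by (intro avg_le_mf) simp
    then show "avg (\<lambda>x. G x powe p) w (\<Lambda> * r) \<le> ennreal (\<tau> powr p)" using good w order_trans by blast
  qed
  have step: "\<bar>mean u w' s - mean u w r\<bar> \<le> c ^ n * (K * r)"
    if w: "w = x \<or> w = y" and r: "0 < r" "0 < s" and sub: "ball w' s \<subseteq> ball w r" and n: "dist w w' + r \<le> 2 ^ n * s" for w w' r s n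
  proof -
    let ?b = "emeasure M (ball w' s)"
    have b: "?b \<noteq> 0" "?b \<noteq> top" using ball_emeasure(1)[OF r(2), of w'] ball_emeasure(2)[of w' s] by auto
    have "ennreal \<bar>mean u w' s - mean u w r\<bar> * ?b \<le> (\<integral>\<^sup>+y\<in>ball w' s. ennreal \<bar>u y - mean u w r\<bar> \<partial>M)"
      by (rule mean_diff[OF u r(2)])
    also have "\<dots> \<le> (\<integral>\<^sup>+y\<in>ball w r. ennreal \<bar>u y - mean u w r\<bar> \<partial>M)"
      using sub by (intro nn_integral_mono) (auto split: split_indicator)
    also have "\<dots> \<le> ennreal (K * r) * emeasure M (ball w r)" by (rule osc[OF w r(1)])
    also have "\<dots> \<le> ennreal (K * r) * (ennreal (c ^ n) * ?b)" by (intro mult_left_mono ball_compare n) simp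
    also have "\<dots> = ennreal (c ^ n * (K * r)) * ?b"
      using c K r by (simp add: ennreal_mult mult_ac)
    finally have "ennreal \<bar>mean u w' s - mean u w r\<bar> \<le> ennreal (c ^ n * (K * r))"
      using b by (metis ennreal_mult_divide_eq divide_right_mono_ennreal)
    then show ?thesis using c K r by (simp add: ennreal_le_iff)
  qed
  have lim: "\<bar>u w - mean u w r\<bar> \<le> 2 * c * K * r" if w: "w = x \<or> w = y" and r: "0 < r" for w r
  proof -
    have st: "\<bar>mean u w (r / 2 ^ Suc n) - mean u w (r / 2 ^ n)\<bar> \<le> c * K * r * (1/2) ^ n" for n
      using step[OF w, of "r / 2 ^ n" "r / 2 ^ Suc n" w 1] r by (simp add: ball_subset_ball_iff power_divide subset_ball field_simps)
    have tel: "\<bar>mean u w (r / 2 ^ n) - mean u w r\<bar> \<le> 2 * c * K * r * (1 - (1/2) ^ n)" for n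
    proof (induction n)
      case (Suc n)
      have "2 * c * K * r * (1 - (1/2) ^ n) + c * K * r * (1/2) ^ n = 2 * c * K * r * (1 - (1/2) ^ Suc n)"
        by (simp add: algebra_simps)
      then show ?case using Suc st[of n] by linarith
    qed simp
    have le: "\<bar>u w - mean u w r\<bar> \<le> 2 * c * K * r + e" if e: "0 < e" for e
    proof -
      obtain \<delta> where \<delta>: "0 < \<delta>" "\<And>s. 0 < s \<Longrightarrow> s < \<delta> \<Longrightarrow> \<bar>mean u w s - u w\<bar> \<le> e"
        using leb w e unfolding leb_point_def by blast
      obtain n where "(1/2) ^ n < \<delta> / r" using real_arch_pow_inv[of "\<delta> / r" "1/2"] \<delta> r by auto
      then have "r / 2 ^ n < \<delta>" using r by (simp add: power_divide field_simps)
      then have "\<bar>mean u w (r / 2 ^ n) - u w\<bar> \<le> e" using \<delta>(2) r by simp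
      moreover have "2 * c * K * r * (1 - (1/2) ^ n) \<le> 2 * c * K * r * 1"
        using c K r by (intro mult_left_mono) auto
      ultimately show ?thesis using tel[of n] by linarith
    qed
    show ?thesis by (rule field_le_epsilon) (rule le)
  qed
  have "ball y d \<subseteq> ball x (2 * d)"
  proof
    fix z assume "z \<in> ball y d"
    then show "z \<in> ball x (2 * d)" using dist_triangle[of x z y] by (simp add: d_def)
  qed
  then have "\<bar>mean u y d - mean u x (2 * d)\<bar> \<le> c ^ 2 * (K * (2 * d))"
    by (intro step) (use d in \<open>auto simp: d_def\<close>)
  moreover have "\<bar>u x - mean u x (2 * d)\<bar> \<le> 2 * c * K * (2 * d)" "\<bar>u y - mean u y d\<bar> \<le> 2 * c * K * d"
    using d by (intro lim; simp)+
  ultimately have "\<bar>u x - u y\<bar> \<le> c ^ 2 * (K * (2 * d)) + 2 * c * K * (2 * d) + 2 * c * K * d" by linarith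
  also have "\<dots> = (2 * c ^ 2 + 6 * c) * (K * d)" by (simp add: algebra_simps)
  also have "\<dots> \<le> (8 * c ^ 2) * (K * d)"
  proof (rule mult_right_mono)
    have "c \<le> c ^ 2" using c by (simp add: power2_eq_square)
    then show "2 * c ^ 2 + 6 * c \<le> 8 * c ^ 2" by linarith
  qed (use K d in simp)
  also have "\<dots> = K0 * \<tau> * dist x y" by (simp add: K0_def K_def d_def)
  finally show ?thesis .
qed simp

text \<open>\<open>A\<close> may have infinite measure, so its complement is approximated from
  inside in each ball of radius n, with errors that sum to e; what these closed sets leave over is
  open.\<close>

lemma outer_approx:
  assumes A: "A \<in> sets M" and e: "0 < e"
  obtains U where "open U" "A \<subseteq> U" "emeasure M U \<le> emeasure M A + ennreal e"
proof -
  define z :: 'a where "z = undefined"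
  have "\<exists>L. closed L \<and> L \<subseteq> ball z (real n) - A \<and> emeasure M (ball z (real n) - A - L) < ennreal (e * (1/2) ^ Suc n)" for n
  proof -
    obtain L where "closed L" "L \<subseteq> ball z (real n) - A" "emeasure M (ball z (real n) - A - L) < ennreal (e * (1/2) ^ Suc n)"
      by (rule inner_approx[of "ball z (real n) - A" z "real n" "e * (1/2) ^ Suc n"]) (use A e in auto)
    then show ?thesis by blast
  qed
  then obtain L where L: "\<And>n. closed (L n)" "\<And>n. L n \<subseteq> ball z (real n) - A"
    "\<And>n. emeasure M (ball z (real n) - A - L n) < ennreal (e * (1/2) ^ Suc n)" by metis
  define U where "U = (\<Union>n. ball z (real n) - L n)"
  have LM: "L n \<in> sets M" for n using L(1) by (intro borel_sets_M borel_closed)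
  have "open U" unfolding U_def using L(1) by (intro open_UN) (auto intro: open_Diff)
  moreover have "A \<subseteq> U"
  proof
    fix x assume "x \<in> A"
    obtain n :: nat where "dist z x < real n" using reals_Archimedean2 by blast
    then show "x \<in> U" using \<open>x \<in> A\<close> L(2)[of n] by (auto simp: U_def)
  qed
  moreover have "emeasure M U \<le> emeasure M A + ennreal e"
  proof -
    have "U \<subseteq> A \<union> (\<Union>n. ball z (real n) - A - L n)" by (auto simp: U_def)
    then have "emeasure M U \<le> emeasure M (A \<union> (\<Union>n. ball z (real n) - A - L n))"
      using A LM by (intro emeasure_mono) auto
    also have "\<dots> \<le> emeasure M A + emeasure M (\<Union>n. ball z (real n) - A - L n)"
      using A LM by (intro emeasure_subadditive) auto
    also have "emeasure M (\<Union>n. ball z (real n) - A - L n) \<le> (\<Sum>n. emeasure M (ball z (real n) - A - L n))"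
      using A LM by (intro emeasure_subadditive_countably) auto
    also have "\<dots> \<le> (\<Sum>n. ennreal e * ennreal ((1/2) ^ Suc n))"
    proof (intro suminf_le)
      fix n show "emeasure M (ball z (real n) - A - L n) \<le> ennreal e * ennreal ((1/2) ^ Suc n)"
        using less_imp_le[OF L(3)[of n]] e by (subst ennreal_mult[symmetric]) auto
    qed auto
    also have "\<dots> = ennreal e" by (simp only: ennreal_suminf_cmult suminf_ennreal_half mult_1_right)
    finally show ?thesis by (simp add: add_left_mono)
  qed
  ultimately show ?thesis using that by blast
qed

end

lemma borel_restrict_UNIV: "f \<in> borel_measurable (restrict_space borel UNIV) \<longleftrightarrow> f \<in> borel_measurable borel"
  by (simp add: measurable_def space_restrict_space sets_restrict_space)

text \<open>The absorption step of the recursion. It requires a finite \<open>T\<close>, which is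
  why \<open>isum_X\<close> works with sums over bounded ranges of j.\<close>

lemma ennreal_absorb_half:
  fixes T A :: ennreal
  assumes "T \<le> ennreal (1/2) * T + A" "T < top"
  shows "T \<le> 2 * A"
proof (cases "A = top")
  case False
  then obtain a where a: "A = ennreal a" "0 \<le> a" by (cases A) auto
  obtain t where t: "T = ennreal t" "0 \<le> t" using assms(2) by (cases T) auto
  have "ennreal (1/2 * t + a) = ennreal (1/2 * t) + ennreal a"
    using a t by (intro ennreal_plus) auto
  also have "ennreal (1/2 * t) = ennreal (1/2) * ennreal t"
    using t by (intro ennreal_mult) auto
  finally have "ennreal t \<le> ennreal (1/2 * t + a)"
    using assms(1) unfolding a(1) t(1) by simp
  then have "t \<le> 1/2 * t + a" by (subst (asm) ennreal_le_iff) (use a t in auto)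
  then have "t \<le> 2 * a" by simp
  then have "ennreal t \<le> ennreal (2 * a)" by (rule ennreal_leI)
  also have "\<dots> = 2 * A" using a by (simp add: ennreal_mult)
  finally show ?thesis using t by simp
qed (simp add: ennreal_mult_top)

lemma ennreal_mult4:
  "0 \<le> x \<Longrightarrow> 0 \<le> y \<Longrightarrow> 0 \<le> z \<Longrightarrow> 0 \<le> w \<Longrightarrow>
    ennreal x * (ennreal y * (ennreal z * (ennreal w * v))) = ennreal (x * y * z * w) * v"
  by (simp add: ennreal_mult mult.assoc)

lemma ennreal_mult3:
  "0 \<le> x \<Longrightarrow> 0 \<le> y \<Longrightarrow> 0 \<le> z \<Longrightarrow> ennreal x * (ennreal y * (ennreal z * v)) = ennreal (x * y * z) * v"
  by (simp add: ennreal_mult mult.assoc)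

lemma lev_mono: "i \<le> j \<Longrightarrow> lev i \<le> lev j"
  by (auto simp: lev_def intro!: ennreal_leI)

lemma lev_powe_shift: "lev (j + i) powe q = ennreal (2 powr (real_of_int i * q)) * lev j powe q"
  unfolding lev_powe by (subst ennreal_mult[symmetric]) (simp_all add: powr_add[symmetric] distrib_right add.commute)

text \<open>Distinct powers of 2 add up to at most twice the largest, so the q-th power costs 2^q
  however many terms there are. This independence of the number of terms is the source of the gain
  in \<open>X_step\<close>.\<close>

lemma sum_lev_powe_le:
  assumes I: "finite I" and q: "0 < q"
  shows "(\<Sum>n\<in>I. lev n * indicator (E n) x) powe q \<le> ennreal (2 powr q) * (\<Sum>n\<in>I. lev n powe q * indicator (E n) x)"
proof -
  define I' where "I' = {n\<in>I. x \<in> E n}"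
  have f: "finite I'" using I by (simp add: I'_def)
  have e: "(\<Sum>n\<in>I. g n * indicator (E n) x) = sum g I'" for g :: "int \<Rightarrow> ennreal"
    unfolding I'_def using I by (intro sum.mono_neutral_cong_right) (auto split: split_indicator)
  show ?thesis
  proof (cases "I' = {}")
    case False
    define J where "J = Max I'"
    have J: "J \<in> I'" "\<And>n. n \<in> I' \<Longrightarrow> n \<le> J" using f False by (auto simp: J_def)
    have "sum lev I' = ennreal (\<Sum>n\<in>I'. 2 powr (real_of_int n * 1))"
      by (simp add: lev_def sum_ennreal)
    also have "\<dots> \<le> ennreal (2 powr (real_of_int J * 1) * (1 / (1 - 2 powr - 1)))"
      by (intro ennreal_leI sum_int_geometric f J) auto
    also have "2 powr (real_of_int J * 1) * (1 / (1 - 2 powr - 1)) = 2 * 2 powr real_of_int J"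
      by (simp add: powr_minus)
    finally have "sum lev I' powe q \<le> ennreal (2 * 2 powr real_of_int J) powe q"
      using q by (intro powe_mono) auto
    also have "ennreal (2 * 2 powr real_of_int J) = ennreal 2 * lev J"
      unfolding lev_def by (rule ennreal_mult) auto
    also have "(ennreal 2 * lev J) powe q = ennreal (2 powr q) * lev J powe q"
      unfolding powe_mult by (subst powe_ennreal) auto
    also have "lev J powe q \<le> (\<Sum>n\<in>I'. lev n powe q)"
      using J(1) f by (intro member_le_sum) auto
    finally show ?thesis unfolding e by (simp add: mult_left_mono)
  qed (simp add: e)
qed

section \<open>The Keith-Zhong self-improvement\<close>

context poincare_mms
begin

lemma lipschitz_regular:
  fixes f :: "'a \<Rightarrow> real"
  assumes L: "\<And>x y. \<bar>f x - f y\<bar> \<le> L * dist x y"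
  shows "continuous_on UNIV f" "loc_int f"
proof -
  have L': "\<bar>f x - f y\<bar> \<le> (\<bar>L\<bar> + 1) * dist x y" for x y
    by (rule order_trans[OF L[of x y] mult_right_mono]) auto
  show c: "continuous_on UNIV f"
    unfolding continuous_on_iff
  proof (intro ballI allI impI)
    fix x :: 'a and e :: real assume e: "0 < e"
    show "\<exists>d>0. \<forall>x'\<in>UNIV. dist x' x < d \<longrightarrow> dist (f x') (f x) < e"
    proof (intro exI[of _ "e / (\<bar>L\<bar> + 1)"] conjI ballI impI)
      fix y assume "dist y x < e / (\<bar>L\<bar> + 1)"
      then have "(\<bar>L\<bar> + 1) * dist y x < e" by (simp add: field_simps)
      then show "dist (f y) (f x) < e" using L'[of y x] by (simp add: dist_real_def)
    qed (use e in simp)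
  qed
  show "loc_int f"
  proof (rule loc_int_bounded_on_balls)
    show "f \<in> borel_measurable M" by (intro borel_measurable_M borel_measurable_continuous_onI c)
    show "\<exists>K. \<forall>y\<in>ball x r. \<bar>f y\<bar> \<le> K" for x r
    proof (intro exI[of _ "\<bar>f x\<bar> + (\<bar>L\<bar> + 1) * r"] ballI)
      fix y assume "y \<in> ball x r"
      then have "(\<bar>L\<bar> + 1) * dist y x \<le> (\<bar>L\<bar> + 1) * r" by (intro mult_left_mono) (auto simp: dist_commute)
      then show "\<bar>f y\<bar> \<le> \<bar>f x\<bar> + (\<bar>L\<bar> + 1) * r" using L'[of y x] by linarith
    qed
  qed
qed

text \<open>In the recursion each \<open>X n\<close> has the coefficient kk^(-p) * A1: the summand 1
  pays for discarding the sets \<open>E n\<close>, the rest for their share in the weak-type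
  bound.\<close>

definition A1 where "A1 = 1 + 2 * c ^ 2 * K0 powr p * 8 powr p"

text \<open>Here p > 1 is decisive: the kk coefficients kk^(-p) * A1 of the recursion add up to at
  most 1/2, so their contribution can be absorbed.\<close>

lemma ex_k: "\<exists>k::nat. 1 \<le> k \<and> A1 * real k powr (1 - p) \<le> 1 / 2"
proof -
  have A1: "1 \<le> A1" using c by (simp add: A1_def)
  obtain k :: nat where k: "max 1 ((2 * A1) powr (1 / (p - 1))) \<le> real k" using real_arch_simple by blast
  then have k1: "1 \<le> k" by simp
  have "((2 * A1) powr (1 / (p - 1))) powr (p - 1) \<le> real k powr (p - 1)"
    using k p by (intro powr_mono2) auto
  then have "2 * A1 \<le> real k powr (p - 1)" using p A1 by (simp add: powr_powr)
  moreover have "real k powr (1 - p) = 1 / real k powr (p - 1)"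
    using powr_minus_divide[of "real k" "p - 1"] by simp
  ultimately have "2 * A1 * real k powr (1 - p) \<le> real k powr (p - 1) * (1 / real k powr (p - 1))"
    by (simp add: divide_right_mono)
  also have "\<dots> = 1" using k1 by simp
  finally have "A1 * real k powr (1 - p) \<le> 1 / 2" by simp
  then show ?thesis using k1 by blast
qed

definition kk where "kk = (SOME k::nat. 1 \<le> k \<and> A1 * real k powr (1 - p) \<le> 1 / 2)"

lemma kk: "1 \<le> kk" "A1 * real kk powr (1 - p) \<le> 1 / 2"
  using someI_ex[OF ex_k] by (simp_all add: kk_def)

text \<open>With this depth, the values of \<rho> below 2^(j - ll) contribute at most half of the
  threshold for the maximal function, see \<open>small\<close> in \<open>X_step\<close>.\<close>

lemma ex_l: "\<exists>l::nat. 2 * 2 powr p * K0 powr p \<le> 2 powr (real l * p)"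
proof -
  have "1 < (2::real) powr p" using p by simp
  then obtain l where "2 * 2 powr p * K0 powr p < (2 powr p) ^ l" using real_arch_pow by blast
  also have "(2 powr p) ^ l = 2 powr (real l * p)" by (subst powr_realpow[symmetric], simp, simp add: powr_powr mult.commute)
  finally show ?thesis by (intro exI[of _ l]) simp
qed

definition ll where "ll = (SOME l::nat. 2 * 2 powr p * K0 powr p \<le> 2 powr (real l * p))"

lemma ll: "2 * 2 powr p * K0 powr p \<le> 2 powr (real ll * p)"
  using someI_ex[OF ex_l] by (simp add: ll_def)

text \<open>The coefficient of \<open>Y (j - int ll)\<close>: weak type gives 2 * c^2 * K0^p, two
  splittings of a p-th power give 4^p, and the last factor bounds \<rho> from above by 2^(j + 2 kk)
  relative to 2^(j - ll).\<close>

definition D1 where "D1 = 2 * c ^ 2 * K0 powr p * 4 powr p * 2 powr (real (2 * kk + ll) * p)"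

definition W1 where "W1 = c ^ 2 * K0 powr p + 1"

text \<open>The factor 2 is left by the absorption, kk * W1 stems from the levels that stick out of
  the range of summation, and D1 + 1 collects the two terms with \<open>Y\<close>.\<close>

definition C1 where "C1 = 2 * (real kk * W1 + (D1 + 1) * geom_const p)"

lemma const_nonneg: "1 \<le> A1" "0 \<le> D1" "1 \<le> W1" "0 \<le> C1"
proof -
  show "1 \<le> A1" "0 \<le> D1" and W: "1 \<le> W1" using c by (simp_all add: A1_def D1_def W1_def)
  then show "0 \<le> C1" using geom_const_pos[OF p0] by (simp add: C1_def)
qed

end

text \<open>A countable family with one common gradient, because the truncated distances that test a
  Banach-valued map need the same exceptional sets. Boundedness makes each member locally integrable
  and gives it Lebesgue points almost everywhere.\<close>

locale kz = poincare_mms \<mu> c p CP \<Lambda> for \<mu> :: "'a::polish_space set \<Rightarrow> ennreal" and c p CP \<Lambda> :: real +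
  fixes F :: "nat \<Rightarrow> 'a \<Rightarrow> real" and B :: "nat \<Rightarrow> real" and \<rho> :: "'a \<Rightarrow> ennreal"
  assumes Fm: "\<And>i. F i \<in> borel_measurable M" and Fb: "\<And>i x. \<bar>F i x\<bar> \<le> B i"
    and Fug: "\<And>i. weak_upper_gradient p \<mu> UNIV (F i) \<rho>" and \<rho>: "\<rho> \<in> Lp_borel p \<mu> UNIV"
begin

lemma \<rho>b: "\<rho> \<in> borel_measurable borel"
  using \<rho> by (simp add: Lp_borel_iff borel_restrict_UNIV)

lemma \<rho>M [measurable]: "\<rho> \<in> borel_measurable M"
  by (rule borel_measurable_M[OF \<rho>b])

definition R where "R = (\<integral>\<^sup>+x. \<rho> x powe p \<partial>M)"

lemma R_finite: "R < top"
  using \<rho> by (simp add: Lp_borel_iff Lp_int_UNIV R_def)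

text \<open>Openness is what \<open>wug_glue\<close> asks for. The level set is included so that
  \<rho> is at most 2^j off \<open>E\<close> and may be truncated there.\<close>

definition adm :: "int \<Rightarrow> 'a set \<Rightarrow> bool" where
  "adm j E \<longleftrightarrow> open E \<and> {x. lev j < \<rho> x} \<subseteq> E \<and>
    (\<forall>i x y. x \<notin> E \<longrightarrow> y \<notin> E \<longrightarrow> \<bar>F i x - F i y\<bar> \<le> 2 powr real_of_int j * dist x y)"

definition mj :: "int \<Rightarrow> ennreal" where
  "mj j = (INF E\<in>{E. adm j E}. emeasure M E)"

text \<open>Summability over j is the goal: near-optimal sets \<open>E\<close> for all levels then
  combine into a pointwise gradient in L^p (\<open>hajlasz_family\<close>).\<close>

definition X :: "int \<Rightarrow> ennreal" where "X j = lev j powe p * mj j"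

definition Y :: "int \<Rightarrow> ennreal" where "Y j = lev j powe p * emeasure M {x. lev j < \<rho> x}"

lemma level_M [measurable]: "{x. lev j < \<rho> x} \<in> sets M"
proof -
  have "{x \<in> space M. lev j < \<rho> x} \<in> sets M" by measurable
  then show ?thesis by simp
qed

lemma mj_le:
  assumes E: "E \<in> sets M" and lip: "\<And>i x y. x \<notin> E \<Longrightarrow> y \<notin> E \<Longrightarrow> \<bar>F i x - F i y\<bar> \<le> 2 powr real_of_int j * dist x y"
  shows "mj j \<le> emeasure M E + emeasure M {x. lev j < \<rho> x}"
proof (rule ennreal_le_epsilon)
  fix e :: real assume e: "0 < e"
  have "E \<union> {x. lev j < \<rho> x} \<in> sets M" using E by auto
  then obtain U where U: "open U" "E \<union> {x. lev j < \<rho> x} \<subseteq> U" "emeasure M U \<le> emeasure M (E \<union> {x. lev j < \<rho> x}) + ennreal e"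
    by (rule outer_approx[OF _ e])
  have "adm j U" unfolding adm_def using U(1,2) by (intro conjI allI impI lip) auto
  then have "mj j \<le> emeasure M U" unfolding mj_def by (intro INF_lower) simp
  also note U(3)
  also have "emeasure M (E \<union> {x. lev j < \<rho> x}) \<le> emeasure M E + emeasure M {x. lev j < \<rho> x}"
    using E by (intro emeasure_subadditive) auto
  finally show "mj j \<le> emeasure M E + emeasure M {x. lev j < \<rho> x} + ennreal e" by (simp add: add_right_mono)
qed

lemma Y_le_R: "Y j \<le> R"
proof -
  have "Y j = (\<integral>\<^sup>+x. lev j powe p * indicator {x. lev j < \<rho> x} x \<partial>M)"
    unfolding Y_def by (rule nn_integral_cmult_indicator[symmetric]) (rule level_M)
  also have "\<dots> \<le> R"
    unfolding R_def using p0 by (intro nn_integral_mono) (auto split: split_indicator intro!: powe_mono)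
  finally show ?thesis .
qed

lemma isum_Y: "isum Y \<le> ennreal (geom_const p) * R"
proof -
  have "Y j = (\<integral>\<^sup>+x. lev j powe p * of_bool (lev j < \<rho> x) \<partial>M)" for j
    unfolding Y_def by (subst nn_integral_cmult_indicator[symmetric, OF level_M]) (auto intro!: nn_integral_cong split: split_indicator)
  then have "isum Y = (\<integral>\<^sup>+x. isum (\<lambda>j. lev j powe p * of_bool (lev j < \<rho> x)) \<partial>M)"
    by (subst nn_integral_isum) (auto simp: isum_def)
  also have "\<dots> \<le> (\<integral>\<^sup>+x. ennreal (geom_const p) * \<rho> x powe p \<partial>M)"
    by (intro nn_integral_mono isum_geom_le p0)
  also have "\<dots> = ennreal (geom_const p) * R"
    unfolding R_def by (rule nn_integral_cmult) measurable
  finally show ?thesis .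
qed

lemma lev_scale:
  assumes "\<tau> = 2 powr real_of_int j / K0"
  shows "lev j powe p = ennreal (K0 powr p) * ennreal (\<tau> powr p)"
proof -
  have "K0 * \<tau> = 2 powr real_of_int j" using assms K0 by simp
  then show ?thesis
    using K0 assms by (simp add: lev_def powe_ennreal ennreal_mult[symmetric] powr_mult[symmetric])
qed

text \<open>What Poincare and the maximal function of \<rho>^p give directly, with K0 * \<tau> =
  2^j: a bound for each level that does not decay in j. It makes the quantities finite, and it later
  controls the boundary terms of the summed recursion.\<close>

lemma X_weak: "X j \<le> ennreal W1 * R"
proof -
  define \<tau> where "\<tau> = 2 powr real_of_int j / K0"
  have \<tau>: "0 < \<tau>" using K0 by (simp add: \<tau>_def)
  have "AE x in M. \<forall>i. leb_point (F i) x"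
    unfolding AE_all_countable using AE_leb_point[OF Fm Fb] by blast
  then have N: "{x. \<not> (\<forall>i. leb_point (F i) x)} \<in> null_sets M" by (simp add: AE_M_iff)
  let ?L = "{x. ennreal (\<tau> powr p) < mf (\<lambda>x. \<rho> x powe p) x}"
  define E where "E = ?L \<union> {x. \<not> (\<forall>i. leb_point (F i) x)}"
  have LM: "?L \<in> sets M" by (rule open_M[OF open_mf_level])
  then have E: "E \<in> sets M" using N by (auto simp: E_def)
  have "mj j \<le> emeasure M E + emeasure M {x. lev j < \<rho> x}"
  proof (rule mj_le[OF E])
    fix i x y assume xy: "x \<notin> E" "y \<notin> E"
    have "\<bar>F i x - F i y\<bar> \<le> K0 * \<tau> * dist x y"
    proof (rule lipschitz_at_good_points[OF _ \<rho>b Fug _ _ \<tau>])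
      show "loc_int (F i)" by (rule loc_int_bounded_on_balls[OF Fm]) (use Fb in blast)
    qed (use xy in \<open>auto simp: E_def not_less\<close>)
    then show "\<bar>F i x - F i y\<bar> \<le> 2 powr real_of_int j * dist x y" using K0 by (simp add: \<tau>_def)
  qed
  also have "emeasure M E = emeasure M ?L"
    unfolding E_def by (rule emeasure_Un_null_set[OF LM N])
  finally have "X j \<le> lev j powe p * (emeasure M ?L + emeasure M {x. lev j < \<rho> x})"
    unfolding X_def by (rule mult_left_mono) simp
  also have "\<dots> = ennreal (K0 powr p) * (ennreal (\<tau> powr p) * emeasure M ?L) + Y j"
    by (simp add: distrib_left Y_def lev_scale[OF \<tau>_def] mult.assoc)
  also have "\<dots> \<le> ennreal (K0 powr p) * (ennreal (c ^ 2) * R) + R"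
    unfolding R_def using \<tau> by (intro add_mono mult_left_mono weak_type Y_le_R[unfolded R_def]) auto
  also have "\<dots> = ennreal W1 * R"
    using c K0 by (simp add: W1_def ennreal_plus ennreal_mult distrib_right distrib_left mult_ac)
  finally show ?thesis .
qed

lemma X_finite: "X j < top"
  using X_weak[of j] R_finite by (auto simp: ennreal_mult_less_top intro: order.strict_trans1)

text \<open>The Keith-Zhong step: off the sets \<open>E n\<close> every \<open>F i\<close> agrees with the average of its \<open>kk\<close> McShane
  extensions, whose weak upper gradient on \<open>E n\<close> gains a factor \<open>1 / kk\<close>.\<close>

lemma X_step:
  defines "I \<equiv> \<lambda>j. {j + int kk..<j + 2 * int kk}"
  assumes E: "\<And>n. n \<in> I j \<Longrightarrow> adm n (E n)"
  shows "X j \<le> ennreal (real kk powr - p * A1) * (\<Sum>n\<in>I j. lev n powe p * emeasure M (E n)) +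
    ennreal D1 * Y (j - int ll) + Y j"
proof -
  have fI: "finite (I j)" and cI: "card (I j) = kk" by (simp_all add: I_def)
  have k0: "0 < real kk" using kk(1) by simp
  define Z where "Z = (\<Sum>n\<in>I j. lev n powe p * emeasure M (E n))"
  have EM: "E n \<in> sets M" "E n \<in> sets borel" "open (E n)" if "n \<in> I j" for n
    using E[OF that] by (auto simp: adm_def intro: open_M)
  have ex: "\<exists>g. (\<forall>x. x \<notin> E n \<longrightarrow> g x = F i x) \<and> (\<forall>x y. \<bar>g x - g y\<bar> \<le> 2 powr real_of_int n * dist x y)" if "n \<in> I j" for i n
    by (rule mcshane[of "2 powr real_of_int n" "- E n" "F i"]) (use E[OF that] in \<open>auto simp: adm_def\<close>)
  then have "\<forall>i n. \<exists>g. n \<in> I j \<longrightarrow> (\<forall>x. x \<notin> E n \<longrightarrow> g x = F i x) \<and> (\<forall>x y. \<bar>g x - g y\<bar> \<le> 2 powr real_of_int n * dist x y)"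
    by blast
  then have "\<exists>f. \<forall>i n. n \<in> I j \<longrightarrow> (\<forall>x. x \<notin> E n \<longrightarrow> f i n x = F i x) \<and> (\<forall>x y. \<bar>f i n x - f i n y\<bar> \<le> 2 powr real_of_int n * dist x y)"
    by (simp only: choice_iff)
  then obtain f where f: "\<And>i n x. n \<in> I j \<Longrightarrow> x \<notin> E n \<Longrightarrow> f i n x = F i x"
    "\<And>i n x y. n \<in> I j \<Longrightarrow> \<bar>f i n x - f i n y\<bar> \<le> 2 powr real_of_int n * dist x y" by blast
  \<comment> \<open>\<open>T + S\<close> dominates the average of the glued gradients: off
    \<open>E n\<close> the function \<rho> is at most 2^n, hence survives the truncation in
    \<open>T\<close>, and on \<open>E n\<close> the McShane extension has constant 2^n, weighted by
    1 / kk.\<close>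
  define S where "S x = ennreal (1 / real kk) * (\<Sum>n\<in>I j. lev n * indicator (E n) x)" for x
  define T where "T x = \<rho> x * of_bool (\<rho> x \<le> lev (j + 2 * int kk))" for x
  define G where "G x = T x + S x" for x
  have Sb[measurable]: "S \<in> borel_measurable borel"
    unfolding S_def[abs_def] using EM(2) by (intro borel_measurable_times_ennreal borel_measurable_sum borel_measurable_const borel_measurable_indicator)
  have Tb[measurable]: "T \<in> borel_measurable borel"
    unfolding T_def[abs_def] using \<rho>b by measurable
  have Gb: "G \<in> borel_measurable borel" unfolding G_def[abs_def] by measurable
  define \<phi> where "\<phi> i x = (1 / real kk) *\<^sub>R (\<Sum>n\<in>I j. f i n x)" for i x
  have ug: "weak_upper_gradient p \<mu> UNIV (\<phi> i) G" for i
  proof (rule wug_mono)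
    show "weak_upper_gradient p \<mu> UNIV (\<phi> i) (\<lambda>x. ennreal \<bar>1 / real kk\<bar> * (\<Sum>n\<in>I j. \<rho> x * indicator (- E n) x + ennreal (2 powr real_of_int n) * indicator (E n) x))"
      unfolding \<phi>_def
    proof (intro wug_cmult wug_sum p0)
      fix n assume n: "n \<in> I j"
      show "weak_upper_gradient p \<mu> UNIV (f i n) (\<lambda>x. \<rho> x * indicator (- E n) x + ennreal (2 powr real_of_int n) * indicator (E n) x)"
        by (rule wug_glue[OF p0 EM(3)[OF n] _ f(2)[OF n] f(1)[OF n] Fug \<rho>]) auto
    qed
    show "G \<in> borel_measurable (restrict_space borel UNIV)" by (simp add: borel_restrict_UNIV Gb)
    fix x
    have "\<rho> x * indicator (- E n) x \<le> T x" if n: "n \<in> I j" for n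
    proof (cases "x \<in> E n")
      case False
      then have "\<not> lev n < \<rho> x" using E[OF n] by (auto simp: adm_def)
      then have "\<rho> x \<le> lev n" by simp
      also have "\<dots> \<le> lev (j + 2 * int kk)" using n by (intro lev_mono) (auto simp: I_def)
      finally show ?thesis by (simp add: T_def mult_right_le_one_le indicator_def)
    qed simp
    then have "(\<Sum>n\<in>I j. \<rho> x * indicator (- E n) x + ennreal (2 powr real_of_int n) * indicator (E n) x)
        \<le> (\<Sum>n\<in>I j. T x + lev n * indicator (E n) x)"
      by (intro sum_mono add_mono) (auto simp: lev_def)
    also have "\<dots> = of_nat kk * T x + (\<Sum>n\<in>I j. lev n * indicator (E n) x)"
      by (simp add: sum.distrib cI)
    finally have "ennreal (1 / real kk) * (\<Sum>n\<in>I j. \<rho> x * indicator (- E n) x + ennreal (2 powr real_of_int n) * indicator (E n) x)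
        \<le> ennreal (1 / real kk) * (of_nat kk * T x + (\<Sum>n\<in>I j. lev n * indicator (E n) x))"
      by (rule mult_left_mono) simp
    also have "\<dots> = (ennreal (1 / real kk) * of_nat kk) * T x + S x"
      by (simp add: S_def distrib_left mult.assoc)
    also have "ennreal (1 / real kk) * of_nat kk = 1"
      using k0 by (simp add: ennreal_of_nat_eq_real_of_nat ennreal_mult[symmetric])
    finally show "ennreal \<bar>1 / real kk\<bar> * (\<Sum>n\<in>I j. \<rho> x * indicator (- E n) x + ennreal (2 powr real_of_int n) * indicator (E n) x) \<le> G x"
      by (simp add: G_def)
  qed
  have \<phi>L: "\<bar>\<phi> i x - \<phi> i y\<bar> \<le> (1 / real kk * (\<Sum>n\<in>I j. 2 powr real_of_int n)) * dist x y" for i x y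
  proof -
    have "\<phi> i x - \<phi> i y = (1 / real kk) * (\<Sum>n\<in>I j. f i n x - f i n y)"
      by (simp add: \<phi>_def sum_subtractf right_diff_distrib)
    also have "\<bar>\<dots>\<bar> = (1 / real kk) * \<bar>\<Sum>n\<in>I j. f i n x - f i n y\<bar>" by (simp add: abs_mult)
    also have "\<dots> \<le> (1 / real kk) * (\<Sum>n\<in>I j. 2 powr real_of_int n * dist x y)"
      by (intro mult_left_mono order_trans[OF sum_abs] sum_mono f(2)) auto
    finally show ?thesis by (simp add: sum_distrib_right mult.assoc)
  qed
  note \<phi>r = lipschitz_regular[OF \<phi>L]
  define \<tau> where "\<tau> = 2 powr real_of_int j / K0"
  have \<tau>: "0 < \<tau>" using K0 by (simp add: \<tau>_def)
  \<comment> \<open>\<open>T\<close> without its small values. These are bounded, so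
    \<open>mf_mono_add\<close> moves them into the threshold; what is integrated lives on a level
    set that \<open>Y (j - int ll)\<close> measures.\<close>
  define V where "V x = \<rho> x * of_bool (lev (j - int ll) < \<rho> x \<and> \<rho> x \<le> lev (j + 2 * int kk))" for x
  define H where "H x = V x + S x" for x
  have Vb[measurable]: "V \<in> borel_measurable borel" unfolding V_def[abs_def] using \<rho>b by measurable
  have Hb[measurable]: "H \<in> borel_measurable borel" unfolding H_def[abs_def] by measurable
  note [measurable] = borel_measurable_M[OF Sb] borel_measurable_M[OF Vb] borel_measurable_M[OF Hb] borel_measurable_M[OF Gb]
  define h where "h x = ennreal (2 powr p) * H x powe p" for x
  have hM[measurable]: "h \<in> borel_measurable M" unfolding h_def[abs_def] by measurable
  have small: "ennreal (2 powr p) * lev (j - int ll) powe p \<le> ennreal (\<tau> powr p / 2)"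
  proof -
    have "2 powr p * 2 powr (real_of_int (j - int ll) * p) = 2 powr p * 2 powr (real_of_int j * p) / 2 powr (real ll * p)"
      by (simp add: left_diff_distrib powr_diff)
    also have "\<dots> \<le> 2 powr p * 2 powr (real_of_int j * p) / (2 * 2 powr p * K0 powr p)"
      using ll K0 by (intro divide_left_mono) (auto intro!: mult_pos_pos)
    also have "\<dots> = \<tau> powr p / 2" using K0 by (simp add: \<tau>_def powr_divide powr_powr)
    finally show ?thesis by (simp add: lev_powe ennreal_mult[symmetric] ennreal_leI)
  qed
  have Gh: "mf (\<lambda>x. G x powe p) x \<le> mf h x + ennreal (\<tau> powr p / 2)" for x
  proof (rule mf_mono_add)
    fix y
    have "T y \<le> lev (j - int ll) + V y"
      by (cases "lev (j - int ll) < \<rho> y") (auto simp: T_def V_def not_less intro: add_increasing2)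
    then have "G y \<le> H y + lev (j - int ll)" by (simp add: G_def H_def add_right_mono add_ac)
    then have "G y powe p \<le> (H y + lev (j - int ll)) powe p" using p0 by (intro powe_mono) auto
    also have "\<dots> \<le> ennreal (2 powr p) * (H y powe p + lev (j - int ll) powe p)" by (rule powe_add_le[OF p0])
    also have "\<dots> \<le> h y + ennreal (\<tau> powr p / 2)" unfolding h_def distrib_left by (intro add_left_mono small)
    finally show "G y powe p \<le> h y + ennreal (\<tau> powr p / 2)" .
  qed measurable
  define Bad where "Bad = {x. ennreal (\<tau> powr p / 2) < mf h x}"
  have BM: "Bad \<in> sets M" unfolding Bad_def by (rule open_M[OF open_mf_level])
  have UM: "(\<Union>n\<in>I j. E n) \<in> sets M" using EM(1) fI by (intro sets.finite_UN) auto
  have "mj j \<le> emeasure M ((\<Union>n\<in>I j. E n) \<union> Bad) + emeasure M {x. lev j < \<rho> x}"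
  proof (rule mj_le)
    show "(\<Union>n\<in>I j. E n) \<union> Bad \<in> sets M" using UM BM by auto
    fix i x y assume xy: "x \<notin> (\<Union>n\<in>I j. E n) \<union> Bad" "y \<notin> (\<Union>n\<in>I j. E n) \<union> Bad"
    have F\<phi>: "\<phi> i z = F i z" if "z \<notin> (\<Union>n\<in>I j. E n)" for z
    proof -
      have "(\<Sum>n\<in>I j. f i n z) = (\<Sum>n\<in>I j. F i z)" using that f(1) by (intro sum.cong) auto
      then show ?thesis using k0 by (simp add: \<phi>_def cI)
    qed
    have gd: "mf (\<lambda>x. G x powe p) z \<le> ennreal (\<tau> powr p)" if "z \<notin> Bad" for z
    proof -
      have "mf h z + ennreal (\<tau> powr p / 2) \<le> ennreal (\<tau> powr p / 2) + ennreal (\<tau> powr p / 2)"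
        using that by (intro add_right_mono) (simp add: Bad_def not_less)
      also have "\<dots> = ennreal (\<tau> powr p)" by (subst ennreal_plus[symmetric]) simp_all
      finally show ?thesis using Gh[of z] by (rule order_trans[rotated])
    qed
    \<comment> \<open>\<open>\<phi> i\<close> is Lipschitz, so every point is a Lebesgue point and
      only the open set \<open>Bad\<close> has to be removed.\<close>
    have "\<bar>\<phi> i x - \<phi> i y\<bar> \<le> K0 * \<tau> * dist x y"
      using xy by (intro lipschitz_at_good_points[OF \<phi>r(2) Gb ug leb_point_continuous[OF \<phi>r(2,1)] leb_point_continuous[OF \<phi>r(2,1)] \<tau>] gd) auto
    then show "\<bar>F i x - F i y\<bar> \<le> 2 powr real_of_int j * dist x y"
      using F\<phi>[of x] F\<phi>[of y] xy K0 by (simp add: \<tau>_def)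
  qed
  also have "emeasure M ((\<Union>n\<in>I j. E n) \<union> Bad) \<le> (\<Sum>n\<in>I j. emeasure M (E n)) + emeasure M Bad"
    using UM BM EM(1) fI by (intro order_trans[OF emeasure_subadditive] add_right_mono emeasure_subadditive_finite) auto
  finally have "X j \<le> lev j powe p * ((\<Sum>n\<in>I j. emeasure M (E n)) + emeasure M Bad + emeasure M {x. lev j < \<rho> x})"
    unfolding X_def by (simp add: mult_left_mono add_right_mono)
  then have X1: "X j \<le> (\<Sum>n\<in>I j. lev j powe p * emeasure M (E n)) + lev j powe p * emeasure M Bad + Y j"
    by (simp add: distrib_left sum_distrib_left Y_def)
  have kp: "ennreal (1 / real kk) powe p = ennreal (real kk powr - p)"
    using k0 by (simp add: powe_ennreal powr_divide powr_minus_divide)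
  have t1: "(\<Sum>n\<in>I j. lev j powe p * emeasure M (E n)) \<le> ennreal (real kk powr - p) * Z"
    unfolding Z_def sum_distrib_left
  proof (rule sum_mono)
    fix n assume n: "n \<in> I j"
    \<comment> \<open>Explains why the window starts at j + kk: with kk <= 2^kk, going up kk levels
      already yields the factor 1 / kk, so the sets \<open>E n\<close> also carry the gain
      kk^(-p).\<close>
    have "lev j \<le> ennreal (1 / real kk) * lev n"
    proof -
      have "real kk \<le> 2 ^ kk" using of_nat_less_two_power[of kk] by (metis less_imp_le of_nat_le_iff of_nat_numeral of_nat_power)
      then have "real kk \<le> 2 powr real kk" by (simp add: powr_realpow)
      then have "real kk * 2 powr real_of_int j \<le> 2 powr real kk * 2 powr real_of_int j" by (rule mult_right_mono) simp
      also have "\<dots> = 2 powr (real_of_int (j + int kk))" by (simp add: powr_add)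
      also have "\<dots> \<le> 2 powr real_of_int n" using n by (intro powr_mono) (auto simp: I_def)
      finally have "2 powr real_of_int j \<le> 1 / real kk * 2 powr real_of_int n" using k0 by (simp add: field_simps)
      then show ?thesis unfolding lev_def by (subst ennreal_mult[symmetric]) (auto intro: ennreal_leI)
    qed
    then have "lev j powe p \<le> ennreal (real kk powr - p) * lev n powe p"
      using powe_mono[of "lev j" _ p] p0 unfolding kp[symmetric] powe_mult[symmetric] by simp
    then show "lev j powe p * emeasure M (E n) \<le> ennreal (real kk powr - p) * (lev n powe p * emeasure M (E n))"
      by (simp add: mult_right_mono mult.assoc[symmetric])
  qed
  have IV: "(\<integral>\<^sup>+x. V x powe p \<partial>M) \<le> ennreal (2 powr (real (2 * kk + ll) * p)) * Y (j - int ll)"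
  proof -
    have "(\<integral>\<^sup>+x. V x powe p \<partial>M) \<le> (\<integral>\<^sup>+x. lev (j + 2 * int kk) powe p * indicator {x. lev (j - int ll) < \<rho> x} x \<partial>M)"
      using p0 by (intro nn_integral_mono) (auto simp: V_def split: split_indicator intro!: powe_mono)
    also have "\<dots> = lev (j + 2 * int kk) powe p * emeasure M {x. lev (j - int ll) < \<rho> x}"
      by (rule nn_integral_cmult_indicator) (rule level_M)
    also have "lev (j + 2 * int kk) powe p = ennreal (2 powr (real (2 * kk + ll) * p)) * lev (j - int ll) powe p"
      using lev_powe_shift[of "j - int ll" "2 * int kk + int ll" p] by simp
    finally show ?thesis by (simp add: Y_def mult.assoc)
  qed
  \<comment> \<open>The levels in \<open>S\<close> are distinct powers of 2, so the p-th power of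
    their sum costs 2^p whatever kk is, while the average contributes kk^(-p).\<close>
  have IS: "(\<integral>\<^sup>+x. S x powe p \<partial>M) \<le> ennreal (real kk powr - p * 2 powr p) * Z"
  proof -
    have "(\<integral>\<^sup>+x. S x powe p \<partial>M) \<le> (\<integral>\<^sup>+x. ennreal (real kk powr - p) * (ennreal (2 powr p) * (\<Sum>n\<in>I j. lev n powe p * indicator (E n) x)) \<partial>M)"
      unfolding S_def powe_mult kp by (intro nn_integral_mono mult_left_mono sum_lev_powe_le fI p0) simp
    also have "\<dots> = ennreal (real kk powr - p) * (ennreal (2 powr p) * (\<integral>\<^sup>+x. (\<Sum>n\<in>I j. lev n powe p * indicator (E n) x) \<partial>M))"
    proof -
      have 2: "(\<lambda>x. \<Sum>n\<in>I j. lev n powe p * indicator (E n) x) \<in> borel_measurable M"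
        using EM(1) by (intro borel_measurable_sum borel_measurable_times_ennreal borel_measurable_const borel_measurable_indicator)
      have 1: "(\<lambda>x. ennreal (2 powr p) * (\<Sum>n\<in>I j. lev n powe p * indicator (E n) x)) \<in> borel_measurable M"
        by (intro borel_measurable_times_ennreal borel_measurable_const 2)
      show ?thesis by (subst nn_integral_cmult[OF 1], subst nn_integral_cmult[OF 2]) (rule refl)
    qed
    also have "(\<integral>\<^sup>+x. (\<Sum>n\<in>I j. lev n powe p * indicator (E n) x) \<partial>M) = Z"
      unfolding Z_def using EM(1) by (subst nn_integral_sum) (auto simp: nn_integral_cmult_indicator intro!: sum.cong)
    finally show ?thesis by (simp add: ennreal_mult mult.assoc)
  qed
  have IH: "(\<integral>\<^sup>+x. h x \<partial>M) \<le> ennreal (4 powr p) * (ennreal (2 powr (real (2 * kk + ll) * p)) * Y (j - int ll) + ennreal (real kk powr - p * 2 powr p) * Z)"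
  proof -
    have "(\<integral>\<^sup>+x. h x \<partial>M) = ennreal (2 powr p) * (\<integral>\<^sup>+x. H x powe p \<partial>M)"
      unfolding h_def by (rule nn_integral_cmult) measurable
    also have "(\<integral>\<^sup>+x. H x powe p \<partial>M) \<le> (\<integral>\<^sup>+x. ennreal (2 powr p) * (V x powe p + S x powe p) \<partial>M)"
      unfolding H_def by (intro nn_integral_mono powe_add_le p0)
    also have "\<dots> = ennreal (2 powr p) * ((\<integral>\<^sup>+x. V x powe p \<partial>M) + (\<integral>\<^sup>+x. S x powe p \<partial>M))"
      by (subst nn_integral_cmult, measurable) (subst nn_integral_add, measurable)
    also have "ennreal (2 powr p) * (ennreal (2 powr p) * ((\<integral>\<^sup>+x. V x powe p \<partial>M) + (\<integral>\<^sup>+x. S x powe p \<partial>M)))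
      \<le> ennreal (2 powr p) * (ennreal (2 powr p) * (ennreal (2 powr (real (2 * kk + ll) * p)) * Y (j - int ll) + ennreal (real kk powr - p * 2 powr p) * Z))"
      by (intro mult_left_mono add_mono IV IS) auto
    also have "\<dots> = ennreal (4 powr p) * (ennreal (2 powr (real (2 * kk + ll) * p)) * Y (j - int ll) + ennreal (real kk powr - p * 2 powr p) * Z)"
      by (simp add: mult.assoc[symmetric] ennreal_mult[symmetric] powr_mult[symmetric])
    finally show ?thesis by (simp add: mult_left_mono)
  qed
  have t2: "lev j powe p * emeasure M Bad \<le> ennreal D1 * Y (j - int ll) + ennreal (real kk powr - p * (A1 - 1)) * Z"
  proof -
    have "lev j powe p * emeasure M Bad = ennreal (2 * K0 powr p) * (ennreal (\<tau> powr p / 2) * emeasure M Bad)"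
      by (simp add: lev_scale[OF \<tau>_def] mult.assoc[symmetric] ennreal_mult[symmetric])
    also have "\<dots> \<le> ennreal (2 * K0 powr p) * (ennreal (c ^ 2) * (\<integral>\<^sup>+x. h x \<partial>M))"
      unfolding Bad_def using \<tau> by (intro mult_left_mono weak_type hM) auto
    also have "\<dots> \<le> ennreal (2 * K0 powr p) * (ennreal (c ^ 2) * (ennreal (4 powr p) * (ennreal (2 powr (real (2 * kk + ll) * p)) * Y (j - int ll) + ennreal (real kk powr - p * 2 powr p) * Z)))"
      by (intro mult_left_mono IH) auto
    also have "\<dots> = ennreal (2 * K0 powr p) * (ennreal (c ^ 2) * (ennreal (4 powr p) * (ennreal (2 powr (real (2 * kk + ll) * p)) * Y (j - int ll)))) +
      ennreal (2 * K0 powr p) * (ennreal (c ^ 2) * (ennreal (4 powr p) * (ennreal (real kk powr - p * 2 powr p) * Z)))"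
      by (simp add: distrib_left)
    also have "ennreal (2 * K0 powr p) * (ennreal (c ^ 2) * (ennreal (4 powr p) * (ennreal (2 powr (real (2 * kk + ll) * p)) * Y (j - int ll)))) = ennreal D1 * Y (j - int ll)"
      unfolding D1_def by (subst ennreal_mult4) (auto simp: mult_ac)
    also have "ennreal (2 * K0 powr p) * (ennreal (c ^ 2) * (ennreal (4 powr p) * (ennreal (real kk powr - p * 2 powr p) * Z))) = ennreal (real kk powr - p * (A1 - 1)) * Z"
    proof -
      have "8 powr p = 4 powr p * (2::real) powr p" by (simp flip: powr_mult)
      then have eq: "2 * K0 powr p * c ^ 2 * 4 powr p * (real kk powr - p * 2 powr p) = real kk powr - p * (A1 - 1)"
        by (simp add: A1_def mult_ac)
      show ?thesis
        unfolding eq[symmetric] by (rule ennreal_mult4) auto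
    qed
    finally show ?thesis .
  qed
  have "X j \<le> ennreal (real kk powr - p) * Z + (ennreal D1 * Y (j - int ll) + ennreal (real kk powr - p * (A1 - 1)) * Z) + Y j"
    by (rule order_trans[OF X1]) (intro add_mono t1 t2 order_refl)
  also have "\<dots> = (ennreal (real kk powr - p) + ennreal (real kk powr - p * (A1 - 1))) * Z + ennreal D1 * Y (j - int ll) + Y j"
    by (simp add: distrib_right add_ac)
  also have "ennreal (real kk powr - p) + ennreal (real kk powr - p * (A1 - 1)) = ennreal (real kk powr - p * A1)"
  proof -
    have "real kk powr - p + real kk powr - p * (A1 - 1) = real kk powr - p * A1" by (simp add: algebra_simps)
    then show ?thesis using const_nonneg(1) by (subst ennreal_plus[symmetric]) simp_all
  qed
  finally show ?thesis unfolding Z_def .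
qed

lemma near_optimal:
  assumes \<delta>: "0 < \<delta>"
  shows "\<exists>E. adm n E \<and> lev n powe p * emeasure M E \<le> X n + ennreal \<delta>"
proof -
  have l: "lev n powe p \<noteq> 0" "lev n powe p \<noteq> top"
    using lev_pos[of n] lev_finite[of n] by (simp_all add: powe_eq_0_iff del: lev_pos lev_finite)
  have "lev n powe p * mj n \<noteq> top" using X_finite[of n] by (simp add: X_def)
  then have "mj n \<noteq> top" using l by (auto simp: ennreal_mult_top)
  moreover have "0 < ennreal \<delta> / lev n powe p" using \<delta> l by (simp add: ennreal_zero_less_divide)
  ultimately have "mj n < mj n + ennreal \<delta> / lev n powe p"
    using ennreal_add_left_cancel_less[of "mj n" 0 "ennreal \<delta> / lev n powe p"] by simp
  then obtain E where E: "adm n E" "emeasure M E < mj n + ennreal \<delta> / lev n powe p"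
    by (subst (asm) (1) mj_def) (auto simp: INF_less_iff)
  have "lev n powe p * emeasure M E \<le> lev n powe p * (mj n + ennreal \<delta> / lev n powe p)"
    using E(2) by (intro mult_left_mono) auto
  also have "\<dots> = X n + ennreal \<delta> / lev n powe p * lev n powe p"
    by (simp add: distrib_left X_def mult.commute)
  also have "\<dots> = X n + ennreal \<delta>" using l by (simp add: ennreal_divide_mult_self)
  finally show ?thesis using E(1) by blast
qed

lemma X_recursion:
  "X j \<le> ennreal (real kk powr - p * A1) * (\<Sum>n\<in>{j + int kk..<j + 2 * int kk}. X n) + ennreal D1 * Y (j - int ll) + Y j"
proof (rule ennreal_le_epsilon)
  fix e :: real assume e: "0 < e"
  define K where "K = real kk powr - p * A1"
  have K: "0 < K" using kk(1) const_nonneg(1) by (simp add: K_def)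
  have k0: "0 < real kk" using kk(1) by simp
  define \<delta> where "\<delta> = e / (K * real kk)"
  have \<delta>: "0 < \<delta>" using e K k0 by (simp add: \<delta>_def)
  obtain E where E: "\<And>n. adm n (E n)" "\<And>n. lev n powe p * emeasure M (E n) \<le> X n + ennreal \<delta>"
    using near_optimal[OF \<delta>] by metis
  let ?I = "{j + int kk..<j + 2 * int kk}"
  have "(\<Sum>n\<in>?I. lev n powe p * emeasure M (E n)) \<le> (\<Sum>n\<in>?I. X n + ennreal \<delta>)"
    by (intro sum_mono E)
  also have "\<dots> = (\<Sum>n\<in>?I. X n) + ennreal (real kk * \<delta>)"
    using \<delta> by (simp add: sum.distrib ennreal_mult ennreal_of_nat_eq_real_of_nat)
  finally have "ennreal K * (\<Sum>n\<in>?I. lev n powe p * emeasure M (E n)) \<le> ennreal K * ((\<Sum>n\<in>?I. X n) + ennreal (real kk * \<delta>))"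
    by (rule mult_left_mono) simp
  also have "\<dots> = ennreal K * (\<Sum>n\<in>?I. X n) + ennreal e"
  proof -
    have "K * (real kk * \<delta>) = e" using K k0 by (simp add: \<delta>_def)
    then have "ennreal K * ennreal (real kk * \<delta>) = ennreal e" using K k0 \<delta> by (subst ennreal_mult[symmetric]) auto
    then show ?thesis by (simp add: distrib_left)
  qed
  finally have s: "ennreal K * (\<Sum>n\<in>?I. lev n powe p * emeasure M (E n)) \<le> ennreal K * (\<Sum>n\<in>?I. X n) + ennreal e" .
  have "X j \<le> ennreal K * (\<Sum>n\<in>?I. lev n powe p * emeasure M (E n)) + ennreal D1 * Y (j - int ll) + Y j"
    unfolding K_def by (rule X_step) (rule E(1))
  also have "\<dots> \<le> ennreal K * (\<Sum>n\<in>?I. X n) + ennreal e + ennreal D1 * Y (j - int ll) + Y j"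
    by (intro add_right_mono s)
  finally show "X j \<le> ennreal (real kk powr - p * A1) * (\<Sum>n\<in>?I. X n) + ennreal D1 * Y (j - int ll) + Y j + ennreal e"
    by (simp add: K_def add_ac)
qed

text \<open>Sum the recursion over -N <= j <= N. Each \<open>X n\<close> occurs in at most kk
  windows, so the sum \<open>T\<close> returns with coefficient at most 1/2 and is absorbed; the
  levels above N are handled by \<open>X_weak\<close>. The bound is independent of N.\<close>

lemma isum_X: "isum X \<le> ennreal C1 * R"
proof (rule isum_le)
  fix F' :: "int set" assume F': "finite F'"
  obtain N :: nat where N: "F' \<subseteq> {- int N..int N}"
  proof -
    define m where "m = Max (insert 0 (abs ` F'))"
    have m: "0 \<le> m" "\<And>x. x \<in> F' \<Longrightarrow> \<bar>x\<bar> \<le> m" using F' by (auto simp: m_def intro: Max_ge)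
    have "F' \<subseteq> {- int (nat m)..int (nat m)}"
    proof
      fix x assume "x \<in> F'"
      then show "x \<in> {- int (nat m)..int (nat m)}" using m(1) m(2)[of x] by auto
    qed
    then show ?thesis by (rule that)
  qed
  let ?J = "{- int N..int N}"
  define T where "T = sum X ?J"
  have T: "T < top" unfolding T_def by (simp add: X_finite)
  define K where "K = real kk powr - p * A1"
  have K0': "0 \<le> K" using const_nonneg(1) by (simp add: K_def)
  have K: "K * real kk \<le> 1 / 2"
  proof -
    have "real kk powr (1 - p) = real kk * real kk powr - p"
      using kk(1) powr_add[of "real kk" 1 "- p"] by simp
    then show ?thesis using kk(2) by (simp add: K_def mult_ac)
  qed
  let ?I = "\<lambda>j. {j + int kk..<j + 2 * int kk}"
  have YJ: "(\<Sum>j\<in>?J. Y (j - int ll)) \<le> isum Y"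
  proof -
    have "(\<Sum>j\<in>?J. Y (j - int ll)) = sum Y ((\<lambda>j. j - int ll) ` ?J)"
      by (subst sum.reindex) (auto simp: inj_on_def)
    also have "\<dots> \<le> isum Y" by (rule isum_ge_sum) simp
    finally show ?thesis .
  qed
  \<comment> \<open>Exchange the sums. A shift by kk + i with i < kk moves the range up by less than
    2 kk, so at most 2 kk levels fall outside.\<close>
  have XI: "(\<Sum>j\<in>?J. sum X (?I j)) \<le> of_nat kk * (T + of_nat (2 * kk) * (ennreal W1 * R))"
  proof -
    have "sum X (?I j) = (\<Sum>i<kk. X (j + int kk + int i))" for j
      by (rule sum.reindex_bij_witness[of _ "\<lambda>i. j + int kk + int i" "\<lambda>n. nat (n - j - int kk)"]) auto
    then have "(\<Sum>j\<in>?J. sum X (?I j)) = (\<Sum>i<kk. \<Sum>j\<in>?J. X (j + int kk + int i))"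
      by (simp add: sum.swap[of _ "{..<kk}"])
    also have "\<dots> \<le> (\<Sum>i<kk. T + of_nat (2 * kk) * (ennreal W1 * R))"
    proof (rule sum_mono)
      fix i assume i: "i \<in> {..<kk}"
      have "(\<Sum>j\<in>?J. X (j + int kk + int i)) = sum X ((\<lambda>j. j + int kk + int i) ` ?J)"
        by (subst sum.reindex) (auto simp: inj_on_def)
      also have "\<dots> \<le> sum X (?J \<union> {int N + 1..int N + 2 * int kk})"
        using i by (intro sum_mono2) auto
      also have "\<dots> = T + sum X {int N + 1..int N + 2 * int kk}"
        unfolding T_def by (rule sum.union_disjoint) auto
      also have "sum X {int N + 1..int N + 2 * int kk} \<le> of_nat (card {int N + 1..int N + 2 * int kk}) * (ennreal W1 * R)"
        by (rule sum_bounded_above) (rule X_weak)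
      also have "card {int N + 1..int N + 2 * int kk} = 2 * kk" by simp
      finally show "(\<Sum>j\<in>?J. X (j + int kk + int i)) \<le> T + of_nat (2 * kk) * (ennreal W1 * R)"
        by (simp add: add_left_mono)
    qed
    also have "\<dots> = of_nat kk * (T + of_nat (2 * kk) * (ennreal W1 * R))" by simp
    finally show ?thesis .
  qed
  have "T \<le> (\<Sum>j\<in>?J. ennreal K * sum X (?I j) + ennreal D1 * Y (j - int ll) + Y j)"
    unfolding T_def K_def by (intro sum_mono X_recursion)
  also have "\<dots> = ennreal K * (\<Sum>j\<in>?J. sum X (?I j)) + ennreal D1 * (\<Sum>j\<in>?J. Y (j - int ll)) + sum Y ?J"
    by (simp add: sum.distrib sum_distrib_left)
  also have "\<dots> \<le> ennreal K * (of_nat kk * (T + of_nat (2 * kk) * (ennreal W1 * R))) + ennreal D1 * isum Y + isum Y"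
    by (intro add_mono mult_left_mono XI YJ isum_ge_sum) auto
  also have "ennreal K * (of_nat kk * (T + of_nat (2 * kk) * (ennreal W1 * R))) \<le> ennreal (1/2) * (T + of_nat (2 * kk) * (ennreal W1 * R))"
  proof -
    have "ennreal K * of_nat kk \<le> ennreal (1/2)"
      using K K0' by (simp add: ennreal_of_nat_eq_real_of_nat ennreal_mult[symmetric] ennreal_leI del: ennreal_half)
    then show ?thesis unfolding mult.assoc[symmetric] by (rule mult_right_mono) simp
  qed
  also have "ennreal (1/2) * (T + of_nat (2 * kk) * (ennreal W1 * R)) = ennreal (1/2) * T + ennreal (real kk * W1) * R"
  proof -
    have "ennreal (1/2) * (of_nat (2 * kk) * (ennreal W1 * R)) = ennreal (1/2 * real (2 * kk) * W1) * R"
      unfolding ennreal_of_nat_eq_real_of_nat by (rule ennreal_mult3) (use const_nonneg(3) in auto)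
    also have "1/2 * real (2 * kk) * W1 = real kk * W1" by simp
    finally show ?thesis by (simp only: distrib_left)
  qed
  finally have "T \<le> ennreal (1/2) * T + (ennreal (real kk * W1) * R + (ennreal D1 * isum Y + isum Y))"
    by (simp add: add_ac add_right_mono)
  also have "ennreal D1 * isum Y + isum Y = ennreal (D1 + 1) * isum Y"
    using const_nonneg(2) by (simp add: ennreal_plus distrib_right)
  also have "ennreal (1/2) * T + (ennreal (real kk * W1) * R + ennreal (D1 + 1) * isum Y)
    \<le> ennreal (1/2) * T + (ennreal (real kk * W1) * R + ennreal (D1 + 1) * (ennreal (geom_const p) * R))"
    by (intro add_left_mono mult_left_mono isum_Y) auto
  finally have "T \<le> 2 * (ennreal (real kk * W1) * R + ennreal (D1 + 1) * (ennreal (geom_const p) * R))"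
    using T by (rule ennreal_absorb_half)
  also have "\<dots> = ennreal C1 * R"
  proof -
    have "ennreal (real kk * W1) * R + ennreal (D1 + 1) * (ennreal (geom_const p) * R) = ennreal (real kk * W1 + (D1 + 1) * geom_const p) * R"
      using const_nonneg geom_const_pos[OF p0] by (simp add: ennreal_plus ennreal_mult distrib_right mult.assoc)
    moreover have "ennreal C1 = 2 * ennreal (real kk * W1 + (D1 + 1) * geom_const p)"
      using const_nonneg geom_const_pos[OF p0] unfolding C1_def by (subst ennreal_mult) auto
    ultimately show ?thesis by (simp add: mult.assoc)
  qed
  finally have "T \<le> ennreal C1 * R" .
  moreover have "sum X F' \<le> T" unfolding T_def using N by (intro sum_mono2) auto
  ultimately show "sum X F' \<le> ennreal C1 * R" by (rule order_trans[rotated])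
qed

end

section \<open>From exceptional sets to a pointwise gradient\<close>

context kz
begin

text \<open>\<open>g\<close> is the supremum of 2^(j+1) over the near-optimal sets containing the
  point, with the error e shared out along \<open>int_encode\<close>. If g is below 2^(j+1) at x and
  y, both lie outside \<open>E j\<close>, where the family is 2^j-Lipschitz; choose j with 2^j <=
  max (g x) (g y) < 2^(j+1). If both values vanish, let j tend to minus infinity.\<close>

lemma hajlasz_family:
  assumes e: "0 < e"
  obtains g where "g \<in> borel_measurable borel"
    "(\<integral>\<^sup>+x. g x powe p \<partial>M) \<le> ennreal (2 powr p) * (ennreal C1 * R + ennreal e)"
    "\<And>i x y. ennreal \<bar>F i x - F i y\<bar> \<le> ennreal (dist x y) * max (g x) (g y)"
proof -
  have "\<exists>E. adm j E \<and> lev j powe p * emeasure M E \<le> X j + ennreal (e * (1/2) ^ Suc (int_encode j))" for j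
    by (rule near_optimal) (use e in simp)
  then obtain E where E: "\<And>j. adm j (E j)"
    "\<And>j. lev j powe p * emeasure M (E j) \<le> X j + ennreal (e * (1/2) ^ Suc (int_encode j))" by metis
  have EM: "E j \<in> sets M" "E j \<in> sets borel" for j
    using E(1)[of j] by (auto simp: adm_def intro: open_M)
  define g where "g x = (SUP j. lev (j + 1) * indicator (E j) x)" for x
  have gb: "g \<in> borel_measurable borel"
    unfolding g_def[abs_def] using EM(2)
    by (intro borel_measurable_SUP borel_measurable_times_ennreal borel_measurable_const borel_measurable_indicator) auto
  have gp: "g x powe p \<le> isum (\<lambda>j. lev (j + 1) powe p * indicator (E j) x)" for x
  proof -
    let ?S = "isum (\<lambda>j. lev (j + 1) powe p * indicator (E j) x)"
    have "lev (j + 1) * indicator (E j) x \<le> ?S powe (1 / p)" for j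
    proof -
      have "(lev (j + 1) * indicator (E j) x) powe p = lev (j + 1) powe p * indicator (E j) x"
        by (simp split: split_indicator)
      also have "\<dots> \<le> ?S" by (rule isum_ge)
      also have "\<dots> = (?S powe (1 / p)) powe p" using p0 by (simp add: powe_inverse_powe)
      finally show ?thesis using powe_le_iff[OF p0] by blast
    qed
    then have "g x \<le> ?S powe (1 / p)" unfolding g_def by (intro SUP_least)
    then have "g x powe p \<le> (?S powe (1 / p)) powe p" using p0 by (intro powe_mono) auto
    then show ?thesis using p0 by (simp add: powe_inverse_powe)
  qed
  have "(\<integral>\<^sup>+x. g x powe p \<partial>M) \<le> (\<integral>\<^sup>+x. isum (\<lambda>j. lev (j + 1) powe p * indicator (E j) x) \<partial>M)"
    by (intro nn_integral_mono gp)
  also have "\<dots> = isum (\<lambda>j. \<integral>\<^sup>+x. lev (j + 1) powe p * indicator (E j) x \<partial>M)"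
    using EM(1) by (intro nn_integral_isum borel_measurable_times_ennreal borel_measurable_const borel_measurable_indicator)
  also have "\<dots> \<le> isum (\<lambda>j. ennreal (2 powr p) * (X j + ennreal (e * (1/2) ^ Suc (int_encode j))))"
  proof (rule isum_mono)
    fix j
    have "(\<integral>\<^sup>+x. lev (j + 1) powe p * indicator (E j) x \<partial>M) = lev (j + 1) powe p * emeasure M (E j)"
      by (rule nn_integral_cmult_indicator) (rule EM)
    also have "\<dots> = ennreal (2 powr p) * (lev j powe p * emeasure M (E j))"
      using lev_powe_shift[of j 1 p] by (simp add: mult.assoc)
    also have "\<dots> \<le> ennreal (2 powr p) * (X j + ennreal (e * (1/2) ^ Suc (int_encode j)))"
      by (intro mult_left_mono E) simp
    finally show "(\<integral>\<^sup>+x. lev (j + 1) powe p * indicator (E j) x \<partial>M) \<le> ennreal (2 powr p) * (X j + ennreal (e * (1/2) ^ Suc (int_encode j)))" .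
  qed
  also have "\<dots> = ennreal (2 powr p) * (isum X + isum (\<lambda>j. ennreal (e * (1/2) ^ Suc (int_encode j))))"
    by (simp only: isum_cmult isum_add)
  also have "isum (\<lambda>j. ennreal (e * (1/2) ^ Suc (int_encode j))) = ennreal e"
  proof -
    have "ennreal (e * (1/2) ^ Suc n) = ennreal e * ennreal ((1/2) ^ Suc n)" for n
      using e by (intro ennreal_mult) auto
    then have "isum (\<lambda>j. ennreal (e * (1/2) ^ Suc (int_encode j))) = (\<Sum>n. ennreal e * ennreal ((1/2) ^ Suc n))"
      unfolding isum_def by (simp only: int_decode_inverse)
    then show ?thesis by (simp only: ennreal_suminf_cmult suminf_ennreal_half mult_1_right)
  qed
  also have "ennreal (2 powr p) * (isum X + ennreal e) \<le> ennreal (2 powr p) * (ennreal C1 * R + ennreal e)"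
    by (intro mult_left_mono add_right_mono isum_X) simp
  finally have int: "(\<integral>\<^sup>+x. g x powe p \<partial>M) \<le> ennreal (2 powr p) * (ennreal C1 * R + ennreal e)" .
  have "ennreal \<bar>F i x - F i y\<bar> \<le> ennreal (dist x y) * max (g x) (g y)" for i x y
  proof (cases "x = y")
    case False
    have out: "\<bar>F i x - F i y\<bar> \<le> 2 powr real_of_int j * dist x y" if "max (g x) (g y) < lev (j + 1)" for j
    proof -
      have "z \<notin> E j" if "g z < lev (j + 1)" for z
      proof
        assume "z \<in> E j"
        then have "lev (j + 1) \<le> g z" unfolding g_def by (intro SUP_upper2[of j]) auto
        then show False using \<open>g z < lev (j + 1)\<close> by simp
      qed
      then show ?thesis using E(1)[of j] that unfolding adm_def by simp
    qed
    show ?thesis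
    proof (cases "max (g x) (g y)")
      case (real v)
      show ?thesis
      proof (cases "v = 0")
        case True
        have "\<bar>F i x - F i y\<bar> \<le> 0 + e'" if e': "0 < e'" for e'
        proof -
          obtain n :: nat where n: "(1/2) ^ n < e' / dist x y" 
            using real_arch_pow_inv[of "e' / dist x y" "1/2"] e' False by auto
          have "\<bar>F i x - F i y\<bar> \<le> 2 powr real_of_int (- int n) * dist x y"
            using real True by (intro out) simp
          also have "2 powr real_of_int (- int n) = (1/2) ^ n"
            by (simp add: powr_minus powr_realpow inverse_eq_divide power_divide)
          also have "(1/2) ^ n * dist x y \<le> e'" using n False by (simp add: field_simps)
          finally show ?thesis by simp
        qed
        then have "\<bar>F i x - F i y\<bar> \<le> 0" by (rule field_le_epsilon)
        then show ?thesis by simp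
      next
        case False
        then have v: "0 < v" using real by simp
        define j where "j = \<lfloor>log 2 v\<rfloor>"
        have "real_of_int j \<le> log 2 v" "log 2 v < real_of_int (j + 1)" unfolding j_def by linarith+
        then have j: "2 powr real_of_int j \<le> v" "v < 2 powr real_of_int (j + 1)"
          using v by (simp_all add: le_log_iff log_less_iff)
        have "\<bar>F i x - F i y\<bar> \<le> 2 powr real_of_int j * dist x y"
          using j(2) real v by (intro out) (simp add: lev_def ennreal_less_iff)
        also have "\<dots> \<le> v * dist x y" using j(1) by (rule mult_right_mono) simp
        finally have "ennreal \<bar>F i x - F i y\<bar> \<le> ennreal (dist x y * v)" by (simp add: ennreal_leI mult.commute)
        then show ?thesis using real by (simp add: ennreal_mult)
      qed
    next
      case top
      then show ?thesis using False by (simp add: ennreal_mult_top)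
    qed
  qed simp
  with gb int show ?thesis by (rule that)
qed

end

context poincare_mms
begin

definition CH where "CH = 2 * (C1 + 1)"

lemma CH: "0 < CH" using const_nonneg(4) by (simp add: CH_def)

lemma restrict_M_UNIV [simp]: "measure_on \<mu> UNIV = M"
proof (rule measure_eqI)
  have U: "UNIV \<in> sets M" using sets.top[of M] by simp
  then show "sets (measure_on \<mu> UNIV) = sets M"
    by (auto simp: sets_restrict_space)
  show "emeasure (measure_on \<mu> UNIV) A = emeasure M A" if "A \<in> sets (measure_on \<mu> UNIV)" for A
    using that U by (subst emeasure_restrict_space) auto
qed

text \<open>Index pairs (i, n) enumerate the distances of h' to a dense sequence, capped at n; 0
  joins the sequence to keep it nonempty. For given x and y, take \<open>d i\<close> close to
  \<open>h' y\<close> and a cap that is inactive at both points: the norm of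
  \<open>h' x - h' y\<close> is at most the difference of this one function plus twice the distance
  of \<open>h' y\<close> to \<open>d i\<close>.\<close>

lemma hajlasz:
  fixes h :: "'a \<Rightarrow> 'b::real_normed_vector"
  assumes h: "sob_gauge p UNIV h K" and K: "0 < K"
  obtains g N where "g \<in> borel_measurable borel" "(\<integral>\<^sup>+x. g x powe p \<partial>M) \<le> ennreal ((CH * K) powr p)"
    "N \<in> null_sets M" "\<And>x y. x \<notin> N \<Longrightarrow> y \<notin> N \<Longrightarrow> ennreal (norm (h x - h y)) \<le> ennreal (dist x y) * max (g x) (g y)"
proof -
  have U: "UNIV \<in> sets M" using sets.top[of M] by simp
  obtain h' \<rho> where h': "measurable_map \<mu> UNIV h" "Lp_int p \<mu> UNIV (\<lambda>x. ennreal (norm (h x))) \<le> ennreal (K powr p)"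
    "AE x in measure_on \<mu> UNIV. h' x = h x" "weak_upper_gradient p \<mu> UNIV h' \<rho>" "Lp_int p \<mu> UNIV \<rho> \<le> ennreal (K powr p)"
    "\<rho> \<in> borel_measurable (restrict_space borel UNIV)" "\<rho> \<in> Lp_borel p \<mu> UNIV"
    using h by (rule sob_gaugeE) (rule that)
  have mh: "measurable_map \<mu> UNIV h'" by (rule measurable_map_cong_AE[OF U h'(1,3)])
  then obtain D where D: "countable D" "AE x in measure_on \<mu> UNIV. h' x \<in> closure D"
    unfolding measurable_map_iff[OF U] by blast
  define N where "N = {x. \<not> (h' x = h x \<and> h' x \<in> closure D)}"
  have "AE x in M. h' x = h x \<and> h' x \<in> closure D" using h'(3) D(2) unfolding restrict_M_UNIV by eventually_elim simp
  then have N: "N \<in> null_sets M" unfolding N_def by (rule AE_M_iff[THEN iffD1])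
  define d where "d = from_nat_into (insert 0 D)"
  have rd: "range d = insert 0 D" unfolding d_def using D(1) by (intro range_from_nat_into) auto
  define F where "F k x = min (norm (h' x - d (fst (prod_decode k)))) (real (snd (prod_decode k)))" for k x
  have lip: "norm (min (norm (v - a)) b - min (norm (w - a)) b) \<le> norm (v - w)" for v w a :: 'b and b :: real
    using norm_triangle_ineq3[of "v - a" "w - a"] by (auto simp: min_def abs_le_iff)
  interpret kz \<mu> c p CP \<Lambda> F "\<lambda>k. real (snd (prod_decode k))" \<rho>
  proof
    show "F i \<in> borel_measurable M" for i
    proof -
      have "(\<lambda>x. norm (h' x - d (fst (prod_decode i)))) \<in> borel_measurable M"
        using measurable_map_norm[OF mh] by simp
      then show ?thesis unfolding F_def[abs_def] by measurable
    qed
    show "\<bar>F i x\<bar> \<le> real (snd (prod_decode i))" for i x by (simp add: F_def)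
    show "weak_upper_gradient p \<mu> UNIV (F i) \<rho>" for i
      unfolding F_def by (rule wug_lipschitz_comp[OF h'(4)]) (rule lip)
    show "\<rho> \<in> Lp_borel p \<mu> UNIV" by (rule h')
  qed
  have R: "R \<le> ennreal (K powr p)" using h'(5) by (simp add: Lp_int_UNIV R_def)
  obtain g where g: "g \<in> borel_measurable borel"
    "(\<integral>\<^sup>+x. g x powe p \<partial>M) \<le> ennreal (2 powr p) * (ennreal C1 * R + ennreal (K powr p))"
    "\<And>i x y. ennreal \<bar>F i x - F i y\<bar> \<le> ennreal (dist x y) * max (g x) (g y)"
    by (rule hajlasz_family[of "K powr p"]) (use K in auto)
  have "(\<integral>\<^sup>+x. g x powe p \<partial>M) \<le> ennreal (2 powr p) * (ennreal C1 * ennreal (K powr p) + ennreal (K powr p))"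
    by (rule order_trans[OF g(2)]) (intro mult_left_mono add_right_mono R; simp)
  also have "\<dots> = ennreal (2 powr p * ((C1 + 1) * K powr p))"
    using const_nonneg(4) by (simp add: ennreal_mult ennreal_plus distrib_right)
  also have "\<dots> \<le> ennreal ((CH * K) powr p)"
  proof (rule ennreal_leI)
    have "(C1 + 1) powr 1 \<le> (C1 + 1) powr p" using const_nonneg(4) p by (intro powr_mono) auto
    then have "2 powr p * ((C1 + 1) * K powr p) \<le> 2 powr p * ((C1 + 1) powr p * K powr p)"
      using const_nonneg(4) by (intro mult_left_mono mult_right_mono) auto
    also have "\<dots> = (CH * K) powr p" unfolding CH_def by (simp only: powr_mult mult.assoc)
    finally show "2 powr p * ((C1 + 1) * K powr p) \<le> (CH * K) powr p" .
  qed
  finally have int: "(\<integral>\<^sup>+x. g x powe p \<partial>M) \<le> ennreal ((CH * K) powr p)" .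
  have "ennreal (norm (h x - h y)) \<le> ennreal (dist x y) * max (g x) (g y)" if xy: "x \<notin> N" "y \<notin> N" for x y
  proof (rule ennreal_le_epsilon)
    fix e :: real assume e: "0 < e"
    have hx: "h x = h' x" "h y = h' y" "h' y \<in> closure D" using xy by (auto simp: N_def)
    obtain a where a: "a \<in> D" "dist a (h' y) < e / 2" using hx(3) e by (meson closure_approachable half_gt_zero)
    have "a \<in> range d" using a(1) rd by simp
    then obtain i where i: "a = d i" by blast
    obtain n :: nat where n: "norm (h' x - a) + norm (h' y - a) \<le> real n" using real_arch_simple by blast
    define k where "k = prod_encode (i, n)"
    have Fk: "F k x = norm (h' x - a)" "F k y = norm (h' y - a)"
    proof -
      have "norm (h' x - a) \<le> real n" "norm (h' y - a) \<le> real n"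
        using n norm_ge_zero[of "h' x - a"] norm_ge_zero[of "h' y - a"] by linarith+
      then show "F k x = norm (h' x - a)" "F k y = norm (h' y - a)" by (simp_all add: F_def k_def i[symmetric])
    qed
    have "norm (h' x - h' y) \<le> norm (h' x - a) + norm (h' y - a)"
      using norm_triangle_ineq4[of "h' x - a" "h' y - a"] by simp
    also have "\<dots> \<le> \<bar>F k x - F k y\<bar> + 2 * norm (h' y - a)" unfolding Fk by linarith
    also have "\<dots> \<le> \<bar>F k x - F k y\<bar> + e" using a(2) by (simp add: dist_norm norm_minus_commute)
    finally have "ennreal (norm (h x - h y)) \<le> ennreal (\<bar>F k x - F k y\<bar> + e)" unfolding hx(1,2) by (rule ennreal_leI)
    also have "\<dots> = ennreal \<bar>F k x - F k y\<bar> + ennreal e" using e by (intro ennreal_plus) auto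
    also have "\<dots> \<le> ennreal (dist x y) * max (g x) (g y) + ennreal e" by (intro add_right_mono g)
    finally show "ennreal (norm (h x - h y)) \<le> ennreal (dist x y) * max (g x) (g y) + ennreal e" .
  qed
  with g(1) int N show ?thesis by (rule that)
qed

end

section \<open>Bochner integral\<close>

abbreviation "sb_integrable \<equiv> Bochner_Integration.simple_bochner_integrable"
abbreviation "sb_integral \<equiv> Bochner_Integration.simple_bochner_integral"

context poincare_mms
begin

lemma UNIV_M: "UNIV \<in> sets M" using sets.top[of M] by simp

text \<open>The library's Bochner integral requires a second countable target space; the one below only needs the
  function to be essentially separably valued.\<close>

definition int_map :: "('a \<Rightarrow> 'b::real_normed_vector) \<Rightarrow> bool" where
  "int_map f \<longleftrightarrow> measurable_map \<mu> UNIV f \<and> (\<integral>\<^sup>+x. ennreal (norm (f x)) \<partial>M) < top"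

definition approx :: "('a \<Rightarrow> 'b::real_normed_vector) \<Rightarrow> (nat \<Rightarrow> 'a \<Rightarrow> 'b) \<Rightarrow> bool" where
  "approx f s \<longleftrightarrow> (\<forall>n. sb_integrable M (s n)) \<and>
    (\<lambda>n. \<integral>\<^sup>+x. ennreal (norm (f x - s n x)) \<partial>M) \<longlonglongrightarrow> 0"

lemma int_map_norm_measurable:
  assumes "measurable_map \<mu> UNIV f"
  shows "(\<lambda>x. ennreal (norm (f x))) \<in> borel_measurable M"
  using measurable_map_norm[OF assms, of 0] by simp

lemma measurable_map_diff:
  fixes f g :: "'a \<Rightarrow> 'b::real_normed_vector"
  assumes "measurable_map \<mu> UNIV f" "measurable_map \<mu> UNIV g"
  shows "measurable_map \<mu> UNIV (\<lambda>x. f x - g x)"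
  using measurable_map_add[OF UNIV_M assms(1) measurable_map_cmult[OF UNIV_M assms(2), of "-1"]] by simp

lemma sbi_measurable_map: "sb_integrable M s \<Longrightarrow> measurable_map \<mu> UNIV s"
  by (rule measurable_map_simple[OF UNIV_M]) (simp add: simple_bochner_integrable.simps)

lemma approx_ex:
  fixes f :: "'a \<Rightarrow> 'b::real_normed_vector"
  assumes f: "int_map f"
  obtains s where "approx f s"
proof -
  have fm: "measurable_map \<mu> UNIV f" and fi: "(\<integral>\<^sup>+x. ennreal (norm (f x)) \<partial>M) < top"
    using f by (auto simp: int_map_def)
  obtain s where s: "\<And>n::nat. simple_function (measure_on \<mu> UNIV) (s n)" "AE x in measure_on \<mu> UNIV. (\<lambda>n. s n x) \<longlonglongrightarrow> f x"
    "\<And>n x. norm (s n x - f x) \<le> norm (f x)"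
    by (rule measurable_map_imp_simple[OF UNIV_M fm]) (rule that)
  note s = s[unfolded restrict_M_UNIV]
  have "approx f s" unfolding approx_def
  proof (intro conjI allI)
    fix n
    have "(\<integral>\<^sup>+x. ennreal (norm (s n x)) \<partial>M) \<le> (\<integral>\<^sup>+x. 2 * ennreal (norm (f x)) \<partial>M)"
    proof (rule nn_integral_mono)
      fix x
      have "norm (s n x) \<le> 2 * norm (f x)" using s(3)[of n x] norm_triangle_ineq2[of "s n x" "f x"] by linarith
      then have "ennreal (norm (s n x)) \<le> ennreal (2 * norm (f x))" by (rule ennreal_leI)
      also have "\<dots> = 2 * ennreal (norm (f x))" by (simp add: ennreal_mult)
      finally show "ennreal (norm (s n x)) \<le> 2 * ennreal (norm (f x))" .
    qed
    also have "\<dots> = 2 * (\<integral>\<^sup>+x. ennreal (norm (f x)) \<partial>M)"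
      by (rule nn_integral_cmult) (rule int_map_norm_measurable[OF fm])
    also have "\<dots> < top" using fi by (simp add: ennreal_mult_less_top)
    finally show "sb_integrable M (s n)"
      by (intro simple_bochner_integrableI_bounded s(1)) simp
  next
    have "(\<lambda>n. \<integral>\<^sup>+x. ennreal (norm (f x - s n x)) \<partial>M) \<longlonglongrightarrow> (\<integral>\<^sup>+x. 0 \<partial>M)"
    proof (rule nn_integral_dominated_convergence)
      show "(\<lambda>x. ennreal (norm (f x - s n x))) \<in> borel_measurable M" for n
        by (intro int_map_norm_measurable measurable_map_diff fm measurable_map_simple[OF UNIV_M]) (simp add: s(1))
      show "(\<lambda>x. ennreal (norm (f x))) \<in> borel_measurable M" by (rule int_map_norm_measurable[OF fm])
      show "(\<integral>\<^sup>+x. ennreal (norm (f x)) \<partial>M) < \<infinity>" using fi by simp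
      show "AE x in M. ennreal (norm (f x - s n x)) \<le> ennreal (norm (f x))" for n
        using s(3)[of n] by (intro AE_I2 ennreal_leI) (simp add: norm_minus_commute)
      show "AE x in M. (\<lambda>n. ennreal (norm (f x - s n x))) \<longlonglongrightarrow> 0"
        using s(2)
      proof eventually_elim
        case (elim x)
        have "(\<lambda>n. norm (f x - s n x)) \<longlonglongrightarrow> norm (f x - f x)" by (intro tendsto_intros elim)
        then show ?case using tendsto_ennrealI[of "\<lambda>n. norm (f x - s n x)" 0] by simp
      qed
    qed simp
    then show "(\<lambda>n. \<integral>\<^sup>+x. ennreal (norm (f x - s n x)) \<partial>M) \<longlonglongrightarrow> 0" by simp
  qed
  then show ?thesis by (rule that)
qed

lemma sbi_diff_le:
  fixes f g :: "'a \<Rightarrow> 'b::real_normed_vector"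
  assumes f: "measurable_map \<mu> UNIV f" and g: "measurable_map \<mu> UNIV g"
    and s: "sb_integrable M s" and t: "sb_integrable M t"
  shows "ennreal (norm (sb_integral M s - sb_integral M t)) \<le>
    (\<integral>\<^sup>+x. ennreal (norm (f x - s x)) \<partial>M) + (\<integral>\<^sup>+x. ennreal (norm (f x - g x)) \<partial>M) + (\<integral>\<^sup>+x. ennreal (norm (g x - t x)) \<partial>M)"
proof -
  have d: "sb_integrable M (\<lambda>x. s x - t x)"
    using s t by (rule simple_bochner_integrable_compose2[where p = "(-)", rotated]) simp
  have n: "sb_integrable M (\<lambda>x. norm (s x - t x))"
    using s t by (rule simple_bochner_integrable_compose2[where p = "\<lambda>x y. norm (x - y)", rotated]) simp
  have "ennreal (norm (sb_integral M s - sb_integral M t)) \<le> ennreal (sb_integral M (\<lambda>x. norm (s x - t x)))"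
    using simple_bochner_integral_norm_bound[OF d] by (simp add: simple_bochner_integral_diff[OF s t] ennreal_leI)
  also have "\<dots> = (\<integral>\<^sup>+x. ennreal (norm (s x - t x)) \<partial>M)"
    using simple_bochner_integral_eq_nn_integral[OF n] by simp
  also have "\<dots> \<le> (\<integral>\<^sup>+x. (ennreal (norm (f x - s x)) + ennreal (norm (f x - g x))) + ennreal (norm (g x - t x)) \<partial>M)"
  proof (rule nn_integral_mono)
    fix x
    have "s x - t x = - (f x - s x) + (f x - g x) + (g x - t x)" by simp
    then have "norm (s x - t x) \<le> norm (f x - s x) + norm (f x - g x) + norm (g x - t x)"
      by (metis norm_minus_cancel norm_triangle_le norm_triangle_mono order_refl)
    then show "ennreal (norm (s x - t x)) \<le> (ennreal (norm (f x - s x)) + ennreal (norm (f x - g x))) + ennreal (norm (g x - t x))"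
      by (simp add: ennreal_leI flip: ennreal_plus)
  qed
  also have "\<dots> = (\<integral>\<^sup>+x. ennreal (norm (f x - s x)) \<partial>M) + (\<integral>\<^sup>+x. ennreal (norm (f x - g x)) \<partial>M) + (\<integral>\<^sup>+x. ennreal (norm (g x - t x)) \<partial>M)"
  proof -
    have m: "(\<lambda>x. ennreal (norm (f x - s x))) \<in> borel_measurable M" "(\<lambda>x. ennreal (norm (f x - g x))) \<in> borel_measurable M"
      "(\<lambda>x. ennreal (norm (g x - t x))) \<in> borel_measurable M"
      by (rule int_map_norm_measurable, rule measurable_map_diff, (rule f g sbi_measurable_map[OF s] sbi_measurable_map[OF t])+)+
    show ?thesis using m by (subst nn_integral_add, simp, simp, subst nn_integral_add, simp_all)
  qed
  finally show ?thesis .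
qed

text \<open>The one estimate behind the integral: f = g gives independence of the approximation, g =
  0 the norm bound, and a vanishing right-hand side invariance under null sets.\<close>

lemma approx_limit_diff_le:
  fixes f g :: "'a \<Rightarrow> 'b::real_normed_vector"
  assumes f: "measurable_map \<mu> UNIV f" "approx f s" "(\<lambda>n. sb_integral M (s n)) \<longlonglongrightarrow> v"
    and g: "measurable_map \<mu> UNIV g" "approx g t" "(\<lambda>n. sb_integral M (t n)) \<longlonglongrightarrow> w"
  shows "ennreal (norm (v - w)) \<le> (\<integral>\<^sup>+x. ennreal (norm (f x - g x)) \<partial>M)"
proof -
  let ?d = "\<integral>\<^sup>+x. ennreal (norm (f x - g x)) \<partial>M"
  have A: "(\<lambda>n. ennreal (norm (sb_integral M (s n) - sb_integral M (t n)))) \<longlonglongrightarrow> ennreal (norm (v - w))"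
    by (intro tendsto_ennrealI tendsto_intros f g)
  have B: "(\<lambda>n. (\<integral>\<^sup>+x. ennreal (norm (f x - s n x)) \<partial>M) + ?d + (\<integral>\<^sup>+x. ennreal (norm (g x - t n x)) \<partial>M)) \<longlonglongrightarrow> 0 + ?d + 0"
    using f(2) g(2) unfolding approx_def by (intro tendsto_add tendsto_const) auto
  have "\<forall>n. ennreal (norm (sb_integral M (s n) - sb_integral M (t n))) \<le>
     (\<integral>\<^sup>+x. ennreal (norm (f x - s n x)) \<partial>M) + ?d + (\<integral>\<^sup>+x. ennreal (norm (g x - t n x)) \<partial>M)"
    using f g unfolding approx_def by (intro allI sbi_diff_le) auto
  with LIMSEQ_le[OF A B] show ?thesis by simp
qed

definition has_vint :: "('a \<Rightarrow> 'b::real_normed_vector) \<Rightarrow> 'b \<Rightarrow> bool" where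
  "has_vint f v \<longleftrightarrow> measurable_map \<mu> UNIV f \<and> (\<exists>s. approx f s \<and> (\<lambda>n. sb_integral M (s n)) \<longlonglongrightarrow> v)"

lemma has_vint_diff_le:
  "has_vint f v \<Longrightarrow> has_vint g w \<Longrightarrow> ennreal (norm (v - w)) \<le> (\<integral>\<^sup>+x. ennreal (norm (f x - g x)) \<partial>M)"
  unfolding has_vint_def using approx_limit_diff_le by blast

lemma has_vint_unique: "has_vint f v \<Longrightarrow> has_vint f w \<Longrightarrow> v = w"
  using has_vint_diff_le[of f v f w] by simp

lemma has_vint_ex:
  fixes f :: "'a \<Rightarrow> 'b::banach"
  assumes f: "int_map f"
  shows "\<exists>v. has_vint f v"
proof -
  have fm: "measurable_map \<mu> UNIV f" using f by (simp add: int_map_def)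
  obtain s where s: "approx f s" using f by (rule approx_ex)
  have "Cauchy (\<lambda>n. sb_integral M (s n))"
  proof (rule metric_CauchyI)
    fix e :: real assume e: "0 < e"
    have "(\<lambda>n. \<integral>\<^sup>+x. ennreal (norm (f x - s n x)) \<partial>M) \<longlonglongrightarrow> 0" using s by (simp add: approx_def)
    from order_tendstoD(2)[OF this, of "ennreal (e/2)"] e
    obtain K where K: "\<And>n. K \<le> n \<Longrightarrow> (\<integral>\<^sup>+x. ennreal (norm (f x - s n x)) \<partial>M) < ennreal (e/2)"
      by (auto simp: eventually_sequentially)
    show "\<exists>K. \<forall>m\<ge>K. \<forall>n\<ge>K. dist (sb_integral M (s m)) (sb_integral M (s n)) < e"
    proof (intro exI allI impI)
      fix m n assume mn: "K \<le> m" "K \<le> n"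
      have "ennreal (norm (sb_integral M (s m) - sb_integral M (s n))) \<le>
        (\<integral>\<^sup>+x. ennreal (norm (f x - s m x)) \<partial>M) + (\<integral>\<^sup>+x. ennreal (norm (f x - f x)) \<partial>M) + (\<integral>\<^sup>+x. ennreal (norm (f x - s n x)) \<partial>M)"
        using s by (intro sbi_diff_le fm) (auto simp: approx_def)
      also have "\<dots> < ennreal (e/2) + ennreal (e/2)"
        using add_strict_mono[OF K[OF mn(1)] K[OF mn(2)]] by simp
      also have "\<dots> = ennreal e" using e by (simp flip: ennreal_plus)
      finally show "dist (sb_integral M (s m)) (sb_integral M (s n)) < e"
        by (simp add: dist_norm ennreal_less_iff)
    qed
  qed
  then show ?thesis using s fm unfolding has_vint_def Cauchy_convergent_iff convergent_def by blast
qed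

definition vint :: "('a \<Rightarrow> 'b::banach) \<Rightarrow> 'b" where "vint f = (SOME v. has_vint f v)"

lemma vint: "int_map f \<Longrightarrow> has_vint f (vint f)"
  unfolding vint_def by (rule someI_ex[OF has_vint_ex])

lemma vint_eqI: "int_map f \<Longrightarrow> has_vint f v \<Longrightarrow> vint f = v"
  using has_vint_unique[OF vint] by blast

lemma int_map_add:
  fixes f g :: "'a \<Rightarrow> 'b::real_normed_vector"
  assumes f: "int_map f" and g: "int_map g"
  shows "int_map (\<lambda>x. f x + g x)"
proof -
  have fg: "measurable_map \<mu> UNIV f" "measurable_map \<mu> UNIV g" using f g by (auto simp: int_map_def)
  have "(\<integral>\<^sup>+x. ennreal (norm (f x + g x)) \<partial>M) \<le> (\<integral>\<^sup>+x. ennreal (norm (f x)) + ennreal (norm (g x)) \<partial>M)"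
    by (intro nn_integral_mono) (simp add: ennreal_leI norm_triangle_ineq flip: ennreal_plus)
  also have "\<dots> = (\<integral>\<^sup>+x. ennreal (norm (f x)) \<partial>M) + (\<integral>\<^sup>+x. ennreal (norm (g x)) \<partial>M)"
    by (intro nn_integral_add int_map_norm_measurable fg)
  also have "\<dots> < top" using f g by (simp add: int_map_def)
  finally show ?thesis using measurable_map_add[OF UNIV_M fg] by (simp add: int_map_def)
qed

lemma int_map_cmult:
  fixes f :: "'a \<Rightarrow> 'b::real_normed_vector"
  assumes f: "int_map f"
  shows "int_map (\<lambda>x. a *\<^sub>R f x)"
proof -
  have fm: "measurable_map \<mu> UNIV f" using f by (auto simp: int_map_def)
  have "(\<integral>\<^sup>+x. ennreal (norm (a *\<^sub>R f x)) \<partial>M) = ennreal \<bar>a\<bar> * (\<integral>\<^sup>+x. ennreal (norm (f x)) \<partial>M)"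
    by (simp add: ennreal_mult nn_integral_cmult[OF int_map_norm_measurable[OF fm]])
  also have "\<dots> < top" using f by (simp add: int_map_def ennreal_mult_less_top)
  finally show ?thesis using measurable_map_cmult[OF UNIV_M fm] by (simp add: int_map_def)
qed

lemma vint_add:
  fixes f g :: "'a \<Rightarrow> 'b::banach"
  assumes f: "int_map f" and g: "int_map g"
  shows "vint (\<lambda>x. f x + g x) = vint f + vint g"
proof (rule vint_eqI[OF int_map_add[OF f g]])
  have fg: "measurable_map \<mu> UNIV f" "measurable_map \<mu> UNIV g" using f g by (auto simp: int_map_def)
  obtain s where s: "approx f s" "(\<lambda>n. sb_integral M (s n)) \<longlonglongrightarrow> vint f" using vint[OF f] by (auto simp: has_vint_def)
  obtain t where t: "approx g t" "(\<lambda>n. sb_integral M (t n)) \<longlonglongrightarrow> vint g" using vint[OF g] by (auto simp: has_vint_def)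
  have sm: "sb_integrable M (s n)" "sb_integrable M (t n)" for n
    using s t by (auto simp: approx_def)
  have "approx (\<lambda>x. f x + g x) (\<lambda>n x. s n x + t n x)"
    unfolding approx_def
  proof (intro conjI allI)
    show "sb_integrable M (\<lambda>x. s n x + t n x)" for n
      by (rule simple_bochner_integrable_compose2[where p = "(+)"]) (auto intro: sm)
    have lim: "(\<lambda>n. (\<integral>\<^sup>+x. ennreal (norm (f x - s n x)) \<partial>M) + (\<integral>\<^sup>+x. ennreal (norm (g x - t n x)) \<partial>M)) \<longlonglongrightarrow> 0 + 0"
      using s(1) t(1) unfolding approx_def by (intro tendsto_add) auto
    show "(\<lambda>n. \<integral>\<^sup>+x. ennreal (norm (f x + g x - (s n x + t n x))) \<partial>M) \<longlonglongrightarrow> 0"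
    proof (rule tendsto_sandwich[OF _ _ tendsto_const lim[simplified]])
      show "\<forall>\<^sub>F n in sequentially. (\<integral>\<^sup>+x. ennreal (norm (f x + g x - (s n x + t n x))) \<partial>M) \<le>
         (\<integral>\<^sup>+x. ennreal (norm (f x - s n x)) \<partial>M) + (\<integral>\<^sup>+x. ennreal (norm (g x - t n x)) \<partial>M)"
      proof (intro always_eventually allI)
        fix n
        have "(\<integral>\<^sup>+x. ennreal (norm (f x + g x - (s n x + t n x))) \<partial>M) \<le> (\<integral>\<^sup>+x. ennreal (norm (f x - s n x)) + ennreal (norm (g x - t n x)) \<partial>M)"
          by (intro nn_integral_mono) (simp add: ennreal_leI norm_triangle_ineq add_diff_add flip: ennreal_plus)
        also have "\<dots> = (\<integral>\<^sup>+x. ennreal (norm (f x - s n x)) \<partial>M) + (\<integral>\<^sup>+x. ennreal (norm (g x - t n x)) \<partial>M)"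
          by (intro nn_integral_add int_map_norm_measurable measurable_map_diff fg sbi_measurable_map sm)
        finally show "(\<integral>\<^sup>+x. ennreal (norm (f x + g x - (s n x + t n x))) \<partial>M) \<le>
         (\<integral>\<^sup>+x. ennreal (norm (f x - s n x)) \<partial>M) + (\<integral>\<^sup>+x. ennreal (norm (g x - t n x)) \<partial>M)" .
      qed
    qed simp
  qed
  moreover have "(\<lambda>n. sb_integral M (\<lambda>x. s n x + t n x)) \<longlonglongrightarrow> vint f + vint g"
    unfolding simple_bochner_integral_add[OF sm] by (intro tendsto_add s t)
  ultimately show "has_vint (\<lambda>x. f x + g x) (vint f + vint g)"
    unfolding has_vint_def using measurable_map_add[OF UNIV_M fg] by (intro conjI exI[of _ "\<lambda>n x. s n x + t n x"])
qed

lemma vint_cmult: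
  fixes f :: "'a \<Rightarrow> 'b::banach"
  assumes f: "int_map f"
  shows "vint (\<lambda>x. a *\<^sub>R f x) = a *\<^sub>R vint f"
proof (rule vint_eqI[OF int_map_cmult[OF f]])
  have fm: "measurable_map \<mu> UNIV f" using f by (auto simp: int_map_def)
  obtain s where s: "approx f s" "(\<lambda>n. sb_integral M (s n)) \<longlonglongrightarrow> vint f" using vint[OF f] by (auto simp: has_vint_def)
  have sm: "sb_integrable M (s n)" for n using s by (auto simp: approx_def)
  have "approx (\<lambda>x. a *\<^sub>R f x) (\<lambda>n x. a *\<^sub>R s n x)"
    unfolding approx_def
  proof (intro conjI allI)
    show "sb_integrable M (\<lambda>x. a *\<^sub>R s n x)" for n
      using simple_bochner_integrable_compose2[where p = "\<lambda>x y. a *\<^sub>R x", OF _ sm sm] by simp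
    have "(\<integral>\<^sup>+x. ennreal (norm (a *\<^sub>R f x - a *\<^sub>R s n x)) \<partial>M) = ennreal \<bar>a\<bar> * (\<integral>\<^sup>+x. ennreal (norm (f x - s n x)) \<partial>M)" for n
      by (simp add: scaleR_diff_right[symmetric] ennreal_mult nn_integral_cmult[OF int_map_norm_measurable[OF measurable_map_diff[OF fm sbi_measurable_map[OF sm]]]])
    moreover have "(\<lambda>n. ennreal \<bar>a\<bar> * (\<integral>\<^sup>+x. ennreal (norm (f x - s n x)) \<partial>M)) \<longlonglongrightarrow> ennreal \<bar>a\<bar> * 0"
      using s(1) unfolding approx_def by (intro ennreal_tendsto_cmult) auto
    ultimately show "(\<lambda>n. \<integral>\<^sup>+x. ennreal (norm (a *\<^sub>R f x - a *\<^sub>R s n x)) \<partial>M) \<longlonglongrightarrow> 0" by simp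
  qed
  moreover have "(\<lambda>n. sb_integral M (\<lambda>x. a *\<^sub>R s n x)) \<longlonglongrightarrow> a *\<^sub>R vint f"
  proof -
    have "sb_integral M (\<lambda>x. a *\<^sub>R s n x) = a *\<^sub>R sb_integral M (s n)" for n
      by (rule simple_bochner_integral_linear[OF _ sm]) (auto intro: linearI simp: scaleR_add_right)
    then show ?thesis using s(2) by (auto intro: tendsto_scaleR)
  qed
  ultimately show "has_vint (\<lambda>x. a *\<^sub>R f x) (a *\<^sub>R vint f)"
    unfolding has_vint_def using measurable_map_cmult[OF UNIV_M fm] by (intro conjI exI[of _ "\<lambda>n x. a *\<^sub>R s n x"])
qed

lemma norm_vint_le:
  fixes f :: "'a \<Rightarrow> 'b::banach"
  assumes f: "int_map f"
  shows "ennreal (norm (vint f)) \<le> (\<integral>\<^sup>+x. ennreal (norm (f x)) \<partial>M)"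
proof -
  have z: "simple_function M (\<lambda>x. 0 :: 'b)" by simp
  have "sb_integrable M (\<lambda>x. 0 :: 'b)" by (rule simple_bochner_integrableI_bounded[OF z]) simp
  moreover have "sb_integral M (\<lambda>x. 0 :: 'b) = 0" by (simp add: simple_bochner_integral_def)
  moreover have "measurable_map \<mu> UNIV (\<lambda>x. 0 :: 'b)" by (rule measurable_map_simple[OF UNIV_M]) simp
  ultimately have "has_vint (\<lambda>x. 0 :: 'b) 0"
    unfolding has_vint_def approx_def by (intro conjI exI[of _ "\<lambda>n x. 0"]) auto
  from has_vint_diff_le[OF vint[OF f] this] show ?thesis by simp
qed

lemma vint_cong_AE:
  fixes f g :: "'a \<Rightarrow> 'b::banach"
  assumes f: "int_map f" and g: "int_map g" and eq: "AE x in M. f x = g x"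
  shows "vint f = vint g"
proof -
  have "AE x in M. ennreal (norm (f x - g x)) = 0" using eq by eventually_elim simp
  then have "(\<integral>\<^sup>+x. ennreal (norm (f x - g x)) \<partial>M) = (\<integral>\<^sup>+x. 0 \<partial>M)" by (rule nn_integral_cong_AE)
  then show ?thesis using has_vint_diff_le[OF vint[OF f] vint[OF g]] by simp
qed

lemma measurable_map_real:
  fixes \<phi> :: "'a \<Rightarrow> real"
  assumes pm: "\<phi> \<in> borel_measurable M"
  shows "measurable_map \<mu> UNIV \<phi>"
  unfolding measurable_map_iff[OF UNIV_M]
proof (intro conjI)
  show "\<phi> \<in> borel_measurable (measure_on \<mu> UNIV)" using pm by simp
  obtain D :: "real set" where D: "countable D" "\<And>X. open X \<Longrightarrow> X \<noteq> {} \<Longrightarrow> \<exists>d\<in>D. d \<in> X"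
    by (erule countable_dense_setE)
  have "x \<in> closure D" for x
    unfolding closure_approachable
  proof (intro allI impI)
    fix e :: real assume "0 < e"
    then show "\<exists>y\<in>D. dist y x < e"
      using D(2)[of "ball x e"] by (auto simp: dist_commute)
  qed
  with D(1) show "\<exists>D. countable D \<and> (AE x in measure_on \<mu> UNIV. \<phi> x \<in> closure D)" by auto
qed

lemma measurable_map_scaleR:
  fixes f :: "'a \<Rightarrow> 'b::real_normed_vector"
  assumes \<phi>: "measurable_map \<mu> UNIV \<phi>" and f: "measurable_map \<mu> UNIV f"
  shows "measurable_map \<mu> UNIV (\<lambda>x. \<phi> x *\<^sub>R f x)"
proof -
  obtain t where t: "\<And>n::nat. simple_function (measure_on \<mu> UNIV) (t n)" "AE x in measure_on \<mu> UNIV. (\<lambda>n. t n x) \<longlonglongrightarrow> \<phi> x"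
    "\<And>n x. norm (t n x - \<phi> x) \<le> norm (\<phi> x)"
    by (rule measurable_map_imp_simple[OF UNIV_M \<phi>]) (rule that)
  obtain s where s: "\<And>n::nat. simple_function (measure_on \<mu> UNIV) (s n)" "AE x in measure_on \<mu> UNIV. (\<lambda>n. s n x) \<longlonglongrightarrow> f x"
    "\<And>n x. norm (s n x - f x) \<le> norm (f x)"
    by (rule measurable_map_imp_simple[OF UNIV_M f]) (rule that)
  show ?thesis
  proof (rule measurable_map_limit[OF UNIV_M])
    show "measurable_map \<mu> UNIV (\<lambda>x. t n x *\<^sub>R s n x)" for n
      using simple_function_compose2[OF t(1) s(1), of "(*\<^sub>R)"] by (intro measurable_map_simple[OF UNIV_M])
    show "AE x in measure_on \<mu> UNIV. (\<lambda>n. t n x *\<^sub>R s n x) \<longlonglongrightarrow> \<phi> x *\<^sub>R f x"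
      using t(2) s(2) by eventually_elim (intro tendsto_intros)
  qed
qed

lemma measurable_map_zero_ext:
  fixes u :: "'a \<Rightarrow> 'b::real_normed_vector"
  assumes S: "S \<in> sets M" and u: "measurable_map \<mu> S u"
  shows "measurable_map \<mu> UNIV (\<lambda>x. indicator S x *\<^sub>R u x)"
proof -
  obtain s where s: "\<And>n::nat. simple_function (measure_on \<mu> S) (s n)" "AE x in measure_on \<mu> S. (\<lambda>n. s n x) \<longlonglongrightarrow> u x"
    "\<And>n x. norm (s n x - u x) \<le> norm (u x)"
    by (rule measurable_map_imp_simple[OF S u]) (rule that)
  show ?thesis
  proof (rule measurable_map_limit[OF UNIV_M])
    show "measurable_map \<mu> UNIV (\<lambda>x. indicator S x *\<^sub>R s n x)" for n
      using s(1)[of n] S by (intro measurable_map_simple[OF UNIV_M]) (simp add: simple_function_restrict_space)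
    have "AE x in M. x \<in> S \<longrightarrow> (\<lambda>n. s n x) \<longlonglongrightarrow> u x" using s(2) by (simp add: AE_on_iff[OF S])
    then show "AE x in measure_on \<mu> UNIV. (\<lambda>n. indicator S x *\<^sub>R s n x) \<longlonglongrightarrow> indicator S x *\<^sub>R u x"
      unfolding restrict_M_UNIV by eventually_elim (auto split: split_indicator)
  qed
qed

lemma vint_scaleR_const:
  fixes v :: "'b::banach"
  assumes \<phi>: "integrable M \<phi>"
  shows "int_map (\<lambda>x. \<phi> x *\<^sub>R v)" "vint (\<lambda>x. \<phi> x *\<^sub>R v) = (LINT x|M. \<phi> x) *\<^sub>R v"
proof -
  have pm: "\<phi> \<in> borel_measurable M" using \<phi> by simp
  obtain s where "\<phi> \<in> borel_measurable M" and s: "\<And>i::nat. sb_integrable M (s i)" "(\<lambda>i. \<integral>\<^sup>+x. ennreal (norm (\<phi> x - s i x)) \<partial>M) \<longlonglongrightarrow> 0"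
    "(\<lambda>i. sb_integral M (s i)) \<longlonglongrightarrow> (LINT x|M. \<phi> x)"
    using has_bochner_integral_integrable[OF \<phi>] by (rule has_bochner_integral.cases) (rule that)
  have "measurable_map \<mu> UNIV (\<lambda>x. v)" by (rule measurable_map_simple[OF UNIV_M]) simp
  then have mm: "measurable_map \<mu> UNIV (\<lambda>x. \<phi> x *\<^sub>R v)"
    by (rule measurable_map_scaleR[OF measurable_map_real[OF pm]])
  have fin: "(\<integral>\<^sup>+x. ennreal (norm (\<phi> x)) \<partial>M) < top" using \<phi> by (simp add: integrable_iff_bounded)
  have "(\<integral>\<^sup>+x. ennreal (norm (\<phi> x *\<^sub>R v)) \<partial>M) = (\<integral>\<^sup>+x. ennreal (norm (\<phi> x)) \<partial>M) * ennreal (norm v)"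
    using pm by (simp add: ennreal_mult nn_integral_multc)
  also have "\<dots> < top" using fin by (simp add: ennreal_mult_less_top)
  finally show im: "int_map (\<lambda>x. \<phi> x *\<^sub>R v)" using mm by (simp add: int_map_def)
  show "vint (\<lambda>x. \<phi> x *\<^sub>R v) = (LINT x|M. \<phi> x) *\<^sub>R v"
  proof (rule vint_eqI[OF im])
    have "approx (\<lambda>x. \<phi> x *\<^sub>R v) (\<lambda>n x. s n x *\<^sub>R v)"
      unfolding approx_def
    proof (intro conjI allI)
      show "sb_integrable M (\<lambda>x. s n x *\<^sub>R v)" for n
        using simple_bochner_integrable_compose2[where p = "\<lambda>x y. x *\<^sub>R v", OF _ s(1) s(1)] by simp
      have "(\<lambda>x. ennreal (norm (\<phi> x - s n x))) \<in> borel_measurable M" for n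
        using pm borel_measurable_simple_function[of M "s n"] s(1)[of n] by (auto simp: simple_bochner_integrable.simps)
      then have "(\<integral>\<^sup>+x. ennreal (norm (\<phi> x *\<^sub>R v - s n x *\<^sub>R v)) \<partial>M) = (\<integral>\<^sup>+x. ennreal (norm (\<phi> x - s n x)) \<partial>M) * ennreal (norm v)" for n
        by (simp add: scaleR_diff_left[symmetric] ennreal_mult nn_integral_multc)
      moreover have "(\<lambda>n. (\<integral>\<^sup>+x. ennreal (norm (\<phi> x - s n x)) \<partial>M) * ennreal (norm v)) \<longlonglongrightarrow> 0 * ennreal (norm v)"
        using s(2) by (subst (1 2) mult.commute, intro ennreal_tendsto_cmult) auto
      ultimately show "(\<lambda>n. \<integral>\<^sup>+x. ennreal (norm (\<phi> x *\<^sub>R v - s n x *\<^sub>R v)) \<partial>M) \<longlonglongrightarrow> 0" by simp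
    qed
    moreover have "(\<lambda>n. sb_integral M (\<lambda>x. s n x *\<^sub>R v)) \<longlonglongrightarrow> (LINT x|M. \<phi> x) *\<^sub>R v"
    proof -
      have "sb_integral M (\<lambda>x. s n x *\<^sub>R v) = sb_integral M (s n) *\<^sub>R v" for n
        by (rule simple_bochner_integral_linear[OF _ s(1)]) (auto intro: linearI simp: scaleR_add_left)
      then show ?thesis using s(3) by (auto intro: tendsto_scaleR)
    qed
    ultimately show "has_vint (\<lambda>x. \<phi> x *\<^sub>R v) ((LINT x|M. \<phi> x) *\<^sub>R v)"
      unfolding has_vint_def using mm by (intro conjI exI[of _ "\<lambda>n x. s n x *\<^sub>R v"])
  qed
qed

end

section \<open>Averages over the domain\<close>

text \<open>Only differences with the value at the centre x are controlled, and \<open>G\<close>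
  dominates the constant on the whole ball. Both fit \<open>local_to_global\<close>, which compares
  on short intervals containing x; every rectifiable path is good.\<close>

lemma (in metric_measure) wug_local:
  fixes v :: "'a \<Rightarrow> 'b::real_normed_vector" and G :: "'a \<Rightarrow> ennreal"
  assumes p: "0 < p" and G: "G \<in> borel_measurable borel"
    and loc: "\<And>x. \<exists>d>0. \<exists>L\<ge>0. (\<forall>y\<in>ball x d. norm (v y - v x) \<le> L * dist x y) \<and> (\<forall>y\<in>ball x d. ennreal L \<le> G y)"
  shows "weak_upper_gradient p \<mu> UNIV v G"
proof (rule wugI)
  have Gr: "G \<in> borel_measurable (restrict_space borel UNIV)" using G by (rule measurable_restrict_space1)
  then show "G \<in> borel_measurable (restrict_space borel UNIV)" .
  show "(\<lambda>x. 0) \<in> Lp_borel p \<mu> UNIV" by (simp add: Lp_borel_iff Lp_int_def)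
  fix a b and \<gamma> :: "real \<Rightarrow> 'a" assume q: "(a, b, \<gamma>) \<in> paths_in UNIV" "path_integral (\<lambda>x. 0) (a, b, \<gamma>) < top"
  interpret rect_path a b \<gamma>
    using q by (intro paths_in_rect_path path_integral_finite_rectifiable)
  have Gm: "(\<lambda>x. G (\<gamma> x) * indicator {a..b} x) \<in> borel_measurable borel" by (rule measurable_along_path[OF Gr q(1)])
  have "ennreal (dist (v (\<gamma> a)) (v (\<gamma> b))) \<le> (\<integral>\<^sup>+x\<in>{a..b}. G (\<gamma> x) \<partial>lm)"
  proof (rule local_to_global[OF ab, where \<phi> = "\<lambda>x. v (\<gamma> x)" and I = "\<lambda>s t. \<integral>\<^sup>+x\<in>{s..t}. G (\<gamma> x) \<partial>lm"])
    show "(\<integral>\<^sup>+x\<in>{s..m}. G (\<gamma> x) \<partial>lm) + (\<integral>\<^sup>+x\<in>{m..t}. G (\<gamma> x) \<partial>lm) \<le> (\<integral>\<^sup>+x\<in>{s..t}. G (\<gamma> x) \<partial>lm)"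
      if "a \<le> s" "s \<le> m" "m \<le> t" "t \<le> b" for s m t
      using integral_split[OF that Gm] by simp
    fix x assume x: "a \<le> x" "x \<le> b"
    obtain d K where d: "0 < d" "0 \<le> K" "\<forall>y\<in>ball (\<gamma> x) d. norm (v y - v (\<gamma> x)) \<le> K * dist (\<gamma> x) y"
      "\<forall>y\<in>ball (\<gamma> x) d. ennreal K \<le> G y" using loc by blast
    obtain d' where d': "0 < d'" "\<And>y. y \<in> {a..b} \<Longrightarrow> dist y x < d' \<Longrightarrow> dist (\<gamma> y) (\<gamma> x) < d"
      using cont x d(1) unfolding continuous_on_iff by (metis atLeastAtMost_iff)
    show "\<exists>d>0. \<forall>s t. a \<le> s \<and> s \<le> x \<and> x \<le> t \<and> t \<le> b \<and> t - s < d \<longrightarrow>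
        ennreal (dist (v (\<gamma> s)) (v (\<gamma> t))) \<le> (\<integral>\<^sup>+x\<in>{s..t}. G (\<gamma> x) \<partial>lm)"
    proof (intro exI[of _ d'] conjI allI impI d'(1))
      fix s t assume st: "a \<le> s \<and> s \<le> x \<and> x \<le> t \<and> t \<le> b \<and> t - s < d'"
      have inb: "\<gamma> y \<in> ball (\<gamma> x) d" if "s \<le> y" "y \<le> t" for y
        using d'(2)[of y] st that by (simp add: dist_real_def dist_commute abs_less_iff)
      have "dist (v (\<gamma> s)) (v (\<gamma> t)) \<le> norm (v (\<gamma> s) - v (\<gamma> x)) + norm (v (\<gamma> t) - v (\<gamma> x))"
        using dist_triangle2[of "v (\<gamma> s)" "v (\<gamma> t)" "v (\<gamma> x)"] by (simp add: dist_norm)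
      also have "\<dots> \<le> K * dist (\<gamma> x) (\<gamma> s) + K * dist (\<gamma> x) (\<gamma> t)"
        using d(3) inb[of s] inb[of t] st by (intro add_mono) auto
      finally have "ennreal (dist (v (\<gamma> s)) (v (\<gamma> t))) \<le> ennreal (K * (dist (\<gamma> s) (\<gamma> x) + dist (\<gamma> x) (\<gamma> t)))"
        by (simp add: ennreal_leI distrib_left dist_commute)
      also have "\<dots> = ennreal K * (ennreal (dist (\<gamma> s) (\<gamma> x)) + ennreal (dist (\<gamma> x) (\<gamma> t)))"
        using d(2) by (simp add: ennreal_mult)
      also have "\<dots> \<le> ennreal K * (L s x + L x t)"
        using st by (intro mult_left_mono add_mono dist_le_path_length) auto
      also have "L s x + L x t = emeasure lm {s..t}"
        using st L_split[of s x t] emeasure_lm_Icc[of s t] by simp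
      also have "ennreal K * emeasure lm {s..t} = (\<integral>\<^sup>+x. ennreal K * indicator {s..t} x \<partial>lm)"
        by (subst nn_integral_cmult_indicator) auto
      also have "\<dots> \<le> (\<integral>\<^sup>+x\<in>{s..t}. G (\<gamma> x) \<partial>lm)"
      proof (rule nn_integral_mono)
        fix y show "ennreal K * indicator {s..t} y \<le> G (\<gamma> y) * indicator {s..t} y"
          using d(4) inb[of y] by (auto split: split_indicator)
      qed
      finally show "ennreal (dist (v (\<gamma> s)) (v (\<gamma> t))) \<le> (\<integral>\<^sup>+x\<in>{s..t}. G (\<gamma> x) \<partial>lm)" .
    qed
  qed
  then show "ennreal (norm (v (\<gamma> a) - v (\<gamma> b))) \<le> path_integral G (a, b, \<gamma>)"
    by (simp add: path_integral_eq dist_norm)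
qed

locale ext_setting = poincare_mms \<mu> c p CP \<Lambda> for \<mu> :: "'a::polish_space set \<Rightarrow> ennreal" and c p CP \<Lambda> :: real +
  fixes \<Omega> :: "'a set" and cO :: real
  assumes \<Omega>: "\<Omega> \<in> sets M" and ne: "\<Omega> \<noteq> {}" and cO: "0 < cO"
    and dens: "\<And>x r. x \<in> \<Omega> \<Longrightarrow> 0 < r \<Longrightarrow> r \<le> 1 \<Longrightarrow> ennreal cO * emeasure M (ball x r) \<le> emeasure M (ball x r \<inter> \<Omega>)"
begin

definition sc :: "nat \<Rightarrow> 'a \<Rightarrow> real" where "sc n x = max (1 / (real n + 4)) (infdist x \<Omega>)"

text \<open>A plateau of height \<open>sc n x\<close> up to distance 3 * sc n x, falling to zero at
  4 * sc n x. The height equals the scale instead of 1 so that the dependence on x is Lipschitz with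
  a constant independent of the scale (\<open>wt_lip\<close>).\<close>

definition wt :: "nat \<Rightarrow> 'a \<Rightarrow> 'a \<Rightarrow> real" where
  "wt n x y = max 0 (min (sc n x) (4 * sc n x - dist x y)) * indicator \<Omega> y"

definition Dn :: "nat \<Rightarrow> 'a \<Rightarrow> real" where "Dn n x = (LINT y|M. wt n x y)"

text \<open>Averaging over \<open>\<Omega>\<close> at the scale \<open>max (1 / (n + 4)) (infdist x \<Omega>)\<close> smooths \<open>u\<close> on \<open>\<Omega>\<close> and extends
  it at the same time; no Whitney covering is needed.\<close>

definition T :: "nat \<Rightarrow> ('a \<Rightarrow> 'b::banach) \<Rightarrow> 'a \<Rightarrow> 'b" where
  "T n u x = (1 / Dn n x) *\<^sub>R vint (\<lambda>y. wt n x y *\<^sub>R u y)"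

text \<open>Vanishes at distance 1/4 from \<Omega>. Together with the 4 in the scale this keeps all
  scales in use at most 1, the range of the measure-density condition.\<close>

definition \<eta> :: "'a \<Rightarrow> real" where "\<eta> x = max 0 (1 - 4 * infdist x \<Omega>)"

definition V :: "nat \<Rightarrow> ('a \<Rightarrow> 'b::banach) \<Rightarrow> 'a \<Rightarrow> 'b" where "V n u x = \<eta> x *\<^sub>R T n u x"

definition Ext :: "('a \<Rightarrow> 'b::banach) \<Rightarrow> 'a \<Rightarrow> 'b" where
  "Ext u x = (if convergent (\<lambda>n. V n u x) then lim (\<lambda>n. V n u x) else 0)"

text \<open>The power 4 arises in \<open>Dn_lower\<close>, where a ball of radius 8 s is covered by
  one of radius 16 s about a point of \<Omega> at distance below 2 s.\<close>

definition \<kappa> where "\<kappa> = cO / c ^ 4"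

lemma \<kappa>: "0 < \<kappa>" using c cO by (simp add: \<kappa>_def)

lemma infdist_lip: "\<bar>infdist x \<Omega> - infdist y \<Omega>\<bar> \<le> dist x y"
  by (rule infdist_triangle_abs)

lemma sc_pos: "0 < sc n x"
proof -
  have "0 < 1 / (real n + 4)" by simp
  then show ?thesis unfolding sc_def by linarith
qed

lemma sc_lip: "\<bar>sc n x - sc n y\<bar> \<le> dist x y"
  using infdist_lip[of x y] unfolding sc_def by (auto simp: max_def abs_le_iff)

lemma wt_nonneg: "0 \<le> wt n x y" by (simp add: wt_def)

lemma wt_le: "wt n x y \<le> sc n x" using sc_pos[of n x] by (auto simp: wt_def split: split_indicator)

lemma wt_zero: "y \<notin> \<Omega> \<or> 4 * sc n x \<le> dist x y \<Longrightarrow> wt n x y = 0"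
  by (auto simp: wt_def split: split_indicator)

lemma wt_full: "y \<in> \<Omega> \<Longrightarrow> dist x y \<le> 3 * sc n x \<Longrightarrow> wt n x y = sc n x"
  using sc_pos[of n x] by (auto simp: wt_def)

lemma wt_lip: "\<bar>wt n x y - wt n x' y\<bar> \<le> 5 * dist x x'"
proof -
  have "\<bar>dist x y - dist x' y\<bar> \<le> dist x x'"
    using dist_triangle[of x y x'] dist_triangle[of x' y x] by (simp add: abs_le_iff dist_commute)
  moreover have "\<bar>sc n x - sc n x'\<bar> \<le> dist x x'" by (rule sc_lip)
  ultimately have "\<bar>max 0 (min (sc n x) (4 * sc n x - dist x y)) - max 0 (min (sc n x') (4 * sc n x' - dist x' y))\<bar> \<le> 5 * dist x x'"
    by (simp add: max_def min_def abs_le_iff)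
  then show ?thesis by (auto simp: wt_def split: split_indicator)
qed

lemma wt_measurable [measurable]: "wt n x \<in> borel_measurable M"
proof -
  have "continuous_on UNIV (\<lambda>y. max 0 (min (sc n x) (4 * sc n x - dist x y)))"
    by (intro continuous_intros)
  then have "(\<lambda>y. max 0 (min (sc n x) (4 * sc n x - dist x y))) \<in> borel_measurable M"
    by (intro borel_measurable_M borel_measurable_continuous_onI)
  then show ?thesis unfolding wt_def[abs_def] using \<Omega> by simp
qed

lemma wt_integrable: "integrable M (wt n x)"
proof (rule integrableI_bounded_set[where A = "ball x (4 * sc n x)" and B = "sc n x"])
  show "AE y in M. y \<in> ball x (4 * sc n x) \<longrightarrow> norm (wt n x y) \<le> sc n x"
    using wt_nonneg wt_le by (intro AE_I2) simp
  show "AE y in M. y \<notin> ball x (4 * sc n x) \<longrightarrow> wt n x y = 0"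
    by (intro AE_I2) (simp add: wt_zero)
qed (use ball_emeasure(2) in auto)

lemma Dn_eq: "ennreal (Dn n x) = (\<integral>\<^sup>+y. ennreal (wt n x y) \<partial>M)"
  unfolding Dn_def using wt_integrable wt_nonneg by (intro nn_integral_eq_integral[symmetric]) auto

lemma near_\<Omega>: "\<exists>z\<in>\<Omega>. dist x z < 2 * sc n x"
proof -
  have "infdist x \<Omega> < 2 * sc n x" using sc_pos[of n x] by (simp add: sc_def)
  then have "(INF a\<in>\<Omega>. dist x a) < 2 * sc n x" by (simp add: infdist_notempty[OF ne])
  then show ?thesis by (subst (asm) cINF_less_iff) (auto simp: ne intro: bdd_belowI2[of _ 0])
qed

text \<open>Some z in \<Omega> lies within 2 s of x, where s is the scale. On the ball of radius s
  about z the weight is on its plateau, and measure density at z bounds the mass of \<Omega> there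
  from below.\<close>

lemma Dn_lower:
  assumes s: "sc n x \<le> 1"
  shows "ennreal (\<kappa> * sc n x) * emeasure M (ball x (8 * sc n x)) \<le> ennreal (Dn n x)"
proof -
  obtain z where z: "z \<in> \<Omega>" "dist x z < 2 * sc n x" using near_\<Omega> by blast
  let ?s = "sc n x"
  have s0: "0 < ?s" by (rule sc_pos)
  have "ennreal (\<kappa> * ?s) * emeasure M (ball x (8 * ?s)) \<le> ennreal (\<kappa> * ?s) * (ennreal (c ^ 4) * emeasure M (ball z ?s))"
    using z s0 by (intro mult_left_mono ball_compare) auto
  also have "\<dots> = ennreal ?s * (ennreal cO * emeasure M (ball z ?s))"
  proof -
    have "\<kappa> * ?s * c ^ 4 = ?s * cO" using c by (simp add: \<kappa>_def)
    then have "ennreal (\<kappa> * ?s) * ennreal (c ^ 4) = ennreal ?s * ennreal cO"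
      using \<kappa> s0 c cO by (simp add: ennreal_mult[symmetric])
    then show ?thesis by (simp add: mult.assoc[symmetric])
  qed
  also have "\<dots> \<le> ennreal ?s * emeasure M (ball z ?s \<inter> \<Omega>)"
    by (intro mult_left_mono dens z s s0) simp
  also have "\<dots> = (\<integral>\<^sup>+y. ennreal ?s * indicator (ball z ?s \<inter> \<Omega>) y \<partial>M)"
    using \<Omega> by (subst nn_integral_cmult_indicator) auto
  also have "\<dots> \<le> (\<integral>\<^sup>+y. ennreal (wt n x y) \<partial>M)"
  proof (rule nn_integral_mono)
    fix y
    have "wt n x y = ?s" if "y \<in> \<Omega>" "y \<in> ball z ?s"
      using that z(2) dist_triangle[of x y z] by (intro wt_full) auto
    then show "ennreal ?s * indicator (ball z ?s \<inter> \<Omega>) y \<le> ennreal (wt n x y)"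
      by (auto split: split_indicator)
  qed
  finally show ?thesis by (simp add: Dn_eq)
qed

lemma Dn_pos:
  assumes s: "sc n x \<le> 1"
  shows "0 < Dn n x"
proof -
  have "0 < ennreal (\<kappa> * sc n x) * emeasure M (ball x (8 * sc n x))"
    using \<kappa> sc_pos[of n x] ball_emeasure(1)[of "8 * sc n x" x] by (simp add: ennreal_zero_less_mult_iff)
  also note Dn_lower[OF s]
  finally show ?thesis by simp
qed

definition nu :: "('a \<Rightarrow> 'b::banach) \<Rightarrow> 'a \<Rightarrow> ennreal" where "nu u y = ennreal (norm (u y)) * indicator \<Omega> y"

definition Uok :: "('a \<Rightarrow> 'b::banach) \<Rightarrow> bool" where
  "Uok u \<longleftrightarrow> measurable_map \<mu> \<Omega> u \<and> (\<integral>\<^sup>+y. nu u y powe p \<partial>M) < top"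

lemma nu_eq: "nu u y = ennreal (norm (indicator \<Omega> y *\<^sub>R u y))"
  by (simp add: nu_def split: split_indicator)

lemma nu_measurable: "Uok u \<Longrightarrow> nu u \<in> borel_measurable M"
  unfolding nu_eq[abs_def] by (intro int_map_norm_measurable measurable_map_zero_ext \<Omega>) (simp add: Uok_def)

lemma Lp_int_nu: "Lp_int p \<mu> \<Omega> (\<lambda>x. ennreal (norm (u x))) = (\<integral>\<^sup>+y. nu u y powe p \<partial>M)"
  unfolding Lp_int_on[OF \<Omega>] nu_def by (intro nn_integral_cong) (auto split: split_indicator)

lemma local_integral_finite:
  assumes [measurable]: "f \<in> borel_measurable M" and f: "(\<integral>\<^sup>+y. f y powe p \<partial>M) < top"
  shows "(\<integral>\<^sup>+y\<in>ball x r. f y \<partial>M) < top"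
proof -
  have "(\<integral>\<^sup>+y\<in>ball x r. f y \<partial>M) \<le> (\<integral>\<^sup>+y. indicator (ball x r) y + f y powe p \<partial>M)"
  proof (rule nn_integral_mono)
    fix y
    have "f y \<le> 1 + f y powe p"
    proof (cases "f y \<le> 1")
      case False
      then have "f y powe 1 \<le> f y powe p"
      proof (cases "f y")
        case (real w)
        then have "w powr 1 \<le> w powr p" using False p by (intro powr_mono) (auto simp: ennreal_le_1)
        then show ?thesis using real by (simp add: powe_ennreal ennreal_leI)
      qed simp
      moreover have "f y powe 1 = f y" by (cases "f y") (auto simp: powe_ennreal)
      ultimately show ?thesis by (simp add: add_increasing)
    qed (simp add: add_increasing2)
    then show "f y * indicator (ball x r) y \<le> indicator (ball x r) y + f y powe p"
      by (auto split: split_indicator)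
  qed
  also have "\<dots> = emeasure M (ball x r) + (\<integral>\<^sup>+y. f y powe p \<partial>M)"
    by (subst nn_integral_add) auto
  also have "\<dots> < top" using f ball_emeasure(2) by simp
  finally show ?thesis .
qed

lemma weighted_int_map:
  assumes u: "Uok u" and m: "\<phi> \<in> borel_measurable M"
    and b: "\<And>y. \<bar>\<phi> y\<bar> \<le> K" and z: "\<And>y. y \<notin> \<Omega> \<or> y \<notin> ball x r \<Longrightarrow> \<phi> y = 0"
  shows "int_map (\<lambda>y. \<phi> y *\<^sub>R u y)"
proof -
  have e: "\<phi> y *\<^sub>R u y = \<phi> y *\<^sub>R (indicator \<Omega> y *\<^sub>R u y)" for y
    using z[of y] by (auto split: split_indicator)
  have "measurable_map \<mu> UNIV (\<lambda>y. \<phi> y *\<^sub>R u y)"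
    unfolding e using u by (intro measurable_map_scaleR measurable_map_real m measurable_map_zero_ext \<Omega>) (simp add: Uok_def)
  moreover have "(\<integral>\<^sup>+y. ennreal (norm (\<phi> y *\<^sub>R u y)) \<partial>M) \<le> (\<integral>\<^sup>+y. ennreal K * (nu u y * indicator (ball x r) y) \<partial>M)"
  proof (rule nn_integral_mono)
    fix y
    have "ennreal (\<bar>\<phi> y\<bar> * norm (u y)) \<le> ennreal (K * norm (u y))"
      using b[of y] by (intro ennreal_leI mult_right_mono) auto
    moreover have "0 \<le> K" using b[of y] by linarith
    ultimately show "ennreal (norm (\<phi> y *\<^sub>R u y)) \<le> ennreal K * (nu u y * indicator (ball x r) y)"
      using z[of y] by (auto simp: nu_def ennreal_mult split: split_indicator)
  qed
  moreover have "(\<integral>\<^sup>+y. ennreal K * (nu u y * indicator (ball x r) y) \<partial>M) = ennreal K * (\<integral>\<^sup>+y\<in>ball x r. nu u y \<partial>M)"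
    using nu_measurable[OF u] by (intro nn_integral_cmult) simp
  moreover have "(\<integral>\<^sup>+y\<in>ball x r. nu u y \<partial>M) < top"
    using u by (intro local_integral_finite nu_measurable) (simp_all add: Uok_def)
  ultimately show ?thesis
    unfolding int_map_def by (auto simp: ennreal_mult_less_top elim: order.strict_trans1)
qed

lemma wt_int_map: "Uok u \<Longrightarrow> int_map (\<lambda>y. wt n x y *\<^sub>R u y)"
  by (rule weighted_int_map[where K = "sc n x" and x = x and r = "4 * sc n x"])
     (use wt_nonneg wt_le wt_zero in \<open>auto simp: not_less\<close>)

lemma wt_const_int_map: "int_map (\<lambda>y. wt n x y *\<^sub>R v)" for v :: "'b::banach"
  by (rule vint_scaleR_const(1)[OF wt_integrable])

lemma vint_wt_const: "vint (\<lambda>y. wt n x y *\<^sub>R v) = Dn n x *\<^sub>R v"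
  unfolding Dn_def by (rule vint_scaleR_const(2)[OF wt_integrable])

lemma vint_wt_shift:
  assumes u: "Uok u"
  shows "int_map (\<lambda>y. wt n x y *\<^sub>R (u y - v))"
    and "vint (\<lambda>y. wt n x y *\<^sub>R (u y - v)) = vint (\<lambda>y. wt n x y *\<^sub>R u y) - Dn n x *\<^sub>R v"
proof -
  have e: "(\<lambda>y. wt n x y *\<^sub>R (u y - v)) = (\<lambda>y. wt n x y *\<^sub>R u y + (-1) *\<^sub>R (wt n x y *\<^sub>R v))"
    by (simp add: scaleR_diff_right)
  have i: "int_map (\<lambda>y. (-1) *\<^sub>R (wt n x y *\<^sub>R v))" by (rule int_map_cmult[OF wt_const_int_map])
  show "int_map (\<lambda>y. wt n x y *\<^sub>R (u y - v))"
    unfolding e by (rule int_map_add[OF wt_int_map[OF u] i])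
  show "vint (\<lambda>y. wt n x y *\<^sub>R (u y - v)) = vint (\<lambda>y. wt n x y *\<^sub>R u y) - Dn n x *\<^sub>R v"
    unfolding e vint_add[OF wt_int_map[OF u] i] vint_cmult[OF wt_const_int_map] vint_wt_const by simp
qed

lemma T_dev:
  assumes u: "Uok u" and s: "sc n x \<le> 1"
  shows "Dn n x *\<^sub>R (T n u x - v) = vint (\<lambda>y. wt n x y *\<^sub>R (u y - v))"
    and "ennreal (norm (T n u x - v)) * (ennreal (\<kappa> * sc n x) * emeasure M (ball x (8 * sc n x))) \<le>
      (\<integral>\<^sup>+y. ennreal (wt n x y * norm (u y - v)) \<partial>M)"
proof -
  have D: "0 < Dn n x" by (rule Dn_pos[OF s])
  show eq: "Dn n x *\<^sub>R (T n u x - v) = vint (\<lambda>y. wt n x y *\<^sub>R (u y - v))"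
    unfolding vint_wt_shift(2)[OF u] T_def using D by (simp add: scaleR_diff_right)
  have "ennreal (norm (T n u x - v)) * (ennreal (\<kappa> * sc n x) * emeasure M (ball x (8 * sc n x))) \<le>
    ennreal (norm (T n u x - v)) * ennreal (Dn n x)"
    by (intro mult_left_mono Dn_lower s) simp
  also have "\<dots> = ennreal (norm (vint (\<lambda>y. wt n x y *\<^sub>R (u y - v))))"
    unfolding eq[symmetric] using D by (simp add: ennreal_mult[symmetric] mult.commute)
  also have "\<dots> \<le> (\<integral>\<^sup>+y. ennreal (norm (wt n x y *\<^sub>R (u y - v))) \<partial>M)"
    by (rule norm_vint_le[OF vint_wt_shift(1)[OF u]])
  finally show "ennreal (norm (T n u x - v)) * (ennreal (\<kappa> * sc n x) * emeasure M (ball x (8 * sc n x))) \<le>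
      (\<integral>\<^sup>+y. ennreal (wt n x y * norm (u y - v)) \<partial>M)"
    using wt_nonneg by simp
qed

text \<open>With \<open>T n u x\<close> subtracted, the integral against the weight at x vanishes.
  The difference of the averages is therefore an integral of u against the difference of the two
  weights, and no difference of normalising factors appears.\<close>

lemma T_diff:
  assumes u: "Uok u" and s: "sc n x \<le> 1" "sc n x' \<le> 1"
  shows "ennreal (norm (T n u x' - T n u x)) * (ennreal (\<kappa> * sc n x') * emeasure M (ball x' (8 * sc n x'))) \<le>
    (\<integral>\<^sup>+y. ennreal (\<bar>wt n x' y - wt n x y\<bar> * norm (u y - T n u x)) \<partial>M)"
proof -
  let ?v = "T n u x"
  have D: "0 < Dn n x'" by (rule Dn_pos[OF s(2)])
  have "vint (\<lambda>y. wt n x y *\<^sub>R (u y - ?v)) = Dn n x *\<^sub>R (T n u x - ?v)"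
    by (rule T_dev(1)[OF u s(1), symmetric])
  then have z: "vint (\<lambda>y. wt n x y *\<^sub>R (u y - ?v)) = 0" by simp
  have e: "(\<lambda>y. wt n x' y *\<^sub>R (u y - ?v) + (-1) *\<^sub>R (wt n x y *\<^sub>R (u y - ?v))) = (\<lambda>y. (wt n x' y - wt n x y) *\<^sub>R (u y - ?v))"
    by (simp add: scaleR_diff_left)
  have i: "int_map (\<lambda>y. (-1) *\<^sub>R (wt n x y *\<^sub>R (u y - ?v)))" by (rule int_map_cmult[OF vint_wt_shift(1)[OF u]])
  have i2: "int_map (\<lambda>y. (wt n x' y - wt n x y) *\<^sub>R (u y - ?v))"
    unfolding e[symmetric] by (rule int_map_add[OF vint_wt_shift(1)[OF u] i])
  have eq: "Dn n x' *\<^sub>R (T n u x' - ?v) = vint (\<lambda>y. (wt n x' y - wt n x y) *\<^sub>R (u y - ?v))"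
    unfolding e[symmetric] vint_add[OF vint_wt_shift(1)[OF u] i] vint_cmult[OF vint_wt_shift(1)[OF u]] z T_dev(1)[OF u s(2)]
    by simp
  have "ennreal (norm (T n u x' - ?v)) * (ennreal (\<kappa> * sc n x') * emeasure M (ball x' (8 * sc n x'))) \<le>
    ennreal (norm (T n u x' - ?v)) * ennreal (Dn n x')"
    by (intro mult_left_mono Dn_lower s) simp
  also have "\<dots> = ennreal (norm (vint (\<lambda>y. (wt n x' y - wt n x y) *\<^sub>R (u y - ?v))))"
    unfolding eq[symmetric] using D by (simp add: ennreal_mult[symmetric] mult.commute)
  also have "\<dots> \<le> (\<integral>\<^sup>+y. ennreal (norm ((wt n x' y - wt n x y) *\<^sub>R (u y - ?v))) \<partial>M)"
    by (rule norm_vint_le[OF i2])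
  finally show ?thesis by simp
qed

lemma cancel_ball:
  assumes le: "a * (ennreal k * emeasure M (ball x r)) \<le> ennreal l * I" and k: "0 < k" and l: "0 \<le> l" and r: "0 < r"
  shows "a \<le> ennreal (l / k) * (I / emeasure M (ball x r))"
proof -
  let ?b = "emeasure M (ball x r)"
  have b: "?b \<noteq> 0" "?b \<noteq> top" using ball_emeasure(1)[OF r, of x] ball_emeasure(2)[of x r] by auto
  have kb: "ennreal k * ?b \<noteq> 0" "ennreal k * ?b \<noteq> top" using b k by (auto simp: ennreal_mult_eq_top_iff)
  have "a = a * (ennreal k * ?b) / (ennreal k * ?b)" using kb by (simp add: ennreal_mult_divide_eq)
  also have "\<dots> \<le> ennreal l * I / (ennreal k * ?b)" by (rule divide_right_mono_ennreal[OF le])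
  also have "\<dots> = ennreal (l / k) * (I / ?b)"
  proof -
    have "ennreal (l / k) * (I / ?b) * (ennreal k * ?b) = ennreal (l / k) * ennreal k * (I / ?b * ?b)"
      by (simp add: mult_ac)
    also have "\<dots> = ennreal l * I"
      using b k l by (simp add: ennreal_divide_mult_self ennreal_mult[symmetric])
    finally show ?thesis using kb by (metis ennreal_mult_divide_eq)
  qed
  finally show ?thesis .
qed

lemma T_bound:
  assumes u: "Uok u" and s: "sc n x \<le> 1"
  shows "ennreal (norm (T n u x)) \<le> ennreal (1 / \<kappa>) * avg (nu u) x (8 * sc n x)"
proof -
  let ?s = "sc n x"
  have s0: "0 < ?s" by (rule sc_pos)
  have "ennreal (norm (T n u x - 0)) * (ennreal (\<kappa> * ?s) * emeasure M (ball x (8 * ?s))) \<le>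
      (\<integral>\<^sup>+y. ennreal (wt n x y * norm (u y - 0)) \<partial>M)"
    by (rule T_dev(2)[OF u s])
  also have "\<dots> \<le> (\<integral>\<^sup>+y. ennreal ?s * (nu u y * indicator (ball x (8 * ?s)) y) \<partial>M)"
  proof (rule nn_integral_mono)
    fix y
    have "wt n x y * norm (u y) \<le> ?s * norm (u y)" by (intro mult_right_mono wt_le) simp
    then have "ennreal (wt n x y * norm (u y)) \<le> ennreal ?s * ennreal (norm (u y))"
      using s0 by (simp add: ennreal_leI flip: ennreal_mult)
    then show "ennreal (wt n x y * norm (u y - 0)) \<le> ennreal ?s * (nu u y * indicator (ball x (8 * ?s)) y)"
      using wt_zero[of y n x] s0 by (cases "y \<in> \<Omega> \<and> dist x y < 4 * ?s") (auto simp: nu_def)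
  qed
  also have "\<dots> = ennreal ?s * (\<integral>\<^sup>+y\<in>ball x (8 * ?s). nu u y \<partial>M)"
    using nu_measurable[OF u] by (intro nn_integral_cmult) simp
  finally have "ennreal (norm (T n u x)) \<le> ennreal (?s / (\<kappa> * ?s)) * ((\<integral>\<^sup>+y\<in>ball x (8 * ?s). nu u y \<partial>M) / emeasure M (ball x (8 * ?s)))"
    using s0 \<kappa> by (intro cancel_ball) simp_all
  then show ?thesis using s0 by (simp add: avg_def)
qed

end

section \<open>The cut-off, the constants and linearity of the approximations\<close>

context ext_setting
begin

text \<open>From \<open>T_lip\<close>: 5 * 16 for the weights and the deviation, divided by 3/4 for
  the change of scale, times 2 because the average of g enters twice.\<close>

definition C2 :: real where "C2 = 640 * c / (3 * \<kappa>\<^sup>2)"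

lemma C2: "0 < C2" using \<kappa> c by (simp add: C2_def)

lemma \<eta>: "0 \<le> \<eta> x" "\<eta> x \<le> 1" "\<bar>\<eta> x - \<eta> y\<bar> \<le> 4 * dist x y"
  using infdist_lip[of x y] infdist_nonneg[of x \<Omega>] unfolding \<eta>_def by (auto simp: max_def abs_le_iff)

lemma \<eta>_zero: "1 / 4 \<le> infdist x \<Omega> \<Longrightarrow> \<eta> x = 0"
  by (simp add: \<eta>_def)

lemma sc_le: "infdist x \<Omega> \<le> r \<Longrightarrow> 1 / 4 \<le> r \<Longrightarrow> sc n x \<le> r"
proof -
  assume *: "infdist x \<Omega> \<le> r" "1 / 4 \<le> r"
  have "1 / (real n + 4) \<le> 1 / 4" by (rule divide_left_mono) auto
  then have "1 / (real n + 4) \<le> r" using *(2) by (rule order_trans)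
  with *(1) show ?thesis unfolding sc_def by (rule max.boundedI[rotated])
qed

definition S :: real where "S = c ^ 2 * 4 powr p * geom_const (p - 1)"

lemma S: "0 < S" using p c geom_const_pos[of "p - 1"] by (simp add: S_def)

lemma mf_finite:
  assumes f: "f \<in> borel_measurable M" "(\<integral>\<^sup>+y. f y powe p \<partial>M) < top"
  shows "AE x in M. mf f x < top"
proof -
  have "(\<integral>\<^sup>+x. mf f x powe p \<partial>M) < top"
    by (rule order.strict_trans1[OF strong_type[OF p f(1)]]) (use f(2) in \<open>simp add: ennreal_mult_less_top\<close>)
  moreover have "(\<lambda>x. mf f x powe p) \<in> borel_measurable M"
    using borel_measurable_M[OF mf_measurable] by measurable
  ultimately have "AE x in M. mf f x powe p \<noteq> \<infinity>" by (intro nn_integral_PInf_AE) auto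
  then show ?thesis by eventually_elim (auto simp: ennreal_powr_def less_top split: if_splits)
qed

lemma Ext_tendsto: "convergent (\<lambda>n. V n u x) \<Longrightarrow> (\<lambda>n. V n u x) \<longlonglongrightarrow> Ext u x"
  by (simp add: Ext_def convergent_LIMSEQ_iff)

text \<open>The p-th root of the bound in \<open>Ext_gauge\<close>: 2^p splits the gradient
  \<open>G\<close>, \<open>S\<close> is the strong-type constant, and the two summands belong to the
  maximal functions of g and of u.\<close>

definition CE :: real where
  "CE = (2 powr p * S * (C2 powr p * CH powr p + (4 / \<kappa>) powr p)) powr (1 / p)"

lemma CE_nonneg: "0 \<le> CE" by (simp add: CE_def)

lemma V_add:
  assumes u: "Uok u" and v: "Uok v"
  shows "V n (\<lambda>y. u y + v y) x = V n u x + V n v x"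
  unfolding V_def T_def scaleR_add_right vint_add[OF wt_int_map[OF u] wt_int_map[OF v]] ..

lemma V_cmult:
  assumes u: "Uok u"
  shows "V n (\<lambda>y. a *\<^sub>R u y) x = a *\<^sub>R V n u x"
proof -
  have e: "(\<lambda>y. wt n x y *\<^sub>R a *\<^sub>R u y) = (\<lambda>y. a *\<^sub>R wt n x y *\<^sub>R u y)" by (simp add: mult.commute)
  show ?thesis
    unfolding V_def T_def e vint_cmult[OF wt_int_map[OF u]] by (simp add: mult_ac)
qed

lemma Ext_cong:
  assumes u: "Uok u" and v: "Uok v" and eq: "AE x in measure_on \<mu> \<Omega>. u x = v x"
  shows "Ext u = Ext v"
proof -
  have "AE y in M. y \<in> \<Omega> \<longrightarrow> u y = v y" using eq by (simp add: AE_on_iff[OF \<Omega>])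
  then have "AE y in M. wt n x y *\<^sub>R u y = wt n x y *\<^sub>R v y" for n x
    by eventually_elim (auto simp: wt_def split: split_indicator)
  then have "V n u x = V n v x" for n x
    unfolding V_def T_def using vint_cong_AE[OF wt_int_map[OF u] wt_int_map[OF v]] by metis
  then show ?thesis by (simp add: Ext_def fun_eq_iff)
qed

end

text \<open>One function u with an auxiliary extension h, a pointwise gradient g of h and a null set
  N off which both are related. The functions \<open>T n u\<close>, \<open>V n u\<close> and
  \<open>Ext u\<close> involve u alone; h, g and N serve the estimates.\<close>

locale ext_datum = ext_setting \<mu> c p CP \<Lambda> \<Omega> cO
  for \<mu> :: "'a::polish_space set \<Rightarrow> ennreal" and c p CP \<Lambda> :: real and \<Omega> cO +
  fixes u h :: "'a \<Rightarrow> 'b::banach" and g :: "'a \<Rightarrow> ennreal" and N :: "'a set"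
  assumes u: "Uok u" and g [measurable]: "g \<in> borel_measurable M" and gp: "(\<integral>\<^sup>+x. g x powe p \<partial>M) < top"
    and N: "N \<in> null_sets M"
    and H: "\<And>x y. x \<notin> N \<Longrightarrow> y \<notin> N \<Longrightarrow> ennreal (norm (h x - h y)) \<le> ennreal (dist x y) * (g x + g y)"
    and hu: "\<And>x. x \<in> \<Omega> \<Longrightarrow> x \<notin> N \<Longrightarrow> h x = u x"
begin

lemma avg_add_const:
  assumes r: "0 < r"
  shows "(\<integral>\<^sup>+y\<in>ball x r. a + g y \<partial>M) / emeasure M (ball x r) = a + avg g x r"
proof -
  have b: "emeasure M (ball x r) \<noteq> 0" "emeasure M (ball x r) \<noteq> top"
    using ball_emeasure(1)[OF r, of x] ball_emeasure(2)[of x r] by auto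
  have "(\<integral>\<^sup>+y\<in>ball x r. a + g y \<partial>M) = (\<integral>\<^sup>+y. a * indicator (ball x r) y + g y * indicator (ball x r) y \<partial>M)"
    by (simp add: distrib_right)
  also have "\<dots> = a * emeasure M (ball x r) + (\<integral>\<^sup>+y\<in>ball x r. g y \<partial>M)"
    by (subst nn_integral_add) (auto simp: nn_integral_cmult_indicator)
  finally show ?thesis using b by (simp add: avg_def add_divide_distrib_ennreal ennreal_mult_divide_eq)
qed

lemma avg_finite:
  assumes r: "0 < r" and f: "f \<in> borel_measurable M" "(\<integral>\<^sup>+y. f y powe p \<partial>M) < top"
  shows "avg f x r < top"
proof -
  have "(\<integral>\<^sup>+y\<in>ball x r. f y \<partial>M) \<noteq> top" using local_integral_finite[OF f, of x r] by simp
  then have "avg f x r \<noteq> top" unfolding avg_def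
    using ball_emeasure(1)[OF r, of x] ball_emeasure(2)[of x r] by (auto simp: ennreal_divide_eq_top_iff)
  then show ?thesis by (simp add: less_top)
qed

text \<open>The comparison value is \<open>h w\<close>, so w may lie outside \<Omega>:
  \<open>T_lip\<close> takes w in \<Omega>, \<open>V_tendsto\<close> takes w = x in the closure of
  \<Omega>. The weight is at most s and lives within 4 s, w is within 8 s, whence 16 s generously
  bounds the distances.\<close>

lemma T_dev_avg:
  assumes s: "sc n x \<le> 1" and w: "w \<notin> N" "dist x w < 8 * sc n x"
  shows "ennreal (norm (T n u x - h w)) \<le> ennreal (16 * sc n x / \<kappa>) * (g w + avg g x (8 * sc n x))"
proof -
  let ?s = "sc n x" and ?B = "ball x (8 * sc n x)"
  have s0: "0 < ?s" by (rule sc_pos)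
  have "ennreal (norm (T n u x - h w)) * (ennreal (\<kappa> * ?s) * emeasure M ?B) \<le>
      (\<integral>\<^sup>+z. ennreal (wt n x z * norm (u z - h w)) \<partial>M)"
    by (rule T_dev(2)[OF u s])
  also have "\<dots> \<le> (\<integral>\<^sup>+z. ennreal (16 * ?s * ?s) * ((g w + g z) * indicator ?B z) \<partial>M)"
  proof (rule nn_integral_mono_AE)
    show "AE z in M. ennreal (wt n x z * norm (u z - h w)) \<le> ennreal (16 * ?s * ?s) * ((g w + g z) * indicator ?B z)"
      using AE_not_in[OF N]
    proof eventually_elim
      case (elim z)
      show ?case
      proof (cases "z \<in> \<Omega> \<and> dist x z < 4 * ?s")
        case True
        have d: "dist z w \<le> 16 * ?s" using True w(2) dist_triangle3[of z w x] s0 by linarith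
        have "ennreal (wt n x z * norm (u z - h w)) = ennreal (wt n x z) * ennreal (norm (h z - h w))"
          using True elim hu[of z] wt_nonneg by (simp add: ennreal_mult)
        also have "\<dots> \<le> ennreal ?s * (ennreal (16 * ?s) * (g z + g w))"
          by (intro mult_mono ennreal_leI wt_le order_trans[OF H[OF elim w(1)]] mult_right_mono d) simp_all
        also have "\<dots> = ennreal (16 * ?s * ?s) * (g w + g z)"
          using s0 by (simp add: ennreal_mult mult_ac add.commute)
        finally show ?thesis using True s0 by simp
      qed (use wt_zero[of z n x] in auto)
    qed
  qed
  also have "\<dots> = ennreal (16 * ?s * ?s) * (\<integral>\<^sup>+z\<in>?B. g w + g z \<partial>M)"
    by (rule nn_integral_cmult) measurable
  finally have "ennreal (norm (T n u x - h w)) \<le>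
      ennreal (16 * ?s * ?s / (\<kappa> * ?s)) * ((\<integral>\<^sup>+z\<in>?B. g w + g z \<partial>M) / emeasure M ?B)"
    using s0 \<kappa> by (intro cancel_ball) simp_all
  then show ?thesis using s0 by (simp add: avg_add_const)
qed

text \<open>The scales at x and x' differ by at most a quarter, so the balls are comparable at the
  cost of c. In \<open>T_diff\<close> the weights differ by at most 5 * dist x x' and vanish off the
  ball about x; there \<open>T_dev_avg\<close> bounds the deviation of u from its average,
  contributing another factor s that cancels the normalisation.\<close>

lemma T_lip:
  assumes s: "sc n x \<le> 1 / 2" and d: "dist x x' \<le> sc n x / 4"
  shows "ennreal (norm (T n u x' - T n u x)) \<le> ennreal (C2 * dist x x') * avg g x (8 * sc n x)"
proof -
  let ?s = "sc n x" and ?s' = "sc n x'" and ?B = "ball x (8 * sc n x)" and ?d = "dist x x'"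
  define A where "A = avg g x (8 * ?s)"
  have s0: "0 < ?s" by (rule sc_pos)
  have ss: "3 / 4 * ?s \<le> ?s'" "?s' \<le> 5 / 4 * ?s" using sc_lip[of n x x'] d by (auto simp: abs_le_iff)
  have Ab: "A * emeasure M ?B = (\<integral>\<^sup>+y\<in>?B. g y \<partial>M)"
    using ball_emeasure(1)[of "8 * ?s" x] ball_emeasure(2)[of x "8 * ?s"] s0
    by (simp add: A_def avg_def ennreal_divide_mult_self)
  have "ennreal (norm (T n u x' - T n u x)) * (ennreal (\<kappa> * (3 / 4 * ?s) / c) * emeasure M ?B) \<le>
    ennreal (norm (T n u x' - T n u x)) * (ennreal (\<kappa> * ?s') * emeasure M (ball x' (8 * ?s')))"
  proof (rule mult_left_mono)
    have "emeasure M ?B \<le> ennreal (c ^ 1) * emeasure M (ball x' (8 * ?s'))"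
      using d ss s0 by (intro ball_compare) simp
    then have "ennreal (\<kappa> * (3 / 4 * ?s) / c) * emeasure M ?B \<le> ennreal (\<kappa> * (3 / 4 * ?s) / c) * (ennreal c * emeasure M (ball x' (8 * ?s')))"
      by (intro mult_left_mono) simp_all
    also have "\<dots> = ennreal (\<kappa> * (3 / 4 * ?s) / c * c) * emeasure M (ball x' (8 * ?s'))"
      using c \<kappa> s0 by (subst ennreal_mult) (auto simp: mult.assoc)
    also have "\<dots> \<le> ennreal (\<kappa> * ?s') * emeasure M (ball x' (8 * ?s'))"
      using c \<kappa> ss(1) by (intro mult_right_mono ennreal_leI) auto
    finally show "ennreal (\<kappa> * (3 / 4 * ?s) / c) * emeasure M ?B \<le> ennreal (\<kappa> * ?s') * emeasure M (ball x' (8 * ?s'))" .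
  qed simp
  also have "\<dots> \<le> (\<integral>\<^sup>+y. ennreal (\<bar>wt n x' y - wt n x y\<bar> * norm (u y - T n u x)) \<partial>M)"
    using s ss s0 by (intro T_diff u) auto
  also have "\<dots> \<le> (\<integral>\<^sup>+y. ennreal (80 * ?d * ?s / \<kappa>) * ((A + g y) * indicator ?B y) \<partial>M)"
  proof (rule nn_integral_mono_AE)
    show "AE y in M. ennreal (\<bar>wt n x' y - wt n x y\<bar> * norm (u y - T n u x)) \<le>
        ennreal (80 * ?d * ?s / \<kappa>) * ((A + g y) * indicator ?B y)"
      using AE_not_in[OF N]
    proof eventually_elim
      case (elim y)
      show ?case
      proof (cases "y \<in> \<Omega> \<and> dist x y < 8 * ?s")
        case True
        have "\<bar>wt n x' y - wt n x y\<bar> \<le> 5 * ?d" using wt_lip[of n x y x'] by (simp add: abs_minus_commute)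
        moreover have "ennreal (norm (u y - T n u x)) \<le> ennreal (16 * ?s / \<kappa>) * (g y + A)"
          using T_dev_avg[of n x y] s True elim hu[of y] by (simp add: norm_minus_commute A_def)
        ultimately have "ennreal \<bar>wt n x' y - wt n x y\<bar> * ennreal (norm (u y - T n u x)) \<le>
            ennreal (5 * ?d) * (ennreal (16 * ?s / \<kappa>) * (g y + A))"
          by (intro mult_mono ennreal_leI) simp_all
        also have "\<dots> = ennreal (5 * ?d * (16 * ?s / \<kappa>)) * (A + g y)"
          using s0 \<kappa> by (subst ennreal_mult) (auto simp: mult.assoc add.commute)
        finally show ?thesis using True by (simp add: ennreal_mult'' mult.assoc)
      next
        case False
        have "wt n x y = 0" using False s0 by (intro wt_zero) auto
        moreover have "wt n x' y = 0"
        proof (rule wt_zero)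
          have "dist x y \<le> ?d + dist x' y" by (rule dist_triangle)
          then show "y \<notin> \<Omega> \<or> 4 * ?s' \<le> dist x' y" using False s0 ss d by auto
        qed
        ultimately show ?thesis by simp
      qed
    qed
  qed
  also have "\<dots> = ennreal (80 * ?d * ?s / \<kappa>) * (\<integral>\<^sup>+y\<in>?B. A + g y \<partial>M)"
    by (rule nn_integral_cmult) measurable
  finally have "ennreal (norm (T n u x' - T n u x)) \<le>
      ennreal (80 * ?d * ?s / \<kappa> / (\<kappa> * (3 / 4 * ?s) / c)) * ((\<integral>\<^sup>+y\<in>?B. A + g y \<partial>M) / emeasure M ?B)"
    using s0 \<kappa> c by (intro cancel_ball) simp_all
  also have "(\<integral>\<^sup>+y\<in>?B. A + g y \<partial>M) / emeasure M ?B = 2 * A"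
    using s0 by (simp add: avg_add_const A_def mult_2)
  also have "80 * ?d * ?s / \<kappa> / (\<kappa> * (3 / 4 * ?s) / c) = C2 / 2 * ?d"
    using s0 \<kappa> c by (simp add: C2_def field_simps power2_eq_square)
  also have "ennreal (C2 / 2 * ?d) * (2 * A) = ennreal (C2 / 2 * ?d * 2) * A"
    using C2 by (subst ennreal_mult[of "C2 / 2 * ?d"]) (auto simp: mult.assoc)
  finally show ?thesis by (simp add: A_def)
qed

definition G :: "'a \<Rightarrow> ennreal" where
  "G x = ennreal C2 * mf g x + ennreal (4 / \<kappa>) * mf (nu u) x"

lemma G_measurable: "G \<in> borel_measurable borel"
  unfolding G_def[abs_def] by measurable

text \<open>At distance at least 1/2 from \<Omega> the function vanishes nearby. Otherwise the
  product rule combines \<open>T_lip\<close> with \<open>T_bound\<close> for the derivative of the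
  cut-off. The constant uses averages over a ball about x, which also contains the nearby points y,
  so that the uncentred maximal functions in \<open>G y\<close> dominate it.\<close>

lemma V_local:
  "\<exists>d>0. \<exists>L\<ge>0. (\<forall>y\<in>ball x d. norm (V n u y - V n u x) \<le> L * dist x y) \<and> (\<forall>y\<in>ball x d. ennreal L \<le> G y)"
proof (cases "1 / 2 \<le> infdist x \<Omega>")
  case True
  have "V n u y = 0" if "y \<in> ball x (1 / 4)" for y
    using that True infdist_lip[of x y] by (simp add: V_def \<eta>_zero abs_le_iff)
  moreover have "V n u x = 0" using True by (simp add: V_def \<eta>_zero)
  ultimately show ?thesis by (intro exI[of _ "1/4"] conjI exI[of _ 0]) auto
next
  case False
  let ?s = "sc n x"
  have s: "?s \<le> 1 / 2" using False by (intro sc_le) auto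
  have s0: "0 < ?s" by (rule sc_pos)
  define L' where "L' = ennreal C2 * avg g x (8 * ?s) + ennreal (4 / \<kappa>) * avg (nu u) x (8 * ?s)"
  have "avg g x (8 * ?s) < top" using s0 by (intro avg_finite g gp) simp
  moreover have "avg (nu u) x (8 * ?s) < top"
    using s0 u by (intro avg_finite nu_measurable) (simp_all add: Uok_def)
  ultimately have "L' < top" by (simp add: L'_def ennreal_mult_less_top)
  then obtain L where L: "L' = ennreal L" "0 \<le> L" by (cases L') auto
  have 1: "norm (V n u y - V n u x) \<le> L * dist x y" if y: "y \<in> ball x (?s / 4)" for y
  proof -
    have "V n u y - V n u x = \<eta> y *\<^sub>R (T n u y - T n u x) + (\<eta> y - \<eta> x) *\<^sub>R T n u x"
      by (simp add: V_def algebra_simps)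
    then have "norm (V n u y - V n u x) \<le> \<eta> y * norm (T n u y - T n u x) + \<bar>\<eta> y - \<eta> x\<bar> * norm (T n u x)"
      using \<eta>(1)[of y] norm_triangle_ineq[of "\<eta> y *\<^sub>R (T n u y - T n u x)" "(\<eta> y - \<eta> x) *\<^sub>R T n u x"] by simp
    also have "\<dots> \<le> 1 * norm (T n u y - T n u x) + 4 * dist x y * norm (T n u x)"
      using \<eta>(2)[of y] \<eta>(3)[of y x] by (intro add_mono mult_right_mono) (auto simp: dist_commute)
    finally have "ennreal (norm (V n u y - V n u x)) \<le> ennreal (norm (T n u y - T n u x)) + ennreal (4 * dist x y) * ennreal (norm (T n u x))"
      by (simp add: ennreal_leI flip: ennreal_plus ennreal_mult)
    also have "\<dots> \<le> ennreal (C2 * dist x y) * avg g x (8 * ?s) + ennreal (4 * dist x y) * (ennreal (1 / \<kappa>) * avg (nu u) x (8 * ?s))"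
      using y s by (intro add_mono mult_left_mono T_lip T_bound u) auto
    also have "\<dots> = ennreal (dist x y) * L'"
    proof -
      have "ennreal (4 * dist x y) * ennreal (1 / \<kappa>) = ennreal (dist x y) * ennreal (4 / \<kappa>)"
        using \<kappa> by (simp flip: ennreal_mult)
      moreover have "ennreal (C2 * dist x y) = ennreal (dist x y) * ennreal C2"
        using C2 by (simp add: mult.commute flip: ennreal_mult)
      ultimately show ?thesis unfolding L'_def distrib_left by (simp only: mult.assoc[symmetric])
    qed
    also have "\<dots> = ennreal (L * dist x y)" using L by (simp add: ennreal_mult mult.commute)
    finally show ?thesis using L(2) by (simp add: ennreal_le_iff)
  qed
  have 2: "ennreal L \<le> G y" if y: "y \<in> ball x (?s / 4)" for y
    unfolding L(1)[symmetric] L'_def G_def using y s0 by (intro add_mono mult_left_mono avg_le_mf) auto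
  show ?thesis using s0 L(2) 1 2 by (intro exI[of _ "?s / 4"] conjI exI[of _ L]) auto
qed

lemma V_wug: "weak_upper_gradient p \<mu> UNIV (V n u) G"
  by (rule wug_local[OF _ G_measurable V_local]) (use p in simp)

lemma V_measurable: "measurable_map \<mu> UNIV (V n u)"
proof (rule measurable_map_continuous)
  have "isCont (V n u) x" for x
  proof -
    obtain d L where d: "0 < d" "0 \<le> L" "\<forall>y\<in>ball x d. norm (V n u y - V n u x) \<le> L * dist x y"
      using V_local by blast
    show ?thesis unfolding continuous_at_eps_delta
    proof (intro allI impI)
      fix e :: real assume e: "0 < e"
      show "\<exists>d>0. \<forall>y. dist y x < d \<longrightarrow> dist (V n u y) (V n u x) < e"
      proof (intro exI[of _ "min d (e / (L + 1))"] conjI allI impI)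
        show "0 < min d (e / (L + 1))" using d e by simp
        fix y assume y: "dist y x < min d (e / (L + 1))"
        then have "norm (V n u y - V n u x) \<le> L * dist x y" using d(3) by (simp add: dist_commute[of y])
        also have "\<dots> \<le> (L + 1) * dist x y" by (simp add: mult_right_mono)
        also have "\<dots> < e" using y d(2) by (simp add: pos_less_divide_eq dist_commute mult.commute)
        finally show "dist (V n u y) (V n u x) < e" by (simp add: dist_norm)
      qed
    qed
  qed
  then show "continuous_on UNIV (V n u)" by (simp add: continuous_at_imp_continuous_on)
qed

lemma norm_V_le: "ennreal (norm (V n u x)) \<le> ennreal (1 / \<kappa>) * mf (nu u) x"
proof (cases "1 / 4 \<le> infdist x \<Omega>")
  case False
  have s: "sc n x \<le> 1" using False by (intro order_trans[OF sc_le[of x "1/4"]]) auto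
  have "ennreal (norm (V n u x)) \<le> ennreal (norm (T n u x))"
    using \<eta>(1,2)[of x] by (intro ennreal_leI) (simp add: V_def mult_left_le_one_le)
  also have "\<dots> \<le> ennreal (1 / \<kappa>) * avg (nu u) x (8 * sc n x)" by (rule T_bound[OF u s])
  also have "\<dots> \<le> ennreal (1 / \<kappa>) * mf (nu u) x"
    using sc_pos[of n x] by (intro mult_left_mono avg_le_mf) auto
  finally show ?thesis .
qed (simp add: V_def \<eta>_zero)

text \<open>On the closure of \<Omega> the scale is 1 / (n + 4) and the cut-off is 1, so
  \<open>T_dev_avg\<close> at w = x gives convergence with error of order 1 / n wherever g and its
  maximal function are finite.\<close>

lemma V_tendsto:
  assumes x: "infdist x \<Omega> = 0" "x \<notin> N" "g x < top" "mf g x < top"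
  shows "(\<lambda>n. V n u x) \<longlonglongrightarrow> h x"
proof -
  obtain A where A: "g x + mf g x = ennreal A" "0 \<le> A" using x(3,4) by (cases "g x + mf g x") auto
  have sc: "sc n x = 1 / (real n + 4)" for n using x(1) by (simp add: sc_def max_def)
  have VT: "V n u x = T n u x" for n using x(1) by (simp add: V_def \<eta>_def)
  have b: "norm (V n u x - h x) \<le> 16 / \<kappa> * A * (1 / (real n + 4))" for n
  proof -
    have "ennreal (norm (T n u x - h x)) \<le> ennreal (16 * sc n x / \<kappa>) * (g x + avg g x (8 * sc n x))"
      using sc_pos[of n x] by (intro T_dev_avg x(2)) (auto simp: sc)
    also have "\<dots> \<le> ennreal (16 * sc n x / \<kappa>) * (g x + mf g x)"
      using sc_pos[of n x] by (intro mult_left_mono add_mono avg_le_mf) auto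
    also have "\<dots> = ennreal (16 * sc n x / \<kappa> * A)"
      unfolding A(1) using A(2) \<kappa> sc_pos[of n x] by (intro ennreal_mult[symmetric]) auto
    finally have "norm (T n u x - h x) \<le> 16 * sc n x / \<kappa> * A"
      using A(2) \<kappa> sc_pos[of n x] by (simp add: ennreal_le_iff)
    then show ?thesis by (simp add: VT sc field_simps)
  qed
  have "(\<lambda>n. 16 / \<kappa> * A * (1 / real (n + 4))) \<longlonglongrightarrow> 16 / \<kappa> * A * 0"
    by (intro tendsto_mult tendsto_const LIMSEQ_ignore_initial_segment[OF lim_1_over_n])
  then have lim: "(\<lambda>n. 16 / \<kappa> * A * (1 / real (n + 4))) \<longlonglongrightarrow> 0" by simp
  have "(\<lambda>n. V n u x - h x) \<longlonglongrightarrow> 0"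
    by (rule Lim_null_comparison[OF always_eventually[OF allI] lim]) (use b in simp)
  then show ?thesis by (simp add: LIM_zero_iff)
qed

text \<open>Off the closure of \<Omega> the scale equals \<open>infdist x \<Omega>\<close> for large
  n, so the sequence is eventually constant.\<close>

lemma V_convergent:
  assumes x: "infdist x \<Omega> \<noteq> 0"
  shows "convergent (\<lambda>n. V n u x)"
proof -
  let ?i = "infdist x \<Omega>"
  have i: "0 < ?i" using x infdist_nonneg[of x \<Omega>] by linarith
  obtain n0 where n0: "1 / ?i < real n0" using reals_Archimedean2 by blast
  have "V n u x = V n0 u x" if "n0 \<le> n" for n
  proof -
    have "sc m x = ?i" if "n0 \<le> m" for m
    proof -
      have "1 / ?i < real m + 4" using n0 that by linarith
      then have "1 / (real m + 4) \<le> ?i" using i by (simp add: field_simps)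
      then show ?thesis by (simp add: sc_def max_def)
    qed
    with that have "sc n x = sc n0 x" by simp
    then have "wt n x = wt n0 x" by (intro ext) (simp add: wt_def)
    then show ?thesis by (simp add: V_def T_def Dn_def)
  qed
  then have "(\<lambda>n. V n u x) \<longlonglongrightarrow> V n0 u x"
    by (rule tendsto_eventually[OF eventually_sequentiallyI])
  then show ?thesis by (auto simp: convergent_def)
qed

lemma AE_convergent: "AE x in M. convergent (\<lambda>n. V n u x) \<and> (x \<in> \<Omega> \<longrightarrow> (\<lambda>n. V n u x) \<longlonglongrightarrow> u x)"
proof -
  have "(\<lambda>x. g x powe p) \<in> borel_measurable M" by measurable
  then have "AE x in M. g x powe p \<noteq> \<infinity>" using gp by (intro nn_integral_PInf_AE) auto
  then have "AE x in M. g x < top" by eventually_elim (auto simp: ennreal_powr_def less_top split: if_splits)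
  with mf_finite[OF g gp] AE_not_in[OF N] show ?thesis
  proof eventually_elim
    case (elim x)
    show ?case
    proof (cases "infdist x \<Omega> = 0")
      case True
      then show ?thesis using V_tendsto[OF True] elim hu[of x] by (auto simp: convergent_def)
    next
      case False
      then have "x \<notin> \<Omega>" by auto
      then show ?thesis using V_convergent[OF False] by simp
    qed
  qed
qed

lemma Ext_eq: "AE x in M. x \<in> \<Omega> \<longrightarrow> Ext u x = u x"
  using AE_convergent by eventually_elim (blast intro: LIMSEQ_unique Ext_tendsto)

text \<open>All \<open>V n u\<close> share the upper gradient \<open>G\<close>, so
  \<open>wug_limit\<close> hands it to the limit without any choice of representative;
  \<open>strong_type\<close> bounds \<open>G\<close> and the limit in L^p.\<close>

lemma Ext_gauge:
  assumes K: "0 \<le> K" and gK: "(\<integral>\<^sup>+x. g x powe p \<partial>M) \<le> ennreal ((CH * K) powr p)"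
    and uK: "(\<integral>\<^sup>+x. nu u x powe p \<partial>M) \<le> ennreal (K powr p)"
  shows "sob_gauge p UNIV (Ext u) (CE * K)"
proof -
  let ?m = "mf (nu u)"
  define R where "R = 2 powr p * S * (C2 powr p * CH powr p + (4 / \<kappa>) powr p)"
  have R0: "0 \<le> R" using S by (simp add: R_def)
  have RK: "(R powr (1 / p) * K) powr p = R * K powr p"
    using R0 K p by (simp add: powr_mult powr_powr)
  have num: "nu u \<in> borel_measurable M" by (rule nu_measurable[OF u])
  note [measurable] = borel_measurable_M[OF mf_measurable]
  have mg: "(\<integral>\<^sup>+x. mf g x powe p \<partial>M) \<le> ennreal (S * CH powr p * K powr p)"
  proof -
    have "(\<integral>\<^sup>+x. mf g x powe p \<partial>M) \<le> ennreal S * ennreal ((CH * K) powr p)"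
      unfolding S_def by (rule order_trans[OF strong_type[OF p g] mult_left_mono[OF gK]]) simp
    then show ?thesis using S by (simp add: powr_mult mult.assoc flip: ennreal_mult)
  qed
  have mn: "(\<integral>\<^sup>+x. ?m x powe p \<partial>M) \<le> ennreal (S * K powr p)"
  proof -
    have "(\<integral>\<^sup>+x. ?m x powe p \<partial>M) \<le> ennreal S * ennreal (K powr p)"
      unfolding S_def by (rule order_trans[OF strong_type[OF p num] mult_left_mono[OF uK]]) simp
    then show ?thesis using S by (simp flip: ennreal_mult)
  qed
  have cm: "(\<integral>\<^sup>+x. (ennreal a * f x) powe p \<partial>M) = ennreal (a powr p) * (\<integral>\<^sup>+x. f x powe p \<partial>M)"
    if "0 \<le> a" "f \<in> borel_measurable M" for a f
    using that by (simp add: powe_mult powe_ennreal nn_integral_cmult)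
  have Gp: "Lp_int p \<mu> UNIV G \<le> ennreal (R * K powr p)"
  proof -
    have "Lp_int p \<mu> UNIV G \<le> (\<integral>\<^sup>+x. ennreal (2 powr p) * ((ennreal C2 * mf g x) powe p + (ennreal (4 / \<kappa>) * ?m x) powe p) \<partial>M)"
      unfolding Lp_int_UNIV G_def using p by (intro nn_integral_mono powe_add_le) simp
    also have "\<dots> = ennreal (2 powr p) * (ennreal (C2 powr p) * (\<integral>\<^sup>+x. mf g x powe p \<partial>M) + ennreal ((4 / \<kappa>) powr p) * (\<integral>\<^sup>+x. ?m x powe p \<partial>M))"
      using C2 \<kappa> by (subst nn_integral_cmult, measurable, subst nn_integral_add, measurable) (simp add: cm)
    also have "\<dots> \<le> ennreal (2 powr p) * (ennreal (C2 powr p) * ennreal (S * CH powr p * K powr p) + ennreal ((4 / \<kappa>) powr p) * ennreal (S * K powr p))"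
      by (intro mult_left_mono add_mono mg mn) simp_all
    also have "\<dots> = ennreal (R * K powr p)"
      using S by (simp add: R_def algebra_simps flip: ennreal_mult ennreal_plus)
    finally show ?thesis .
  qed
  have nE: "Lp_int p \<mu> UNIV (\<lambda>x. ennreal (norm (Ext u x))) \<le> ennreal (R * K powr p)"
  proof -
    have "Lp_int p \<mu> UNIV (\<lambda>x. ennreal (norm (Ext u x))) \<le> (\<integral>\<^sup>+x. (ennreal (1 / \<kappa>) * ?m x) powe p \<partial>M)"
      unfolding Lp_int_UNIV
    proof (rule nn_integral_mono_AE)
      show "AE x in M. ennreal (norm (Ext u x)) powe p \<le> (ennreal (1 / \<kappa>) * ?m x) powe p"
        using AE_convergent
      proof eventually_elim
        case (elim x)
        then have "(\<lambda>n. ennreal (norm (V n u x))) \<longlonglongrightarrow> ennreal (norm (Ext u x))"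
          by (intro tendsto_ennrealI tendsto_norm Ext_tendsto) simp
        then have "ennreal (norm (Ext u x)) \<le> ennreal (1 / \<kappa>) * ?m x"
          by (rule LIMSEQ_le_const2) (use norm_V_le in auto)
        then show ?case using p by (intro powe_mono) auto
      qed
    qed
    also have "\<dots> = ennreal ((1 / \<kappa>) powr p) * (\<integral>\<^sup>+x. ?m x powe p \<partial>M)" using \<kappa> by (intro cm) auto
    also have "\<dots> \<le> ennreal ((1 / \<kappa>) powr p) * ennreal (S * K powr p)" by (intro mult_left_mono mn) simp
    also have "\<dots> = ennreal ((1 / \<kappa>) powr p * (S * K powr p))" using S by (simp flip: ennreal_mult)
    also have "\<dots> \<le> ennreal (R * K powr p)"
    proof (rule ennreal_leI)
      have "(1 / \<kappa>) powr p \<le> (4 / \<kappa>) powr p" using \<kappa> p by (intro powr_mono2 divide_right_mono) auto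
      also have "\<dots> \<le> C2 powr p * CH powr p + (4 / \<kappa>) powr p" by simp
      also have "\<dots> \<le> 2 powr p * (C2 powr p * CH powr p + (4 / \<kappa>) powr p)"
        using p mult_right_mono[of 1 "2 powr p" "C2 powr p * CH powr p + (4 / \<kappa>) powr p"]
          by (simp add: ge_one_powr_ge_zero)
      finally have "(1 / \<kappa>) powr p * (S * K powr p) \<le> 2 powr p * (C2 powr p * CH powr p + (4 / \<kappa>) powr p) * (S * K powr p)"
        using S by (intro mult_right_mono) auto
      then show "(1 / \<kappa>) powr p * (S * K powr p) \<le> R * K powr p" by (simp add: R_def mult_ac)
    qed
    finally show ?thesis .
  qed
  have conv: "AE x in measure_on \<mu> UNIV. (\<lambda>n. V n u x) \<longlonglongrightarrow> Ext u x"
    unfolding restrict_M_UNIV using AE_convergent by eventually_elim (simp add: Ext_tendsto)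
  show ?thesis
    unfolding CE_def R_def[symmetric]
  proof (rule sob_gaugeI[where u' = "Ext u" and \<rho> = G])
    show "measurable_map \<mu> UNIV (Ext u)"
      by (rule measurable_map_limit[OF UNIV_M V_measurable conv])
    show "weak_upper_gradient p \<mu> UNIV (Ext u) G"
      unfolding Ext_def[abs_def]
    proof (rule wug_limit)
      show "G \<in> Lp_borel p \<mu> UNIV"
        unfolding Lp_borel_iff using Gp measurable_restrict_space1[OF G_measurable]
        by (auto intro: order.strict_trans1)
      show "AE x in measure_on \<mu> UNIV. convergent (\<lambda>n. V n u x)"
        unfolding restrict_M_UNIV using AE_convergent by eventually_elim simp
    qed (use p V_wug UNIV_M in auto)
  qed (use nE Gp RK in simp_all)
qed

end

section \<open>The extension operator\<close>

context ext_setting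
begin

lemma Uok_sobolev: "v \<in> sobolev_space p \<mu> \<Omega> \<Longrightarrow> Uok v"
  by (simp add: Uok_def sobolev_space_def Lp_space_iff Lp_int_nu)

text \<open>Any extension h of v will do. It is used twice: with an arbitrary h to place
  \<open>Ext v\<close> in the Sobolev space, and with the h of \<open>uniform_extension\<close> for
  the operator bound.\<close>

lemma Ext_bound:
  fixes v h :: "'a \<Rightarrow> 'b::banach"
  assumes v: "Uok v" and h: "sob_gauge p UNIV h K" and K: "0 < K" and hv: "AE x in measure_on \<mu> \<Omega>. h x = v x"
  shows "sob_gauge p UNIV (Ext v) (CE * K)"
    and "AE x in M. (\<lambda>n. V n v x) \<longlonglongrightarrow> Ext v x"
    and "AE x in measure_on \<mu> \<Omega>. Ext v x = v x"
proof -
  obtain g N where gb: "g \<in> borel_measurable borel" "(\<integral>\<^sup>+x. g x powe p \<partial>M) \<le> ennreal ((CH * K) powr p)"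
    and nb: "N \<in> null_sets M" "\<And>x y. x \<notin> N \<Longrightarrow> y \<notin> N \<Longrightarrow> ennreal (norm (h x - h y)) \<le> ennreal (dist x y) * max (g x) (g y)"
    by (rule hajlasz[OF h K]) (rule that)
  have N': "{x\<in>\<Omega>. h x \<noteq> v x} \<in> null_sets M"
    using hv by (simp add: AE_on_iff[OF \<Omega>] AE_M_iff)
  interpret ext_datum \<mu> c p CP \<Lambda> \<Omega> cO v h g "N \<union> {x\<in>\<Omega>. h x \<noteq> v x}"
  proof
    show "Uok v" by (rule v)
    show "g \<in> borel_measurable M" by (rule borel_measurable_M[OF gb(1)])
    show "(\<integral>\<^sup>+x. g x powe p \<partial>M) < top" using gb(2) by (rule order.strict_trans1) simp
    show "N \<union> {x\<in>\<Omega>. h x \<noteq> v x} \<in> null_sets M" using nb(1) N' by (rule null_sets.Un)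
    show "ennreal (norm (h x - h y)) \<le> ennreal (dist x y) * (g x + g y)"
      if "x \<notin> N \<union> {x\<in>\<Omega>. h x \<noteq> v x}" "y \<notin> N \<union> {x\<in>\<Omega>. h x \<noteq> v x}" for x y
      using that by (intro order_trans[OF nb(2) mult_left_mono]) auto
  qed auto
  have "(\<integral>\<^sup>+x. nu v x powe p \<partial>M) = Lp_int p \<mu> \<Omega> (\<lambda>x. ennreal (norm (h x)))"
    unfolding Lp_int_nu[symmetric] Lp_int_def using hv by (intro nn_integral_cong_AE) (auto elim: eventually_mono)
  also have "\<dots> \<le> Lp_int p \<mu> UNIV (\<lambda>x. ennreal (norm (h x)))"
    unfolding Lp_int_on[OF \<Omega>] Lp_int_UNIV by (intro nn_integral_mono) (auto split: split_indicator)
  also have "\<dots> \<le> ennreal (K powr p)" using h by (rule sob_gaugeE)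
  finally show "sob_gauge p UNIV (Ext v) (CE * K)" using K gb(2) by (intro Ext_gauge) auto
  show "AE x in M. (\<lambda>n. V n v x) \<longlonglongrightarrow> Ext v x"
    using AE_convergent by eventually_elim (simp add: Ext_tendsto)
  show "AE x in measure_on \<mu> \<Omega>. Ext v x = v x"
    using Ext_eq by (simp add: AE_on_iff[OF \<Omega>])
qed

lemma Ext_operator:
  assumes ext: "\<And>u :: 'a \<Rightarrow> 'b::banach. u \<in> sobolev_space p \<mu> \<Omega> \<Longrightarrow>
      \<exists>h \<in> sobolev_space p \<mu> UNIV. AE x in measure_on \<mu> \<Omega>. h x = u x"
  shows "linear_extension_operator p \<mu> \<Omega> (Ext :: ('a \<Rightarrow> 'b) \<Rightarrow> 'a \<Rightarrow> 'b)"
proof -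
  interpret E: extension_property \<mu> p \<Omega> "TYPE('b)"
    by unfold_locales (use p \<Omega> ext in auto)
  have p0: "0 < p" using p by simp
  have q: "\<exists>K>0. sob_gauge p UNIV (Ext v) (CE * K) \<and> (AE x in M. (\<lambda>n. V n v x) \<longlonglongrightarrow> Ext v x) \<and>
      (AE x in measure_on \<mu> \<Omega>. Ext v x = v x)" if v: "v \<in> sobolev_space p \<mu> \<Omega>" for v :: "'a \<Rightarrow> 'b"
  proof -
    obtain h where h: "h \<in> sobolev_space p \<mu> UNIV" "AE x in measure_on \<mu> \<Omega>. h x = v x"
      using ext[OF v] by blast
    obtain K where K: "0 < K" "sob_gauge p UNIV h K" by (rule sobolev_space_gauge[OF h(1) p0]) (rule that)
    show ?thesis using Ext_bound[OF Uok_sobolev[OF v] K(2,1) h(2)] K(1) by blast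
  qed
  obtain C where C: "0 < C" "\<And>v :: 'a \<Rightarrow> 'b. sob_gauge p \<Omega> v 1 \<Longrightarrow> E.Q v C"
    using E.uniform_extension by blast
  have norm_le: "sobolev_norm p \<mu> UNIV (Ext v) \<le> ennreal (2 * CE * C) * sobolev_norm p \<mu> \<Omega> v"
    if v: "v \<in> sobolev_space p \<mu> \<Omega>" for v :: "'a \<Rightarrow> 'b"
  proof -
    obtain k where k: "sobolev_norm p \<mu> \<Omega> v = ennreal k" "0 \<le> k"
      using sobolev_norm_finite[OF v] by (cases "sobolev_norm p \<mu> \<Omega> v") auto
    \<comment> \<open>K exceeds the norm strictly, as \<open>sob_gauge_of_norm_less\<close> demands;
      this also covers functions of norm 0, and K is let down to k afterwards.\<close>
    have A: "sobolev_norm p \<mu> UNIV (Ext v) \<le> ennreal (2 * CE * C * K)" if K: "k < K" for K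
    proof -
      have K0: "0 < K" using K k(2) by simp
      have "sob_gauge p \<Omega> v K"
        using k K by (intro sob_gauge_of_norm_less v p0) (simp add: ennreal_less_iff)
      from sob_gauge_cmult[OF \<Omega> this, of "1 / K"] have "sob_gauge p \<Omega> (\<lambda>x. (1 / K) *\<^sub>R v x) 1"
        using K0 by simp
      from E.Q_cmult[OF C(2)[OF this], of K] have "E.Q v (K * C)" using C(1) K0 by simp
      then obtain h where h: "sob_gauge p UNIV h (K * C)" "AE x in measure_on \<mu> \<Omega>. h x = v x"
        unfolding E.Q_def by blast
      have "sob_gauge p UNIV (Ext v) (CE * (K * C))"
        using K0 C(1) by (intro Ext_bound(1)[OF Uok_sobolev[OF v] h(1) _ h(2)]) simp
      from sob_gauge_norm_le[OF UNIV_M this _ p0] show ?thesis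
        using CE_nonneg K0 C(1) by (simp add: mult_ac)
    qed
    then obtain l where l: "sobolev_norm p \<mu> UNIV (Ext v) = ennreal l" "0 \<le> l"
      using A[of "k + 1"] by (cases "sobolev_norm p \<mu> UNIV (Ext v)") (auto simp: top_unique)
    have le: "l \<le> 2 * CE * C * K" if "k < K" for K
      using A[OF that] that k(2) CE_nonneg C(1) unfolding l(1) by (subst (asm) ennreal_le_iff) auto
    have "l \<le> 2 * CE * C * k"
    proof (rule tendsto_lowerbound)
      show "((\<lambda>K. 2 * CE * C * K) \<longlongrightarrow> 2 * CE * C * k) (at_right k)" by (intro tendsto_intros)
      show "\<forall>\<^sub>F K in at_right k. l \<le> 2 * CE * C * K"
        using eventually_at_right_less[of k] by eventually_elim (rule le)
    qed simp
    then show ?thesis using CE_nonneg C(1) k l by (simp add: ennreal_leI flip: ennreal_mult)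
  qed
  have add: "(\<lambda>y. v y + w y) \<in> sobolev_space p \<mu> \<Omega>"
    if vw: "v \<in> sobolev_space p \<mu> \<Omega>" "w \<in> sobolev_space p \<mu> \<Omega>" for v w :: "'a \<Rightarrow> 'b"
  proof -
    obtain K where K: "0 < K" "sob_gauge p \<Omega> v K" by (rule sobolev_space_gauge[OF vw(1) p0]) (rule that)
    obtain L where L: "0 < L" "sob_gauge p \<Omega> w L" by (rule sobolev_space_gauge[OF vw(2) p0]) (rule that)
    show ?thesis using sob_gauge_add[OF \<Omega> E.p K(2) L(2)] K L by (intro sob_gauge_space(1)[OF \<Omega>]) auto
  qed
  have cmult: "(\<lambda>y. a *\<^sub>R v y) \<in> sobolev_space p \<mu> \<Omega>" if v: "v \<in> sobolev_space p \<mu> \<Omega>" for a and v :: "'a \<Rightarrow> 'b"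
  proof -
    obtain K where K: "0 < K" "sob_gauge p \<Omega> v K" by (rule sobolev_space_gauge[OF v p0]) (rule that)
    show ?thesis using sob_gauge_cmult[OF \<Omega> K(2)] K by (intro sob_gauge_space(1)[OF \<Omega>]) auto
  qed
  have conv: "AE x in M. (\<lambda>n. V n v x) \<longlonglongrightarrow> Ext v x" if "v \<in> sobolev_space p \<mu> \<Omega>" for v :: "'a \<Rightarrow> 'b"
    using q[OF that] by blast
  show ?thesis
    unfolding linear_extension_operator_def extension_operator_def restrict_M_UNIV
  proof (intro conjI ballI allI impI)
    fix v :: "'a \<Rightarrow> 'b" assume v: "v \<in> sobolev_space p \<mu> \<Omega>"
    show "Ext v \<in> sobolev_space p \<mu> UNIV" using q[OF v] sob_gauge_space(1)[OF UNIV_M] by blast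
    show "AE x in measure_on \<mu> \<Omega>. Ext v x = v x" using q[OF v] by blast
    show "AE x in M. Ext (\<lambda>y. a *\<^sub>R v y) x = a *\<^sub>R Ext v x" for a
      using conv[OF v] conv[OF cmult[OF v, of a]]
      unfolding V_cmult[OF Uok_sobolev[OF v]]
    proof eventually_elim
      case (elim x)
      show ?case by (rule LIMSEQ_unique[OF elim(2) tendsto_scaleR[OF tendsto_const elim(1)]])
    qed
    fix w :: "'a \<Rightarrow> 'b" assume w: "w \<in> sobolev_space p \<mu> \<Omega>"
    show "AE x in M. Ext (\<lambda>y. v y + w y) x = Ext v x + Ext w x"
      using conv[OF v] conv[OF w] conv[OF add[OF v w]]
      unfolding V_add[OF Uok_sobolev[OF v] Uok_sobolev[OF w]]
    proof eventually_elim
      case (elim x)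
      show ?case by (rule LIMSEQ_unique[OF elim(3) tendsto_add[OF elim(1,2)]])
    qed
    assume "AE x in measure_on \<mu> \<Omega>. v x = w x"
    then have "Ext v = Ext w" by (rule Ext_cong[OF Uok_sobolev[OF v] Uok_sobolev[OF w]])
    then show "AE x in M. Ext v x = Ext w x" by simp
  next
    show "\<exists>C>0. \<forall>u\<in>sobolev_space p \<mu> \<Omega>. sobolev_norm p \<mu> UNIV (Ext u :: 'a \<Rightarrow> 'b) \<le> ennreal C * sobolev_norm p \<mu> \<Omega> u"
    \<comment> \<open>\<open>CE\<close> is only known to be nonnegative, so 1 is added to make the
      operator constant positive.\<close>
    proof (intro exI[of _ "2 * CE * C + 1"] conjI ballI)
      show "0 < 2 * CE * C + 1" using CE_nonneg C(1) by (simp add: add_nonneg_pos)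
      show "sobolev_norm p \<mu> UNIV (Ext u) \<le> ennreal (2 * CE * C + 1) * sobolev_norm p \<mu> \<Omega> u"
        if "u \<in> sobolev_space p \<mu> \<Omega>" for u :: "'a \<Rightarrow> 'b"
        by (rule order_trans[OF norm_le[OF that] mult_right_mono]) (simp_all add: ennreal_leI)
    qed
  qed
qed

end

text \<open>The empty domain satisfies measure density vacuously, but there is nothing to average
  over, so it is settled by the zero operator.\<close>

lemma (in metric_measure) zero_extension_operator:
  assumes p: "1 \<le> p"
  shows "linear_extension_operator p \<mu> {} (\<lambda>u x. 0 :: 'b::real_normed_vector)"
proof -
  have U: "UNIV \<in> sets M" using sets.top[of M] by simp
  have z: "sob_gauge p UNIV (\<lambda>x. 0 :: 'b) 0" by (rule sob_gauge_zero[OF U p])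
  have "(\<lambda>x. 0 :: 'b) \<in> sobolev_space p \<mu> UNIV" by (rule sob_gauge_space(1)[OF U z])
  moreover have "sobolev_norm p \<mu> UNIV (\<lambda>x. 0 :: 'b) = 0"
    using sob_gauge_norm_le[OF U z] p by simp
  ultimately show ?thesis
    unfolding linear_extension_operator_def extension_operator_def
    by (intro conjI ballI allI impI exI[of _ 1]) (auto simp: AE_on_iff)
qed

theorem theorem1p3:
  fixes p :: real
    and \<mu> :: "'a::polish_space set \<Rightarrow> ennreal"
    and \<Omega> :: "'a set"
  assumes "1 < p"
    and "PI_space p \<mu>"
    and "\<Omega> \<in> sets (caratheodory_measure \<mu>)"
    and "measure_density \<mu> \<Omega>"
  shows "(\<exists>E :: ('a \<Rightarrow> 'b::banach) \<Rightarrow> ('a \<Rightarrow> 'b). linear_extension_operator p \<mu> \<Omega> E) \<longleftrightarrow>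
         (\<forall>u :: 'a \<Rightarrow> 'b. u \<in> sobolev_space p \<mu> \<Omega> \<longrightarrow>
            (\<exists>h \<in> sobolev_space p \<mu> UNIV. AE x in measure_on \<mu> \<Omega>. h x = u x))"
proof
  assume "\<exists>E :: ('a \<Rightarrow> 'b) \<Rightarrow> 'a \<Rightarrow> 'b. linear_extension_operator p \<mu> \<Omega> E"
  then show "\<forall>u :: 'a \<Rightarrow> 'b. u \<in> sobolev_space p \<mu> \<Omega> \<longrightarrow>
            (\<exists>h \<in> sobolev_space p \<mu> UNIV. AE x in measure_on \<mu> \<Omega>. h x = u x)"
    unfolding linear_extension_operator_def extension_operator_def by blast
next
  assume ext: "\<forall>u :: 'a \<Rightarrow> 'b. u \<in> sobolev_space p \<mu> \<Omega> \<longrightarrow>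
            (\<exists>h \<in> sobolev_space p \<mu> UNIV. AE x in measure_on \<mu> \<Omega>. h x = u x)"
  have mms: "metric_measure_space \<mu>" and dbl: "doubling \<mu>" and poin: "weak_poincare p \<mu>"
    using assms(2) by (auto simp: PI_space_def)
  interpret metric_measure \<mu> by unfold_locales (rule mms)
  show "\<exists>E :: ('a \<Rightarrow> 'b) \<Rightarrow> 'a \<Rightarrow> 'b. linear_extension_operator p \<mu> \<Omega> E"
  proof (cases "\<Omega> = {}")
    case True
    then show ?thesis using zero_extension_operator[of p] assms(1) by (intro exI) simp
  next
    case False
    obtain c0 where c0: "0 < c0" "\<forall>x. \<forall>r>0. \<mu> (ball x (2 * r)) \<le> ennreal c0 * \<mu> (ball x r)"
      using dbl by (auto simp: doubling_def)
    have dbl': "\<mu> (ball x (2 * r)) \<le> ennreal (max 1 c0) * \<mu> (ball x r)" if "0 < r" for x r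
    proof (rule order_trans)
      show "\<mu> (ball x (2 * r)) \<le> ennreal c0 * \<mu> (ball x r)" using c0(2) that by simp
      show "ennreal c0 * \<mu> (ball x r) \<le> ennreal (max 1 c0) * \<mu> (ball x r)"
        by (rule mult_right_mono) (simp_all add: ennreal_leI)
    qed
    obtain cO where cO: "0 < cO" "\<forall>x\<in>\<Omega>. \<forall>r. 0 < r \<and> r \<le> 1 \<longrightarrow> \<mu> (ball x r \<inter> \<Omega>) \<ge> ennreal cO * \<mu> (ball x r)"
      using assms(4) by (auto simp: measure_density_def)
    obtain CP \<Lambda> where P: "0 < CP" "1 \<le> \<Lambda>" and
      poin': "\<And>x r (u :: 'a \<Rightarrow> real) \<rho>. 0 < r \<Longrightarrow> integrable (measure_on \<mu> (ball x (\<Lambda> * r))) u \<Longrightarrow>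
        \<rho> \<in> Lp_borel p \<mu> (ball x (\<Lambda> * r)) \<Longrightarrow> weak_upper_gradient p \<mu> (ball x (\<Lambda> * r)) u \<rho> \<Longrightarrow>
        (\<integral>\<^sup>+y. ennreal \<bar>u y - mean_value \<mu> (ball x r) u\<bar> \<partial>measure_on \<mu> (ball x r)) / \<mu> (ball x r)
          \<le> ennreal (CP * diameter (ball x r)) *
             ((\<integral>\<^sup>+y. \<rho> y powe p \<partial>measure_on \<mu> (ball x (\<Lambda> * r))) / \<mu> (ball x (\<Lambda> * r))) powe (1 / p)"
      using poin unfolding weak_poincare_def by blast
    have em: "emeasure M A = \<mu> A" if "A \<in> sets M" for A by (rule emeasure_M[OF that])
    interpret ext_setting \<mu> "max 1 c0" p CP \<Lambda> \<Omega> cO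
    proof unfold_locales
      show "ennreal cO * emeasure M (ball x r) \<le> emeasure M (ball x r \<inter> \<Omega>)" if "x \<in> \<Omega>" "0 < r" "r \<le> 1" for x r
        using cO(2) that assms(3) by (simp add: em)
    qed (use dbl' P poin' cO False assms(1,3) in auto)
    show ?thesis by (rule exI[of _ Ext], rule Ext_operator) (use ext in blast)
  qed
qed

end
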